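(* Let $0<\xi_0<\sqrt\pi$ and let $\hat f_0(\xi,v)\in L^2(\mathbb{R},L^2_w(\mathbb{R}))$. Then the solution $f$ of the Cauchy problem $\partial_t\hat f=L_\xi\hat f$, $\hat f(0)=\hat f_0$, converges to the grossly determined solution $g^{\xi_0}:=\mathfrak F^{-1}(P_{\xi_0}(\xi)\hat f)$ at exponential rate: for any $\epsilon>0$ there are constants $C=C(\epsilon)>0$ and $C_2>0$ such that for all $t\ge0$ $$\|f-g^{\xi_0}\|_{L^2(\mathbb{R},L^2_w(\mathbb{R}))}\le Ce^{(\lambda^*(\xi_0)+\epsilon)t}\|f_0-g_0^{\xi_0}\|_{L^2(\mathbb{R},L^2_w(\mathbb{R}))}\le C_2e^{(\lambda^*(\xi_0)+\epsilon)t}\|f_0\|_{L^2(\mathbb{R},L^2_w(\mathbb{R}))},$$ where $g_0^{\xi_0}$ is $g^{\xi_0}$ at $t=0$.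
   Context: Let $w(v)=e^{-v^2}/\sqrt{\pi}$, $L^2_w=L^2_w(\mathbb{R})$ with $(f,g)_{L^2_w}=\int f\bar g\,w\,dv$. $\mathbb{1}$ is the constant function $1$, and $(L_\xi f)(v)=(-iv\xi-1)f(v)+(f,\mathbb{1})_{L^2_w}\mathbb{1}$ with maximal domain in $L^2_w$. The equation $\partial_t\hat f=L_\xi\hat f$ is the Fourier transform in $x$ of $\partial_tf+v\partial_xf=-f+\int_{\mathbb{R}}w(r)f(t,x,r)\,dr$, whose generator generates a contraction semigroup on $L^2(\mathbb{R},L^2_w)$; solutions are understood in the semigroup sense. $\mathfrak F^{-1}$ is the inverse Fourier transform in $\xi$. The norms are $L^2$ in $x$ with values in $L^2_w$ in $v$. For $\xi\in(-\sqrt\pi,\sqrt\pi)$, $\lambda^*(\xi)\in(-1,0]$ is the unique solution $\lambda$ of $1-\int_{\mathbb{R}}\frac{w(v)\,dv}{iv\xi+1+\lambda}=0$; it is a simple isolated eigenvalue of $L_\xi$, with Riesz projection $P_{\lambda^*}(\xi)$. The truncated projector is $P_{\xi_0}(\xi)=P_{\lambda^*}(\xi)$ for $\xi\in[-\xi_0,\xi_0]$ and $P_{\xi_0}(\xi)=0$ for $\xi\notin[-\xi_0,\xi_0]$. A grossly determined solution is a solution whose evolution is determined entirely by its moment $\mu(t,x)=(g(t,x,\cdot),\mathbb{1})_{L^2_w}$. *)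

theory Defs
  imports "HOL-Complex_Analysis.Complex_Analysis"
begin

text \<open>
  Elements of an \<open>L\<^sup>2\<close> space are represented by functions, and equality in the space is equality
  almost everywhere.  Operators, possibly unbounded, are represented by their graphs.
\<close>

definition L2 :: "'a measure \<Rightarrow> ('a \<Rightarrow> complex) set" where
  "L2 M = {f \<in> borel_measurable M. integrable M (\<lambda>x. (norm (f x))\<^sup>2)}"

definition l2_norm :: "'a measure \<Rightarrow> ('a \<Rightarrow> complex) \<Rightarrow> real" where
  "l2_norm M f = sqrt (\<integral>x. (norm (f x))\<^sup>2 \<partial>M)"

definition l2_inner :: "'a measure \<Rightarrow> ('a \<Rightarrow> complex) \<Rightarrow> ('a \<Rightarrow> complex) \<Rightarrow> complex" where
  "l2_inner M f g = (\<integral>x. f x * cnj (g x) \<partial>M)"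

text \<open>
  Membership in \<open>L2 M\<close> is required separately because \<open>l2_norm\<close> is 0 on functions that
  are not square integrable.
\<close>

definition l2_tendsto ::
  "'a measure \<Rightarrow> ('i \<Rightarrow> 'a \<Rightarrow> complex) \<Rightarrow> ('a \<Rightarrow> complex) \<Rightarrow> 'i filter \<Rightarrow> bool" where
  "l2_tendsto M u f \<F> \<longleftrightarrow> f \<in> L2 M \<and> (\<forall>\<^sub>F i in \<F>. u i \<in> L2 M) \<and>
     ((\<lambda>i. l2_norm M (\<lambda>x. u i x - f x)) \<longlongrightarrow> 0) \<F>"

type_synonym 'a l2_graph = "(('a \<Rightarrow> complex) \<times> ('a \<Rightarrow> complex)) set"

definition contraction_semigroup ::
  "'a measure \<Rightarrow> (real \<Rightarrow> ('a \<Rightarrow> complex) \<Rightarrow> 'a \<Rightarrow> complex) \<Rightarrow> bool" where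
  "contraction_semigroup M T \<longleftrightarrow>
     (\<forall>t\<ge>0. \<forall>f\<in>L2 M. T t f \<in> L2 M \<and> l2_norm M (T t f) \<le> l2_norm M f) \<and>
     (\<forall>t\<ge>0. \<forall>f\<in>L2 M. \<forall>g\<in>L2 M. \<forall>a b.
        AE x in M. T t (\<lambda>y. a * f y + b * g y) x = a * T t f x + b * T t g x) \<and>
     (\<forall>f\<in>L2 M. AE x in M. T 0 f x = f x) \<and>
     (\<forall>s\<ge>0. \<forall>t\<ge>0. \<forall>f\<in>L2 M. AE x in M. T (s + t) f x = T s (T t f) x) \<and>
     (\<forall>f\<in>L2 M. l2_tendsto M (\<lambda>t. T t f) f (at_right 0))"

definition generator ::
  "'a measure \<Rightarrow> (real \<Rightarrow> ('a \<Rightarrow> complex) \<Rightarrow> 'a \<Rightarrow> complex) \<Rightarrow> 'a l2_graph" where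
  "generator M T = {(f, g). f \<in> L2 M \<and>
     l2_tendsto M (\<lambda>h x. (T h f x - f x) / complex_of_real h) g (at_right 0)}"

definition semigroup_solution ::
  "'a measure \<Rightarrow> 'a l2_graph \<Rightarrow> ('a \<Rightarrow> complex) \<Rightarrow> (real \<Rightarrow> 'a \<Rightarrow> complex) \<Rightarrow> bool" where
  "semigroup_solution M A f0 f \<longleftrightarrow> f0 \<in> L2 M \<and>
     (\<exists>T. contraction_semigroup M T \<and> generator M T = A \<and>
          (\<forall>t\<ge>0. f t \<in> L2 M \<and> (AE x in M. f t x = T t f0 x)))"

text \<open>The graph of \<open>(z - A)\<^sup>-\<^sup>1\<close>.\<close>

definition resolvent_graph :: "'a measure \<Rightarrow> 'a l2_graph \<Rightarrow> complex \<Rightarrow> 'a l2_graph" where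
  "resolvent_graph M A z =
     {(g, f). g \<in> L2 M \<and> (\<exists>h. (f, h) \<in> A \<and> (AE x in M. z * f x - h x = g x))}"

text \<open>For linear \<open>A\<close> the bound also gives injectivity of \<open>z - A\<close>.\<close>

definition resolvent_set :: "'a measure \<Rightarrow> 'a l2_graph \<Rightarrow> complex set" where
  "resolvent_set M A = {z. (\<forall>g\<in>L2 M. \<exists>f. (g, f) \<in> resolvent_graph M A z) \<and>
     (\<exists>B. \<forall>(g, f)\<in>resolvent_graph M A z. l2_norm M f \<le> B * l2_norm M g)}"

definition spectrum :: "'a measure \<Rightarrow> 'a l2_graph \<Rightarrow> complex set" where
  "spectrum M A = - resolvent_set M A"

definition resolvent ::
  "'a measure \<Rightarrow> 'a l2_graph \<Rightarrow> complex \<Rightarrow> ('a \<Rightarrow> complex) \<Rightarrow> 'a \<Rightarrow> complex" where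
  "resolvent M A z g = (SOME f. (g, f) \<in> resolvent_graph M A z)"

text \<open>
  Graph of the Riesz projection \<open>(2 \<pi> i)\<^sup>-\<^sup>1 \<integral> (z - A)\<^sup>-\<^sup>1 dz\<close> for an isolated point \<open>z0\<close> of the
  spectrum, the contour being a positively oriented circle enclosing no other point of the
  spectrum.  The vector-valued integral is taken weakly, i.e. tested against all \<open>h\<close> in
  \<open>L\<^sup>2\<close>.
\<close>

definition riesz_projection :: "'a measure \<Rightarrow> 'a l2_graph \<Rightarrow> complex \<Rightarrow> 'a l2_graph" where
  "riesz_projection M A z0 = {(f, p). f \<in> L2 M \<and> p \<in> L2 M \<and>
     (\<exists>r>0. cball z0 r \<inter> spectrum M A = {z0} \<and>
        (\<forall>h\<in>L2 M. ((\<lambda>z. l2_inner M (resolvent M A z f) h)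
            has_contour_integral (2 * complex_of_real pi * \<i> * l2_inner M p h))
          (circlepath z0 r)))}"

definition weight :: "real \<Rightarrow> real" where
  "weight v = exp (- v\<^sup>2) / sqrt pi"

definition maxwell :: "real measure" where
  "maxwell = density lborel (\<lambda>v. ennreal (weight v))"

text \<open>The graph of \<open>L\<^sub>\<xi>\<close> on its maximal domain.\<close>

definition L_op :: "real \<Rightarrow> real l2_graph" where
  "L_op \<xi> = {(f, g). f \<in> L2 maxwell \<and> g \<in> L2 maxwell \<and>
     (AE v in maxwell. g v = (- \<i> * complex_of_real v * complex_of_real \<xi> - 1) * f v
                             + l2_inner maxwell f (\<lambda>_. 1))}"

text \<open>
  \<open>L\<^sup>2(\<real>, L\<^sup>2\<^sub>w)\<close> is identified with \<open>L\<^sup>2(\<real>\<^sup>2)\<close> for the measure \<open>d\<xi> w(v) dv\<close>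
  (or \<open>dx w(v) dv\<close>).
\<close>

definition phase :: "(real \<times> real) measure" where
  "phase = lborel \<Otimes>\<^sub>M maxwell"

definition L_hat :: "(real \<times> real) l2_graph" where
  "L_hat = {(F, G). F \<in> L2 phase \<and> G \<in> L2 phase \<and>
     (AE \<xi> in lborel. ((\<lambda>v. F (\<xi>, v)), (\<lambda>v. G (\<xi>, v))) \<in> L_op \<xi>)}"

definition lambda_star :: "real \<Rightarrow> real" where
  "lambda_star \<xi> = (THE l. l \<in> {-1<..0} \<and>
     1 - (\<integral>v. 1 / (\<i> * complex_of_real v * complex_of_real \<xi> + 1 + complex_of_real l)
            \<partial>maxwell) = 0)"

text \<open>
  The choice is made at the level of \<open>L\<^sup>2(\<real>, L\<^sup>2\<^sub>w)\<close> and not fibrewise, so that the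
  representative is jointly measurable.
\<close>

definition trunc_projector :: "real \<Rightarrow> (real \<times> real \<Rightarrow> complex) \<Rightarrow> real \<times> real \<Rightarrow> complex" where
  "trunc_projector \<xi>0 F = (SOME G. G \<in> L2 phase \<and>
     (AE \<xi> in lborel.
        if \<xi> \<in> {-\<xi>0..\<xi>0}
        then ((\<lambda>v. F (\<xi>, v)), (\<lambda>v. G (\<xi>, v)))
               \<in> riesz_projection maxwell (L_op \<xi>) (complex_of_real (lambda_star \<xi>))
        else (AE v in maxwell. G (\<xi>, v) = 0)))"

text \<open>
  Inverse Fourier transform in the first variable on \<open>L\<^sup>2\<close>, as the limit in mean of truncated
  integrals.  The sign and normalization are those for which \<open>\<partial>\<^sub>x\<close> corresponds to \<open>i\<xi>\<close> and
  the forward transform has no prefactor.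
\<close>

definition inverse_fourier :: "(real \<times> real \<Rightarrow> complex) \<Rightarrow> real \<times> real \<Rightarrow> complex" where
  "inverse_fourier F = (SOME f. l2_tendsto phase
     (\<lambda>R (x, v). (1 / (2 * complex_of_real pi)) *
        (LINT \<xi>:{-R..R}|lborel. exp (\<i> * complex_of_real x * complex_of_real \<xi>) * F (\<xi>, v)))
     f at_top)"

definition moment :: "(real \<times> real \<Rightarrow> complex) \<Rightarrow> real \<Rightarrow> complex" where
  "moment g x = l2_inner maxwell (\<lambda>v. g (x, v)) (\<lambda>_. 1)"

definition kinetic_solution :: "(real \<Rightarrow> real \<times> real \<Rightarrow> complex) \<Rightarrow> bool" where
  "kinetic_solution g \<longleftrightarrow> (\<exists>G0 G. semigroup_solution phase L_hat G0 G \<and>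
     (\<forall>t\<ge>0. g t \<in> L2 phase \<and> (AE z in phase. g t z = inverse_fourier (G t) z)))"

text \<open>
  Being determined by the moment is a property of a class of solutions: if two of its
  members have the same moment at some instants, they evolve identically from there on.
\<close>

definition grossly_determined :: "(real \<Rightarrow> real \<times> real \<Rightarrow> complex) set \<Rightarrow> bool" where
  "grossly_determined S \<longleftrightarrow> (\<forall>g\<in>S. kinetic_solution g) \<and>
     (\<forall>g\<in>S. \<forall>h\<in>S. \<forall>s\<ge>0. \<forall>t\<ge>0.
        (AE x in lborel. moment (g s) x = moment (h t) x) \<longrightarrow>
        (\<forall>\<tau>\<ge>0. AE z in phase. g (s + \<tau>) z = h (t + \<tau>) z))"

definition g_trunc ::
  "real \<Rightarrow> (real \<Rightarrow> real \<times> real \<Rightarrow> complex) \<Rightarrow> real \<Rightarrow> real \<times> real \<Rightarrow> complex" where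
  "g_trunc \<xi>0 F t = inverse_fourier (trunc_projector \<xi>0 (F t))"

end

theory Submission
  imports Defs "HOL-Probability.Probability"
begin

text \<open>
  On a fibre, \<open>L\<^sub>\<xi>\<close> is multiplication by \<open>- (1 + i v \<xi>)\<close> plus a rank-one operator, so resolvent,
  eigenvalue and Riesz projection are explicit: with \<open>a = 1 + \<lambda>\<^sup>*(\<xi>)\<close> the eigenfunction is
  \<open>k(v) = 1 / (a + i v \<xi>)\<close>, and a Laplace transform in an auxiliary variable \<open>s\<close> turns the dispersion
  integral into \<open>\<integral> exp (- a s - \<xi>\<^sup>2 s\<^sup>2 / 4) ds\<close>, which is monotone in \<open>a\<close> and in \<open>|\<xi>|\<close>.

  The decay of the complement uses a Lyapunov functional instead of resolvent estimates on vertical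
  lines.  Along \<open>f' = L\<^sub>\<xi> f\<close> with \<open>\<rho> = (f, 1)\<close>, the function
  \<open>y(s) = \<integral> exp (- (\<beta> + i v \<xi>) s) \<psi> f w dv\<close> satisfies a transport equation in \<open>s\<close> with source \<open>\<rho> \<kappa>\<close>,
  where \<open>\<beta> = 1 + \<lambda>\<^sup>*(\<xi>\<^sub>0) + \<epsilon>\<close>.  Above the cutoff take \<open>\<psi> = 1\<close>; below it take \<open>\<psi> = 1 - k\<close>, which has
  \<open>y(0) = \<rho>\<close> exactly on the range of \<open>1 - P\<close> and a kernel \<open>\<kappa>\<close> that is still nonnegative.  In both cases
  \<open>\<integral> \<kappa> \<le> q < 1\<close> uniformly in \<open>\<xi>\<close>, and then \<open>(1 - q) / 2 |f|\<^sup>2 + \<integral> |y|\<^sup>2 / u ds\<close> with \<open>u' = - \<kappa>\<close>,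
  \<open>u(0) = 1\<close>, decays at the rate \<open>2 (\<beta> - 1)\<close>.  Plancherel's theorem transfers the estimate to \<open>x\<close>.
\<close>

subsection \<open>The spaces \<open>L\<^sup>2\<close>\<close>

text \<open>The obstacle is uniformity in \<xi>: for \<xi> \<noteq> 0 the operator
  \<open>L_op \<xi>\<close> is not normal, and every constant has to survive integration over all
  frequencies. Along an orbit half of |f|^2 changes at the rate |\<rho>|^2 - |f|^2, so only the
  moment can prevent decay. The transported part repays it: half of the integral of |y|^2 / u
  changes at most at the rate -(1 - q) |\<rho>|^2 / 2 plus (\<beta> - 1) times the integral, and the
  weight (1 - q) / 2 in front of |f|^2 is exactly the one that cancels |\<rho>|^2. The range of 1 -
  P is the kernel of the pairing with k, so replacing 1 by 1 - k does not change the moment there.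
  Nonnegativity of \<kappa> below the cutoff is the dispersion relation. The bound q < 1 comes from
  strict monotonicity of the dispersion integral above the cutoff, where \<epsilon> > 0 is spent,
  and from the first resolvent identity below it. Rates are proved for data in the domain of the
  generator and extended by density. The semigroup itself is supplied by
  \<open>semigroup_solution\<close>; its uniqueness lets two solutions be compared.\<close>

lemma L2_I: "f \<in> borel_measurable M \<Longrightarrow> integrable M (\<lambda>x. (norm (f x))\<^sup>2) \<Longrightarrow> f \<in> L2 M"
  by (simp add: L2_def)

lemma L2_measurable [measurable_dest]: "f \<in> L2 M \<Longrightarrow> f \<in> borel_measurable M"
  by (simp add: L2_def)

lemma L2_integrable_sq: "f \<in> L2 M \<Longrightarrow> integrable M (\<lambda>x. (norm (f x))\<^sup>2)"
  by (simp add: L2_def)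

lemma l2_norm_nonneg [simp]: "0 \<le> l2_norm M f"
  by (simp add: l2_norm_def)

lemma l2_norm_sq: "(l2_norm M f)\<^sup>2 = (\<integral>x. (norm (f x))\<^sup>2 \<partial>M)"
  by (simp add: l2_norm_def)

lemma L2_dominated:
  assumes "f \<in> L2 M" "g \<in> borel_measurable M" "AE x in M. norm (g x) \<le> C * norm (f x)"
  shows "g \<in> L2 M" and "0 \<le> C \<Longrightarrow> l2_norm M g \<le> C * l2_norm M f"
proof -
  have ae: "AE x in M. (norm (g x))\<^sup>2 \<le> C\<^sup>2 * (norm (f x))\<^sup>2"
    using assms(3)
  proof eventually_elim
    case (elim x)
    then have "(norm (g x))\<^sup>2 \<le> (C * norm (f x))\<^sup>2"
      by (intro power_mono) auto
    then show ?case by (simp add: power_mult_distrib)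
  qed
  have int: "integrable M (\<lambda>x. C\<^sup>2 * (norm (f x))\<^sup>2)"
    using L2_integrable_sq[OF assms(1)] by simp
  have intg: "integrable M (\<lambda>x. (norm (g x))\<^sup>2)"
    by (rule Bochner_Integration.integrable_bound[OF int]) (use assms(2) ae in auto)
  then show "g \<in> L2 M" using assms(2) by (simp add: L2_def)
  assume C: "0 \<le> C"
  have "(l2_norm M g)\<^sup>2 \<le> (C * l2_norm M f)\<^sup>2"
    unfolding power_mult_distrib l2_norm_sq
    using integral_mono_AE[OF intg int ae] by simp
  then show "l2_norm M g \<le> C * l2_norm M f"
    using C by (simp add: power2_le_iff_abs_le)
qed

lemma L2_scale: "f \<in> L2 M \<Longrightarrow> (\<lambda>x. a * f x) \<in> L2 M"
  by (rule L2_dominated(1)[where C = "norm a"]) (auto simp: norm_mult intro: L2_measurable)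

lemma l2_norm_scale: "l2_norm M (\<lambda>x. a * f x) = norm a * l2_norm M f"
  unfolding l2_norm_def by (simp add: norm_mult power_mult_distrib real_sqrt_mult)

lemma L2_add:
  assumes "f \<in> L2 M" "g \<in> L2 M"
  shows "(\<lambda>x. f x + g x) \<in> L2 M"
proof (rule L2_I)
  show "(\<lambda>x. f x + g x) \<in> borel_measurable M" using assms by measurable
  have int: "integrable M (\<lambda>x. 2 * (norm (f x))\<^sup>2 + 2 * (norm (g x))\<^sup>2)"
    using assms by (auto simp: L2_def)
  show "integrable M (\<lambda>x. (norm (f x + g x))\<^sup>2)"
  proof (rule Bochner_Integration.integrable_bound[OF int])
    show "AE x in M. norm ((norm (f x + g x))\<^sup>2) \<le> norm (2 * (norm (f x))\<^sup>2 + 2 * (norm (g x))\<^sup>2)"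
    proof (intro AE_I2)
      fix x
      have "(norm (f x + g x))\<^sup>2 \<le> (norm (f x) + norm (g x))\<^sup>2"
        by (intro power_mono norm_triangle_ineq) auto
      also have "\<dots> \<le> 2 * (norm (f x))\<^sup>2 + 2 * (norm (g x))\<^sup>2"
        using zero_le_power2[of "norm (f x) - norm (g x)"] by (simp add: power2_eq_square algebra_simps)
      finally show "norm ((norm (f x + g x))\<^sup>2) \<le> norm (2 * (norm (f x))\<^sup>2 + 2 * (norm (g x))\<^sup>2)"
        by simp
    qed
  qed (use assms in measurable)
qed

lemma L2_lincomb: "f \<in> L2 M \<Longrightarrow> g \<in> L2 M \<Longrightarrow> (\<lambda>x. a * f x + b * g x) \<in> L2 M"
  by (intro L2_add L2_scale)

lemma L2_diff: "f \<in> L2 M \<Longrightarrow> g \<in> L2 M \<Longrightarrow> (\<lambda>x. f x - g x) \<in> L2 M"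
  using L2_lincomb[of f M g 1 "-1"] by simp

lemma L2_zero [simp]: "(\<lambda>x. 0) \<in> L2 M"
  by (simp add: L2_def)

lemma borel_measurable_cnj [measurable]:
  "f \<in> borel_measurable M \<Longrightarrow> (\<lambda>x. cnj (f x)) \<in> borel_measurable M"
  by (intro borel_measurable_continuous_on[where f = cnj]) (auto intro: continuous_intros)

lemma L2_cnj: "f \<in> L2 M \<Longrightarrow> (\<lambda>x. cnj (f x)) \<in> L2 M"
  by (auto simp: L2_def intro: borel_measurable_cnj)

lemma L2_integrable_mult:
  assumes "f \<in> L2 M" "g \<in> L2 M"
  shows "integrable M (\<lambda>x. f x * g x)"
proof -
  have int: "integrable M (\<lambda>x. (norm (f x))\<^sup>2 + (norm (g x))\<^sup>2)"
    using assms by (auto simp: L2_def)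
  show ?thesis
  proof (rule Bochner_Integration.integrable_bound[OF int])
    show "AE x in M. norm (f x * g x) \<le> norm ((norm (f x))\<^sup>2 + (norm (g x))\<^sup>2)"
    proof (intro AE_I2)
      fix x
      have "2 * (norm (f x) * norm (g x)) \<le> (norm (f x))\<^sup>2 + (norm (g x))\<^sup>2"
        using zero_le_power2[of "norm (f x) - norm (g x)"] by (simp add: power2_eq_square algebra_simps)
      moreover have "0 \<le> norm (f x) * norm (g x)" by simp
      ultimately show "norm (f x * g x) \<le> norm ((norm (f x))\<^sup>2 + (norm (g x))\<^sup>2)"
        by (simp add: norm_mult del: mult_nonneg_nonneg zero_le_mult_iff)
    qed
  qed (use assms in measurable)
qed

lemma L2_integrable_inner:
  "f \<in> L2 M \<Longrightarrow> g \<in> L2 M \<Longrightarrow> integrable M (\<lambda>x. f x * cnj (g x))"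
  by (intro L2_integrable_mult L2_cnj)

lemma l2_inner_self: "l2_inner M f f = of_real ((l2_norm M f)\<^sup>2)"
  unfolding l2_inner_def l2_norm_sq integral_complex_of_real[symmetric]
  by (intro Bochner_Integration.integral_cong) (auto simp: complex_norm_square simp del: of_real_power)

lemma l2_norm_add_sq:
  assumes "f \<in> L2 M" "g \<in> L2 M"
  shows "(l2_norm M (\<lambda>x. f x + g x))\<^sup>2 = (l2_norm M f)\<^sup>2 + 2 * Re (l2_inner M f g) + (l2_norm M g)\<^sup>2"
proof -
  have "(norm (f x + g x))\<^sup>2 = (norm (f x))\<^sup>2 + 2 * Re (f x * cnj (g x)) + (norm (g x))\<^sup>2" for x
    by (simp only: cmod_power2) (simp add: power2_eq_square algebra_simps)
  then have "(l2_norm M (\<lambda>x. f x + g x))\<^sup>2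
      = (\<integral>x. (norm (f x))\<^sup>2 + 2 * Re (f x * cnj (g x)) + (norm (g x))\<^sup>2 \<partial>M)"
    by (simp add: l2_norm_sq)
  also have "\<dots> = (l2_norm M f)\<^sup>2 + 2 * (\<integral>x. Re (f x * cnj (g x)) \<partial>M) + (l2_norm M g)\<^sup>2"
    using L2_integrable_sq[OF assms(1)] L2_integrable_sq[OF assms(2)] L2_integrable_inner[OF assms]
    by (simp add: l2_norm_sq del: complex_cnj_mult times_complex.sel)
  also have "(\<integral>x. Re (f x * cnj (g x)) \<partial>M) = Re (l2_inner M f g)"
    unfolding l2_inner_def using L2_integrable_inner[OF assms] by (rule integral_Re)
  finally show ?thesis .
qed

lemma l2_inner_scale_left: "l2_inner M (\<lambda>x. a * f x) g = a * l2_inner M f g"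
  by (simp add: l2_inner_def mult.assoc)

lemma l2_inner_scale_right: "l2_inner M f (\<lambda>x. a * g x) = cnj a * l2_inner M f g"
  by (simp add: l2_inner_def mult.assoc mult.left_commute)

lemma l2_cauchy_schwarz:
  assumes "f \<in> L2 M" "g \<in> L2 M"
  shows "norm (l2_inner M f g) \<le> l2_norm M f * l2_norm M g"
proof -
  define I where "I = l2_inner M f g"
  define F where "F = l2_norm M f"
  define G where "G = l2_norm M g"
  \<comment> \<open>This expands |f - s I g|^2 for real s; the factor \<open>I\<close> makes the
    cross term real. For \<open>G = 0\<close> the expression is affine in s and a large s forces
    \<open>I = 0\<close>; otherwise s = 1 / G^2 minimises it.\<close>
  have quad: "0 \<le> F\<^sup>2 - 2 * s * (cmod I)\<^sup>2 + s\<^sup>2 * (cmod I)\<^sup>2 * G\<^sup>2" for s :: real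
  proof -
    have 1: "0 \<le> (l2_norm M (\<lambda>x. f x + (- of_real s * I) * g x))\<^sup>2" by simp
    have "(l2_norm M (\<lambda>x. f x + (- of_real s * I) * g x))\<^sup>2
      = F\<^sup>2 + 2 * Re (cnj (- of_real s * I) * I) + (norm (- of_real s * I) * G)\<^sup>2"
      unfolding F_def G_def l2_norm_add_sq[OF assms(1) L2_scale[OF assms(2)]]
        l2_inner_scale_right l2_norm_scale I_def ..
    also have "Re (cnj (- of_real s * I) * I) = - s * (cmod I)\<^sup>2"
      by (simp add: cmod_power2[of I]) (simp add: power2_eq_square algebra_simps)
    also have "(norm (- of_real s * I) * G)\<^sup>2 = s\<^sup>2 * (cmod I)\<^sup>2 * G\<^sup>2"
      by (simp add: norm_mult power_mult_distrib)
    finally show ?thesis using 1 by simp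
  qed
  have "cmod I \<le> F * G"
  proof (cases "G = 0")
    case True
    have "cmod I = 0"
    proof (rule ccontr)
      assume "cmod I \<noteq> 0"
      then have "(cmod I)\<^sup>2 > 0" by simp
      moreover have "0 \<le> F\<^sup>2 - 2 * ((F\<^sup>2 + 1) / (cmod I)\<^sup>2) * (cmod I)\<^sup>2"
        using quad[of "(F\<^sup>2 + 1) / (cmod I)\<^sup>2"] True by simp
      ultimately have "0 \<le> F\<^sup>2 - 2 * (F\<^sup>2 + 1)" by simp
      then show False using zero_le_power2[of F] by (simp add: algebra_simps)
    qed
    then show ?thesis using True by simp
  next
    case False
    then have G: "G > 0" using l2_norm_nonneg[of M g] unfolding G_def by linarith
    have "0 \<le> F\<^sup>2 - 2 * (1 / G\<^sup>2) * (cmod I)\<^sup>2 + (1 / G\<^sup>2)\<^sup>2 * (cmod I)\<^sup>2 * G\<^sup>2" by (rule quad)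
    also have "\<dots> = F\<^sup>2 - (cmod I)\<^sup>2 / G\<^sup>2"
      using G by (simp add: power2_eq_square field_simps)
    finally have "(cmod I)\<^sup>2 \<le> (F * G)\<^sup>2"
      using G by (simp add: power_mult_distrib field_simps)
    then show ?thesis
      by (rule power2_le_imp_le) (simp add: F_def G_def)
  qed
  then show ?thesis by (simp add: I_def F_def G_def)
qed

lemma l2_triangle:
  assumes "f \<in> L2 M" "g \<in> L2 M"
  shows "l2_norm M (\<lambda>x. f x + g x) \<le> l2_norm M f + l2_norm M g"
proof (rule power2_le_imp_le)
  have "Re (l2_inner M f g) \<le> l2_norm M f * l2_norm M g"
    using l2_cauchy_schwarz[OF assms] complex_Re_le_cmod order_trans by blast
  then show "(l2_norm M (\<lambda>x. f x + g x))\<^sup>2 \<le> (l2_norm M f + l2_norm M g)\<^sup>2"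
    unfolding l2_norm_add_sq[OF assms] power2_sum by simp
qed simp

lemma l2_norm_minus: "l2_norm M (\<lambda>x. - f x) = l2_norm M f"
  by (simp add: l2_norm_def)

lemma l2_norm_minus_commute: "l2_norm M (\<lambda>x. f x - g x) = l2_norm M (\<lambda>x. g x - f x)"
  by (simp add: l2_norm_def norm_minus_commute)

lemma l2_triangle_diff:
  assumes "f \<in> L2 M" "g \<in> L2 M"
  shows "l2_norm M (\<lambda>x. f x - g x) \<le> l2_norm M f + l2_norm M g"
  using l2_triangle[OF assms(1) L2_scale[OF assms(2), of "-1"]] by (simp add: l2_norm_minus)

lemma l2_triangle_via:
  assumes "f \<in> L2 M" "g \<in> L2 M" "h \<in> L2 M"
  shows "l2_norm M (\<lambda>x. f x - h x) \<le> l2_norm M (\<lambda>x. f x - g x) + l2_norm M (\<lambda>x. g x - h x)"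
  using l2_triangle[OF L2_diff[OF assms(1,2)] L2_diff[OF assms(2,3)]] by simp

lemma l2_norm_le_via:
  assumes "f \<in> L2 M" "g \<in> L2 M"
  shows "l2_norm M f \<le> l2_norm M g + l2_norm M (\<lambda>x. f x - g x)"
  using l2_triangle[OF assms(2) L2_diff[OF assms]] by simp

lemma l2_norm_cong_AE:
  assumes "AE x in M. f x = g x" "f \<in> borel_measurable M" "g \<in> borel_measurable M"
  shows "l2_norm M f = l2_norm M g"
  unfolding l2_norm_def by (rule arg_cong[OF integral_cong_AE]) (use assms in auto)

lemma l2_inner_cong_AE:
  assumes "AE x in M. f x = f' x" "AE x in M. g x = g' x" "f \<in> borel_measurable M"
    "f' \<in> borel_measurable M" "g \<in> borel_measurable M" "g' \<in> borel_measurable M"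
  shows "l2_inner M f g = l2_inner M f' g'"
  unfolding l2_inner_def by (rule integral_cong_AE) (use assms in auto)

lemma l2_norm_eq_0_iff:
  assumes "f \<in> L2 M"
  shows "l2_norm M f = 0 \<longleftrightarrow> (AE x in M. f x = 0)"
proof -
  have "l2_norm M f = 0 \<longleftrightarrow> (\<integral>x. (norm (f x))\<^sup>2 \<partial>M) = 0"
    by (simp add: l2_norm_def)
  also have "\<dots> \<longleftrightarrow> (AE x in M. (norm (f x))\<^sup>2 = 0)"
    by (rule integral_nonneg_eq_0_iff_AE[OF L2_integrable_sq[OF assms]]) simp
  finally show ?thesis by simp
qed

lemma l2_norm_diff_eq_0_iff:
  assumes "f \<in> L2 M" "g \<in> L2 M"
  shows "l2_norm M (\<lambda>x. f x - g x) = 0 \<longleftrightarrow> (AE x in M. f x = g x)"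
  using l2_norm_eq_0_iff[OF L2_diff[OF assms]] by simp

lemma l2_inner_add_left:
  assumes "f \<in> L2 M" "g \<in> L2 M" "h \<in> L2 M"
  shows "l2_inner M (\<lambda>x. f x + g x) h = l2_inner M f h + l2_inner M g h"
  unfolding l2_inner_def distrib_right
  using L2_integrable_inner[OF assms(1,3)] L2_integrable_inner[OF assms(2,3)]
  by (rule Bochner_Integration.integral_add)

lemma l2_inner_diff_left:
  assumes "f \<in> L2 M" "g \<in> L2 M" "h \<in> L2 M"
  shows "l2_inner M (\<lambda>x. f x - g x) h = l2_inner M f h - l2_inner M g h"
  unfolding l2_inner_def left_diff_distrib
  using L2_integrable_inner[OF assms(1,3)] L2_integrable_inner[OF assms(2,3)]
  by (rule Bochner_Integration.integral_diff)

lemma L2_indicator: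
  assumes "f \<in> L2 M" "A \<in> sets M"
  shows "(\<lambda>x. indicator A x * f x) \<in> L2 M"
  by (rule L2_dominated(1)[OF assms(1), where C = 1]) (use assms in \<open>auto simp: indicator_def\<close>)

lemma tendsto_l2_norm_zero_dominated:
  fixes f :: "nat \<Rightarrow> 'a \<Rightarrow> complex"
  assumes "\<And>n. f n \<in> borel_measurable M" "w \<in> L2 M"
    and "\<And>n. AE x in M. norm (f n x) \<le> norm (w x)"
    and "AE x in M. (\<lambda>n. f n x) \<longlonglongrightarrow> 0"
  shows "(\<lambda>n. l2_norm M (f n)) \<longlonglongrightarrow> 0"
proof -
  have "(\<lambda>n. \<integral>x. (norm (f n x))\<^sup>2 \<partial>M) \<longlonglongrightarrow> (\<integral>x. 0 \<partial>M)"
  proof (rule integral_dominated_convergence)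
    show "integrable M (\<lambda>x. (norm (w x))\<^sup>2)" by (rule L2_integrable_sq) fact
    show "AE x in M. (\<lambda>n. (norm (f n x))\<^sup>2) \<longlonglongrightarrow> 0"
      using assms(4)
    proof eventually_elim
      case (elim x)
      from tendsto_power[OF tendsto_norm[OF this], of 2] show ?case by simp
    qed
    show "AE x in M. norm ((norm (f n x))\<^sup>2) \<le> (norm (w x))\<^sup>2" for n
      using assms(3)[of n] by eventually_elim (simp add: power_mono)
  qed (use assms(1) in measurable)
  from tendsto_real_sqrt[OF this] show ?thesis by (simp add: l2_norm_def)
qed

text \<open>Riesz--Fischer: a rapidly Cauchy subsequence converges almost everywhere, and Fatou's lemma
  identifies its pointwise limit as the limit in \<open>L\<^sup>2\<close>.\<close>

lemma L2_complete:
  fixes f :: "nat \<Rightarrow> 'a \<Rightarrow> complex"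
  assumes L2: "\<And>n. f n \<in> L2 M"
    and cauchy: "\<And>e. e > 0 \<Longrightarrow> \<exists>N. \<forall>m\<ge>N. \<forall>n\<ge>N. l2_norm M (\<lambda>x. f m x - f n x) < e"
  shows "\<exists>g\<in>L2 M. (\<lambda>n. l2_norm M (\<lambda>x. f n x - g x)) \<longlonglongrightarrow> 0"
proof -
  have "\<forall>k. \<exists>N. \<forall>m\<ge>N. \<forall>n\<ge>N. l2_norm M (\<lambda>x. f m x - f n x) < (1/2)^k"
    using cauchy by simp
  then obtain N where N: "\<And>k m n. m \<ge> N k \<Longrightarrow> n \<ge> N k \<Longrightarrow> l2_norm M (\<lambda>x. f m x - f n x) < (1/2)^k"
    by metis
  \<comment> \<open>Partial sums turn the arbitrary thresholds into a nondecreasing sequence that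
    still dominates every \<open>N k\<close>, so consecutive terms along \<open>r\<close> differ by
    at most (1/2)^k.\<close>
  define r where "r k = (\<Sum>j\<le>k. N j)" for k
  have rN: "N k \<le> r k" for k
    unfolding r_def by (rule member_le_sum) auto
  have r_mono: "r k \<le> r (Suc k)" for k
    unfolding r_def by simp
  define d where "d k x = norm (f (r (Suc k)) x - f (r k) x)" for k x
  have [measurable]: "f n \<in> borel_measurable M" for n using L2 by (rule L2_measurable)
  have d_meas[measurable]: "d k \<in> borel_measurable M" for k
    unfolding d_def by measurable
  define S where "S n x = (\<Sum>k<n. complex_of_real (d k x))" for n x
  have dL2: "(\<lambda>x. complex_of_real (d k x)) \<in> L2 M" for k
  proof (rule L2_dominated(1)[OF L2_diff[OF L2[of "r (Suc k)"] L2[of "r k"]], where C = 1])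
    show "AE x in M. norm (complex_of_real (d k x)) \<le> 1 * norm (f (r (Suc k)) x - f (r k) x)"
      by (simp add: d_def)
  qed measurable
  \<comment> \<open>The bound is the geometric sum of (1/2)^k over k < n; it stays below 2, whence
    the constant 4 for the squares.\<close>
  have S_L2: "S n \<in> L2 M \<and> l2_norm M (S n) \<le> 2 - 2 * (1/2)^n" for n
  proof (induction n)
    case 0
    then show ?case unfolding S_def by (simp add: l2_norm_def)
  next
    case (Suc n)
    have eq: "S (Suc n) = (\<lambda>x. S n x + complex_of_real (d n x))"
      by (auto simp: S_def)
    have "l2_norm M (S (Suc n)) \<le> l2_norm M (S n) + l2_norm M (\<lambda>x. complex_of_real (d n x))"
      unfolding eq using Suc dL2 by (intro l2_triangle) auto
    also have "l2_norm M (\<lambda>x. complex_of_real (d n x)) = l2_norm M (\<lambda>x. f (r (Suc n)) x - f (r n) x)"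
      by (simp add: l2_norm_def d_def)
    also have "\<dots> \<le> (1/2)^n"
      using N[of n "r (Suc n)" "r n"] rN r_mono by (meson less_imp_le order_trans)
    finally show ?case
      using Suc L2_add[of "S n" M "\<lambda>x. complex_of_real (d n x)"] dL2 unfolding eq
      by (simp add: field_simps)
  qed
  have nn: "(\<integral>\<^sup>+x. (\<Sum>k. ennreal (d k x))^2 \<partial>M) \<le> 4"
  proof -
    have eq: "(\<Sum>k. ennreal (d k x))^2 = (SUP n. ennreal ((norm (S n x))\<^sup>2))" for x
    proof -
      have "(\<lambda>n. ennreal ((norm (S n x))\<^sup>2)) \<longlonglongrightarrow> (\<Sum>k. ennreal (d k x))^2"
      proof -
        have "(\<lambda>n. (\<Sum>k<n. ennreal (d k x))) \<longlonglongrightarrow> (\<Sum>k. ennreal (d k x))"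
          by (intro summable_LIMSEQ summableI)
        then have "(\<lambda>n. (\<Sum>k<n. ennreal (d k x))^2) \<longlonglongrightarrow> (\<Sum>k. ennreal (d k x))^2"
          unfolding power2_eq_square by (intro tendsto_mult_ennreal) (auto simp: d_def)
        moreover have "(\<Sum>k<n. ennreal (d k x))^2 = ennreal ((norm (S n x))\<^sup>2)" for n
        proof -
          have "norm (S n x) = (\<Sum>k<n. d k x)"
            unfolding S_def of_real_sum[symmetric] norm_of_real
            by (simp add: sum_nonneg d_def)
          then show ?thesis
            by (simp add: sum_nonneg d_def flip: sum_ennreal ennreal_power)
        qed
        ultimately show ?thesis by simp
      qed
      moreover have "incseq (\<lambda>n. ennreal ((norm (S n x))\<^sup>2))"
      proof (rule incseq_SucI, rule ennreal_leI, rule power_mono)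
        fix n
        have e: "norm (S n x) = (\<Sum>k<n. d k x)" for n
          unfolding S_def of_real_sum[symmetric] norm_of_real
          by (simp add: sum_nonneg d_def)
        show "norm (S n x) \<le> norm (S (Suc n) x)" unfolding e by (simp add: d_def)
      qed simp
      ultimately show ?thesis using LIMSEQ_SUP LIMSEQ_unique by blast
    qed
    have "(\<integral>\<^sup>+x. (\<Sum>k. ennreal (d k x))^2 \<partial>M) = (SUP n. \<integral>\<^sup>+x. ennreal ((norm (S n x))\<^sup>2) \<partial>M)"
      unfolding eq
    proof (rule nn_integral_monotone_convergence_SUP)
      show "incseq (\<lambda>n x. ennreal ((norm (S n x))\<^sup>2))"
      proof (rule incseq_SucI, rule le_funI, rule ennreal_leI, rule power_mono)
        fix n x
        have e: "norm (S n x) = (\<Sum>k<n. d k x)" for n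
          unfolding S_def of_real_sum[symmetric] norm_of_real
          by (simp add: sum_nonneg d_def)
        show "norm (S n x) \<le> norm (S (Suc n) x)" unfolding e by (simp add: d_def)
      qed simp
      show "(\<lambda>x. ennreal ((norm (S n x))\<^sup>2)) \<in> borel_measurable M" for n
        unfolding S_def by measurable
    qed
    also have "\<dots> \<le> 4"
    proof (rule SUP_least)
      fix n
      have "(\<integral>\<^sup>+x. ennreal ((norm (S n x))\<^sup>2) \<partial>M) = ennreal ((l2_norm M (S n))\<^sup>2)"
        unfolding l2_norm_sq using S_L2[of n]
        by (intro nn_integral_eq_integral L2_integrable_sq) auto
      also have "(l2_norm M (S n))\<^sup>2 \<le> 2\<^sup>2"
      proof (rule power_mono)
        have "(0::real) \<le> (1/2)^n" by simp
        then show "l2_norm M (S n) \<le> 2" using S_L2[of n] by linarith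
      qed simp
      then have "ennreal ((l2_norm M (S n))\<^sup>2) \<le> ennreal 4" by (intro ennreal_leI) simp
      finally show "(\<integral>\<^sup>+x. ennreal ((norm (S n x))\<^sup>2) \<partial>M) \<le> 4" by simp
    qed
    finally show ?thesis .
  qed
  have "AE x in M. (\<Sum>k. ennreal (d k x))^2 \<noteq> \<infinity>"
    using nn by (intro nn_integral_PInf_AE) (auto simp: top_unique)
  then have ae: "AE x in M. summable (\<lambda>k. d k x)"
  proof eventually_elim
    case (elim x)
    then have "(\<Sum>k. ennreal (d k x)) \<noteq> \<top>"
      by (auto simp: power2_eq_square)
    then show ?case by (intro summable_suminf_not_top) (auto simp: d_def)
  qed
  define g where "g x = lim (\<lambda>k. f (r k) x)" for x
  have conv: "AE x in M. (\<lambda>k. f (r k) x) \<longlonglongrightarrow> g x"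
    using ae
  proof eventually_elim
    case (elim x)
    have "summable (\<lambda>k. f (r (Suc k)) x - f (r k) x)"
      by (rule summable_norm_cancel) (use elim in \<open>simp add: d_def\<close>)
    then have "convergent (\<lambda>n. \<Sum>k<n. f (r (Suc k)) x - f (r k) x)"
      by (simp add: summable_iff_convergent)
    also have "(\<lambda>n. \<Sum>k<n. f (r (Suc k)) x - f (r k) x) = (\<lambda>n. f (r n) x - f (r 0) x)"
      by (simp add: sum_lessThan_telescope[of "\<lambda>k. f (r k) x"])
    finally have "convergent (\<lambda>n. f (r n) x)" by (simp only: convergent_diff_const_right_iff)
    then show ?case unfolding g_def by (simp add: convergent_LIMSEQ_iff)
  qed
  have g_meas[measurable]: "g \<in> borel_measurable M" unfolding g_def by measurable
  \<comment> \<open>Fatou is applied with n fixed while the index of the subsequence tends to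
    infinity, so the whole sequence is controlled and not only the subsequence.\<close>
  have fatou: "integrable M (\<lambda>x. (norm (f n x - g x))\<^sup>2) \<and> l2_norm M (\<lambda>x. f n x - g x) \<le> (1/2)^j"
    if n: "n \<ge> N j" for n j
  proof -
    have "(\<integral>\<^sup>+x. ennreal ((norm (f n x - g x))\<^sup>2) \<partial>M)
        = (\<integral>\<^sup>+x. liminf (\<lambda>k. ennreal ((norm (f n x - f (r k) x))\<^sup>2)) \<partial>M)"
    proof (rule nn_integral_cong_AE)
      show "AE x in M. ennreal ((norm (f n x - g x))\<^sup>2) = liminf (\<lambda>k. ennreal ((norm (f n x - f (r k) x))\<^sup>2))"
        using conv
      proof eventually_elim
        case (elim x)
        then have "(\<lambda>k. ennreal ((norm (f n x - f (r k) x))\<^sup>2)) \<longlonglongrightarrow> ennreal ((norm (f n x - g x))\<^sup>2)"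
          by (intro tendsto_ennrealI tendsto_power tendsto_norm tendsto_diff tendsto_const)
        then show ?case by (rule lim_imp_Liminf[symmetric, rotated]) simp
      qed
    qed
    also have "\<dots> \<le> liminf (\<lambda>k. \<integral>\<^sup>+x. ennreal ((norm (f n x - f (r k) x))\<^sup>2) \<partial>M)"
      by (rule nn_integral_liminf) measurable
    also have "\<dots> \<le> ennreal (((1/2)^j)\<^sup>2)"
    proof (rule Liminf_le)
      show "\<forall>\<^sub>F k in sequentially. (\<integral>\<^sup>+x. ennreal ((norm (f n x - f (r k) x))\<^sup>2) \<partial>M) \<le> ennreal (((1/2)^j)\<^sup>2)"
        using eventually_ge_at_top[of j]
      proof eventually_elim
        case (elim k)
        have "r j \<le> r k" unfolding r_def using elim by (intro sum_mono2) auto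
        then have "N j \<le> r k" using rN[of j] by linarith
        then have "l2_norm M (\<lambda>x. f n x - f (r k) x) \<le> (1/2)^j"
          using N[OF n] by (simp add: less_imp_le)
        then have le: "(l2_norm M (\<lambda>x. f n x - f (r k) x))\<^sup>2 \<le> ((1/2)^j)\<^sup>2" by (intro power_mono) auto
        have "(\<integral>\<^sup>+x. ennreal ((norm (f n x - f (r k) x))\<^sup>2) \<partial>M) = ennreal ((l2_norm M (\<lambda>x. f n x - f (r k) x))\<^sup>2)"
          unfolding l2_norm_sq
          by (intro nn_integral_eq_integral L2_integrable_sq L2_diff L2) auto
        then show ?case using le by (simp only: ennreal_leI)
      qed
    qed simp
    finally have le: "(\<integral>\<^sup>+x. ennreal ((norm (f n x - g x))\<^sup>2) \<partial>M) \<le> ennreal (((1/2)^j)\<^sup>2)" .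
    have int: "integrable M (\<lambda>x. (norm (f n x - g x))\<^sup>2)"
      by (rule integrableI_bounded)
         (use le in \<open>auto intro: le_less_trans simp: top_unique\<close>)
    then have "ennreal ((l2_norm M (\<lambda>x. f n x - g x))\<^sup>2) \<le> ennreal (((1/2)^j)\<^sup>2)"
      using le unfolding l2_norm_sq by (subst nn_integral_eq_integral[symmetric]) auto
    then have "(l2_norm M (\<lambda>x. f n x - g x))\<^sup>2 \<le> ((1/2)^j)\<^sup>2" by simp
    then have "l2_norm M (\<lambda>x. f n x - g x) \<le> (1/2)^j" by (rule power2_le_imp_le) simp
    with int show ?thesis by blast
  qed
  have "(\<lambda>x. f (N 0) x - g x) \<in> L2 M" using fatou[of 0 "N 0"] by (intro L2_I) auto
  from L2_diff[OF L2[of "N 0"] this] have gL2: "g \<in> L2 M" by simp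
  moreover have "(\<lambda>n. l2_norm M (\<lambda>x. f n x - g x)) \<longlonglongrightarrow> 0"
  proof (rule LIMSEQ_I)
    fix e :: real assume "e > 0"
    then obtain j where j: "(1/2::real)^j < e" using real_arch_pow_inv[of e "1/2"] by auto
    show "\<exists>no. \<forall>n\<ge>no. norm (l2_norm M (\<lambda>x. f n x - g x) - 0) < e"
    proof (intro exI[of _ "N j"] allI impI)
      fix n assume "n \<ge> N j"
      then have "l2_norm M (\<lambda>x. f n x - g x) \<le> (1/2)^j" using fatou by blast
      then show "norm (l2_norm M (\<lambda>x. f n x - g x) - 0) < e" using j by simp
    qed
  qed
  ultimately show ?thesis by blast
qed

subsection \<open>Differentiable curves and energy estimates in \<open>L\<^sup>2\<close>\<close>

text \<open>Linearity is demanded only almost everywhere, because \<open>inverse_fourier\<close> and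
  the maps of a semigroup return representatives that are fixed only up to null sets.\<close>

definition l2_bounded ::
  "'a measure \<Rightarrow> 'b measure \<Rightarrow> real \<Rightarrow> (('a \<Rightarrow> complex) \<Rightarrow> 'b \<Rightarrow> complex) \<Rightarrow> bool" where
  "l2_bounded M N C A \<longleftrightarrow> 0 \<le> C \<and>
     (\<forall>f\<in>L2 M. A f \<in> L2 N \<and> l2_norm N (A f) \<le> C * l2_norm M f) \<and>
     (\<forall>f\<in>L2 M. \<forall>g\<in>L2 M. \<forall>a b.
        AE x in N. A (\<lambda>y. a * f y + b * g y) x = a * A f x + b * A g x)"

lemma l2_bounded_L2: "l2_bounded M N C A \<Longrightarrow> f \<in> L2 M \<Longrightarrow> A f \<in> L2 N"
  by (simp add: l2_bounded_def)

lemma l2_bounded_norm: "l2_bounded M N C A \<Longrightarrow> f \<in> L2 M \<Longrightarrow> l2_norm N (A f) \<le> C * l2_norm M f"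
  by (simp add: l2_bounded_def)

lemma l2_bounded_nonneg: "l2_bounded M N C A \<Longrightarrow> 0 \<le> C"
  by (simp add: l2_bounded_def)

lemma l2_bounded_lincomb:
  "l2_bounded M N C A \<Longrightarrow> f \<in> L2 M \<Longrightarrow> g \<in> L2 M \<Longrightarrow>
     AE x in N. A (\<lambda>y. a * f y + b * g y) x = a * A f x + b * A g x"
  by (simp add: l2_bounded_def)

lemma l2_bounded_diff:
  "l2_bounded M N C A \<Longrightarrow> f \<in> L2 M \<Longrightarrow> g \<in> L2 M \<Longrightarrow>
     AE x in N. A (\<lambda>y. f y - g y) x = A f x - A g x"
  using l2_bounded_lincomb[of M N C A f g 1 "-1"] by simp

lemma l2_bounded_diff_lincomb:
  assumes "l2_bounded M N C A" "f \<in> L2 M" "g \<in> L2 M" "h \<in> L2 M"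
  shows "AE x in N. A (\<lambda>y. f y - g y - c * h y) x = A f x - A g x - c * A h x"
  using l2_bounded_diff[OF assms(1,2,3)]
    l2_bounded_lincomb[OF assms(1) L2_diff[OF assms(2,3)] assms(4), of 1 "-c"]
  by eventually_elim simp

text \<open>A bounded linear map cannot see the choice of representative, because the image of f - g
  has norm at most C times 0. This lets almost-everywhere equalities pass through operators defined
  by choice.\<close>

lemma l2_bounded_cong_AE:
  assumes A: "l2_bounded M N C A" and f: "f \<in> L2 M" and g: "g \<in> L2 M" and "AE x in M. f x = g x"
  shows "AE x in N. A f x = A g x"
proof -
  have "l2_norm N (\<lambda>x. A f x - A g x) = l2_norm N (A (\<lambda>x. f x - g x))"
    using l2_bounded_diff[OF A f g] A f g
    by (intro l2_norm_cong_AE L2_measurable L2_diff l2_bounded_L2[OF A] f g) auto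
  also have "\<dots> \<le> C * l2_norm M (\<lambda>x. f x - g x)"
    by (intro l2_bounded_norm[OF A] L2_diff f g)
  also have "l2_norm M (\<lambda>x. f x - g x) = 0"
    using l2_norm_diff_eq_0_iff[OF f g] assms(4) by simp
  finally have "l2_norm N (\<lambda>x. A f x - A g x) = 0"
    using l2_norm_nonneg[of N "\<lambda>x. A f x - A g x"] by linarith
  then show ?thesis
    using l2_norm_diff_eq_0_iff[of "A f" N "A g"] l2_bounded_L2[OF A] f g by simp
qed

lemma l2_bounded_complement:
  assumes "l2_bounded M M C A"
  shows "l2_bounded M M (1 + C) (\<lambda>f x. f x - A f x)"
  unfolding l2_bounded_def
proof (intro conjI ballI allI)
  fix f assume f: "f \<in> L2 M"
  show "(\<lambda>x. f x - A f x) \<in> L2 M" by (intro L2_diff f l2_bounded_L2[OF assms])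
  have "l2_norm M (\<lambda>x. f x - A f x) \<le> l2_norm M f + l2_norm M (A f)"
    by (intro l2_triangle_diff f l2_bounded_L2[OF assms])
  then show "l2_norm M (\<lambda>x. f x - A f x) \<le> (1 + C) * l2_norm M f"
    using l2_bounded_norm[OF assms f] by (simp add: distrib_right)
  fix g a b assume g: "g \<in> L2 M"
  show "AE x in M. a * f x + b * g x - A (\<lambda>y. a * f y + b * g y) x = a * (f x - A f x) + b * (g x - A g x)"
    using l2_bounded_lincomb[OF assms f g, of a b] by eventually_elim (simp add: algebra_simps)
qed (use l2_bounded_nonneg[OF assms] in simp)

text \<open>Differentiability is phrased through the remainder, since \<open>l2_norm\<close> is only
  a seminorm on representatives; the filter makes it one-sided at t = 0.\<close>

definition l2_has_derivative ::
  "'a measure \<Rightarrow> (real \<Rightarrow> 'a \<Rightarrow> complex) \<Rightarrow> ('a \<Rightarrow> complex) \<Rightarrow> real \<Rightarrow> bool" where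
  "l2_has_derivative M u d t \<longleftrightarrow> d \<in> L2 M \<and> (\<forall>s\<ge>0. u s \<in> L2 M) \<and>
     ((\<lambda>s. l2_norm M (\<lambda>x. u s x - u t x - complex_of_real (s - t) * d x) / \<bar>s - t\<bar>) \<longlongrightarrow> 0)
       (at t within {0..})"

lemma l2_has_derivative_bounded:
  assumes A: "l2_bounded M N C A" and u: "l2_has_derivative M u d t" and t: "t \<ge> 0"
  shows "l2_has_derivative N (\<lambda>s. A (u s)) (A d) t"
  unfolding l2_has_derivative_def
proof (intro conjI allI impI)
  have d: "d \<in> L2 M" and uL: "\<And>s. s \<ge> 0 \<Longrightarrow> u s \<in> L2 M"
    and lim: "((\<lambda>s. l2_norm M (\<lambda>x. u s x - u t x - complex_of_real (s - t) * d x) / \<bar>s - t\<bar>) \<longlongrightarrow> 0)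
       (at t within {0..})"
    using u by (auto simp: l2_has_derivative_def)
  show "A d \<in> L2 N" "\<And>s. 0 \<le> s \<Longrightarrow> A (u s) \<in> L2 N"
    using d uL l2_bounded_L2[OF A] by auto
  show "((\<lambda>s. l2_norm N (\<lambda>x. A (u s) x - A (u t) x - complex_of_real (s - t) * A d x) / \<bar>s - t\<bar>) \<longlongrightarrow> 0)
       (at t within {0..})"
  proof (rule Lim_null_comparison)
    show "((\<lambda>s. C * (l2_norm M (\<lambda>x. u s x - u t x - complex_of_real (s - t) * d x) / \<bar>s - t\<bar>)) \<longlongrightarrow> 0)
       (at t within {0..})"
      using tendsto_mult_right_zero[OF lim] by simp
    show "\<forall>\<^sub>F s in at t within {0..}.
       norm (l2_norm N (\<lambda>x. A (u s) x - A (u t) x - complex_of_real (s - t) * A d x) / \<bar>s - t\<bar>)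
       \<le> C * (l2_norm M (\<lambda>x. u s x - u t x - complex_of_real (s - t) * d x) / \<bar>s - t\<bar>)"
      unfolding eventually_at_filter
    proof (intro always_eventually allI impI)
      fix s assume "s \<in> {0::real..}"
      then have s: "u s \<in> L2 M" using uL by simp
      have "l2_norm N (\<lambda>x. A (u s) x - A (u t) x - complex_of_real (s - t) * A d x)
          = l2_norm N (A (\<lambda>x. u s x - u t x - complex_of_real (s - t) * d x))"
        using l2_bounded_diff_lincomb[OF A s uL[OF t] d, of "complex_of_real (s - t)"]
        by (intro l2_norm_cong_AE L2_measurable L2_diff L2_scale l2_bounded_L2[OF A] s uL t d) auto
      also have "\<dots> \<le> C * l2_norm M (\<lambda>x. u s x - u t x - complex_of_real (s - t) * d x)"
        by (intro l2_bounded_norm[OF A] L2_diff L2_scale s uL t d)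
      finally show "norm (l2_norm N (\<lambda>x. A (u s) x - A (u t) x - complex_of_real (s - t) * A d x) / \<bar>s - t\<bar>)
       \<le> C * (l2_norm M (\<lambda>x. u s x - u t x - complex_of_real (s - t) * d x) / \<bar>s - t\<bar>)"
        by (simp add: divide_right_mono)
    qed
  qed
qed

lemma l2_has_derivative_diff:
  assumes u: "l2_has_derivative M u d t" and v: "l2_has_derivative M v e t" and t: "t \<ge> 0"
  shows "l2_has_derivative M (\<lambda>s x. u s x - v s x) (\<lambda>x. d x - e x) t"
  unfolding l2_has_derivative_def
proof (intro conjI allI impI)
  have d: "d \<in> L2 M" "e \<in> L2 M" and uL: "\<And>s. s \<ge> 0 \<Longrightarrow> u s \<in> L2 M" "\<And>s. s \<ge> 0 \<Longrightarrow> v s \<in> L2 M"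
    and lim: "((\<lambda>s. l2_norm M (\<lambda>x. u s x - u t x - complex_of_real (s - t) * d x) / \<bar>s - t\<bar>) \<longlongrightarrow> 0)
       (at t within {0..})"
       "((\<lambda>s. l2_norm M (\<lambda>x. v s x - v t x - complex_of_real (s - t) * e x) / \<bar>s - t\<bar>) \<longlongrightarrow> 0)
       (at t within {0..})"
    using u v by (auto simp: l2_has_derivative_def)
  show "(\<lambda>x. d x - e x) \<in> L2 M" "\<And>s. 0 \<le> s \<Longrightarrow> (\<lambda>x. u s x - v s x) \<in> L2 M"
    using d uL by (auto intro: L2_diff)
  show "((\<lambda>s. l2_norm M (\<lambda>x. u s x - v s x - (u t x - v t x) - complex_of_real (s - t) * (d x - e x)) / \<bar>s - t\<bar>) \<longlongrightarrow> 0)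
       (at t within {0..})"
  proof (rule Lim_null_comparison)
    show "((\<lambda>s. l2_norm M (\<lambda>x. u s x - u t x - complex_of_real (s - t) * d x) / \<bar>s - t\<bar> +
       l2_norm M (\<lambda>x. v s x - v t x - complex_of_real (s - t) * e x) / \<bar>s - t\<bar>) \<longlongrightarrow> 0)
       (at t within {0..})"
      using tendsto_add[OF lim] by simp
    show "\<forall>\<^sub>F s in at t within {0..}.
       norm (l2_norm M (\<lambda>x. u s x - v s x - (u t x - v t x) - complex_of_real (s - t) * (d x - e x)) / \<bar>s - t\<bar>)
       \<le> l2_norm M (\<lambda>x. u s x - u t x - complex_of_real (s - t) * d x) / \<bar>s - t\<bar> +
       l2_norm M (\<lambda>x. v s x - v t x - complex_of_real (s - t) * e x) / \<bar>s - t\<bar>"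
      unfolding eventually_at_filter
    proof (intro always_eventually allI impI)
      fix s assume "s \<in> {0::real..}"
      then have s: "s \<ge> 0" by simp
      have "(\<lambda>x. u s x - v s x - (u t x - v t x) - complex_of_real (s - t) * (d x - e x)) =
          (\<lambda>x. (u s x - u t x - complex_of_real (s - t) * d x) - (v s x - v t x - complex_of_real (s - t) * e x))"
        by (auto simp: algebra_simps)
      then have "l2_norm M (\<lambda>x. u s x - v s x - (u t x - v t x) - complex_of_real (s - t) * (d x - e x))
        \<le> l2_norm M (\<lambda>x. u s x - u t x - complex_of_real (s - t) * d x) +
        l2_norm M (\<lambda>x. v s x - v t x - complex_of_real (s - t) * e x)"
        by (simp only:) (intro l2_triangle_diff L2_diff L2_scale uL s t d)
      then show "norm (l2_norm M (\<lambda>x. u s x - v s x - (u t x - v t x) - complex_of_real (s - t) * (d x - e x)) / \<bar>s - t\<bar>)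
       \<le> l2_norm M (\<lambda>x. u s x - u t x - complex_of_real (s - t) * d x) / \<bar>s - t\<bar> +
       l2_norm M (\<lambda>x. v s x - v t x - complex_of_real (s - t) * e x) / \<bar>s - t\<bar>"
        by (simp add: divide_right_mono flip: add_divide_distrib)
    qed
  qed
qed

text \<open>With the increment \<Delta> = r + (s - t) d and r = o(|s - t|), the expansion of |u t +
  \<Delta>|^2 has 2 (s - t) Re (d, u t) as its only first-order term.\<close>

lemma l2_has_derivative_norm_sq:
  assumes u: "l2_has_derivative M u d t" and t: "t \<ge> 0"
  shows "((\<lambda>s. (l2_norm M (u s))\<^sup>2) has_real_derivative 2 * Re (l2_inner M d (u t))) (at t within {0..})"
proof -
  have d: "d \<in> L2 M" and uL: "\<And>s. s \<ge> 0 \<Longrightarrow> u s \<in> L2 M"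
    and lim: "((\<lambda>s. l2_norm M (\<lambda>x. u s x - u t x - complex_of_real (s - t) * d x) / \<bar>s - t\<bar>) \<longlongrightarrow> 0)
       (at t within {0..})"
    using u by (auto simp: l2_has_derivative_def)
  define e where "e s = l2_norm M (\<lambda>x. u s x - u t x - complex_of_real (s - t) * d x) / \<bar>s - t\<bar>" for s
  have lim_e: "(e \<longlongrightarrow> 0) (at t within {0..})" using lim by (simp add: e_def[abs_def])
  have lim_s: "((\<lambda>s. \<bar>s - t\<bar>) \<longlongrightarrow> 0) (at t within {0..})"
    by (auto intro!: tendsto_eq_intros)
  have lim0: "((\<lambda>s. 2 * (e s * l2_norm M (u t)) + \<bar>s - t\<bar> * (e s + l2_norm M d)\<^sup>2) \<longlongrightarrow> 0) (at t within {0..})"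
    by (auto intro!: tendsto_eq_intros lim_e lim_s)
  have "\<forall>\<^sub>F s in at t within {0..}.
     norm (((l2_norm M (u s))\<^sup>2 - (l2_norm M (u t))\<^sup>2) / (s - t) - 2 * Re (l2_inner M d (u t)))
     \<le> 2 * (e s * l2_norm M (u t)) + \<bar>s - t\<bar> * (e s + l2_norm M d)\<^sup>2"
    unfolding eventually_at_filter
  proof (intro always_eventually allI impI)
    fix s assume ne: "s \<noteq> t" and "s \<in> {0::real..}"
    then have s: "s \<ge> 0" by simp
    let ?r = "\<lambda>x. u s x - u t x - complex_of_real (s - t) * d x"
    let ?\<Delta> = "\<lambda>x. u s x - u t x"
    have r: "?r \<in> L2 M" by (intro L2_diff L2_scale uL s t d)
    have \<Delta>: "?\<Delta> \<in> L2 M" by (intro L2_diff uL s t)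
    have r_norm: "l2_norm M ?r = \<bar>s - t\<bar> * e s" using ne by (simp add: e_def)
    have "l2_norm M ?\<Delta> \<le> l2_norm M (\<lambda>x. complex_of_real (s - t) * d x) + l2_norm M ?r"
      by (rule l2_norm_le_via[OF \<Delta> L2_scale[OF d]])
    also have "\<dots> = \<bar>s - t\<bar> * (e s + l2_norm M d)"
      unfolding l2_norm_scale r_norm norm_of_real by (simp add: algebra_simps)
    finally have \<Delta>_norm: "(l2_norm M ?\<Delta>)\<^sup>2 \<le> (\<bar>s - t\<bar> * (e s + l2_norm M d))\<^sup>2"
      by (intro power_mono) auto
    have "(l2_norm M (u s))\<^sup>2 = (l2_norm M (\<lambda>x. ?\<Delta> x + u t x))\<^sup>2" by simp
    also have "\<dots> = (l2_norm M ?\<Delta>)\<^sup>2 + 2 * Re (l2_inner M ?\<Delta> (u t)) + (l2_norm M (u t))\<^sup>2"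
      by (rule l2_norm_add_sq[OF \<Delta> uL[OF t]])
    also have "l2_inner M ?\<Delta> (u t) = l2_inner M (\<lambda>x. ?r x + complex_of_real (s - t) * d x) (u t)"
      by simp
    also have "\<dots> = l2_inner M ?r (u t) + complex_of_real (s - t) * l2_inner M d (u t)"
      by (subst l2_inner_add_left[OF r L2_scale[OF d] uL[OF t]]) (simp only: l2_inner_scale_left)
    also have "Re (l2_inner M ?r (u t) + complex_of_real (s - t) * l2_inner M d (u t))
       = Re (l2_inner M ?r (u t)) + (s - t) * Re (l2_inner M d (u t))" by simp
    finally have expand: "(l2_norm M (u s))\<^sup>2 - (l2_norm M (u t))\<^sup>2 - 2 * (s - t) * Re (l2_inner M d (u t))
       = (l2_norm M ?\<Delta>)\<^sup>2 + 2 * Re (l2_inner M ?r (u t))" by (simp add: algebra_simps)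
    have "\<bar>Re (l2_inner M ?r (u t))\<bar> \<le> l2_norm M ?r * l2_norm M (u t)"
      using l2_cauchy_schwarz[OF r uL[OF t]] abs_Re_le_cmod order_trans by blast
    then have "\<bar>(l2_norm M ?\<Delta>)\<^sup>2 + 2 * Re (l2_inner M ?r (u t))\<bar>
      \<le> (\<bar>s - t\<bar> * (e s + l2_norm M d))\<^sup>2 + 2 * (\<bar>s - t\<bar> * e s * l2_norm M (u t))"
      using \<Delta>_norm unfolding r_norm by (smt (verit) zero_le_power2)
    also have "\<dots> = \<bar>s - t\<bar> * (2 * (e s * l2_norm M (u t)) + \<bar>s - t\<bar> * (e s + l2_norm M d)\<^sup>2)"
      by (simp add: power2_eq_square algebra_simps)
    finally have le: "\<bar>(l2_norm M (u s))\<^sup>2 - (l2_norm M (u t))\<^sup>2 - 2 * (s - t) * Re (l2_inner M d (u t))\<bar>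
      \<le> \<bar>s - t\<bar> * (2 * (e s * l2_norm M (u t)) + \<bar>s - t\<bar> * (e s + l2_norm M d)\<^sup>2)"
      unfolding expand .
    have "((l2_norm M (u s))\<^sup>2 - (l2_norm M (u t))\<^sup>2) / (s - t) - 2 * Re (l2_inner M d (u t))
      = ((l2_norm M (u s))\<^sup>2 - (l2_norm M (u t))\<^sup>2 - 2 * (s - t) * Re (l2_inner M d (u t))) / (s - t)"
      using ne by (simp add: field_simps)
    then show "norm (((l2_norm M (u s))\<^sup>2 - (l2_norm M (u t))\<^sup>2) / (s - t) - 2 * Re (l2_inner M d (u t)))
     \<le> 2 * (e s * l2_norm M (u t)) + \<bar>s - t\<bar> * (e s + l2_norm M d)\<^sup>2"
      using le ne by (simp add: abs_divide pos_divide_le_eq mult.commute)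
  qed
  then show ?thesis
    unfolding has_field_derivative_iff by (subst Lim_null) (rule Lim_null_comparison[OF _ lim0])
qed

text \<open>The product of q with the integrating factor exp (- c t) is nonincreasing on
  [0, T].\<close>

lemma nonneg_gronwall:
  fixes q q' :: "real \<Rightarrow> real"
  assumes deriv: "\<And>t. t \<ge> 0 \<Longrightarrow> (q has_real_derivative q' t) (at t within {0..})"
    and le: "\<And>t. t \<ge> 0 \<Longrightarrow> q' t \<le> c * q t" and T: "T \<ge> 0"
  shows "q T \<le> exp (c * T) * q 0"
proof (cases "T = 0")
  case False
  with T have T: "T > 0" by simp
  define p where "p t = exp (- c * t) * q t" for t
  have dp: "(p has_real_derivative exp (- c * t) * (q' t - c * q t)) (at t within {0..})" if "t \<ge> 0" for t
    unfolding p_def[abs_def] by (rule derivative_eq_intros deriv[OF that] refl)+ (simp add: algebra_simps)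
  have "p T \<le> p 0"
  proof (rule DERIV_nonpos_imp_decreasing_open[of 0 T p])
    fix x assume x: "0 < x" "x < T"
    then have "(p has_real_derivative exp (- c * x) * (q' x - c * q x)) (at x)"
      using dp[of x] by (simp add: at_within_interior[of x "{0..}"])
    moreover have "exp (- c * x) * (q' x - c * q x) \<le> 0"
      using le[of x] x by (intro mult_nonneg_nonpos) auto
    ultimately show "\<exists>y. DERIV p x :> y \<and> y \<le> 0" by blast
  next
    have "continuous_on {0..} p" using dp by (intro DERIV_continuous_on) auto
    then show "continuous_on {0..T} p" by (rule continuous_on_subset) auto
  qed (use T in simp)
  then have "exp (c * T) * p T \<le> exp (c * T) * p 0" by (intro mult_left_mono) auto
  then show ?thesis by (simp add: p_def mult.assoc[symmetric] flip: exp_add)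
qed simp

text \<open>The functional \<eta> |u|^2 + |Y u|^2 lies between \<eta> |u|^2 and (\<eta> + C^2)
  |u|^2, so Gronwall's inequality for it costs only the square root of the ratio. The instance with
  Y = 0 serves for uniqueness, the one with \<open>lyap \<beta>\<close> for the decay.\<close>

lemma l2_energy_decay:
  assumes Y: "l2_bounded M N C Y" and \<eta>: "\<eta> > 0"
    and u: "\<And>t. t \<ge> 0 \<Longrightarrow> l2_has_derivative M u (d t) t"
    and le: "\<And>t. t \<ge> 0 \<Longrightarrow> \<eta> * Re (l2_inner M (d t) (u t)) + Re (l2_inner N (Y (d t)) (Y (u t)))
        \<le> \<sigma> * (\<eta> * (l2_norm M (u t))\<^sup>2 + (l2_norm N (Y (u t)))\<^sup>2)"
    and t: "t \<ge> 0"
  shows "l2_norm M (u t) \<le> sqrt ((\<eta> + C\<^sup>2) / \<eta>) * exp (\<sigma> * t) * l2_norm M (u 0)"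
proof -
  define q where "q t = \<eta> * (l2_norm M (u t))\<^sup>2 + (l2_norm N (Y (u t)))\<^sup>2" for t
  have "q t \<le> exp (2 * \<sigma> * t) * q 0"
  proof (rule nonneg_gronwall[OF _ _ t])
    fix t :: real assume t: "t \<ge> 0"
    show "(q has_real_derivative \<eta> * (2 * Re (l2_inner M (d t) (u t))) + 2 * Re (l2_inner N (Y (d t)) (Y (u t))))
        (at t within {0..})"
      unfolding q_def[abs_def]
      by (intro DERIV_add DERIV_cmult l2_has_derivative_norm_sq u t l2_has_derivative_bounded[OF Y])
    show "\<eta> * (2 * Re (l2_inner M (d t) (u t))) + 2 * Re (l2_inner N (Y (d t)) (Y (u t))) \<le> 2 * \<sigma> * q t"
      using le[OF t] unfolding q_def by (simp add: algebra_simps)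
  qed
  moreover have "\<eta> * (l2_norm M (u t))\<^sup>2 \<le> q t" by (simp add: q_def)
  moreover have "q 0 \<le> (\<eta> + C\<^sup>2) * (l2_norm M (u 0))\<^sup>2"
  proof -
    have "l2_norm N (Y (u 0)) \<le> C * l2_norm M (u 0)"
      using u[of 0] by (intro l2_bounded_norm[OF Y]) (auto simp: l2_has_derivative_def)
    then have "(l2_norm N (Y (u 0)))\<^sup>2 \<le> (C * l2_norm M (u 0))\<^sup>2" by (intro power_mono) auto
    then show ?thesis by (simp add: q_def algebra_simps power_mult_distrib)
  qed
  ultimately have "\<eta> * (l2_norm M (u t))\<^sup>2 \<le> exp (2 * \<sigma> * t) * ((\<eta> + C\<^sup>2) * (l2_norm M (u 0))\<^sup>2)"
    by (meson order_trans mult_left_mono exp_ge_zero)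
  then have "(l2_norm M (u t))\<^sup>2 \<le> (\<eta> + C\<^sup>2) / \<eta> * exp (2 * \<sigma> * t) * (l2_norm M (u 0))\<^sup>2"
    using \<eta> by (simp add: field_simps)
  also have "\<dots> = (sqrt ((\<eta> + C\<^sup>2) / \<eta>) * exp (\<sigma> * t) * l2_norm M (u 0))\<^sup>2"
    using \<eta> by (simp add: power_mult_distrib exp_double[symmetric] mult.assoc)
  finally show ?thesis
    by (rule power2_le_imp_le) (use \<eta> in auto)
qed

subsection \<open>Orbits of a contraction semigroup\<close>

lemma contraction_semigroup_bounded:
  assumes "contraction_semigroup M T" "t \<ge> 0"
  shows "l2_bounded M M 1 (T t)"
  using assms unfolding contraction_semigroup_def l2_bounded_def by auto

lemma contraction_semigroup_add:
  assumes "contraction_semigroup M T" "s \<ge> 0" "t \<ge> 0" "f \<in> L2 M"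
  shows "AE x in M. T (s + t) f x = T s (T t f) x"
  using assms unfolding contraction_semigroup_def by blast

lemma contraction_semigroup_0:
  assumes "contraction_semigroup M T" "f \<in> L2 M"
  shows "AE x in M. T 0 f x = f x"
  using assms unfolding contraction_semigroup_def by blast

lemma contraction_semigroup_lim:
  assumes "contraction_semigroup M T" "f \<in> L2 M"
  shows "((\<lambda>t. l2_norm M (\<lambda>x. T t f x - f x)) \<longlongrightarrow> 0) (at_right 0)"
  using assms unfolding contraction_semigroup_def l2_tendsto_def by blast

lemma generator_lim:
  assumes T: "contraction_semigroup M T" and fg: "(f, g) \<in> generator M T"
  shows "((\<lambda>h. l2_norm M (\<lambda>x. T h f x - f x - complex_of_real h * g x) / h) \<longlongrightarrow> 0) (at_right 0)"
proof -
  have lim: "((\<lambda>h. l2_norm M (\<lambda>x. (T h f x - f x) / complex_of_real h - g x)) \<longlongrightarrow> 0) (at_right 0)"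
    using fg by (simp add: generator_def l2_tendsto_def)
  show ?thesis
  proof (rule Lim_transform_eventually[OF lim])
    show "\<forall>\<^sub>F h in at_right 0. l2_norm M (\<lambda>x. (T h f x - f x) / complex_of_real h - g x)
      = l2_norm M (\<lambda>x. T h f x - f x - complex_of_real h * g x) / h"
      using eventually_at_right_less
    proof eventually_elim
      case (elim h)
      have "(\<lambda>x. (T h f x - f x) / complex_of_real h - g x)
        = (\<lambda>x. complex_of_real (1 / h) * (T h f x - f x - complex_of_real h * g x))"
        using elim by (auto simp: field_simps)
      then show ?case using elim by (simp only: l2_norm_scale) (simp add: norm_divide)
    qed
  qed
qed

lemma generator_L2:
  assumes "(f, g) \<in> generator M T"
  shows "f \<in> L2 M" "g \<in> L2 M"
  using assms by (auto simp: generator_def l2_tendsto_def)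

text \<open>\<open>T h\<close> and \<open>T t\<close> commute through \<open>T (t + h)\<close>, and
  contractivity of \<open>T t\<close> carries the limit of the difference quotient along the
  orbit.\<close>

lemma generator_orbit:
  assumes T: "contraction_semigroup M T" and fg: "(f, g) \<in> generator M T" and t: "t \<ge> 0"
  shows "(T t f, T t g) \<in> generator M T"
proof -
  note L2 = generator_L2[OF fg]
  note bd = contraction_semigroup_bounded[OF T]
  note TL2 = l2_bounded_L2[OF bd]
  have "((\<lambda>h. l2_norm M (\<lambda>x. (T h (T t f) x - T t f x) / complex_of_real h - T t g x)) \<longlongrightarrow> 0) (at_right 0)"
  proof (rule Lim_null_comparison[OF _ generator_lim[OF T fg]])
    show "\<forall>\<^sub>F h in at_right 0. norm (l2_norm M (\<lambda>x. (T h (T t f) x - T t f x) / complex_of_real h - T t g x))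
       \<le> l2_norm M (\<lambda>x. T h f x - f x - complex_of_real h * g x) / h"
      using eventually_at_right_less
    proof eventually_elim
      case (elim h)
      then have h: "h \<ge> 0" by simp
      have "(\<lambda>x. (T h (T t f) x - T t f x) / complex_of_real h - T t g x)
        = (\<lambda>x. complex_of_real (1 / h) * (T h (T t f) x - T t f x - complex_of_real h * T t g x))"
        using elim by (auto simp: field_simps)
      then have "l2_norm M (\<lambda>x. (T h (T t f) x - T t f x) / complex_of_real h - T t g x)
        = l2_norm M (\<lambda>x. T h (T t f) x - T t f x - complex_of_real h * T t g x) / h"
        using elim by (simp only: l2_norm_scale) (simp add: norm_divide)
      also have "l2_norm M (\<lambda>x. T h (T t f) x - T t f x - complex_of_real h * T t g x)
        = l2_norm M (T t (\<lambda>x. T h f x - f x - complex_of_real h * g x))"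
      proof (rule l2_norm_cong_AE)
        have "AE x in M. T h (T t f) x = T t (T h f) x"
          using contraction_semigroup_add[OF T h t L2(1)] contraction_semigroup_add[OF T t h L2(1)]
          by eventually_elim (simp add: add.commute)
        then show "AE x in M. T h (T t f) x - T t f x - complex_of_real h * T t g x
            = T t (\<lambda>x. T h f x - f x - complex_of_real h * g x) x"
          using l2_bounded_diff_lincomb[OF bd[OF t] TL2[OF h L2(1)] L2, of "complex_of_real h"]
          by eventually_elim simp
      qed (intro L2_measurable L2_diff L2_scale TL2 h t L2)+
      also have "\<dots> \<le> l2_norm M (\<lambda>x. T h f x - f x - complex_of_real h * g x)"
        using l2_bounded_norm[OF bd[OF t]] TL2[OF h L2(1)] L2 by (simp add: L2_diff L2_scale)
      finally show ?case using elim by (simp add: divide_right_mono)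
    qed
  qed
  moreover have "\<forall>\<^sub>F h in at_right 0. (\<lambda>x. (T h (T t f) x - T t f x) / complex_of_real h) \<in> L2 M"
    using eventually_at_right_less
  proof eventually_elim
    case (elim h)
    then have "(\<lambda>x. complex_of_real (1 / h) * (T h (T t f) x - T t f x)) \<in> L2 M"
      by (intro L2_scale L2_diff TL2 t L2) auto
    then show ?case by (simp add: divide_simps)
  qed
  ultimately show ?thesis using TL2[OF t] L2 by (simp add: generator_def l2_tendsto_def)
qed

text \<open>The generator gives only right derivatives at 0. For s < t the remainder is
  \<open>T s\<close> applied to h (T h g - g) minus the right remainder, so strong continuity on g
  supplies the left derivative.\<close>

lemma generator_orbit_derivative:
  assumes T: "contraction_semigroup M T" and fg: "(f, g) \<in> generator M T" and t: "t \<ge> 0"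
  shows "l2_has_derivative M (\<lambda>s. T s f) (T t g) t"
  unfolding l2_has_derivative_def
proof (intro conjI allI impI)
  note L2 = generator_L2[OF fg]
  note bd = contraction_semigroup_bounded[OF T]
  note TL2 = l2_bounded_L2[OF bd]
  show "T t g \<in> L2 M" "\<And>s. 0 \<le> s \<Longrightarrow> T s f \<in> L2 M" using TL2 t L2 by auto
  define \<omega> where "\<omega> h = l2_norm M (\<lambda>x. T h f x - f x - complex_of_real h * g x) / h
     + l2_norm M (\<lambda>x. T h g x - g x)" for h
  have \<omega>: "(\<omega> \<longlongrightarrow> 0) (at_right 0)"
    unfolding \<omega>_def[abs_def]
    using tendsto_add[OF generator_lim[OF T fg] contraction_semigroup_lim[OF T L2(2)]] by simp
  have abs_lim: "filterlim (\<lambda>s. \<bar>s - t\<bar>) (at_right 0) (at t within {0..})"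
    unfolding filterlim_at by (auto simp: eventually_at_filter intro!: tendsto_eq_intros)
  show "((\<lambda>s. l2_norm M (\<lambda>x. T s f x - T t f x - complex_of_real (s - t) * T t g x) / \<bar>s - t\<bar>) \<longlongrightarrow> 0)
     (at t within {0..})"
  proof (rule Lim_null_comparison[OF _ filterlim_compose[OF \<omega> abs_lim]])
    show "\<forall>\<^sub>F s in at t within {0..}.
        norm (l2_norm M (\<lambda>x. T s f x - T t f x - complex_of_real (s - t) * T t g x) / \<bar>s - t\<bar>) \<le> \<omega> \<bar>s - t\<bar>"
      unfolding eventually_at_filter
    proof (intro always_eventually allI impI)
      fix s assume ne: "s \<noteq> t" and "s \<in> {0::real..}"
      then have s: "s \<ge> 0" by simp
      define h where "h = \<bar>s - t\<bar>"
      have h: "h \<ge> 0" "h > 0" using ne by (auto simp: h_def)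
      let ?r = "\<lambda>x. T h f x - f x - complex_of_real h * g x"
      have r: "?r \<in> L2 M" by (intro L2_diff L2_scale TL2 h L2)
      have "l2_norm M (\<lambda>x. T s f x - T t f x - complex_of_real (s - t) * T t g x)
        \<le> l2_norm M ?r + h * l2_norm M (\<lambda>x. T h g x - g x)"
      proof (cases "s > t")
        case True
        then have st: "s = t + h" by (simp add: h_def)
        have "l2_norm M (\<lambda>x. T s f x - T t f x - complex_of_real (s - t) * T t g x) = l2_norm M (T t ?r)"
        proof (rule l2_norm_cong_AE)
          show "AE x in M. T s f x - T t f x - complex_of_real (s - t) * T t g x = T t ?r x"
            using l2_bounded_diff_lincomb[OF bd[OF t] TL2[OF h(1) L2(1)] L2, of "complex_of_real h"]
              contraction_semigroup_add[OF T t h(1) L2(1)]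
            by eventually_elim (simp add: st)
        qed (intro L2_measurable L2_diff L2_scale TL2 h t s L2)+
        also have "\<dots> \<le> l2_norm M ?r" using l2_bounded_norm[OF bd[OF t] r] by simp
        finally show ?thesis using h by (simp add: add_increasing2)
      next
        case False
        then have ts: "t = s + h" using ne by (simp add: h_def)
        let ?r' = "\<lambda>x. f x - T h f x - complex_of_real (- h) * T h g x"
        have r': "?r' \<in> L2 M" by (intro L2_diff L2_scale TL2 h L2)
        have "l2_norm M (\<lambda>x. T s f x - T t f x - complex_of_real (s - t) * T t g x) = l2_norm M (T s ?r')"
        proof (rule l2_norm_cong_AE)
          show "AE x in M. T s f x - T t f x - complex_of_real (s - t) * T t g x = T s ?r' x"
            using l2_bounded_diff_lincomb[OF bd[OF s] L2(1) TL2[OF h(1) L2(1)] TL2[OF h(1) L2(2)], of "complex_of_real (-h)"]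
              contraction_semigroup_add[OF T s h(1) L2(1)] contraction_semigroup_add[OF T s h(1) L2(2)]
            by eventually_elim (simp add: ts)
        qed (intro L2_measurable L2_diff L2_scale TL2 h t s L2)+
        also have "\<dots> \<le> l2_norm M ?r'" using l2_bounded_norm[OF bd[OF s] r'] by simp
        also have "?r' = (\<lambda>x. complex_of_real h * (T h g x - g x) - ?r x)"
          by (auto simp: algebra_simps)
        also have "l2_norm M \<dots> \<le> l2_norm M (\<lambda>x. complex_of_real h * (T h g x - g x)) + l2_norm M ?r"
          by (intro l2_triangle_diff r L2_scale L2_diff TL2 h L2)
        also have "l2_norm M (\<lambda>x. complex_of_real h * (T h g x - g x)) = h * l2_norm M (\<lambda>x. T h g x - g x)"
          unfolding l2_norm_scale using h by simp
        finally show ?thesis by simp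
      qed
      then show "norm (l2_norm M (\<lambda>x. T s f x - T t f x - complex_of_real (s - t) * T t g x) / \<bar>s - t\<bar>) \<le> \<omega> \<bar>s - t\<bar>"
        unfolding h_def[symmetric] \<omega>_def using h by (simp add: field_simps)
    qed
  qed
qed

subsection \<open>Fibres of square integrable functions on a product\<close>

lemma L2_pair_fst:
  assumes "sigma_finite_measure A" "sigma_finite_measure B" and F: "F \<in> L2 (A \<Otimes>\<^sub>M B)"
  shows "AE x in A. (\<lambda>y. F (x, y)) \<in> L2 B"
    and "integrable A (\<lambda>x. (l2_norm B (\<lambda>y. F (x, y)))\<^sup>2)"
    and "(l2_norm (A \<Otimes>\<^sub>M B) F)\<^sup>2 = (\<integral>x. (l2_norm B (\<lambda>y. F (x, y)))\<^sup>2 \<partial>A)"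
proof -
  interpret A: sigma_finite_measure A by fact
  interpret B: sigma_finite_measure B by fact
  interpret pair_sigma_finite A B ..
  note int = L2_integrable_sq[OF F]
  have [measurable]: "F \<in> borel_measurable (A \<Otimes>\<^sub>M B)" using F by (rule L2_measurable)
  show "AE x in A. (\<lambda>y. F (x, y)) \<in> L2 B"
    using AE_integrable_fst'[OF int] AE_space
  proof eventually_elim
    case (elim x)
    then show ?case by (intro L2_I) (auto intro: measurable_compose[OF measurable_Pair1'])
  qed
  show "integrable A (\<lambda>x. (l2_norm B (\<lambda>y. F (x, y)))\<^sup>2)"
    unfolding l2_norm_sq using integrable_fst'[OF int] .
  show "(l2_norm (A \<Otimes>\<^sub>M B) F)\<^sup>2 = (\<integral>x. (l2_norm B (\<lambda>y. F (x, y)))\<^sup>2 \<partial>A)"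
    unfolding l2_norm_sq using integral_fst'[OF int] by simp
qed

lemma L2_pair_I:
  assumes "sigma_finite_measure A" "sigma_finite_measure B"
    and [measurable]: "G \<in> borel_measurable (A \<Otimes>\<^sub>M B)"
    and ae: "AE x in A. (\<lambda>y. G (x, y)) \<in> L2 B"
    and int: "integrable A (\<lambda>x. (l2_norm B (\<lambda>y. G (x, y)))\<^sup>2)"
  shows "G \<in> L2 (A \<Otimes>\<^sub>M B)"
proof -
  interpret A: sigma_finite_measure A by fact
  interpret B: sigma_finite_measure B by fact
  interpret pair_sigma_finite A B ..
  have "integrable (A \<Otimes>\<^sub>M B) (\<lambda>z. (norm (G z))\<^sup>2)"
  proof (rule Fubini_integrable)
    show "integrable A (\<lambda>x. \<integral>y. norm ((norm (G (x, y)))\<^sup>2) \<partial>B)"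
      using int unfolding l2_norm_sq by simp
    show "AE x in A. integrable B (\<lambda>y. (norm (G (x, y)))\<^sup>2)"
      using ae by eventually_elim (rule L2_integrable_sq)
  qed measurable
  then show ?thesis by (intro L2_I) auto
qed

text \<open>A fibrewise operator bound that is uniform in x integrates to a bound on the product;
  almost all fibres are square integrable, so the others need no estimate. The norms of
  \<open>velocity_avg\<close>, \<open>projector\<close> and \<open>lyap\<close> are all obtained
  this way.\<close>

lemma L2_pair_dominated:
  assumes sA: "sigma_finite_measure A" and sB: "sigma_finite_measure B" and sB': "sigma_finite_measure B'"
    and F: "F \<in> L2 (A \<Otimes>\<^sub>M B)" and G[measurable]: "G \<in> borel_measurable (A \<Otimes>\<^sub>M B')" and C: "C \<ge> 0"
    and ae: "AE x in A. (\<lambda>y. F (x, y)) \<in> L2 B \<longrightarrow> (\<lambda>y. G (x, y)) \<in> L2 B' \<and>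
        l2_norm B' (\<lambda>y. G (x, y)) \<le> C * l2_norm B (\<lambda>y. F (x, y))"
  shows "G \<in> L2 (A \<Otimes>\<^sub>M B')" and "l2_norm (A \<Otimes>\<^sub>M B') G \<le> C * l2_norm (A \<Otimes>\<^sub>M B) F"
proof -
  interpret B': sigma_finite_measure B' by fact
  note F_fst = L2_pair_fst[OF sA sB F]
  have ae': "AE x in A. (\<lambda>y. G (x, y)) \<in> L2 B' \<and>
      (l2_norm B' (\<lambda>y. G (x, y)))\<^sup>2 \<le> C\<^sup>2 * (l2_norm B (\<lambda>y. F (x, y)))\<^sup>2"
    using ae F_fst(1)
  proof eventually_elim
    case (elim x)
    then have "(l2_norm B' (\<lambda>y. G (x, y)))\<^sup>2 \<le> (C * l2_norm B (\<lambda>y. F (x, y)))\<^sup>2"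
      by (intro power_mono) auto
    then show ?case using elim by (simp add: power_mult_distrib)
  qed
  have intC: "integrable A (\<lambda>x. C\<^sup>2 * (l2_norm B (\<lambda>y. F (x, y)))\<^sup>2)" using F_fst(2) by simp
  have int: "integrable A (\<lambda>x. (l2_norm B' (\<lambda>y. G (x, y)))\<^sup>2)"
  proof (rule Bochner_Integration.integrable_bound[OF intC])
    show "(\<lambda>x. (l2_norm B' (\<lambda>y. G (x, y)))\<^sup>2) \<in> borel_measurable A"
      unfolding l2_norm_sq by measurable
    show "AE x in A. norm ((l2_norm B' (\<lambda>y. G (x, y)))\<^sup>2) \<le> norm (C\<^sup>2 * (l2_norm B (\<lambda>y. F (x, y)))\<^sup>2)"
      using ae' by eventually_elim simp
  qed
  show GL2: "G \<in> L2 (A \<Otimes>\<^sub>M B')"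
    by (rule L2_pair_I[OF sA sB' G _ int]) (use ae' in \<open>auto elim: eventually_mono\<close>)
  have "(l2_norm (A \<Otimes>\<^sub>M B') G)\<^sup>2 \<le> (C * l2_norm (A \<Otimes>\<^sub>M B) F)\<^sup>2"
    unfolding power_mult_distrib F_fst(3) L2_pair_fst(3)[OF sA sB' GL2]
    using integral_mono_AE[OF int intC] ae' by (simp add: eventually_mono)
  then show "l2_norm (A \<Otimes>\<^sub>M B') G \<le> C * l2_norm (A \<Otimes>\<^sub>M B) F"
    by (rule power2_le_imp_le) (use C in simp)
qed

lemma l2_inner_pair:
  assumes "sigma_finite_measure A" "sigma_finite_measure B"
    and F: "F \<in> L2 (A \<Otimes>\<^sub>M B)" and G: "G \<in> L2 (A \<Otimes>\<^sub>M B)"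
  shows "integrable A (\<lambda>x. l2_inner B (\<lambda>y. F (x, y)) (\<lambda>y. G (x, y)))"
    and "l2_inner (A \<Otimes>\<^sub>M B) F G = (\<integral>x. l2_inner B (\<lambda>y. F (x, y)) (\<lambda>y. G (x, y)) \<partial>A)"
proof -
  interpret A: sigma_finite_measure A by fact
  interpret B: sigma_finite_measure B by fact
  interpret pair_sigma_finite A B ..
  note int = L2_integrable_inner[OF F G]
  show "integrable A (\<lambda>x. l2_inner B (\<lambda>y. F (x, y)) (\<lambda>y. G (x, y)))"
    unfolding l2_inner_def using integrable_fst'[OF int] .
  show "l2_inner (A \<Otimes>\<^sub>M B) F G = (\<integral>x. l2_inner B (\<lambda>y. F (x, y)) (\<lambda>y. G (x, y)) \<partial>A)"
    unfolding l2_inner_def using integral_fst'[OF int] by simp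
qed

lemma L2_pair_swap:
  assumes "sigma_finite_measure A" "sigma_finite_measure B" and F: "F \<in> L2 (A \<Otimes>\<^sub>M B)"
  shows "(\<lambda>(y, x). F (x, y)) \<in> L2 (B \<Otimes>\<^sub>M A)"
    and "l2_norm (B \<Otimes>\<^sub>M A) (\<lambda>(y, x). F (x, y)) = l2_norm (A \<Otimes>\<^sub>M B) F"
proof -
  interpret A: sigma_finite_measure A by fact
  interpret B: sigma_finite_measure B by fact
  interpret pair_sigma_finite A B ..
  have [measurable]: "F \<in> borel_measurable (A \<Otimes>\<^sub>M B)" using F by (rule L2_measurable)
  have eq: "(\<lambda>z. (norm (case z of (y, x) \<Rightarrow> F (x, y)))\<^sup>2) = (\<lambda>(y, x). (norm (F (x, y)))\<^sup>2)"
    by (auto simp: split_def)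
  show "(\<lambda>(y, x). F (x, y)) \<in> L2 (B \<Otimes>\<^sub>M A)"
  proof (rule L2_I)
    show "integrable (B \<Otimes>\<^sub>M A) (\<lambda>z. (norm (case z of (y, x) \<Rightarrow> F (x, y)))\<^sup>2)"
      unfolding eq by (rule integrable_product_swap[OF L2_integrable_sq[OF F]])
  qed (simp add: split_def)
  show "l2_norm (B \<Otimes>\<^sub>M A) (\<lambda>(y, x). F (x, y)) = l2_norm (A \<Otimes>\<^sub>M B) F"
    unfolding l2_norm_def eq by (subst integral_product_swap) auto
qed

subsection \<open>Plancherel's theorem\<close>

lemma L2_lborel_translate:
  fixes f :: "real \<Rightarrow> complex"
  assumes f: "f \<in> L2 lborel"
  shows "(\<lambda>x. f (x + s)) \<in> L2 lborel" "l2_norm lborel (\<lambda>x. f (x + s)) = l2_norm lborel f"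
proof -
  have [measurable]: "f \<in> borel_measurable borel" using L2_measurable[OF f] by simp
  have "integrable lborel (\<lambda>x. (norm (f (s + 1 * x)))\<^sup>2)"
    by (rule lborel_integrable_real_affine[OF L2_integrable_sq[OF f]]) simp
  then show "(\<lambda>x. f (x + s)) \<in> L2 lborel"
    by (intro L2_I) (auto simp: add.commute)
  show "l2_norm lborel (\<lambda>x. f (x + s)) = l2_norm lborel f"
    unfolding l2_norm_def
    using lborel_integral_real_affine[of 1 "\<lambda>x. (norm (f x))\<^sup>2" s] by (simp add: add.commute)
qed

section \<open>Approximation by truncations and by bounded continuous functions\<close>

lemma L2_approx_truncation:
  assumes f: "f \<in> L2 M" and [measurable]: "\<And>n. B n \<in> sets M"
    and B: "\<And>x. x \<in> space M \<Longrightarrow> \<exists>N. \<forall>n\<ge>N. x \<in> B n"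
  shows "(\<lambda>n::nat. l2_norm M (\<lambda>x. f x - indicator (B n) x * f x)) \<longlonglongrightarrow> 0"
proof (rule tendsto_l2_norm_zero_dominated[OF _ f])
  have [measurable]: "f \<in> borel_measurable M" using f by (rule L2_measurable)
  show "(\<lambda>x. f x - indicator (B n) x * f x) \<in> borel_measurable M" for n by measurable
  show "AE x in M. norm (f x - indicator (B n) x * f x) \<le> norm (f x)" for n
    by (auto simp: indicator_def)
  show "AE x in M. (\<lambda>n. f x - indicator (B n) x * f x) \<longlonglongrightarrow> 0"
  proof (rule AE_I2)
    fix x assume "x \<in> space M"
    then obtain N where N: "\<And>n. n \<ge> N \<Longrightarrow> x \<in> B n" using B by blast
    have "\<forall>\<^sub>F n in sequentially. f x - indicator (B n) x * f x = 0"
      using eventually_ge_at_top[of N] by eventually_elim (simp add: N)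
    then show "(\<lambda>n. f x - indicator (B n) x * f x) \<longlonglongrightarrow> 0" by (rule tendsto_eventually)
  qed
qed

text \<open>Truncating domain and values reduces to a bounded h of bounded support. Lebesgue
  measurability yields continuous functions that converge to h off a negligible set, and once these
  are clipped dominated convergence applies.\<close>

lemma L2_lborel_dense_continuous:
  fixes f :: "real \<Rightarrow> complex"
  assumes f: "f \<in> L2 lborel" and e: "e > 0"
  obtains g where "g \<in> L2 lborel" "continuous_on UNIV g" "bounded (range g)"
    "l2_norm lborel (\<lambda>x. f x - g x) < e"
proof -
  have f_meas[measurable]: "f \<in> borel_measurable borel" using L2_measurable[OF f] by simp
  define B where "B n = {x. \<bar>x\<bar> \<le> real (n + 1) \<and> norm (f x) \<le> real (n + 1)}" for n :: nat
  have B_meas: "B n \<in> sets lborel" for n unfolding B_def by measurable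
  have "(\<lambda>n. l2_norm lborel (\<lambda>x. f x - indicator (B n) x * f x)) \<longlonglongrightarrow> 0"
  proof (rule L2_approx_truncation[OF f B_meas])
    fix x :: real
    obtain N where N: "max \<bar>x\<bar> (norm (f x)) \<le> real N" using real_arch_simple by blast
    have "x \<in> B n" if "n \<ge> N" for n
    proof -
      have "real N \<le> real (n + 1)" using that by linarith
      then show ?thesis using N unfolding B_def by auto
    qed
    then show "\<exists>N. \<forall>n\<ge>N. x \<in> B n" by blast
  qed
  from order_tendstoD(2)[OF this, of "e/2"] e
  obtain n where n: "l2_norm lborel (\<lambda>x. f x - indicator (B n) x * f x) < e/2"
    by (auto simp: eventually_sequentially)
  define b where "b = real (n + 1)"
  have b: "b > 0" by (simp add: b_def)
  define h where "h x = indicator (B n) x * f x" for x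
  have h_meas[measurable]: "h \<in> borel_measurable borel"
    unfolding h_def using B_meas by measurable
  have hL2: "h \<in> L2 lborel" unfolding h_def by (rule L2_indicator[OF f B_meas])
  have h_bd: "norm (h x) \<le> b" for x
    using b by (auto simp: h_def indicator_def B_def b_def)
  have h_supp: "h x = 0" if "\<bar>x\<bar> > b" for x using that by (auto simp: h_def indicator_def B_def b_def)
  have "h measurable_on UNIV"
    by (rule lebesgue_measurable_imp_measurable_on) (auto intro: borel_measurable_if_I measurable_completion)
  then obtain N g where N: "negligible N" and g: "\<And>k. continuous_on UNIV (g k)"
    and lim: "\<And>x. x \<notin> N \<Longrightarrow> (\<lambda>k. g k x) \<longlonglongrightarrow> h x"
    unfolding measurable_on_def by auto
  \<comment> \<open>\<open>c\<close> retracts onto the disc of radius b and \<open>cut\<close> is a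
    trapezoid equal to 1 on [-b, b]; both leave h fixed, so clipping does not disturb the pointwise
    limit.\<close>
  define c where "c z = z /\<^sub>R max 1 (norm z / b)" for z :: complex
  define cut where "cut x = max 0 (min 1 (b + 1 - \<bar>x\<bar>))" for x :: real
  have c_cont: "continuous_on UNIV c"
    unfolding c_def using b by (intro continuous_intros) (auto simp: max_def)
  have c_bd: "norm (c z) \<le> b" for z
  proof -
    have "norm z \<le> b * max 1 (norm z / b)" using b by (auto simp: max_def field_simps)
    then show ?thesis using b unfolding c_def by (simp add: divide_inverse[symmetric] field_simps)
  qed
  have c_id: "c z = z" if "norm z \<le> b" for z
    using that b by (simp add: c_def max_def field_simps)
  have cut: "0 \<le> cut x" "cut x \<le> 1" "\<bar>x\<bar> \<le> b \<Longrightarrow> cut x = 1" "\<bar>x\<bar> > b + 1 \<Longrightarrow> cut x = 0" for x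
    by (auto simp: cut_def)
  define w where "w k x = complex_of_real (cut x) * c (g k x)" for k x
  have w_cont: "continuous_on UNIV (w k)" for k
    unfolding w_def cut_def
    by (intro continuous_intros continuous_on_compose2[OF c_cont g]) auto
  have w_meas[measurable]: "w k \<in> borel_measurable borel" for k
    using borel_measurable_continuous_onI[OF w_cont] .
  have w_bd: "norm (w k x) \<le> b * indicator {-(b+1)..b+1} x" for k x
  proof (cases "\<bar>x\<bar> \<le> b + 1")
    case True
    have "norm (w k x) \<le> 1 * b" unfolding w_def norm_mult using cut[of x] c_bd[of "g k x"] b
      by (intro mult_mono) auto
    then show ?thesis using True by (auto simp: indicator_def)
  next
    case False
    then show ?thesis using cut(4)[of x] b by (simp add: w_def)
  qed
  define d where "d x = complex_of_real (2 * b * indicator {-(b+1)..b+1} x)" for x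
  have dL2: "d \<in> L2 lborel"
  proof (rule L2_I)
    have "(\<lambda>x. (norm (d x))\<^sup>2) = (\<lambda>x. (2*b)\<^sup>2 * indicator {-(b+1)..b+1} x)"
      by (auto simp: d_def indicator_def)
    moreover have "integrable lborel (indicator {-(b+1)..b+1} :: real \<Rightarrow> real)"
      by (rule integrable_real_indicator) (auto simp: emeasure_lborel_Icc_eq)
    ultimately show "integrable lborel (\<lambda>x. (norm (d x))\<^sup>2)" by simp
  qed (unfold d_def, measurable)
  have wL2: "w k \<in> L2 lborel" for k
    by (rule L2_dominated(1)[OF dL2, where C = 1])
       (use b in \<open>auto simp: d_def norm_mult intro!: AE_I2 order_trans[OF w_bd] mult_right_mono\<close>)
  have "(\<lambda>k. l2_norm lborel (\<lambda>x. h x - w k x)) \<longlonglongrightarrow> 0"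
  proof (rule tendsto_l2_norm_zero_dominated[OF _ dL2])
    show "AE x in lborel. norm (h x - w k x) \<le> norm (d x)" for k
    proof (rule AE_I2)
      fix x
      have "norm (h x) \<le> b * indicator {-(b+1)..b+1} x"
        using h_bd[of x] h_supp[of x] b by (cases "\<bar>x\<bar> > b") (auto simp: indicator_def)
      then show "norm (h x - w k x) \<le> norm (d x)"
        using w_bd[of k x] norm_triangle_ineq4[of "h x" "w k x"] b by (auto simp: d_def indicator_def split: if_splits)
    qed
    have "AE x in lebesgue. x \<notin> N" using N by (simp add: negligible_iff_null_sets AE_not_in)
    then have "AE x in lborel. x \<notin> N" by (simp add: AE_completion_iff)
    then show "AE x in lborel. (\<lambda>k. h x - w k x) \<longlonglongrightarrow> 0"
    proof eventually_elim
      case (elim x)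
      have "(\<lambda>k. c (g k x)) \<longlonglongrightarrow> c (h x)"
        using c_cont lim[OF elim] by (intro isCont_tendsto_compose[of _ c]) (auto simp: continuous_on_eq_continuous_at)
      then have "(\<lambda>k. h x - w k x) \<longlonglongrightarrow> h x - cut x * c (h x)"
        unfolding w_def by (intro tendsto_intros)
      also have "h x - cut x * c (h x) = 0"
        using c_id[OF h_bd[of x]] h_supp[of x] cut(3)[of x] by (cases "\<bar>x\<bar> \<le> b") auto
      finally show ?case .
    qed
  qed measurable
  from order_tendstoD(2)[OF this, of "e/2"] e
  obtain k where k: "l2_norm lborel (\<lambda>x. h x - w k x) < e/2"
    by (auto simp: eventually_sequentially)
  show ?thesis
  proof (rule that[of "w k"])
    show "bounded (range (w k))"
      by (rule boundedI[of _ b]) (use b in \<open>auto simp: indicator_def intro: order_trans[OF w_bd]\<close>)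
    show "l2_norm lborel (\<lambda>x. f x - w k x) < e"
      using l2_triangle_via[OF f hL2 wL2[of k]] n k by (simp add: h_def)
  qed (use wL2 w_cont in auto)
qed

section \<open>The autocorrelation and the Plancherel identity\<close>

definition autocorrelation :: "(real \<Rightarrow> complex) \<Rightarrow> real \<Rightarrow> complex" where
  "autocorrelation f s = l2_inner lborel (\<lambda>y. f (y + s)) f"

lemma norm_autocorrelation_le:
  assumes "f \<in> L2 lborel"
  shows "norm (autocorrelation f s) \<le> (l2_norm lborel f)\<^sup>2"
  using l2_cauchy_schwarz[OF L2_lborel_translate(1)[OF assms, of s] assms]
  unfolding autocorrelation_def L2_lborel_translate(2)[OF assms] by (simp add: power2_eq_square)

text \<open>Split f into a bounded continuous g and a small rest. The translates of the rest are
  small uniformly in the shift by Cauchy--Schwarz; for g dominated convergence works with the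
  majorant 2 b |f|, which is where integrability of f enters.\<close>

lemma autocorrelation_tendsto:
  fixes s :: "nat \<Rightarrow> real"
  assumes f: "f \<in> L2 lborel" and int: "integrable lborel f" and s: "s \<longlonglongrightarrow> 0"
  shows "(\<lambda>n. autocorrelation f (s n)) \<longlonglongrightarrow> autocorrelation f 0"
proof (rule LIMSEQ_I)
  fix e :: real assume e: "e > 0"
  \<comment> \<open>The summand 1 keeps K positive when f vanishes.\<close>
  define K where "K = l2_norm lborel f + 1"
  have K: "K > 0" unfolding K_def by (rule add_nonneg_pos) auto
  obtain g where g: "g \<in> L2 lborel" "continuous_on UNIV g" "bounded (range g)"
    and fg: "l2_norm lborel (\<lambda>x. f x - g x) < e / (3 * K)"
    using L2_lborel_dense_continuous[OF f, of "e / (3 * K)"] e K by auto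
  obtain b where b: "\<And>x. norm (g x) \<le> b" using g(3) by (auto simp: bounded_iff)
  have [measurable]: "f \<in> borel_measurable borel" "g \<in> borel_measurable borel"
    using L2_measurable[OF f] L2_measurable[OF g(1)] by auto
  have "(\<lambda>n. \<integral>y. (g (y + s n) - g y) * cnj (f y) \<partial>lborel) \<longlonglongrightarrow> (\<integral>y. 0 \<partial>(lborel::real measure))"
  proof (rule integral_dominated_convergence)
    show "integrable lborel (\<lambda>y. 2 * b * norm (f y))" using int by simp
    show "AE y in lborel. (\<lambda>n. (g (y + s n) - g y) * cnj (f y)) \<longlonglongrightarrow> 0"
    proof (rule AE_I2)
      fix y
      have "(\<lambda>n. g (y + s n)) \<longlonglongrightarrow> g y"
        using g(2) s tendsto_add[OF tendsto_const s, of y]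
        by (intro isCont_tendsto_compose[of _ g]) (auto simp: continuous_on_eq_continuous_at)
      then have "(\<lambda>n. (g (y + s n) - g y) * cnj (f y)) \<longlonglongrightarrow> (g y - g y) * cnj (f y)"
        by (intro tendsto_intros)
      then show "(\<lambda>n. (g (y + s n) - g y) * cnj (f y)) \<longlonglongrightarrow> 0" by simp
    qed
    show "AE y in lborel. norm ((g (y + s n) - g y) * cnj (f y)) \<le> 2 * b * norm (f y)" for n
    proof (rule AE_I2)
      fix y
      have "norm (g (y + s n) - g y) \<le> b + b"
        by (rule order_trans[OF norm_triangle_ineq4 add_mono[OF b b]])
      then show "norm ((g (y + s n) - g y) * cnj (f y)) \<le> 2 * b * norm (f y)"
        unfolding norm_mult complex_mod_cnj by (intro mult_right_mono) auto
    qed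
  qed measurable
  then have "(\<lambda>n. \<integral>y. (g (y + s n) - g y) * cnj (f y) \<partial>lborel) \<longlonglongrightarrow> 0" by simp
  from LIMSEQ_D[OF this, of "e / 3"] e
  obtain N where N: "\<And>n. n \<ge> N \<Longrightarrow> norm (\<integral>y. (g (y + s n) - g y) * cnj (f y) \<partial>lborel) < e / 3"
    by auto
  have "norm (autocorrelation f (s n) - autocorrelation f 0) < e" if n: "n \<ge> N" for n
  proof -
    let ?d = "\<lambda>x. f x - g x"
    note tr = L2_lborel_translate
    have d: "?d \<in> L2 lborel" by (rule L2_diff[OF f g(1)])
    have gs: "(\<lambda>y. g (y + s n) - g y) \<in> L2 lborel" by (intro L2_diff tr g)
    have "autocorrelation f (s n) - autocorrelation f 0
        = l2_inner lborel (\<lambda>y. ?d (y + s n) - ?d y + (g (y + s n) - g y)) f"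
      unfolding autocorrelation_def
      by (subst l2_inner_diff_left[symmetric, OF tr(1)[OF f] tr(1)[OF f] f]) simp
    also have "\<dots> = l2_inner lborel (\<lambda>y. ?d (y + s n) - ?d y) f + l2_inner lborel (\<lambda>y. g (y + s n) - g y) f"
      by (rule l2_inner_add_left[OF L2_diff[OF tr(1)[OF d] d] gs f])
    finally have "norm (autocorrelation f (s n) - autocorrelation f 0)
        \<le> norm (l2_inner lborel (\<lambda>y. ?d (y + s n) - ?d y) f) + norm (l2_inner lborel (\<lambda>y. g (y + s n) - g y) f)"
      by (simp add: norm_triangle_ineq)
    also have "norm (l2_inner lborel (\<lambda>y. g (y + s n) - g y) f) < e / 3"
      using N[OF n] by (simp add: l2_inner_def)
    also have "norm (l2_inner lborel (\<lambda>y. ?d (y + s n) - ?d y) f)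
       \<le> l2_norm lborel (\<lambda>y. ?d (y + s n) - ?d y) * l2_norm lborel f"
      by (rule l2_cauchy_schwarz[OF L2_diff[OF tr(1)[OF d] d] f])
    also have "\<dots> \<le> (2 * (e / (3 * K))) * K"
    proof (rule mult_mono)
      show "l2_norm lborel (\<lambda>y. ?d (y + s n) - ?d y) \<le> 2 * (e / (3 * K))"
        using l2_triangle_diff[OF tr(1)[OF d, of "s n"] d] tr(2)[OF d, of "s n"] fg by linarith
    qed (use e K in \<open>auto simp: K_def\<close>)
    also have "\<dots> = 2 * e / 3" using K by simp
    finally show ?thesis by simp
  qed
  then show "\<exists>no. \<forall>n\<ge>no. norm (autocorrelation f (s n) - autocorrelation f 0) < e" by blast
qed

lemma fourier_std_normal:
  "(\<integral>x. iexp (t * x) * std_normal_density x \<partial>lborel) = complex_of_real (exp (- (t\<^sup>2) / 2))"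
proof -
  have "char std_normal_distribution t = (\<integral>x. std_normal_density x *\<^sub>R iexp (t * x) \<partial>lborel)"
    unfolding char_def by (subst integral_density) auto
  also have "\<dots> = (\<integral>x. iexp (t * x) * std_normal_density x \<partial>lborel)"
    by (simp add: scaleR_conv_of_real mult.commute)
  finally show ?thesis by (simp add: char_std_normal_distribution)
qed

text \<open>Plancherel by Gaussian regularisation: the squared modulus of the transform is the transform
  of the autocorrelation, so its Gaussian means are Gaussian averages of the autocorrelation, which
  concentrate at the origin.\<close>

lemma plancherel_L1_L2:
  fixes f :: "real \<Rightarrow> complex"
  assumes f: "f \<in> L2 lborel" and int: "integrable lborel f"
  defines "fh \<equiv> \<lambda>x. \<integral>\<xi>. iexp (x * \<xi>) * f \<xi> \<partial>lborel"
  shows "fh \<in> L2 lborel" "(l2_norm lborel fh)\<^sup>2 = 2 * pi * (l2_norm lborel f)\<^sup>2"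
proof -
  have [measurable]: "f \<in> borel_measurable borel" using L2_measurable[OF f] by simp
  have fh_meas[measurable]: "fh \<in> borel_measurable borel" unfolding fh_def by measurable
  let ?A = "autocorrelation f"
  have pair_int: "integrable (lborel \<Otimes>\<^sub>M lborel) (\<lambda>(y, s). f (y + s) * cnj (f y))"
  proof (rule lborel_pair.Fubini_integrable)
    show "(\<lambda>(y, s). f (y + s) * cnj (f y)) \<in> borel_measurable (lborel \<Otimes>\<^sub>M lborel)" by measurable
    have "(\<integral>s. norm (f (y + s) * cnj (f y)) \<partial>lborel) = norm (f y) * (\<integral>s. norm (f s) \<partial>lborel)" for y
    proof -
      have "(\<integral>s. norm (f (y + s) * cnj (f y)) \<partial>lborel) = (\<integral>s. norm (f y) * norm (f (y + s)) \<partial>lborel)"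
        by (simp add: norm_mult mult.commute)
      also have "\<dots> = norm (f y) * (\<integral>s. norm (f (y + s)) \<partial>lborel)" by simp
      also have "(\<integral>s. norm (f (y + s)) \<partial>lborel) = (\<integral>s. norm (f s) \<partial>lborel)"
        using lborel_integral_real_affine[of 1 "\<lambda>x. norm (f x)" y] by simp
      finally show ?thesis .
    qed
    then show "integrable lborel (\<lambda>y. \<integral>s. norm (case (y, s) of (y, s) \<Rightarrow> f (y + s) * cnj (f y)) \<partial>lborel)"
      using int by simp
    show "AE y in lborel. integrable lborel (\<lambda>s. case (y, s) of (y, s) \<Rightarrow> f (y + s) * cnj (f y))"
    proof (rule AE_I2)
      fix y
      have "integrable lborel (\<lambda>s. f (y + 1 * s))" by (rule lborel_integrable_real_affine[OF int]) simp
      then show "integrable lborel (\<lambda>s. case (y, s) of (y, s) \<Rightarrow> f (y + s) * cnj (f y))" by simp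
    qed
  qed
  have A_int: "integrable lborel ?A"
    using lborel_pair.integrable_snd[OF pair_int] by (simp add: autocorrelation_def[abs_def] l2_inner_def)
  have A_meas[measurable]: "?A \<in> borel_measurable borel" using A_int by auto
  have fh_sq: "complex_of_real ((norm (fh x))\<^sup>2) = (\<integral>s. iexp (x * s) * ?A s \<partial>lborel)" for x
  proof -
    have "complex_of_real ((norm (fh x))\<^sup>2) = fh x * cnj (fh x)"
      by (simp only: complex_norm_square)
    also have "cnj (fh x) = (\<integral>y. iexp (- (x * y)) * cnj (f y) \<partial>lborel)"
      unfolding fh_def Bochner_Integration.integral_cnj[symmetric]
      by (rule Bochner_Integration.integral_cong) (auto simp: exp_cnj)
    also have "fh x * (\<integral>y. iexp (- (x * y)) * cnj (f y) \<partial>lborel)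
       = (\<integral>y. fh x * (iexp (- (x * y)) * cnj (f y)) \<partial>lborel)" by simp
    also have "\<dots> = (\<integral>y. (\<integral>s. iexp (x * s) * (f (y + s) * cnj (f y)) \<partial>lborel) \<partial>lborel)"
    proof (rule Bochner_Integration.integral_cong[OF refl])
      fix y
      have "fh x = (\<integral>s. iexp (x * (y + s)) * f (y + s) \<partial>lborel)"
        unfolding fh_def using lborel_integral_real_affine[of 1 "\<lambda>\<xi>. iexp (x * \<xi>) * f \<xi>" y] by simp
      then have "fh x * (iexp (- (x * y)) * cnj (f y))
        = (\<integral>s. iexp (x * (y + s)) * f (y + s) * (iexp (- (x * y)) * cnj (f y)) \<partial>lborel)" by simp
      also have "\<dots> = (\<integral>s. iexp (x * s) * (f (y + s) * cnj (f y)) \<partial>lborel)"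
        by (rule Bochner_Integration.integral_cong)
           (auto simp: exp_minus exp_add field_simps)
      finally show "fh x * (iexp (- (x * y)) * cnj (f y))
        = (\<integral>s. iexp (x * s) * (f (y + s) * cnj (f y)) \<partial>lborel)" .
    qed
    also have "\<dots> = (\<integral>s. (\<integral>y. iexp (x * s) * (f (y + s) * cnj (f y)) \<partial>lborel) \<partial>lborel)"
    proof (rule lborel_pair.Fubini_integral[symmetric])
      show "integrable (lborel \<Otimes>\<^sub>M lborel) (\<lambda>(y, s). iexp (x * s) * (f (y + s) * cnj (f y)))"
        by (rule Bochner_Integration.integrable_bound[OF pair_int]) (auto simp: norm_mult split_def)
    qed
    also have "\<dots> = (\<integral>s. iexp (x * s) * ?A s \<partial>lborel)"
      by (simp add: autocorrelation_def l2_inner_def)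
    finally show ?thesis .
  qed
  \<comment> \<open>Boundedness of the transform makes its Gaussian means finite before its square
    integrability is known.\<close>
  have fh_bd: "(norm (fh x))\<^sup>2 \<le> (\<integral>s. norm (?A s) \<partial>lborel)" for x
  proof -
    have "(norm (fh x))\<^sup>2 = norm (complex_of_real ((norm (fh x))\<^sup>2))"
      by (simp only: norm_of_real abs_power2)
    also have "\<dots> \<le> (\<integral>s. norm (iexp (x * s) * ?A s) \<partial>lborel)"
      unfolding fh_sq by (rule integral_norm_bound)
    finally show ?thesis by (simp add: norm_mult)
  qed
  \<comment> \<open>Inserting \<open>fh_sq\<close> and exchanging the integrals leaves the transform
    of a Gaussian, again a Gaussian; the substitution s = \<delta> z then turns the right side into
    an average of the autocorrelation near 0.\<close>
  have gauss: "(\<integral>x. (norm (fh x))\<^sup>2 * std_normal_density (\<delta> * x) \<partial>lborel)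
      = sqrt (2 * pi) * Re (\<integral>z. ?A (\<delta> * z) * std_normal_density z \<partial>lborel)" 
    and gauss_int: "integrable lborel (\<lambda>x. (norm (fh x))\<^sup>2 * std_normal_density (\<delta> * x))" if \<delta>: "\<delta> > 0" for \<delta>
  proof -
    have nd: "integrable lborel (\<lambda>x. std_normal_density (\<delta> * x))"
      using lborel_integrable_real_affine[OF integrable_normal_density[OF zero_less_one, of 0], of \<delta> 0] \<delta> by simp
    show "integrable lborel (\<lambda>x. (norm (fh x))\<^sup>2 * std_normal_density (\<delta> * x))"
    proof (rule Bochner_Integration.integrable_bound)
      show "integrable lborel (\<lambda>x. (\<integral>s. norm (?A s) \<partial>lborel) * std_normal_density (\<delta> * x))" using nd by simp
      show "AE x in lborel. norm ((norm (fh x))\<^sup>2 * std_normal_density (\<delta> * x))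
        \<le> norm ((\<integral>s. norm (?A s) \<partial>lborel) * std_normal_density (\<delta> * x))"
        using fh_bd by (auto simp: abs_mult intro!: mult_right_mono order_trans[OF fh_bd])
    qed measurable
    have pint: "integrable (lborel \<Otimes>\<^sub>M lborel)
       (\<lambda>(x, s). iexp (x * s) * ?A s * complex_of_real (std_normal_density (\<delta> * x)))"
    proof (rule Bochner_Integration.integrable_bound)
      show "integrable (lborel \<Otimes>\<^sub>M lborel) (\<lambda>(x, s). complex_of_real (std_normal_density (\<delta> * x)) * ?A s)"
      proof (rule lborel_pair.Fubini_integrable)
        show "integrable lborel (\<lambda>x. \<integral>s. norm (case (x, s) of (x, s) \<Rightarrow> complex_of_real (std_normal_density (\<delta> * x)) * ?A s) \<partial>lborel)"
          using nd by (simp add: norm_mult)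
        show "AE x in lborel. integrable lborel (\<lambda>s. case (x, s) of (x, s) \<Rightarrow> complex_of_real (std_normal_density (\<delta> * x)) * ?A s)"
          using A_int by simp
      qed measurable
    qed (auto simp: norm_mult split_def)
    have "complex_of_real (\<integral>x. (norm (fh x))\<^sup>2 * std_normal_density (\<delta> * x) \<partial>lborel)
       = (\<integral>x. complex_of_real ((norm (fh x))\<^sup>2) * std_normal_density (\<delta> * x) \<partial>lborel)"
      unfolding integral_complex_of_real[symmetric] by simp
    also have "\<dots> = (\<integral>x. (\<integral>s. iexp (x * s) * ?A s * complex_of_real (std_normal_density (\<delta> * x)) \<partial>lborel) \<partial>lborel)"
      unfolding fh_sq by simp
    also have "\<dots> = (\<integral>s. (\<integral>x. iexp (x * s) * ?A s * complex_of_real (std_normal_density (\<delta> * x)) \<partial>lborel) \<partial>lborel)"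
      by (rule lborel_pair.Fubini_integral[symmetric, OF pint])
    also have "\<dots> = (\<integral>s. ?A s * (complex_of_real (exp (- ((s / \<delta>)\<^sup>2) / 2)) / \<delta>) \<partial>lborel)"
    proof (rule Bochner_Integration.integral_cong[OF refl])
      fix s
      have "(\<integral>x. iexp (x * s) * ?A s * complex_of_real (std_normal_density (\<delta> * x)) \<partial>lborel)
         = ?A s * (\<integral>x. iexp ((s / \<delta>) * (0 + \<delta> * x)) * complex_of_real (std_normal_density (0 + \<delta> * x)) \<partial>lborel)"
        using \<delta> by (simp add: integral_mult_right_zero[symmetric] mult_ac del: integral_mult_right_zero)
      also have "(\<integral>x. iexp ((s / \<delta>) * (0 + \<delta> * x)) * complex_of_real (std_normal_density (0 + \<delta> * x)) \<partial>lborel)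
         = complex_of_real (exp (- ((s / \<delta>)\<^sup>2) / 2)) / \<delta>"
        using lborel_integral_real_affine[of \<delta> "\<lambda>x. iexp ((s / \<delta>) * x) * complex_of_real (std_normal_density x)" 0] \<delta>
        unfolding fourier_std_normal by (simp add: scaleR_conv_of_real field_simps)
      finally show "(\<integral>x. iexp (x * s) * ?A s * complex_of_real (std_normal_density (\<delta> * x)) \<partial>lborel)
         = ?A s * (complex_of_real (exp (- ((s / \<delta>)\<^sup>2) / 2)) / \<delta>)" .
    qed
    also have "\<dots> = \<delta> *\<^sub>R (\<integral>z. ?A (\<delta> * z) * (complex_of_real (exp (- (z\<^sup>2) / 2)) / \<delta>) \<partial>lborel)"
      using lborel_integral_real_affine[of \<delta> "\<lambda>s. ?A s * (complex_of_real (exp (- ((s / \<delta>)\<^sup>2) / 2)) / \<delta>)" 0] \<delta>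
      by simp
    also have "(\<integral>z. ?A (\<delta> * z) * (complex_of_real (exp (- (z\<^sup>2) / 2)) / \<delta>) \<partial>lborel)
       = (\<integral>z. complex_of_real (sqrt (2 * pi) / \<delta>) * (?A (\<delta> * z) * std_normal_density z) \<partial>lborel)"
      by (simp add: std_normal_density_def)
    also have "\<delta> *\<^sub>R \<dots> = complex_of_real (sqrt (2 * pi)) * (\<integral>z. ?A (\<delta> * z) * std_normal_density z \<partial>lborel)"
      using \<delta> by (simp add: scaleR_conv_of_real)
    finally have "complex_of_real (\<integral>x. (norm (fh x))\<^sup>2 * std_normal_density (\<delta> * x) \<partial>lborel)
      = complex_of_real (sqrt (2 * pi)) * (\<integral>z. ?A (\<delta> * z) * std_normal_density z \<partial>lborel)" .
    from arg_cong[OF this, of Re]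
    show "(\<integral>x. (norm (fh x))\<^sup>2 * std_normal_density (\<delta> * x) \<partial>lborel)
      = sqrt (2 * pi) * Re (\<integral>z. ?A (\<delta> * z) * std_normal_density z \<partial>lborel)"
      by simp
  qed
  define \<delta> where "\<delta> n = inverse (real (Suc n))" for n
  have \<delta>: "\<delta> n > 0" for n by (simp add: \<delta>_def)
  have \<delta>_lim: "\<delta> \<longlonglongrightarrow> 0" unfolding \<delta>_def[abs_def] by (rule LIMSEQ_inverse_real_of_nat)
  \<comment> \<open>The factor sqrt (2 pi) removes the normalisation of the density, so that p n
    increases to |fh|^2; with the sqrt (2 pi) from \<open>gauss\<close> it produces the constant 2
    pi. Monotone convergence then delivers integrability and value together.\<close>
  define p where "p n x = sqrt (2 * pi) * ((norm (fh x))\<^sup>2 * std_normal_density (\<delta> n * x))" for n x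
  have p_eq: "p n x = (norm (fh x))\<^sup>2 * exp (- (\<delta> n * x)\<^sup>2 / 2)" for n x
    by (simp add: p_def std_normal_density_def)
  have "(\<lambda>n. \<integral>z. ?A (\<delta> n * z) * std_normal_density z \<partial>lborel)
     \<longlonglongrightarrow> (\<integral>z. ?A 0 * std_normal_density z \<partial>lborel)"
  proof (rule integral_dominated_convergence)
    show "integrable lborel (\<lambda>z. (l2_norm lborel f)\<^sup>2 * std_normal_density z)" by simp
    show "AE z in lborel. (\<lambda>n. ?A (\<delta> n * z) * std_normal_density z) \<longlonglongrightarrow> ?A 0 * std_normal_density z"
    proof (intro AE_I2 tendsto_mult tendsto_const autocorrelation_tendsto[OF f int])
      fix z show "(\<lambda>n. \<delta> n * z) \<longlonglongrightarrow> 0" using tendsto_mult_left_zero[OF \<delta>_lim] by simp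
    qed
    show "AE z in lborel. norm (?A (\<delta> n * z) * complex_of_real (std_normal_density z))
        \<le> (l2_norm lborel f)\<^sup>2 * std_normal_density z" for n
      using norm_autocorrelation_le[OF f] by (auto simp: norm_mult intro!: mult_right_mono)
  qed measurable
  also have "(\<integral>z. ?A 0 * std_normal_density z \<partial>lborel) = ?A 0"
    by simp
  also have "?A 0 = complex_of_real ((l2_norm lborel f)\<^sup>2)"
    by (simp add: autocorrelation_def l2_inner_self)
  finally have lim: "(\<lambda>n. \<integral>z. ?A (\<delta> n * z) * std_normal_density z \<partial>lborel)
     \<longlonglongrightarrow> complex_of_real ((l2_norm lborel f)\<^sup>2)" .
  have p_int: "integrable lborel (p n)" for n
    unfolding p_def using gauss_int[OF \<delta>[of n]] by simp
  have "(\<lambda>n. integral\<^sup>L lborel (p n)) \<longlonglongrightarrow> sqrt (2 * pi) * (sqrt (2 * pi) * Re (complex_of_real ((l2_norm lborel f)\<^sup>2)))"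
    unfolding p_def integral_mult_right_zero gauss[OF \<delta>] by (intro tendsto_intros lim)
  also have "sqrt (2 * pi) * (sqrt (2 * pi) * Re (complex_of_real ((l2_norm lborel f)\<^sup>2))) = 2 * pi * (l2_norm lborel f)\<^sup>2"
    by (simp add: mult.assoc[symmetric])
  finally have p_lim: "(\<lambda>n. integral\<^sup>L lborel (p n)) \<longlonglongrightarrow> 2 * pi * (l2_norm lborel f)\<^sup>2" .
  have p_mono: "AE x in lborel. mono (\<lambda>n. p n x)"
  proof (rule AE_I2, rule incseq_SucI)
    fix x n
    have "(\<delta> (Suc n) * x)\<^sup>2 \<le> (\<delta> n * x)\<^sup>2"
      unfolding power_mult_distrib by (intro mult_right_mono power_mono) (auto simp: \<delta>_def field_simps)
    then show "p n x \<le> p (Suc n) x"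
      unfolding p_eq by (intro mult_left_mono) auto
  qed
  have p_conv: "AE x in lborel. (\<lambda>n. p n x) \<longlonglongrightarrow> (norm (fh x))\<^sup>2"
  proof (rule AE_I2)
    fix x
    have "(\<lambda>n. p n x) \<longlonglongrightarrow> (norm (fh x))\<^sup>2 * exp (- (0 * x)\<^sup>2 / 2)"
      unfolding p_eq by (intro tendsto_intros \<delta>_lim) auto
    then show "(\<lambda>n. p n x) \<longlonglongrightarrow> (norm (fh x))\<^sup>2" by simp
  qed
  note mc = p_int p_mono p_conv p_lim
  have "integrable lborel (\<lambda>x. (norm (fh x))\<^sup>2)"
    by (rule integrable_monotone_convergence[OF mc]) measurable
  then show "fh \<in> L2 lborel" by (intro L2_I) auto
  show "(l2_norm lborel fh)\<^sup>2 = 2 * pi * (l2_norm lborel f)\<^sup>2"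
    unfolding l2_norm_sq[of _ fh] by (rule integral_monotone_convergence[OF mc]) measurable
qed

subsection \<open>The Gaussian measure and the phase space\<close>

lemma weight_eq_normal_density: "weight = normal_density 0 (1 / sqrt 2)"
  by (rule ext) (simp add: weight_def normal_density_def power_divide)

lemma weight_measurable [measurable]: "weight \<in> borel_measurable borel"
  unfolding weight_def by measurable

lemma maxwell_eq: "maxwell = density lborel (normal_density 0 (1 / sqrt 2))"
  unfolding maxwell_def weight_eq_normal_density ..

lemma sets_maxwell [simp, measurable_cong]: "sets maxwell = sets borel"
  by (simp add: maxwell_def)

lemma space_maxwell [simp]: "space maxwell = UNIV"
  by (simp add: maxwell_def)

interpretation maxwell: prob_space maxwell
  unfolding maxwell_eq by (rule prob_space_normal_density) simp

interpretation phase: pair_sigma_finite lborel maxwell ..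

lemma sigma_finite_lborel: "sigma_finite_measure (lborel :: real measure)"
  by (rule lborel.sigma_finite_measure_axioms)

lemma sigma_finite_maxwell: "sigma_finite_measure maxwell"
  by (rule maxwell.sigma_finite_measure_axioms)

lemma sets_phase [simp, measurable_cong]: "sets phase = sets (borel \<Otimes>\<^sub>M borel)"
  unfolding phase_def by (intro sets_pair_measure_cong) auto

lemma space_phase [simp]: "space phase = UNIV"
  by (simp add: phase_def space_pair_measure)

lemma maxwell_const_L2 [simp]: "(\<lambda>_. c) \<in> L2 maxwell"
  by (simp add: L2_def)

lemma maxwell_bounded_L2:
  "g \<in> borel_measurable borel \<Longrightarrow> (\<And>v. norm (g v) \<le> C) \<Longrightarrow> g \<in> L2 maxwell"
  by (rule L2_dominated(1)[OF maxwell_const_L2[of 1], where C = C]) auto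

lemma l2_norm_maxwell_one [simp]: "l2_norm maxwell (\<lambda>_. 1) = 1"
  using maxwell.prob_space by (simp add: l2_norm_def)

lemma L2_maxwell_integrable: "f \<in> L2 maxwell \<Longrightarrow> integrable maxwell f"
  using L2_integrable_mult[OF _ maxwell_const_L2[of 1], of f] by simp

lemma norm_integral_maxwell_le:
  assumes "f \<in> L2 maxwell"
  shows "norm (\<integral>v. f v \<partial>maxwell) \<le> l2_norm maxwell f"
  using l2_cauchy_schwarz[OF assms maxwell_const_L2[of 1]] by (simp add: l2_inner_def)

lemma fourier_maxwell:
  "(\<integral>v. exp (\<i> * complex_of_real (t * v)) \<partial>maxwell) = complex_of_real (exp (- t\<^sup>2 / 4))"
proof -
  have dens: "normal_density 0 (1 / sqrt 2) v = sqrt 2 * std_normal_density (sqrt 2 * v)" for v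
    by (simp add: normal_density_def power_mult_distrib real_sqrt_mult power_divide)
  have "(\<integral>v. exp (\<i> * complex_of_real (t * v)) \<partial>maxwell)
    = (\<integral>v. normal_density 0 (1 / sqrt 2) v *\<^sub>R exp (\<i> * complex_of_real (t * v)) \<partial>lborel)"
    unfolding maxwell_eq by (subst integral_density) auto
  also have "\<dots> = sqrt 2 *\<^sub>R (\<integral>v. iexp ((t / sqrt 2) * (0 + sqrt 2 * v)) * std_normal_density (0 + sqrt 2 * v) \<partial>lborel)"
    unfolding integral_scaleR_right[symmetric] dens
    by (intro Bochner_Integration.integral_cong) (auto simp: scaleR_conv_of_real mult_ac)
  also have "\<dots> = (\<integral>x. iexp ((t / sqrt 2) * x) * std_normal_density x \<partial>lborel)"
    using lborel_integral_real_affine[of "sqrt 2" "\<lambda>x. iexp ((t / sqrt 2) * x) * std_normal_density x" 0] by simp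
  finally show ?thesis unfolding fourier_std_normal by (simp add: power_divide)
qed

lemma AE_pair_measure_fst:
  assumes "sigma_finite_measure B" "AE x in A. P x"
  shows "AE z in A \<Otimes>\<^sub>M B. P (fst z)"
proof -
  interpret B: sigma_finite_measure B by fact
  obtain N where N: "N \<in> null_sets A" "{x \<in> space A. \<not> P x} \<subseteq> N"
    using assms(2) by (auto elim!: AE_E2 AE_E intro: that simp: null_sets_def)
  show ?thesis
  proof (rule AE_I'[of "N \<times> space B"])
    show "N \<times> space B \<in> null_sets (A \<Otimes>\<^sub>M B)"
      using N(1) by (auto simp: null_sets_def B.emeasure_pair_measure_Times)
  qed (use N(2) in \<open>auto simp: space_pair_measure\<close>)
qed

lemma AE_pair_measure_snd:
  assumes "sigma_finite_measure B" "AE y in B. P y"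
  shows "AE z in A \<Otimes>\<^sub>M B. P (snd z)"
proof -
  interpret B: sigma_finite_measure B by fact
  obtain N where N: "N \<in> null_sets B" "{x \<in> space B. \<not> P x} \<subseteq> N"
    using assms(2) by (auto elim!: AE_E2 AE_E intro: that simp: null_sets_def)
  show ?thesis
  proof (rule AE_I'[of "space A \<times> N"])
    show "space A \<times> N \<in> null_sets (A \<Otimes>\<^sub>M B)"
      using N(1) by (auto simp: null_sets_def B.emeasure_pair_measure_Times)
  qed (use N(2) in \<open>auto simp: space_pair_measure\<close>)
qed

lemmas L2_phase_fst = L2_pair_fst[OF sigma_finite_lborel sigma_finite_maxwell, folded phase_def]

lemma AE_phase_fst: "AE \<xi> in lborel. P \<xi> \<Longrightarrow> AE z in phase. P (fst z)"
  unfolding phase_def by (rule AE_pair_measure_fst[OF sigma_finite_maxwell])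

lemma AE_phase_snd: "AE v in maxwell. P v \<Longrightarrow> AE z in phase. P (snd z)"
  unfolding phase_def by (rule AE_pair_measure_snd[OF sigma_finite_maxwell])

lemma AE_phase_I:
  assumes "Measurable.pred (borel \<Otimes>\<^sub>M borel) P" "AE \<xi> in lborel. AE v in maxwell. P (\<xi>, v)"
  shows "AE z in phase. P z"
proof -
  have "AE z in lborel \<Otimes>\<^sub>M maxwell. P z"
  proof (rule phase.AE_pair_measure)
    show "{x \<in> space (lborel \<Otimes>\<^sub>M maxwell). P x} \<in> sets (lborel \<Otimes>\<^sub>M maxwell)"
      using assms(1) sets_phase unfolding phase_def pred_def
      by (simp add: space_pair_measure)
  qed (use assms(2) in auto)
  then show ?thesis unfolding phase_def .
qed

lemma L2_phase_snd:
  assumes "F \<in> L2 phase"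
  shows "AE v in maxwell. (\<lambda>\<xi>. F (\<xi>, v)) \<in> L2 lborel"
  using L2_pair_fst(1)[OF sigma_finite_maxwell sigma_finite_lborel
      L2_pair_swap(1)[OF sigma_finite_lborel sigma_finite_maxwell assms[unfolded phase_def]]]
  by simp

lemma phase_borel: "F \<in> L2 phase \<Longrightarrow> F \<in> borel_measurable (borel \<Otimes>\<^sub>M borel)"
  using L2_measurable[of F phase] by (simp cong: measurable_cong_sets)

lemma l2_norm_tendsto:
  assumes "\<And>n. f n \<in> L2 M" "g \<in> L2 M" "((\<lambda>n. l2_norm M (\<lambda>x. f n x - g x)) \<longlongrightarrow> 0) F"
  shows "((\<lambda>n. l2_norm M (f n)) \<longlongrightarrow> l2_norm M g) F"
proof (rule Lim_transform2[OF tendsto_const])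
  show "((\<lambda>n. l2_norm M g - l2_norm M (f n)) \<longlongrightarrow> 0) F"
  proof (rule Lim_null_comparison[OF _ assms(3)], rule always_eventually, rule allI)
    fix n
    show "norm (l2_norm M g - l2_norm M (f n)) \<le> l2_norm M (\<lambda>x. f n x - g x)"
      using l2_norm_le_via[OF assms(1)[of n] assms(2)] l2_norm_le_via[OF assms(2) assms(1)[of n]]
        l2_norm_minus_commute[of M "f n" g] by auto
  qed
qed

subsection \<open>The inverse Fourier transform on the phase space\<close>

definition fourier_trunc :: "real \<Rightarrow> (real \<times> real \<Rightarrow> complex) \<Rightarrow> real \<times> real \<Rightarrow> complex" where
  "fourier_trunc R F = (\<lambda>(x, v). (1 / (2 * complex_of_real pi)) *
        (LINT \<xi>:{-R..R}|lborel. exp (\<i> * complex_of_real x * complex_of_real \<xi>) * F (\<xi>, v)))"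

lemma inverse_fourier_eq:
  "inverse_fourier F = (SOME f. l2_tendsto phase (\<lambda>R. fourier_trunc R F) f at_top)"
  unfolding inverse_fourier_def fourier_trunc_def ..

definition band :: "real \<Rightarrow> (real \<times> real \<Rightarrow> complex) \<Rightarrow> real \<times> real \<Rightarrow> complex" where
  "band R F z = indicator ({-R..R} \<times> UNIV) z * F z"

lemma band_sets [measurable]: "{-R..R::real} \<times> UNIV \<in> sets (borel \<Otimes>\<^sub>M (borel :: real measure))"
  by (intro pair_measureI) auto

lemma band_L2: "F \<in> L2 phase \<Longrightarrow> band R F \<in> L2 phase"
  unfolding band_def by (rule L2_indicator) auto

lemma band_approx:
  assumes "F \<in> L2 phase"
  shows "(\<lambda>n. l2_norm phase (\<lambda>z. F z - band (real n) F z)) \<longlonglongrightarrow> 0"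
  unfolding band_def
proof (rule L2_approx_truncation[OF assms])
  fix z :: "real \<times> real"
  obtain N where N: "\<bar>fst z\<bar> \<le> real N" using real_arch_simple by blast
  have "z \<in> {- real n..real n} \<times> UNIV" if "n \<ge> N" for n
  proof -
    have "\<bar>fst z\<bar> \<le> real n" using N that by linarith
    then show ?thesis by (cases z) auto
  qed
  then show "\<exists>N. \<forall>n\<ge>N. z \<in> {- real n..real n} \<times> UNIV" by blast
qed simp

text \<open>Differences of two truncations thereby become the truncation, at the larger radius, of
  the tail F - band R F; this is how the Cauchy property is obtained.\<close>

lemma fourier_trunc_band:
  assumes "R \<le> S"
  shows "fourier_trunc S (band R F) = fourier_trunc R F"
  unfolding fourier_trunc_def band_def set_lebesgue_integral_def
  by (intro ext) (use assms in \<open>auto simp: indicator_def intro!: Bochner_Integration.integral_cong\<close>)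

lemma L2_lborel_set_integrable:
  assumes f: "f \<in> L2 lborel"
  shows "set_integrable lborel {-R..R} (\<lambda>\<xi>. exp (\<i> * complex_of_real x * complex_of_real \<xi>) * f \<xi>)"
proof -
  have [measurable]: "f \<in> borel_measurable borel" using L2_measurable[OF f] by simp
  have "(\<lambda>\<xi>. indicator {-R..R} \<xi> :: complex) \<in> L2 lborel"
  proof (rule L2_I)
    have "integrable lborel (indicator {-R..R} :: real \<Rightarrow> real)"
      by (rule integrable_real_indicator) (auto simp: emeasure_lborel_Icc_eq)
    moreover have "(\<lambda>\<xi>. (norm (indicator {-R..R} \<xi> :: complex))\<^sup>2) = (indicator {-R..R} :: real \<Rightarrow> real)"
      by (auto simp: indicator_def)
    ultimately show "integrable lborel (\<lambda>\<xi>. (norm (indicator {-R..R} \<xi> :: complex))\<^sup>2)" by simp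
  qed measurable
  from L2_integrable_mult[OF this f] show ?thesis
    unfolding set_integrable_def
    by (rule Bochner_Integration.integrable_bound) (auto simp: norm_mult indicator_def)
qed

text \<open>For almost every v the cut slice is both integrable and square integrable, so the
  one-dimensional Plancherel identity applies to it; the square of the prefactor 1 / (2 pi) times 2
  pi leaves 1 / (2 pi). The variables are swapped because the transform acts on slices with v
  fixed.\<close>

lemma fourier_trunc_L2:
  assumes F: "F \<in> L2 phase"
  shows "fourier_trunc R F \<in> L2 phase"
    and "l2_norm phase (fourier_trunc R F) = l2_norm phase (band R F) / sqrt (2 * pi)"
proof -
  have [measurable]: "F \<in> borel_measurable (borel \<Otimes>\<^sub>M borel)"
    by (rule phase_borel[OF F])
  note fin = sigma_finite_lborel sigma_finite_maxwell
  define H where "H = (\<lambda>(v, \<xi>). band R F (\<xi>, v))"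
  define G where "G = (\<lambda>(v, x). fourier_trunc R F (x, v))"
  have H: "H \<in> L2 (maxwell \<Otimes>\<^sub>M lborel)" "l2_norm (maxwell \<Otimes>\<^sub>M lborel) H = l2_norm phase (band R F)"
    unfolding H_def phase_def
    by (rule L2_pair_swap[OF fin band_L2[OF F, unfolded phase_def]])+
  have [measurable]: "fourier_trunc R F \<in> borel_measurable (borel \<Otimes>\<^sub>M borel)"
    unfolding fourier_trunc_def set_lebesgue_integral_def by measurable
  have G_meas: "G \<in> borel_measurable (maxwell \<Otimes>\<^sub>M lborel)"
    unfolding G_def by measurable
  have ae: "AE v in maxwell. (\<lambda>x. G (v, x)) \<in> L2 lborel \<and>
      (l2_norm lborel (\<lambda>x. G (v, x)))\<^sup>2 = (l2_norm lborel (\<lambda>\<xi>. H (v, \<xi>)))\<^sup>2 / (2 * pi)"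
    using L2_pair_fst(1)[OF fin(2,1) H(1)] L2_phase_snd[OF F]
  proof eventually_elim
    case (elim v)
    let ?h = "\<lambda>\<xi>. H (v, \<xi>)"
    have "?h = (\<lambda>\<xi>. indicator {-R..R} \<xi> *\<^sub>R (exp (\<i> * complex_of_real 0 * complex_of_real \<xi>) * F (\<xi>, v)))"
      by (auto simp: H_def band_def indicator_def)
    then have int: "integrable lborel ?h"
      using L2_lborel_set_integrable[OF elim(2), of R 0] unfolding set_integrable_def by simp
    have "(\<lambda>x. G (v, x)) = (\<lambda>x. (1 / (2 * complex_of_real pi)) * (\<integral>\<xi>. iexp (x * \<xi>) * ?h \<xi> \<partial>lborel))"
      unfolding G_def fourier_trunc_def H_def band_def set_lebesgue_integral_def
      by (auto simp: indicator_def mult.assoc intro!: ext Bochner_Integration.integral_cong)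
    moreover note pl = plancherel_L1_L2[OF elim(1) int]
    ultimately have G: "(\<lambda>x. G (v, x)) \<in> L2 lborel"
       "l2_norm lborel (\<lambda>x. G (v, x)) = norm (1 / (2 * complex_of_real pi)) * l2_norm lborel (\<lambda>x. \<integral>\<xi>. iexp (x * \<xi>) * ?h \<xi> \<partial>lborel)"
      by (simp_all only: l2_norm_scale L2_scale)
    have "(l2_norm lborel (\<lambda>x. G (v, x)))\<^sup>2 = (1 / (2 * pi))\<^sup>2 * (2 * pi * (l2_norm lborel ?h)\<^sup>2)"
      unfolding G(2) power_mult_distrib pl(2) by (simp add: norm_divide)
    then show ?case using G(1) by (simp add: power2_eq_square)
  qed
  have int: "integrable maxwell (\<lambda>v. (l2_norm lborel (\<lambda>x. G (v, x)))\<^sup>2)"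
  proof (subst integrable_cong_AE)
    show "integrable maxwell (\<lambda>v. (l2_norm lborel (\<lambda>\<xi>. H (v, \<xi>)))\<^sup>2 / (2 * pi))"
      using L2_pair_fst(2)[OF fin(2,1) H(1)] by simp
    then show "(\<lambda>v. (l2_norm lborel (\<lambda>\<xi>. H (v, \<xi>)))\<^sup>2 / (2 * pi)) \<in> borel_measurable maxwell" by auto
    show "(\<lambda>v. (l2_norm lborel (\<lambda>x. G (v, x)))\<^sup>2) \<in> borel_measurable maxwell"
      unfolding l2_norm_sq G_def by measurable
    show "AE v in maxwell. (l2_norm lborel (\<lambda>x. G (v, x)))\<^sup>2 = (l2_norm lborel (\<lambda>\<xi>. H (v, \<xi>)))\<^sup>2 / (2 * pi)"
      using ae by (rule eventually_mono) auto
  qed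
  have GL2: "G \<in> L2 (maxwell \<Otimes>\<^sub>M lborel)"
    by (rule L2_pair_I[OF fin(2,1) G_meas _ int]) (use ae in \<open>auto elim: eventually_mono\<close>)
  have swap: "(\<lambda>(x, v). G (v, x)) = fourier_trunc R F" by (auto simp: G_def)
  show L2: "fourier_trunc R F \<in> L2 phase"
    using L2_pair_swap(1)[OF fin(2,1) GL2] unfolding swap phase_def .
  have "l2_norm phase (fourier_trunc R F) = l2_norm (maxwell \<Otimes>\<^sub>M lborel) G"
    using L2_pair_swap(2)[OF fin(2,1) GL2] unfolding swap phase_def .
  also have "(l2_norm (maxwell \<Otimes>\<^sub>M lborel) G)\<^sup>2 = (\<integral>v. (l2_norm lborel (\<lambda>\<xi>. H (v, \<xi>)))\<^sup>2 / (2 * pi) \<partial>maxwell)"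
    unfolding L2_pair_fst(3)[OF fin(2,1) GL2]
  proof (rule integral_cong_AE)
    show "(\<lambda>v. (l2_norm lborel (\<lambda>x. G (v, x)))\<^sup>2) \<in> borel_measurable maxwell" using int by auto
    show "(\<lambda>v. (l2_norm lborel (\<lambda>\<xi>. H (v, \<xi>)))\<^sup>2 / (2 * pi)) \<in> borel_measurable maxwell"
      using borel_measurable_integrable[OF L2_pair_fst(2)[OF fin(2,1) H(1)]] by measurable
    show "AE v in maxwell. (l2_norm lborel (\<lambda>x. G (v, x)))\<^sup>2 = (l2_norm lborel (\<lambda>\<xi>. H (v, \<xi>)))\<^sup>2 / (2 * pi)"
      using ae by (rule eventually_mono) auto
  qed
  also have "\<dots> = (l2_norm phase (band R F))\<^sup>2 / (2 * pi)"
    using L2_pair_fst(3)[OF fin(2,1) H(1)] H(2) by simp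
  also have "\<dots> = (l2_norm phase (band R F) / sqrt (2 * pi))\<^sup>2" by (simp add: power_divide)
  finally show "l2_norm phase (fourier_trunc R F) = l2_norm phase (band R F) / sqrt (2 * pi)"
    by (rule power2_eq_imp_eq) auto
qed

lemma fourier_trunc_bounded: "l2_bounded phase phase (1 / sqrt (2 * pi)) (fourier_trunc R)"
  unfolding l2_bounded_def
proof (intro conjI ballI allI)
  fix F assume F: "F \<in> L2 phase"
  show "fourier_trunc R F \<in> L2 phase" by (rule fourier_trunc_L2[OF F])
  have "l2_norm phase (band R F) \<le> 1 * l2_norm phase F"
    by (rule L2_dominated(2)[OF F]) (auto intro!: L2_measurable band_L2 F simp: band_def indicator_def)
  then show "l2_norm phase (fourier_trunc R F) \<le> 1 / sqrt (2 * pi) * l2_norm phase F"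
    unfolding fourier_trunc_L2(2)[OF F] by (simp add: divide_right_mono)
  fix G a b assume G: "G \<in> L2 phase"
  have "AE z in phase. (\<lambda>\<xi>. F (\<xi>, snd z)) \<in> L2 lborel \<and> (\<lambda>\<xi>. G (\<xi>, snd z)) \<in> L2 lborel"
    using AE_phase_snd[OF L2_phase_snd[OF F]] AE_phase_snd[OF L2_phase_snd[OF G]] by eventually_elim simp
  then show "AE z in phase. fourier_trunc R (\<lambda>y. a * F y + b * G y) z = a * fourier_trunc R F z + b * fourier_trunc R G z"
  proof eventually_elim
    case (elim z)
    obtain x v where z: "z = (x, v)" by (cases z)
    let ?e = "\<lambda>\<xi>. exp (\<i> * complex_of_real x * complex_of_real \<xi>)"
    have sF: "set_integrable lborel {-R..R} (\<lambda>\<xi>. a * (?e \<xi> * F (\<xi>, v)))"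
      and sG: "set_integrable lborel {-R..R} (\<lambda>\<xi>. b * (?e \<xi> * G (\<xi>, v)))"
      using elim z by (auto intro!: set_integrable_mult_right L2_lborel_set_integrable)
    have "(LINT \<xi>:{-R..R}|lborel. ?e \<xi> * (a * F (\<xi>, v) + b * G (\<xi>, v)))
      = (LINT \<xi>:{-R..R}|lborel. a * (?e \<xi> * F (\<xi>, v)) + b * (?e \<xi> * G (\<xi>, v)))"
      by (simp add: algebra_simps)
    also have "\<dots> = (LINT \<xi>:{-R..R}|lborel. a * (?e \<xi> * F (\<xi>, v))) + (LINT \<xi>:{-R..R}|lborel. b * (?e \<xi> * G (\<xi>, v)))"
      by (rule set_integral_add(2)[OF sF sG])
    also have "\<dots> = a * (LINT \<xi>:{-R..R}|lborel. ?e \<xi> * F (\<xi>, v)) + b * (LINT \<xi>:{-R..R}|lborel. ?e \<xi> * G (\<xi>, v))"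
      by simp
    finally have eq: "(LINT \<xi>:{-R..R}|lborel. ?e \<xi> * (a * F (\<xi>, v) + b * G (\<xi>, v)))
      = a * (LINT \<xi>:{-R..R}|lborel. ?e \<xi> * F (\<xi>, v)) + b * (LINT \<xi>:{-R..R}|lborel. ?e \<xi> * G (\<xi>, v))" .
    show ?case unfolding fourier_trunc_def z prod.case eq by (simp only: distrib_left mult.left_commute)
  qed
qed simp

lemma fourier_trunc_diff_le:
  assumes F: "F \<in> L2 phase" and "R \<le> S"
  shows "l2_norm phase (\<lambda>z. fourier_trunc S F z - fourier_trunc R F z)
    \<le> l2_norm phase (\<lambda>z. F z - band R F z)"
proof -
  note bd = fourier_trunc_bounded[of S]
  have "l2_norm phase (\<lambda>z. fourier_trunc S F z - fourier_trunc R F z)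
    = l2_norm phase (fourier_trunc S (\<lambda>z. F z - band R F z))"
    using l2_bounded_diff[OF bd F band_L2[OF F, of R]] unfolding fourier_trunc_band[OF assms(2)]
    by (intro l2_norm_cong_AE L2_measurable L2_diff fourier_trunc_L2 band_L2 F) auto
  also have "\<dots> \<le> 1 / sqrt (2 * pi) * l2_norm phase (\<lambda>z. F z - band R F z)"
    by (intro l2_bounded_norm[OF bd] L2_diff F band_L2)
  also have "\<dots> \<le> 1 * l2_norm phase (\<lambda>z. F z - band R F z)"
  proof (rule mult_right_mono)
    have "1 \<le> sqrt (2 * pi)" using pi_ge_two by simp
    then show "1 / sqrt (2 * pi) \<le> 1" by simp
  qed simp
  finally show ?thesis by simp
qed

text \<open>The integer truncations are Cauchy and \<open>L2_complete\<close> gives a limit; the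
  tail estimate holds for every real radius beyond N and extends the convergence from integers to
  real R. So the choice in \<open>inverse_fourier\<close> is never vacuous on
  \<open>L2 phase\<close>.\<close>

lemma inverse_fourier_tendsto:
  assumes F: "F \<in> L2 phase"
  shows "l2_tendsto phase (\<lambda>R. fourier_trunc R F) (inverse_fourier F) at_top"
proof -
  let ?J = "\<lambda>R. fourier_trunc R F"
  let ?d = "\<lambda>R. l2_norm phase (\<lambda>z. F z - band R F z)"
  have J: "?J R \<in> L2 phase" for R by (rule fourier_trunc_L2[OF F])
  have "\<exists>g\<in>L2 phase. (\<lambda>n. l2_norm phase (\<lambda>x. ?J (real n) x - g x)) \<longlonglongrightarrow> 0"
  proof (rule L2_complete[OF J])
    fix e :: real assume "e > 0"
    then obtain N where N: "?d (real N) < e / 2"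
      using order_tendstoD(2)[OF band_approx[OF F], of "e/2"] by (auto simp: eventually_sequentially)
    have "l2_norm phase (\<lambda>x. ?J (real m) x - ?J (real n) x) < e" if "m \<ge> N" "n \<ge> N" for m n
    proof -
      have "l2_norm phase (\<lambda>x. ?J (real m) x - ?J (real n) x)
        \<le> l2_norm phase (\<lambda>x. ?J (real m) x - ?J (real N) x) + l2_norm phase (\<lambda>x. ?J (real N) x - ?J (real n) x)"
        by (rule l2_triangle_via[OF J J J])
      also have "\<dots> < e"
        using fourier_trunc_diff_le[OF F, of "real N" "real m"] fourier_trunc_diff_le[OF F, of "real N" "real n"]
          that N l2_norm_minus_commute[of phase "?J (real N)" "?J (real n)"] by simp
      finally show ?thesis .
    qed
    then show "\<exists>N. \<forall>m\<ge>N. \<forall>n\<ge>N. l2_norm phase (\<lambda>x. ?J (real m) x - ?J (real n) x) < e" by blast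
  qed
  then obtain g where g: "g \<in> L2 phase" and lim: "(\<lambda>n. l2_norm phase (\<lambda>x. ?J (real n) x - g x)) \<longlonglongrightarrow> 0"
    by blast
  have "l2_tendsto phase ?J g at_top"
    unfolding l2_tendsto_def
  proof (intro conjI)
    show "((\<lambda>R. l2_norm phase (\<lambda>x. ?J R x - g x)) \<longlongrightarrow> 0) at_top"
    proof (rule tendstoI)
    fix e :: real assume "e > 0"
    have "(\<lambda>n. ?d (real n) + l2_norm phase (\<lambda>x. ?J (real n) x - g x)) \<longlonglongrightarrow> 0"
      using tendsto_add[OF band_approx[OF F] lim] by simp
    from order_tendstoD(2)[OF this \<open>e > 0\<close>]
    obtain N where N: "?d (real N) + l2_norm phase (\<lambda>x. ?J (real N) x - g x) < e"
      by (auto simp: eventually_sequentially)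
    show "\<forall>\<^sub>F R in at_top. dist (l2_norm phase (\<lambda>x. ?J R x - g x)) 0 < e"
      using eventually_ge_at_top[of "real N"]
    proof eventually_elim
      case (elim R)
      have "l2_norm phase (\<lambda>x. ?J R x - g x)
         \<le> l2_norm phase (\<lambda>x. ?J R x - ?J (real N) x) + l2_norm phase (\<lambda>x. ?J (real N) x - g x)"
        by (rule l2_triangle_via[OF J J g])
      then show ?case using fourier_trunc_diff_le[OF F elim] N by simp
    qed
    qed
  qed (use g J in auto)
  then show ?thesis unfolding inverse_fourier_eq
    by (rule someI[where P = "\<lambda>f. l2_tendsto phase (\<lambda>R. fourier_trunc R F) f at_top"])
qed

lemma inverse_fourier_L2: "F \<in> L2 phase \<Longrightarrow> inverse_fourier F \<in> L2 phase"
  using inverse_fourier_tendsto by (auto simp: l2_tendsto_def)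

lemma inverse_fourier_lim:
  assumes "F \<in> L2 phase"
  shows "(\<lambda>n. l2_norm phase (\<lambda>z. fourier_trunc (real n) F z - inverse_fourier F z)) \<longlonglongrightarrow> 0"
  using inverse_fourier_tendsto[OF assms] filterlim_compose[OF _ filterlim_real_sequentially]
  unfolding l2_tendsto_def by blast

lemma inverse_fourier_norm:
  assumes F: "F \<in> L2 phase"
  shows "l2_norm phase (inverse_fourier F) = l2_norm phase F / sqrt (2 * pi)"
proof (rule LIMSEQ_unique)
  show "(\<lambda>n. l2_norm phase (fourier_trunc (real n) F)) \<longlonglongrightarrow> l2_norm phase (inverse_fourier F)"
    by (rule l2_norm_tendsto[OF fourier_trunc_L2(1)[OF F] inverse_fourier_L2[OF F] inverse_fourier_lim[OF F]])
  have "(\<lambda>n. l2_norm phase (band (real n) F)) \<longlonglongrightarrow> l2_norm phase F"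
    using band_approx[OF F] by (intro l2_norm_tendsto band_L2 F) (simp add: l2_norm_minus_commute)
  then show "(\<lambda>n. l2_norm phase (fourier_trunc (real n) F)) \<longlonglongrightarrow> l2_norm phase F / sqrt (2 * pi)"
    unfolding fourier_trunc_L2(2)[OF F] by (intro tendsto_intros) auto
qed

lemma l2_eq_AE_by_limit:
  fixes f g :: "'a \<Rightarrow> complex" and e :: "nat \<Rightarrow> real"
  assumes "f \<in> L2 M" "g \<in> L2 M" "\<And>n. l2_norm M (\<lambda>x. f x - g x) \<le> e n" "e \<longlonglongrightarrow> 0"
  shows "AE x in M. f x = g x"
proof -
  have "l2_norm M (\<lambda>x. f x - g x) \<le> 0"
    by (rule LIMSEQ_le_const[OF assms(4)]) (use assms(3) in auto)
  then have "l2_norm M (\<lambda>x. f x - g x) = 0" using l2_norm_nonneg[of M "\<lambda>x. f x - g x"] by linarith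
  then show ?thesis using l2_norm_diff_eq_0_iff[OF assms(1,2)] by simp
qed

text \<open>Being chosen, \<open>inverse_fourier\<close> is linear only up to null sets; this is
  inherited from the truncations in the limit.\<close>

lemma inverse_fourier_bounded: "l2_bounded phase phase (1 / sqrt (2 * pi)) inverse_fourier"
  unfolding l2_bounded_def
proof (intro conjI ballI allI)
  fix F assume F: "F \<in> L2 phase"
  show "inverse_fourier F \<in> L2 phase" by (rule inverse_fourier_L2[OF F])
  show "l2_norm phase (inverse_fourier F) \<le> 1 / sqrt (2 * pi) * l2_norm phase F"
    by (simp add: inverse_fourier_norm[OF F])
  fix G a b assume G: "G \<in> L2 phase"
  let ?H = "\<lambda>y. a * F y + b * G y"
  have H: "?H \<in> L2 phase" by (rule L2_lincomb[OF F G])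
  note IF = inverse_fourier_L2[OF F] inverse_fourier_L2[OF G] inverse_fourier_L2[OF H]
  let ?J = "\<lambda>n. fourier_trunc (real n)"
  define e where "e n = l2_norm phase (\<lambda>z. ?J n ?H z - inverse_fourier ?H z)
     + (norm a * l2_norm phase (\<lambda>z. ?J n F z - inverse_fourier F z)
     + norm b * l2_norm phase (\<lambda>z. ?J n G z - inverse_fourier G z))" for n
  show "AE z in phase. inverse_fourier ?H z = a * inverse_fourier F z + b * inverse_fourier G z"
  proof (rule l2_eq_AE_by_limit[where e = e])
    show "e \<longlonglongrightarrow> 0"
      unfolding e_def by (auto intro!: tendsto_eq_intros inverse_fourier_lim F G H)
    fix n
    note J = fourier_trunc_L2(1)[OF F, of "real n"] fourier_trunc_L2(1)[OF G, of "real n"] fourier_trunc_L2(1)[OF H, of "real n"]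
    let ?L = "\<lambda>z. a * inverse_fourier F z + b * inverse_fourier G z"
    have "l2_norm phase (\<lambda>z. inverse_fourier ?H z - ?L z)
       \<le> l2_norm phase (\<lambda>z. inverse_fourier ?H z - ?J n ?H z) + l2_norm phase (\<lambda>z. ?J n ?H z - ?L z)"
      by (rule l2_triangle_via[OF IF(3) J(3) L2_lincomb[OF IF(1,2)]])
    also have "l2_norm phase (\<lambda>z. ?J n ?H z - ?L z)
       = l2_norm phase (\<lambda>z. a * (?J n F z - inverse_fourier F z) + b * (?J n G z - inverse_fourier G z))"
      using l2_bounded_lincomb[OF fourier_trunc_bounded F G, of "real n" a b]
      by (intro l2_norm_cong_AE L2_measurable L2_diff L2_lincomb IF J) (auto simp: algebra_simps)
    also have "\<dots> \<le> norm a * l2_norm phase (\<lambda>z. ?J n F z - inverse_fourier F z)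
        + norm b * l2_norm phase (\<lambda>z. ?J n G z - inverse_fourier G z)"
      using l2_triangle[OF L2_scale[OF L2_diff[OF J(1) IF(1)], of a] L2_scale[OF L2_diff[OF J(2) IF(2)], of b]]
      unfolding l2_norm_scale .
    finally show "l2_norm phase (\<lambda>z. inverse_fourier ?H z - ?L z) \<le> e n"
      unfolding e_def by (simp add: l2_norm_minus_commute[of phase "inverse_fourier ?H"])
  qed (use IF in \<open>auto intro: L2_lincomb\<close>)
qed simp

lemma inverse_fourier_diff_norm:
  assumes "F \<in> L2 phase" "G \<in> L2 phase"
  shows "l2_norm phase (\<lambda>z. inverse_fourier F z - inverse_fourier G z) = l2_norm phase (\<lambda>z. F z - G z) / sqrt (2 * pi)"
proof -
  have "l2_norm phase (\<lambda>z. inverse_fourier F z - inverse_fourier G z) = l2_norm phase (inverse_fourier (\<lambda>z. F z - G z))"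
    using l2_bounded_diff[OF inverse_fourier_bounded assms]
    by (intro l2_norm_cong_AE L2_measurable L2_diff inverse_fourier_L2 assms) auto
  then show ?thesis using inverse_fourier_norm[OF L2_diff[OF assms]] by simp
qed

lemma inverse_fourier_inj:
  assumes "F \<in> L2 phase" "G \<in> L2 phase" "AE z in phase. inverse_fourier F z = inverse_fourier G z"
  shows "AE z in phase. F z = G z"
  using assms(3) l2_norm_diff_eq_0_iff[OF inverse_fourier_L2[OF assms(1)] inverse_fourier_L2[OF assms(2)]]
    inverse_fourier_diff_norm[OF assms(1,2)] l2_norm_diff_eq_0_iff[OF assms(1,2)] by simp

text \<open>The moment is kept as a function constant in v, so that it stays in
  \<open>L2 phase\<close> and can be fed to \<open>inverse_fourier\<close>.\<close>

definition velocity_avg :: "(real \<times> real \<Rightarrow> complex) \<Rightarrow> real \<times> real \<Rightarrow> complex" where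
  "velocity_avg F = (\<lambda>(x, v). moment F x)"

lemma moment_eq: "moment F x = (\<integral>v. F (x, v) \<partial>maxwell)"
  by (simp add: moment_def l2_inner_def)

lemma velocity_avg_bounded: "l2_bounded phase phase 1 velocity_avg"
  unfolding l2_bounded_def
proof (intro conjI ballI allI)
  fix F assume F: "F \<in> L2 phase"
  have [measurable]: "F \<in> borel_measurable (borel \<Otimes>\<^sub>M borel)"
    by (rule phase_borel[OF F])
  have meas: "velocity_avg F \<in> borel_measurable (lborel \<Otimes>\<^sub>M maxwell)"
    unfolding velocity_avg_def moment_eq by measurable
  have ae: "AE x in lborel. (\<lambda>v. F (x, v)) \<in> L2 maxwell \<longrightarrow> (\<lambda>v. velocity_avg F (x, v)) \<in> L2 maxwell \<and>
        l2_norm maxwell (\<lambda>v. velocity_avg F (x, v)) \<le> 1 * l2_norm maxwell (\<lambda>v. F (x, v))"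
  proof (intro AE_I2 impI conjI)
    fix x assume x: "(\<lambda>v. F (x, v)) \<in> L2 maxwell"
    show "(\<lambda>v. velocity_avg F (x, v)) \<in> L2 maxwell" by (simp add: velocity_avg_def)
    have "l2_norm maxwell (\<lambda>v. velocity_avg F (x, v)) = norm (moment F x)"
      using l2_norm_scale[of maxwell "moment F x" "\<lambda>_. 1"] by (simp add: velocity_avg_def)
    then show "l2_norm maxwell (\<lambda>v. velocity_avg F (x, v)) \<le> 1 * l2_norm maxwell (\<lambda>v. F (x, v))"
      using norm_integral_maxwell_le[OF x] by (simp add: moment_eq)
  qed
  show "velocity_avg F \<in> L2 phase" "l2_norm phase (velocity_avg F) \<le> 1 * l2_norm phase F"
    using L2_pair_dominated[OF sigma_finite_lborel sigma_finite_maxwell sigma_finite_maxwell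
        F[unfolded phase_def] meas zero_le_one ae]
    unfolding phase_def by this+
  fix G a b assume G: "G \<in> L2 phase"
  show "AE z in phase. velocity_avg (\<lambda>y. a * F y + b * G y) z = a * velocity_avg F z + b * velocity_avg G z"
    using AE_phase_fst[OF L2_phase_fst(1)[OF F]] AE_phase_fst[OF L2_phase_fst(1)[OF G]]
  proof eventually_elim
    case (elim z)
    obtain x v where z: "z = (x, v)" by (cases z)
    have "integrable maxwell (\<lambda>v. a * F (x, v))" "integrable maxwell (\<lambda>v. b * G (x, v))"
      using elim by (auto simp: z intro!: L2_maxwell_integrable L2_scale)
    then show ?case by (simp add: velocity_avg_def moment_eq z)
  qed
qed simp

lemma velocity_avg_fourier_trunc:
  assumes F: "F \<in> L2 phase"
  shows "velocity_avg (fourier_trunc R F) = fourier_trunc R (velocity_avg F)"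
proof -
  have [measurable]: "F \<in> borel_measurable (borel \<Otimes>\<^sub>M borel)"
    by (rule phase_borel[OF F])
  have "moment (fourier_trunc R F) x = (1 / (2 * complex_of_real pi)) *
        (LINT \<xi>:{-R..R}|lborel. exp (\<i> * complex_of_real x * complex_of_real \<xi>) * moment F \<xi>)" for x
  proof -
    let ?e = "\<lambda>\<xi>. exp (\<i> * complex_of_real x * complex_of_real \<xi>)"
    have "(\<lambda>z. indicator ({-R..R} \<times> UNIV) z :: complex) \<in> L2 phase"
    proof (rule L2_I)
      have "emeasure phase ({-R..R} \<times> UNIV) = emeasure lborel {-R..R} * emeasure maxwell UNIV"
        unfolding phase_def by (rule maxwell.emeasure_pair_measure_Times) auto
      also have "\<dots> < \<infinity>"
        using maxwell.emeasure_space_1 by (auto simp: emeasure_lborel_Icc_eq)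
      finally have "integrable phase (indicator ({-R..R} \<times> UNIV) :: _ \<Rightarrow> real)"
        by (intro integrable_real_indicator) auto
      moreover have "(\<lambda>z. (norm (indicator ({-R..R} \<times> UNIV) z :: complex))\<^sup>2) = (indicator ({-R..R} \<times> (UNIV :: real set)) :: _ \<Rightarrow> real)"
        by (auto simp: indicator_def)
      ultimately show "integrable phase (\<lambda>z. (norm (indicator ({-R..R} \<times> UNIV) z :: complex))\<^sup>2)" by simp
    qed measurable
    from L2_integrable_mult[OF this F]
    have int: "integrable (lborel \<Otimes>\<^sub>M maxwell) (\<lambda>(\<xi>, v). indicator {-R..R} \<xi> *\<^sub>R (?e \<xi> * F (\<xi>, v)))"
      unfolding phase_def
      by (rule Bochner_Integration.integrable_bound) (auto simp: norm_mult indicator_def)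
    have "moment (fourier_trunc R F) x = (1 / (2 * complex_of_real pi)) *
      (\<integral>v. (\<integral>\<xi>. indicator {-R..R} \<xi> *\<^sub>R (?e \<xi> * F (\<xi>, v)) \<partial>lborel) \<partial>maxwell)"
      unfolding moment_eq fourier_trunc_def set_lebesgue_integral_def by simp
    also have "(\<integral>v. (\<integral>\<xi>. indicator {-R..R} \<xi> *\<^sub>R (?e \<xi> * F (\<xi>, v)) \<partial>lborel) \<partial>maxwell)
      = (\<integral>\<xi>. (\<integral>v. indicator {-R..R} \<xi> *\<^sub>R (?e \<xi> * F (\<xi>, v)) \<partial>maxwell) \<partial>lborel)"
      by (rule phase.Fubini_integral[OF int])
    finally show ?thesis by (simp add: moment_eq set_lebesgue_integral_def)
  qed
  then show ?thesis
    by (intro ext) (auto simp: velocity_avg_def fourier_trunc_def)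
qed

text \<open>Fubini gives the commutation for each truncation, and boundedness passes it to the
  limit. It converts knowledge of moments in x into knowledge of moments in \<xi>.\<close>

lemma velocity_avg_inverse_fourier:
  assumes F: "F \<in> L2 phase"
  shows "AE z in phase. velocity_avg (inverse_fourier F) z = inverse_fourier (velocity_avg F) z"
proof -
  note A = velocity_avg_bounded
  note AF = l2_bounded_L2[OF A F]
  let ?J = "\<lambda>n. fourier_trunc (real n)"
  define e where "e n = l2_norm phase (\<lambda>z. ?J n F z - inverse_fourier F z)
     + l2_norm phase (\<lambda>z. ?J n (velocity_avg F) z - inverse_fourier (velocity_avg F) z)" for n
  show ?thesis
  proof (rule l2_eq_AE_by_limit[where e = e])
    show IF: "velocity_avg (inverse_fourier F) \<in> L2 phase" "inverse_fourier (velocity_avg F) \<in> L2 phase"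
      by (intro l2_bounded_L2[OF A] inverse_fourier_L2 F)+
    show "e \<longlonglongrightarrow> 0"
      unfolding e_def by (auto intro!: tendsto_eq_intros inverse_fourier_lim F AF)
    fix n
    note J = fourier_trunc_L2(1)[OF F, of "real n"] fourier_trunc_L2(1)[OF AF, of "real n"]
    have "l2_norm phase (\<lambda>z. velocity_avg (inverse_fourier F) z - inverse_fourier (velocity_avg F) z)
      \<le> l2_norm phase (\<lambda>z. velocity_avg (inverse_fourier F) z - ?J n (velocity_avg F) z)
       + l2_norm phase (\<lambda>z. ?J n (velocity_avg F) z - inverse_fourier (velocity_avg F) z)"
      by (rule l2_triangle_via[OF IF(1) J(2) IF(2)])
    also have "l2_norm phase (\<lambda>z. velocity_avg (inverse_fourier F) z - ?J n (velocity_avg F) z)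
      = l2_norm phase (velocity_avg (\<lambda>z. inverse_fourier F z - ?J n F z))"
      using l2_bounded_diff[OF A inverse_fourier_L2[OF F] J(1)]
      unfolding velocity_avg_fourier_trunc[OF F, symmetric]
      by (intro l2_norm_cong_AE L2_measurable L2_diff l2_bounded_L2[OF A] inverse_fourier_L2 F J) auto
    also have "\<dots> \<le> 1 * l2_norm phase (\<lambda>z. inverse_fourier F z - ?J n F z)"
      by (intro l2_bounded_norm[OF A] L2_diff inverse_fourier_L2 F J)
    finally show "l2_norm phase (\<lambda>z. velocity_avg (inverse_fourier F) z - inverse_fourier (velocity_avg F) z) \<le> e n"
      unfolding e_def by (simp add: l2_norm_minus_commute)
  qed
qed

subsection \<open>Laplace representation of the dispersion relation\<close>

lemma exp_minus_half_line:
  fixes b :: real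
  assumes "b > 0"
  shows "set_integrable lborel {0<..} (\<lambda>s. exp (- (b * s)))"
    and "(LINT s:{0<..}|lborel. exp (- (b * s))) = 1 / b"
proof -
  interpret P: prob_space "density lborel (exponential_density b)"
    by (rule prob_space_exponential_density) fact
  have "(\<integral>\<^sup>+s. ennreal (exponential_density b s) \<partial>lborel) = 1"
    using P.emeasure_space_1 by (simp add: emeasure_density)
  moreover have nn: "0 \<le> exponential_density b s" for s
    using assms by (simp add: exponential_density_def)
  ultimately have 1: "has_bochner_integral lborel (exponential_density b) 1"
    by (intro has_bochner_integral_nn_integral) auto
  have "AE s in lborel. indicator {0<..} s *\<^sub>R exp (- (b * s)) = exponential_density b s / b"
    using AE_lborel_singleton[of 0]
    by eventually_elim (use assms in \<open>auto simp: exponential_density_def indicator_def mult.commute\<close>)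
  moreover have "has_bochner_integral lborel (\<lambda>s. exponential_density b s / b) (1 / b)"
    using 1 by (rule has_bochner_integral_divide_zero)
  ultimately have "has_bochner_integral lborel (\<lambda>s. indicator {0<..} s *\<^sub>R exp (- (b * s))) (1 / b)"
    by (subst has_bochner_integral_cong_AE[where g = "\<lambda>s. exponential_density b s / b"]) auto
  then show "set_integrable lborel {0<..} (\<lambda>s. exp (- (b * s)))"
    "(LINT s:{0<..}|lborel. exp (- (b * s))) = 1 / b"
    unfolding set_integrable_def set_lebesgue_integral_def
    by (simp_all add: has_bochner_integral_iff)
qed

lemma set_integrable_exp_bound:
  fixes f :: "real \<Rightarrow> 'a::{banach, second_countable_topology}" and b :: real
  assumes "b > 0" "f \<in> borel_measurable borel" "\<And>s. s > 0 \<Longrightarrow> norm (f s) \<le> C * exp (- (b * s))"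
  shows "set_integrable lborel {0<..} f"
  unfolding set_integrable_def
proof (rule Bochner_Integration.integrable_bound)
  show "integrable lborel (\<lambda>s. C * (indicator {0<..} s *\<^sub>R exp (- (b * s))))"
    using exp_minus_half_line(1)[OF assms(1)] unfolding set_integrable_def by (rule integrable_mult_right)
  show "AE s in lborel. norm (indicator {0<..} s *\<^sub>R f s) \<le> norm (C * (indicator {0<..} s *\<^sub>R exp (- (b * s))))"
    using assms(3) by (auto simp: indicator_def intro!: AE_I2 order_trans[OF _ abs_ge_self])
  show "(\<lambda>x. indicat_real {0<..} x *\<^sub>R f x) \<in> borel_measurable lborel"
    using assms(2) by measurable
qed

lemma set_integral_half_line_pos:
  fixes f :: "real \<Rightarrow> real"
  assumes int: "set_integrable lborel {0<..} f" and pos: "\<And>s. s > 0 \<Longrightarrow> f s > 0"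
  shows "(LINT s:{0<..}|lborel. f s) > 0"
proof (rule ccontr)
  assume "\<not> ?thesis"
  moreover have nn: "AE s in lborel. 0 \<le> indicator {0<..} s *\<^sub>R f s"
    using pos by (auto simp: indicator_def less_imp_le)
  then have "(LINT s:{0<..}|lborel. f s) \<ge> 0"
    unfolding set_lebesgue_integral_def by (rule integral_nonneg_AE)
  ultimately have "(\<integral>s. indicator {0<..} s *\<^sub>R f s \<partial>lborel) = 0"
    unfolding set_lebesgue_integral_def by linarith
  then have "AE s in lborel. indicator {0<..} s *\<^sub>R f s = 0"
    using integral_nonneg_eq_0_iff_AE[OF int[unfolded set_integrable_def] nn] by simp
  then have "AE s in lborel. s \<notin> {0<..<1::real}"
    by eventually_elim (use pos in \<open>force simp: indicator_def\<close>)
  then have "emeasure lborel {0<..<1::real} = 0"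
    by (subst (asm) AE_iff_measurable[where N = "{0<..<1}"]) auto
  then show False by simp
qed

text \<open>The symbol of the resolvent of multiplication by \<open>- \<i> v \<xi> - 1\<close> at
  the point \<open>b - 1\<close>; for \<open>b = decay \<xi>\<close> it is the eigenfunction
  k.\<close>

definition free_resolvent :: "complex \<Rightarrow> real \<Rightarrow> real \<Rightarrow> complex" where
  "free_resolvent b \<xi> v = 1 / (b + \<i> * complex_of_real v * complex_of_real \<xi>)"

lemma free_resolvent_denom: "Re b > 0 \<Longrightarrow> b + \<i> * complex_of_real v * complex_of_real \<xi> \<noteq> 0"
  by (auto simp: complex_eq_iff)

lemma norm_free_resolvent_le:
  assumes "0 < c" "c \<le> Re b"
  shows "norm (free_resolvent b \<xi> v) \<le> 1 / c"
proof -
  have "c \<le> norm (b + \<i> * complex_of_real v * complex_of_real \<xi>)"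
    using complex_Re_le_cmod[of "b + \<i> * complex_of_real v * complex_of_real \<xi>"] assms by simp
  then show ?thesis using assms unfolding free_resolvent_def norm_divide by (simp add: divide_simps)
qed

lemma free_resolvent_measurable [measurable]:
  "free_resolvent b \<xi> \<in> borel_measurable borel"
  unfolding free_resolvent_def by measurable

lemma free_resolvent_L2: "Re b > 0 \<Longrightarrow> free_resolvent b \<xi> \<in> L2 maxwell"
  by (rule maxwell_bounded_L2[where C = "1 / Re b"]) (auto intro: norm_free_resolvent_le)

lemma free_resolvent_mult_L2:
  assumes "Re b > 0" "f \<in> L2 maxwell"
  shows "(\<lambda>v. free_resolvent b \<xi> v * f v) \<in> L2 maxwell"
    and "l2_norm maxwell (\<lambda>v. free_resolvent b \<xi> v * f v) \<le> 1 / Re b * l2_norm maxwell f"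
proof -
  have meas: "(\<lambda>v. free_resolvent b \<xi> v * f v) \<in> borel_measurable maxwell"
    using L2_measurable[OF assms(2)] by measurable
  have ae: "AE v in maxwell. norm (free_resolvent b \<xi> v * f v) \<le> 1 / Re b * norm (f v)"
    unfolding norm_mult using norm_free_resolvent_le[OF assms(1)] by (intro AE_I2 mult_right_mono) auto
  show "(\<lambda>v. free_resolvent b \<xi> v * f v) \<in> L2 maxwell"
    by (rule L2_dominated(1)[OF assms(2) meas ae])
  show "l2_norm maxwell (\<lambda>v. free_resolvent b \<xi> v * f v) \<le> 1 / Re b * l2_norm maxwell f"
    by (rule L2_dominated(2)[OF assms(2) meas ae]) (use assms(1) in simp)
qed

lemma complex_exp_half_line:
  assumes "Re c > 0"
  shows "(LINT s:{0<..}|lborel. exp (- (c * complex_of_real s))) = 1 / c"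
proof -
  let ?f = "\<lambda>s::real. exp (- (c * of_real s))"
  let ?F = "\<lambda>s::real. - (exp (- (c * of_real s)) / c)"
  have c: "c \<noteq> 0" using assms by auto
  have norm_f: "norm (?f s) = exp (- (Re c * s))" for s by (simp add: norm_exp_eq_Re)
  have int: "set_integrable lborel {0<..} ?f"
    by (rule set_integrable_exp_bound[OF assms, where C = 1]) (auto simp: norm_f)
  have "(LBINT s=ereal 0..\<infinity>. ?f s) = 0 - ?F 0"
  proof (rule interval_integral_FTC_integrable[where F = ?F])
    show "(?F has_vector_derivative ?f x) (at x)" for x
      using c by (intro has_vector_derivative_real_field[where f = "\<lambda>z. - (exp (- (c * z)) / c)"])
        (auto intro!: derivative_eq_intros)
    show "isCont ?f x" for x by (intro continuous_intros)
    show "set_integrable lborel (einterval (ereal 0) \<infinity>) ?f"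
      using int by simp
    have "(?F \<longlongrightarrow> ?F 0) (at_right 0)"
      using c by (intro tendsto_intros) auto
    then show "((?F \<circ> real_of_ereal) \<longlongrightarrow> ?F 0) (at_right (ereal 0))"
      by (simp only: at_right_ereal o_def filterlim_filtermap real_of_ereal.simps zero_ereal_def)
    have "((\<lambda>s. exp (- (Re c * s))) \<longlongrightarrow> 0) at_top"
      using assms by real_asymp
    then have "((\<lambda>s. exp (- (Re c * s)) / norm c) \<longlongrightarrow> 0) at_top"
      by (rule tendsto_divide_zero)
    then have "(?F \<longlongrightarrow> 0) at_top"
      by (rule Lim_null_comparison[rotated]) (simp only: norm_minus_cancel norm_divide norm_f, simp)
    then show "((?F \<circ> real_of_ereal) \<longlongrightarrow> 0) (at_left \<infinity>)"
      by (simp only: at_left_PInf o_def filterlim_filtermap real_of_ereal.simps)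
  qed simp
  then show ?thesis by (simp add: interval_integral_to_infinity_eq)
qed

lemma free_resolvent_laplace:
  assumes "a > 0"
  shows "free_resolvent (of_real a) \<xi> v
    = (LINT s:{0<..}|lborel. of_real (exp (- (a * s))) * exp (- (\<i> * of_real (v * \<xi> * s))))"
proof -
  let ?c = "complex_of_real a + \<i> * complex_of_real v * complex_of_real \<xi>"
  have "exp (- (?c * of_real s)) = of_real (exp (- (a * s))) * exp (- (\<i> * of_real (v * \<xi> * s)))" for s
  proof -
    have "- (?c * of_real s) = of_real (- (a * s)) + (- (\<i> * of_real (v * \<xi> * s)))"
      by (simp add: algebra_simps)
    then show ?thesis by (simp only: exp_add exp_of_real)
  qed
  then show ?thesis
    using complex_exp_half_line[of ?c] assms by (simp add: free_resolvent_def)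
qed

text \<open>The majorant C exp (- a s) gives absolute convergence, so Fubini moves the integral over
  v inside the Laplace transform, where it becomes a Fourier transform.\<close>

lemma integral_free_resolvent_laplace:
  assumes "a > 0" and [measurable]: "g \<in> borel_measurable borel" and g: "\<And>v. norm (g v) \<le> C"
  shows "(\<integral>v. free_resolvent (of_real a) \<xi> v * g v \<partial>maxwell)
    = (LINT s:{0<..}|lborel. of_real (exp (- (a * s))) * (\<integral>v. exp (- (\<i> * of_real (v * \<xi> * s))) * g v \<partial>maxwell))"
proof -
  let ?f = "\<lambda>s v. indicator {0<..} s *\<^sub>R (of_real (exp (- (a * s))) * exp (- (\<i> * of_real (v * \<xi> * s))) * g v)"
  have C: "C \<ge> 0" using g[of 0] norm_ge_zero order_trans by blast
  have norm_f: "norm (?f s v) \<le> C * (indicator {0<..} s *\<^sub>R exp (- (a * s)))" for s v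
    using g[of v] by (auto simp: norm_mult indicator_def norm_exp_eq_Re intro: mult_left_mono)
  have int: "integrable (lborel \<Otimes>\<^sub>M maxwell) (\<lambda>(s, v). ?f s v)"
  proof (rule phase.Fubini_integrable)
    show "integrable lborel (\<lambda>s. \<integral>v. norm (case (s, v) of (s, v) \<Rightarrow> ?f s v) \<partial>maxwell)"
    proof (rule Bochner_Integration.integrable_bound)
      show "integrable lborel (\<lambda>s. C * (indicator {0<..} s *\<^sub>R exp (- (a * s))))"
        using exp_minus_half_line(1)[OF assms(1)] unfolding set_integrable_def by (rule integrable_mult_right)
      show "AE s in lborel. norm (\<integral>v. norm (case (s, v) of (s, v) \<Rightarrow> ?f s v) \<partial>maxwell)
         \<le> norm (C * (indicator {0<..} s *\<^sub>R exp (- (a * s))))"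
      proof (rule AE_I2)
        fix s :: real
        have "(\<integral>v. norm (?f s v) \<partial>maxwell) \<le> C * (indicator {0<..} s *\<^sub>R exp (- (a * s)))"
        proof (rule maxwell.integral_le_const)
          show "integrable maxwell (\<lambda>v. norm (?f s v))"
            by (rule maxwell.integrable_const_bound[of _ "C * (indicator {0<..} s *\<^sub>R exp (- (a * s)))"])
               (use norm_f in auto)
        qed (use norm_f in auto)
        then show "norm (\<integral>v. norm (case (s, v) of (s, v) \<Rightarrow> ?f s v) \<partial>maxwell)
           \<le> norm (C * (indicator {0<..} s *\<^sub>R exp (- (a * s))))"
          by simp
      qed
    qed measurable
    show "AE s in lborel. integrable maxwell (\<lambda>v. case (s, v) of (s, v) \<Rightarrow> ?f s v)"
    proof (rule AE_I2)
      fix s :: real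
      show "integrable maxwell (\<lambda>v. case (s, v) of (s, v) \<Rightarrow> ?f s v)"
        by (rule maxwell.integrable_const_bound[of _ "C * (indicator {0<..} s *\<^sub>R exp (- (a * s)))"])
           (use norm_f in auto)
    qed
  qed measurable
  have "(\<integral>v. free_resolvent (of_real a) \<xi> v * g v \<partial>maxwell) = (\<integral>v. (\<integral>s. ?f s v \<partial>lborel) \<partial>maxwell)"
    unfolding free_resolvent_laplace[OF assms(1)] set_lebesgue_integral_def
    by (simp flip: integral_mult_left_zero)
  also have "\<dots> = (\<integral>s. (\<integral>v. ?f s v \<partial>maxwell) \<partial>lborel)"
    by (rule phase.Fubini_integral[OF int])
  finally show ?thesis
    by (simp add: set_lebesgue_integral_def mult.assoc)
qed

lemma fourier_maxwell_minus:
  "(\<integral>v. exp (- (\<i> * complex_of_real (v * \<xi> * s))) \<partial>maxwell) = complex_of_real (exp (- (\<xi>\<^sup>2 * s\<^sup>2 / 4)))"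
  using fourier_maxwell[of "- (\<xi> * s)"] by (simp add: mult_ac power_mult_distrib)

text \<open>For s = 0 this is the dispersion integral of 1 / (b + \<i> v \<xi>); for general s the
  same integrand is multiplied by exp (- \<i> v \<xi> s), see
  \<open>integral_free_resolvent_fourier\<close>. For \<xi> \<noteq> 0 it is, up to an exponential
  factor and scaling, a complementary error function.\<close>

definition gauss_laplace :: "real \<Rightarrow> real \<Rightarrow> real \<Rightarrow> real" where
  "gauss_laplace b \<xi> s = (LINT t:{0<..}|lborel. exp (- (b * t) - \<xi>\<^sup>2 * (s + t)\<^sup>2 / 4))"

text \<open>The integral of a product of two free resolvents, see
  \<open>integral_free_resolvent_mult\<close>; at equal rates it is the normalisation of the
  eigenfunction.\<close>

definition gauss_laplace2 :: "real \<Rightarrow> real \<Rightarrow> real \<Rightarrow> real" where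
  "gauss_laplace2 a b \<xi> = (LINT s:{0<..}|lborel. exp (- (a * s)) * gauss_laplace b \<xi> s)"

lemma gauss_laplace_integrable:
  fixes b :: real
  shows "b > 0 \<Longrightarrow> set_integrable lborel {0<..} (\<lambda>t. exp (- (b * t) - \<xi>\<^sup>2 * (s + t)\<^sup>2 / 4))"
  by (rule set_integrable_exp_bound[where C = 1]) auto

lemma gauss_laplace_pos: "b > 0 \<Longrightarrow> gauss_laplace b \<xi> s > 0"
  unfolding gauss_laplace_def by (rule set_integral_half_line_pos[OF gauss_laplace_integrable]) auto

lemma gauss_laplace_measurable [measurable]: "gauss_laplace b \<xi> \<in> borel_measurable borel"
  unfolding gauss_laplace_def set_lebesgue_integral_def by measurable

lemma gauss_laplace_le:
  assumes "0 < b'" "b' \<le> b" "\<xi>'\<^sup>2 \<le> \<xi>\<^sup>2"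
  shows "gauss_laplace b \<xi> s \<le> gauss_laplace b' \<xi>' s"
  unfolding gauss_laplace_def
proof (rule set_integral_mono[OF gauss_laplace_integrable gauss_laplace_integrable])
  fix t :: real assume "t \<in> {0<..}"
  then have "b' * t \<le> b * t" using assms by (intro mult_right_mono) auto
  moreover have "\<xi>'\<^sup>2 * (s + t)\<^sup>2 \<le> \<xi>\<^sup>2 * (s + t)\<^sup>2" using assms by (intro mult_right_mono) auto
  ultimately show "exp (- (b * t) - \<xi>\<^sup>2 * (s + t)\<^sup>2 / 4) \<le> exp (- (b' * t) - \<xi>'\<^sup>2 * (s + t)\<^sup>2 / 4)"
    by simp
qed (use assms in auto)

lemma gauss_laplace_strict:
  assumes "0 < b'" "b' < b"
  shows "gauss_laplace b \<xi> 0 < gauss_laplace b' \<xi> 0"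
proof -
  note int = gauss_laplace_integrable[of b' \<xi> 0] gauss_laplace_integrable[of b \<xi> 0]
  have "0 < (LINT t:{0<..}|lborel. exp (- (b' * t) - \<xi>\<^sup>2 * (0 + t)\<^sup>2 / 4) - exp (- (b * t) - \<xi>\<^sup>2 * (0 + t)\<^sup>2 / 4))"
    by (rule set_integral_half_line_pos[OF set_integral_diff(1)[OF int]]) (use assms in auto)
  also have "\<dots> = gauss_laplace b' \<xi> 0 - gauss_laplace b \<xi> 0"
    unfolding gauss_laplace_def by (rule set_integral_diff(2)[OF int]) (use assms in auto)
  finally show ?thesis by simp
qed

text \<open>The hazard rate of the density \<open>exp (- b t - \<xi>\<^sup>2 t\<^sup>2 / 4)\<close> is at least its value at \<open>0\<close>.\<close>

lemma gauss_laplace_shift_le: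
  assumes "b > 0" "s \<ge> 0"
  shows "gauss_laplace b \<xi> s \<le> exp (- (\<xi>\<^sup>2 * s\<^sup>2 / 4)) * gauss_laplace b \<xi> 0"
proof -
  have "gauss_laplace b \<xi> s \<le> (LINT t:{0<..}|lborel. exp (- (\<xi>\<^sup>2 * s\<^sup>2 / 4)) * exp (- (b * t) - \<xi>\<^sup>2 * (0 + t)\<^sup>2 / 4))"
    unfolding gauss_laplace_def
  proof (rule set_integral_mono[OF gauss_laplace_integrable])
    show "set_integrable lborel {0<..} (\<lambda>t. exp (- (\<xi>\<^sup>2 * s\<^sup>2 / 4)) * exp (- (b * t) - \<xi>\<^sup>2 * (0 + t)\<^sup>2 / 4))"
      using assms by (intro set_integrable_mult_right gauss_laplace_integrable)
    fix t :: real assume "t \<in> {0<..}"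
    then have "\<xi>\<^sup>2 * (s\<^sup>2 + t\<^sup>2) \<le> \<xi>\<^sup>2 * (s + t)\<^sup>2"
      using assms by (intro mult_left_mono) (auto simp: power2_sum)
    then show "exp (- (b * t) - \<xi>\<^sup>2 * (s + t)\<^sup>2 / 4) \<le> exp (- (\<xi>\<^sup>2 * s\<^sup>2 / 4)) * exp (- (b * t) - \<xi>\<^sup>2 * (0 + t)\<^sup>2 / 4)"
      unfolding exp_add[symmetric] by (simp add: distrib_left)
  qed (use assms in auto)
  then show ?thesis by (simp add: gauss_laplace_def)
qed

lemma gauss_laplace_continuous:
  assumes b: "b > 0"
  shows "isCont (gauss_laplace b \<xi>) s"
  unfolding continuous_at_sequentially o_def gauss_laplace_def set_lebesgue_integral_def
proof (intro allI impI integral_dominated_convergence)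
  fix x :: "nat \<Rightarrow> real" assume x: "x \<longlonglongrightarrow> s"
  show "integrable lborel (\<lambda>t. indicator {0<..} t *\<^sub>R exp (- (b * t)))"
    using exp_minus_half_line(1)[OF b] by (simp add: set_integrable_def)
  show "AE t in lborel. (\<lambda>n. indicator {0<..} t *\<^sub>R exp (- (b * t) - \<xi>\<^sup>2 * (x n + t)\<^sup>2 / 4))
      \<longlonglongrightarrow> indicator {0<..} t *\<^sub>R exp (- (b * t) - \<xi>\<^sup>2 * (s + t)\<^sup>2 / 4)"
    by (intro AE_I2 tendsto_intros x) auto
qed (auto simp: indicator_def)

lemma integral_free_resolvent_fourier:
  assumes "b > 0"
  shows "(\<integral>v. exp (- (\<i> * of_real (v * \<xi> * s))) * free_resolvent (of_real b) \<xi> v \<partial>maxwell)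
    = complex_of_real (gauss_laplace b \<xi> s)"
proof -
  have "(\<integral>v. exp (- (\<i> * of_real (v * \<xi> * s))) * free_resolvent (of_real b) \<xi> v \<partial>maxwell)
    = (LINT t:{0<..}|lborel. of_real (exp (- (b * t))) *
        (\<integral>v. exp (- (\<i> * of_real (v * \<xi> * t))) * exp (- (\<i> * of_real (v * \<xi> * s))) \<partial>maxwell))"
    by (subst integral_free_resolvent_laplace[OF assms, symmetric, where C = 1])
       (auto simp: mult.commute norm_exp_eq_Re)
  also have "\<dots> = (LINT t:{0<..}|lborel. complex_of_real (exp (- (b * t) - \<xi>\<^sup>2 * (s + t)\<^sup>2 / 4)))"
  proof (intro arg_cong[where f = "set_lebesgue_integral lborel {0<..}"] ext)
    fix t
    have "(\<integral>v. exp (- (\<i> * of_real (v * \<xi> * t))) * exp (- (\<i> * of_real (v * \<xi> * s))) \<partial>maxwell)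
      = (\<integral>v. exp (- (\<i> * of_real (v * \<xi> * (s + t)))) \<partial>maxwell)"
      by (simp add: exp_add[symmetric] algebra_simps)
    also have "\<dots> = complex_of_real (exp (- (\<xi>\<^sup>2 * (s + t)\<^sup>2 / 4)))" by (rule fourier_maxwell_minus)
    finally show "of_real (exp (- (b * t))) *
        (\<integral>v. exp (- (\<i> * of_real (v * \<xi> * t))) * exp (- (\<i> * of_real (v * \<xi> * s))) \<partial>maxwell)
      = complex_of_real (exp (- (b * t) - \<xi>\<^sup>2 * (s + t)\<^sup>2 / 4))"
      by (simp only: of_real_mult[symmetric] exp_add[symmetric]) simp
  qed
  also have "\<dots> = complex_of_real (gauss_laplace b \<xi> s)"
    unfolding gauss_laplace_def set_lebesgue_integral_def integral_complex_of_real[symmetric]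
    by (simp add: scaleR_conv_of_real)
  finally show ?thesis .
qed

lemma integral_free_resolvent:
  "b > 0 \<Longrightarrow> (\<integral>v. free_resolvent (of_real b) \<xi> v \<partial>maxwell) = complex_of_real (gauss_laplace b \<xi> 0)"
  using integral_free_resolvent_fourier[of b \<xi> 0] by simp

lemma integral_free_resolvent_mult:
  assumes "a > 0" "b > 0"
  shows "(\<integral>v. free_resolvent (of_real a) \<xi> v * free_resolvent (of_real b) \<xi> v \<partial>maxwell)
    = complex_of_real (gauss_laplace2 a b \<xi>)"
proof -
  have "(\<integral>v. free_resolvent (of_real a) \<xi> v * free_resolvent (of_real b) \<xi> v \<partial>maxwell)
    = (LINT s:{0<..}|lborel. of_real (exp (- (a * s))) *
        (\<integral>v. exp (- (\<i> * of_real (v * \<xi> * s))) * free_resolvent (of_real b) \<xi> v \<partial>maxwell))"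
    by (rule integral_free_resolvent_laplace[OF assms(1), where C = "1 / b"])
       (use assms in \<open>auto intro: norm_free_resolvent_le\<close>)
  also have "\<dots> = (LINT s:{0<..}|lborel. of_real (exp (- (a * s))) * complex_of_real (gauss_laplace b \<xi> s))"
    by (simp only: integral_free_resolvent_fourier[OF assms(2)])
  also have "\<dots> = complex_of_real (gauss_laplace2 a b \<xi>)"
    unfolding gauss_laplace2_def set_lebesgue_integral_def integral_complex_of_real[symmetric]
    by (simp add: scaleR_conv_of_real)
  finally show ?thesis .
qed

lemma gauss_laplace_upper: "b > 0 \<Longrightarrow> gauss_laplace b \<xi> s \<le> 1 / b"
  using set_integral_mono[OF gauss_laplace_integrable exp_minus_half_line(1), of b b \<xi> s]
  unfolding gauss_laplace_def by (simp add: exp_minus_half_line(2))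

lemma gauss_laplace2_integrable:
  assumes "a > 0" "b > 0"
  shows "set_integrable lborel {0<..} (\<lambda>s. exp (- (a * s)) * gauss_laplace b \<xi> s)"
proof (rule set_integrable_exp_bound[OF assms(1), where C = "1 / b"])
  show "norm (exp (- (a * s)) * gauss_laplace b \<xi> s) \<le> 1 / b * exp (- (a * s))" for s
  proof -
    have "exp (- (a * s)) * gauss_laplace b \<xi> s \<le> exp (- (a * s)) * (1 / b)"
      by (intro mult_left_mono gauss_laplace_upper assms) auto
    then show ?thesis using gauss_laplace_pos[OF assms(2), of \<xi> s] by (simp add: abs_mult)
  qed
qed measurable

lemma gauss_laplace2_pos: "a > 0 \<Longrightarrow> b > 0 \<Longrightarrow> gauss_laplace2 a b \<xi> > 0"
  unfolding gauss_laplace2_def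
  by (rule set_integral_half_line_pos[OF gauss_laplace2_integrable]) (auto simp: gauss_laplace_pos)

lemma gauss_laplace2_le:
  assumes "0 < a'" "a' \<le> a" "0 < b'" "b' \<le> b" "\<xi>'\<^sup>2 \<le> \<xi>\<^sup>2"
  shows "gauss_laplace2 a b \<xi> \<le> gauss_laplace2 a' b' \<xi>'"
  unfolding gauss_laplace2_def
proof (rule set_integral_mono[OF gauss_laplace2_integrable gauss_laplace2_integrable])
  fix s :: real assume "s \<in> {0<..}"
  then show "exp (- (a * s)) * gauss_laplace b \<xi> s \<le> exp (- (a' * s)) * gauss_laplace b' \<xi>' s"
    using assms gauss_laplace_pos[of b \<xi> s] gauss_laplace_le[OF assms(3-5)]
    by (intro mult_mono) (auto intro!: less_imp_le[OF gauss_laplace_pos])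
qed (use assms in auto)

text \<open>The first resolvent identity, integrated against the Gaussian. It later evaluates the
  mass of the kernel below the cutoff.\<close>

lemma gauss_laplace_diff:
  assumes "a > 0" "b > 0"
  shows "gauss_laplace a \<xi> 0 - gauss_laplace b \<xi> 0 = (b - a) * gauss_laplace2 a b \<xi>"
proof -
  let ?a = "free_resolvent (of_real a) \<xi>" and ?b = "free_resolvent (of_real b) \<xi>"
  have eq: "?a v - ?b v = of_real (b - a) * (?a v * ?b v)" for v
    using free_resolvent_denom[of "of_real a" v \<xi>] free_resolvent_denom[of "of_real b" v \<xi>] assms
    unfolding free_resolvent_def by (simp add: divide_simps)
  have "complex_of_real (gauss_laplace a \<xi> 0 - gauss_laplace b \<xi> 0) = (\<integral>v. ?a v - ?b v \<partial>maxwell)"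
    using assms by (subst Bochner_Integration.integral_diff)
      (auto simp: integral_free_resolvent intro!: L2_maxwell_integrable free_resolvent_L2)
  also have "\<dots> = of_real ((b - a) * gauss_laplace2 a b \<xi>)"
    unfolding eq using assms by (simp add: integral_free_resolvent_mult)
  finally show ?thesis by (simp only: of_real_eq_iff)
qed

subsection \<open>The eigenvalue branch\<close>

definition decay :: "real \<Rightarrow> real" where
  "decay \<xi> = 1 + lambda_star \<xi>"

text \<open>The imaginary part of the integrand is odd in v, so the complex equation is a single
  real one for the rate 1 + l.\<close>

lemma dispersion_iff:
  assumes "l > -1"
  shows "1 - (\<integral>v. 1 / (\<i> * complex_of_real v * complex_of_real \<xi> + 1 + complex_of_real l) \<partial>maxwell) = 0
    \<longleftrightarrow> gauss_laplace (1 + l) \<xi> 0 = 1"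
proof -
  have "(\<integral>v. 1 / (\<i> * complex_of_real v * complex_of_real \<xi> + 1 + complex_of_real l) \<partial>maxwell)
     = (\<integral>v. free_resolvent (of_real (1 + l)) \<xi> v \<partial>maxwell)"
    by (simp add: free_resolvent_def add_ac)
  also have "\<dots> = complex_of_real (gauss_laplace (1 + l) \<xi> 0)"
    using assms by (intro integral_free_resolvent) simp
  finally have eq: "(\<integral>v. 1 / (\<i> * complex_of_real v * complex_of_real \<xi> + 1 + complex_of_real l) \<partial>maxwell)
     = complex_of_real (gauss_laplace (1 + l) \<xi> 0)" .
  show ?thesis unfolding eq right_minus_eq by (metis of_real_1 of_real_eq_iff)
qed

text \<open>The limiting case b = 0 of the dispersion integral. Its value exceeds 1 exactly for
  |\<xi>| < sqrt pi, which is the origin of that threshold.\<close>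

lemma gauss_half_line:
  assumes "\<xi> \<noteq> 0"
  shows "set_integrable lborel {0<..} (\<lambda>t. exp (- \<xi>\<^sup>2 * t\<^sup>2 / 4))"
    and "(LINT t:{0<..}|lborel. exp (- \<xi>\<^sup>2 * t\<^sup>2 / 4)) = sqrt pi / \<bar>\<xi>\<bar>"
proof -
  let ?c = "\<bar>\<xi>\<bar> / 2"
  have c: "?c > 0" using assms by simp
  have "has_bochner_integral lborel (\<lambda>x. indicator {0..} (0 + ?c * x) *\<^sub>R exp (- (0 + ?c * x)\<^sup>2)) ((sqrt pi / 2) /\<^sub>R \<bar>?c\<bar>)"
    by (rule lborel_has_bochner_integral_real_affine_iff[THEN iffD1, OF _ gaussian_moment_0]) (use c in simp)
  then have hb: "has_bochner_integral lborel (\<lambda>x. indicator {0..} (?c * x) *\<^sub>R exp (- (?c * x)\<^sup>2)) (sqrt pi / \<bar>\<xi>\<bar>)"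
    by (simp add: field_simps)
  have "has_bochner_integral lborel (\<lambda>x. indicator {0<..} x *\<^sub>R exp (- \<xi>\<^sup>2 * x\<^sup>2 / 4)) (sqrt pi / \<bar>\<xi>\<bar>)"
  proof (subst has_bochner_integral_cong_AE[where g = "\<lambda>x. indicator {0..} (?c * x) *\<^sub>R exp (- (?c * x)\<^sup>2)"])
    show "AE x in lborel. indicator {0<..} x *\<^sub>R exp (- \<xi>\<^sup>2 * x\<^sup>2 / 4) = indicator {0..} (?c * x) *\<^sub>R exp (- (?c * x)\<^sup>2)"
      using AE_lborel_singleton[of 0]
      by eventually_elim
         (use assms in \<open>auto simp: indicator_def power_mult_distrib power_divide zero_le_mult_iff zero_le_divide_iff\<close>)
  qed (use hb in auto)
  then show "set_integrable lborel {0<..} (\<lambda>t. exp (- \<xi>\<^sup>2 * t\<^sup>2 / 4))"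
    "(LINT t:{0<..}|lborel. exp (- \<xi>\<^sup>2 * t\<^sup>2 / 4)) = sqrt pi / \<bar>\<xi>\<bar>"
    unfolding set_integrable_def set_lebesgue_integral_def by (auto simp: has_bochner_integral_iff)
qed

text \<open>Intermediate values on [0, 1]: the integral exceeds 1 at b = 0 and is at most 1 at b =
  1. The frequency 0 is separate because the majorant valid down to b = 0 is not integrable there;
  the root is then b = 1.\<close>

lemma dispersion_root_exists:
  assumes "\<bar>\<xi>\<bar> < sqrt pi"
  shows "\<exists>b. 0 < b \<and> b \<le> 1 \<and> gauss_laplace b \<xi> 0 = 1"
proof (cases "\<xi> = 0")
  case True
  then show ?thesis
    using exp_minus_half_line(2)[OF zero_less_one] by (intro exI[of _ 1]) (simp add: gauss_laplace_def)
next
  case False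
  have cont: "continuous_on {0..1} (\<lambda>b. gauss_laplace b \<xi> 0)"
    unfolding continuous_on_sequentially o_def gauss_laplace_def set_lebesgue_integral_def
  proof (intro allI ballI impI integral_dominated_convergence; (elim conjE)?)
    fix x :: "nat \<Rightarrow> real" and b assume x: "\<forall>n. x n \<in> {0..1}" "x \<longlonglongrightarrow> b"
    show "integrable lborel (\<lambda>t. indicator {0<..} t *\<^sub>R exp (- \<xi>\<^sup>2 * t\<^sup>2 / 4))"
      using gauss_half_line(1)[OF False] by (simp add: set_integrable_def)
    show "AE t in lborel. (\<lambda>n. indicator {0<..} t *\<^sub>R exp (- (x n * t) - \<xi>\<^sup>2 * (0 + t)\<^sup>2 / 4))
      \<longlonglongrightarrow> indicator {0<..} t *\<^sub>R exp (- (b * t) - \<xi>\<^sup>2 * (0 + t)\<^sup>2 / 4)"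
      by (intro AE_I2 tendsto_intros x) auto
    show "AE t in lborel. norm (indicator {0<..} t *\<^sub>R exp (- (x n * t) - \<xi>\<^sup>2 * (0 + t)\<^sup>2 / 4))
      \<le> indicator {0<..} t *\<^sub>R exp (- \<xi>\<^sup>2 * t\<^sup>2 / 4)" for n
      using x(1) by (auto simp: indicator_def)
  qed auto
  have "gauss_laplace 0 \<xi> 0 = sqrt pi / \<bar>\<xi>\<bar>"
    using gauss_half_line(2)[OF False] by (simp add: gauss_laplace_def)
  then have 0: "gauss_laplace 0 \<xi> 0 > 1" using assms False by (simp add: less_divide_eq)
  have 1: "gauss_laplace 1 \<xi> 0 \<le> 1" using gauss_laplace_upper[of 1 \<xi> 0] by simp
  obtain b where b: "0 \<le> b" "b \<le> 1" "gauss_laplace b \<xi> 0 = 1"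
    using IVT2'[of "\<lambda>b. gauss_laplace b \<xi> 0" 1 1 0] 0 1 cont by auto
  moreover have "b \<noteq> 0" using b(3) 0 by auto
  ultimately show ?thesis by (intro exI[of _ b]) auto
qed

lemma decay_root:
  assumes "\<bar>\<xi>\<bar> < sqrt pi"
  shows "0 < decay \<xi>" "decay \<xi> \<le> 1" "gauss_laplace (decay \<xi>) \<xi> 0 = 1"
proof -
  obtain b where b: "0 < b" "b \<le> 1" "gauss_laplace b \<xi> 0 = 1"
    using dispersion_root_exists[OF assms] by blast
  have "lambda_star \<xi> = b - 1"
    unfolding lambda_star_def
  proof (rule the_equality)
    show "b - 1 \<in> {-1<..0} \<and> 1 - (\<integral>v. 1 / (\<i> * complex_of_real v * complex_of_real \<xi> + 1 + complex_of_real (b - 1)) \<partial>maxwell) = 0"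
      using b dispersion_iff[of "b - 1" \<xi>] by simp
    fix l assume l: "l \<in> {-1<..0} \<and> 1 - (\<integral>v. 1 / (\<i> * complex_of_real v * complex_of_real \<xi> + 1 + complex_of_real l) \<partial>maxwell) = 0"
    then have "gauss_laplace (1 + l) \<xi> 0 = 1" using dispersion_iff[of l \<xi>] by simp
    then show "l = b - 1"
      using gauss_laplace_strict[of "1 + l" b \<xi>] gauss_laplace_strict[of b "1 + l" \<xi>] b l
      by (cases "1 + l" b rule: linorder_cases) auto
  qed
  then show "0 < decay \<xi>" "decay \<xi> \<le> 1" "gauss_laplace (decay \<xi>) \<xi> 0 = 1"
    using b by (auto simp: decay_def)
qed

text \<open>The dispersion integral decreases in the rate and in the modulus of the frequency, so a
  larger modulus forces a smaller root.\<close>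

lemma decay_antimono:
  assumes "\<bar>\<xi>\<bar> \<le> \<bar>\<eta>\<bar>" "\<bar>\<eta>\<bar> < sqrt pi"
  shows "decay \<eta> \<le> decay \<xi>"
proof (rule ccontr)
  assume "\<not> ?thesis"
  then have "gauss_laplace (decay \<eta>) \<xi> 0 < gauss_laplace (decay \<xi>) \<xi> 0"
    using assms by (intro gauss_laplace_strict decay_root) auto
  moreover have "gauss_laplace (decay \<eta>) \<eta> 0 \<le> gauss_laplace (decay \<eta>) \<xi> 0"
    using assms by (intro gauss_laplace_le decay_root) (auto simp: abs_le_square_iff)
  ultimately show False using decay_root(3)[of \<xi>] decay_root(3)[of \<eta>] assms by auto
qed

subsection \<open>Resolvent and Riesz projection on a fibre\<close>

text \<open>Bilinear, without conjugation: g = f gives the moment of the free resolvent applied to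
  f, g = 1 the dispersion integral, and the product of f with the conjugate of h a matrix element of
  the free resolvent.\<close>

definition cauchy_transform :: "real \<Rightarrow> (real \<Rightarrow> complex) \<Rightarrow> complex \<Rightarrow> complex" where
  "cauchy_transform \<xi> g z = (\<integral>v. g v * free_resolvent (z + 1) \<xi> v \<partial>maxwell)"

lemma free_resolvent_diff:
  assumes "Re b > 0" "Re b' > 0"
  shows "free_resolvent b \<xi> v - free_resolvent b' \<xi> v = (b' - b) * (free_resolvent b \<xi> v * free_resolvent b' \<xi> v)"
  using free_resolvent_denom[of b v \<xi>] free_resolvent_denom[of b' v \<xi>] assms
  unfolding free_resolvent_def by (simp add: divide_simps)

lemma integrable_maxwell_bounded_mult:
  fixes g h :: "real \<Rightarrow> complex"
  assumes g: "integrable maxwell g" and [measurable]: "h \<in> borel_measurable borel" and h: "\<And>v. norm (h v) \<le> C"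
  shows "integrable maxwell (\<lambda>v. g v * h v)"
    and "norm (\<integral>v. g v * h v \<partial>maxwell) \<le> C * (\<integral>v. norm (g v) \<partial>maxwell)"
proof -
  have C: "C \<ge> 0" using h[of 0] norm_ge_zero order_trans by blast
  have [measurable]: "g \<in> borel_measurable borel" using borel_measurable_integrable[OF g] by (simp cong: measurable_cong_sets)
  have bd: "norm (g v * h v) \<le> C * norm (g v)" for v
    using mult_left_mono[OF h[of v] norm_ge_zero[of "g v"]] by (simp add: norm_mult mult.commute)
  have intC: "integrable maxwell (\<lambda>v. C * norm (g v))" using g by simp
  show int: "integrable maxwell (\<lambda>v. g v * h v)"
    by (rule Bochner_Integration.integrable_bound[OF intC])
       (use bd C in \<open>auto simp: abs_mult\<close>)
  have "norm (\<integral>v. g v * h v \<partial>maxwell) \<le> (\<integral>v. norm (g v * h v) \<partial>maxwell)"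
    by (rule integral_norm_bound)
  also have "\<dots> \<le> (\<integral>v. C * norm (g v) \<partial>maxwell)"
    using int bd intC by (intro integral_mono) auto
  finally show "norm (\<integral>v. g v * h v \<partial>maxwell) \<le> C * (\<integral>v. norm (g v) \<partial>maxwell)" by simp
qed

text \<open>By the resolvent identity, used twice, the difference quotient misses the derivative by
  w - z times an integral of g against three resolvent factors.\<close>

lemma cauchy_transform_derivative:
  assumes g: "integrable maxwell g" and z: "Re z > -1"
  shows "(cauchy_transform \<xi> g has_field_derivative
     - (\<integral>v. g v * (free_resolvent (z + 1) \<xi> v)\<^sup>2 \<partial>maxwell)) (at z)"
proof -
  \<comment> \<open>Half the distance to the line Re z = -1: on the disc of radius c each resolvent
    factor is at most 1 / c, hence the cube in \<open>K\<close>.\<close>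
  define c where "c = (Re z + 1) / 2"
  have c: "c > 0" "Re z + 1 = 2 * c" using z by (auto simp: c_def)
  let ?D = "- (\<integral>v. g v * (free_resolvent (z + 1) \<xi> v)\<^sup>2 \<partial>maxwell)"
  let ?r = "free_resolvent (z + 1) \<xi>"
  define K where "K = (1 / c) ^ 3 * (\<integral>v. norm (g v) \<partial>maxwell)"
  have lim: "((\<lambda>w. norm (w - z) * K) \<longlongrightarrow> 0) (at z)"
    by (auto intro!: tendsto_eq_intros)
  have "((\<lambda>w. (cauchy_transform \<xi> g w - cauchy_transform \<xi> g z) / (w - z) - ?D) \<longlongrightarrow> 0) (at z)"
  proof (rule Lim_null_comparison[OF _ lim])
    show "\<forall>\<^sub>F w in at z. norm ((cauchy_transform \<xi> g w - cauchy_transform \<xi> g z) / (w - z) - ?D) \<le> norm (w - z) * K"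
      unfolding eventually_at
    proof (intro exI[of _ c] conjI ballI impI c(1); elim conjE)
      fix w assume ne: "w \<noteq> z" and dist: "dist w z < c"
      have "\<bar>Re w - Re z\<bar> < c"
        using dist abs_Re_le_cmod[of "w - z"] by (simp add: dist_norm)
      then have w: "c \<le> Re (w + 1)" and z': "c \<le> Re (z + 1)" using c by auto
      let ?s = "free_resolvent (w + 1) \<xi>"
      have s: "norm (?s v) \<le> 1 / c" and r: "norm (?r v) \<le> 1 / c" for v
        using norm_free_resolvent_le[OF c(1)] w z' by auto
      have int: "integrable maxwell (\<lambda>v. g v * ?s v)" "integrable maxwell (\<lambda>v. g v * ?r v)"
        by (rule integrable_maxwell_bounded_mult(1)[OF g, where C = "1 / c"], use s r in auto)+
      have norm_rs: "norm (?s v * ?r v) \<le> (1 / c) ^ 2" "norm ((?r v)\<^sup>2) \<le> (1 / c) ^ 2"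
        "norm ((?r v)\<^sup>2 * ?s v) \<le> (1 / c) ^ 3" for v
        unfolding power2_eq_square power3_eq_cube norm_mult by (intro mult_mono s r; use c in simp)+
      have int2: "integrable maxwell (\<lambda>v. g v * (?s v * ?r v))" "integrable maxwell (\<lambda>v. g v * (?r v)\<^sup>2)"
        by (rule integrable_maxwell_bounded_mult(1)[OF g, where C = "(1 / c)^2"], use norm_rs in auto)+
      have pos: "Re (w + 1) > 0" "Re (z + 1) > 0" using w z' c by auto
      have diff: "?s v - ?r v = (z - w) * (?s v * ?r v)" for v
        using free_resolvent_diff[OF pos] by simp
      have "cauchy_transform \<xi> g w - cauchy_transform \<xi> g z = (\<integral>v. g v * ?s v - g v * ?r v \<partial>maxwell)"
        unfolding cauchy_transform_def by (rule Bochner_Integration.integral_diff[symmetric, OF int])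
      also have "\<dots> = (\<integral>v. (z - w) * (g v * (?s v * ?r v)) \<partial>maxwell)"
        unfolding right_diff_distrib[symmetric] diff by (simp add: mult_ac)
      also have "\<dots> = (z - w) * (\<integral>v. g v * (?s v * ?r v) \<partial>maxwell)" by simp
      finally have "(cauchy_transform \<xi> g w - cauchy_transform \<xi> g z) / (w - z) = - (\<integral>v. g v * (?s v * ?r v) \<partial>maxwell)"
        using ne by (simp add: field_simps)
      then have "(cauchy_transform \<xi> g w - cauchy_transform \<xi> g z) / (w - z) - ?D
        = (\<integral>v. g v * (?r v)\<^sup>2 \<partial>maxwell) - (\<integral>v. g v * (?s v * ?r v) \<partial>maxwell)" by simp
      also have "\<dots> = (\<integral>v. g v * (?r v)\<^sup>2 - g v * (?s v * ?r v) \<partial>maxwell)"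
        by (rule Bochner_Integration.integral_diff[symmetric, OF int2(2,1)])
      also have "\<dots> = (\<integral>v. (w - z) * (g v * ((?r v)\<^sup>2 * ?s v)) \<partial>maxwell)"
      proof (rule Bochner_Integration.integral_cong[OF refl])
        fix v
        have "g v * (?r v)\<^sup>2 - g v * (?s v * ?r v) = - (g v * ?r v * (?s v - ?r v))"
          by (simp add: power2_eq_square algebra_simps)
        then show "g v * (?r v)\<^sup>2 - g v * (?s v * ?r v) = (w - z) * (g v * ((?r v)\<^sup>2 * ?s v))"
          unfolding diff by (simp add: power2_eq_square algebra_simps)
      qed
      also have "norm \<dots> = norm (w - z) * norm (\<integral>v. g v * ((?r v)\<^sup>2 * ?s v) \<partial>maxwell)"
        by (simp add: norm_mult)
      also have "\<dots> \<le> norm (w - z) * K"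
        unfolding K_def
        by (intro mult_left_mono integrable_maxwell_bounded_mult(2)[OF g]) (use norm_rs in auto)
      finally show "norm ((cauchy_transform \<xi> g w - cauchy_transform \<xi> g z) / (w - z) - ?D) \<le> norm (w - z) * K" .
    qed
  qed
  then show ?thesis unfolding has_field_derivative_iff by (subst Lim_null)
qed

section \<open>The dispersion function and the explicit resolvent\<close>

lemma open_right_half_plane: "open {z. Re z > -1}"
  by (rule open_halfspace_Re_gt)

lemma cauchy_transform_holomorphic:
  "integrable maxwell g \<Longrightarrow> cauchy_transform \<xi> g holomorphic_on {z. Re z > -1}"
  by (rule holomorphic_onI) (meson cauchy_transform_derivative field_differentiable_at_within
      field_differentiable_def mem_Collect_eq)

text \<open>The perturbation determinant of the rank-one term relative to the multiplication
  operator; its zeros are the spectrum to the right of Re z = -1.\<close>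

definition dispersion :: "real \<Rightarrow> complex \<Rightarrow> complex" where
  "dispersion \<xi> z = 1 - cauchy_transform \<xi> (\<lambda>_. 1) z"

lemma resolvent_graph_L_op_iff:
  "(g, f) \<in> resolvent_graph maxwell (L_op \<xi>) z \<longleftrightarrow> g \<in> L2 maxwell \<and> f \<in> L2 maxwell \<and>
     (AE v in maxwell. (z + 1 + \<i> * complex_of_real v * complex_of_real \<xi>) * f v = g v + (\<integral>u. f u \<partial>maxwell))"
proof
  assume "(g, f) \<in> resolvent_graph maxwell (L_op \<xi>) z"
  then obtain h where g: "g \<in> L2 maxwell" and h: "(f, h) \<in> L_op \<xi>" and "AE v in maxwell. z * f v - h v = g v"
    by (auto simp: resolvent_graph_def)
  moreover from h have "f \<in> L2 maxwell"
    "AE v in maxwell. h v = (- \<i> * complex_of_real v * complex_of_real \<xi> - 1) * f v + (\<integral>u. f u \<partial>maxwell)"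
    by (auto simp: L_op_def l2_inner_def)
  ultimately show "g \<in> L2 maxwell \<and> f \<in> L2 maxwell \<and>
     (AE v in maxwell. (z + 1 + \<i> * complex_of_real v * complex_of_real \<xi>) * f v = g v + (\<integral>u. f u \<partial>maxwell))"
    by (auto elim!: eventually_elim2 simp: algebra_simps)
next
  assume *: "g \<in> L2 maxwell \<and> f \<in> L2 maxwell \<and>
     (AE v in maxwell. (z + 1 + \<i> * complex_of_real v * complex_of_real \<xi>) * f v = g v + (\<integral>u. f u \<partial>maxwell))"
  let ?h = "\<lambda>v. z * f v - g v"
  have "?h \<in> L2 maxwell" using * by (intro L2_diff L2_scale) auto
  moreover have "AE v in maxwell. ?h v = (- \<i> * complex_of_real v * complex_of_real \<xi> - 1) * f v + l2_inner maxwell f (\<lambda>_. 1)"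
    using * by (auto elim!: eventually_mono simp: l2_inner_def algebra_simps)
  ultimately have "(f, ?h) \<in> L_op \<xi>" using * by (auto simp: L_op_def)
  then show "(g, f) \<in> resolvent_graph maxwell (L_op \<xi>) z"
    using * unfolding resolvent_graph_def by auto
qed

text \<open>The rank-one (Sherman--Morrison) formula: solve for f with its moment as a parameter,
  then integrate to find that the moment is
  \<open>cauchy_transform \<xi> g z / dispersion \<xi> z\<close>.\<close>

definition fibre_resolvent :: "real \<Rightarrow> complex \<Rightarrow> (real \<Rightarrow> complex) \<Rightarrow> real \<Rightarrow> complex" where
  "fibre_resolvent \<xi> z g v = free_resolvent (z + 1) \<xi> v * (g v + cauchy_transform \<xi> g z / dispersion \<xi> z)"

lemma fibre_resolvent_L2:
  assumes "Re z > -1" "g \<in> L2 maxwell"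
  shows "fibre_resolvent \<xi> z g \<in> L2 maxwell"
  unfolding fibre_resolvent_def[abs_def] using assms
  by (intro free_resolvent_mult_L2 L2_add) auto

lemma cauchy_transform_bound:
  assumes "Re z > -1" "g \<in> L2 maxwell"
  shows "norm (cauchy_transform \<xi> g z) \<le> 1 / (Re z + 1) * l2_norm maxwell g"
proof -
  have "norm (cauchy_transform \<xi> g z) = norm (\<integral>v. free_resolvent (z + 1) \<xi> v * g v \<partial>maxwell)"
    by (simp add: cauchy_transform_def mult.commute)
  also have "\<dots> \<le> l2_norm maxwell (\<lambda>v. free_resolvent (z + 1) \<xi> v * g v)"
    using assms by (intro norm_integral_maxwell_le free_resolvent_mult_L2) auto
  also have "\<dots> \<le> 1 / Re (z + 1) * l2_norm maxwell g"
    using assms by (intro free_resolvent_mult_L2) auto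
  finally show ?thesis by simp
qed

lemma integral_fibre_resolvent:
  assumes z: "Re z > -1" and disp: "dispersion \<xi> z \<noteq> 0" and g: "g \<in> L2 maxwell"
  shows "(\<integral>v. fibre_resolvent \<xi> z g v \<partial>maxwell) = cauchy_transform \<xi> g z / dispersion \<xi> z"
proof -
  let ?c = "cauchy_transform \<xi> g z / dispersion \<xi> z"
  let ?r = "free_resolvent (z + 1) \<xi>"
  have "(\<integral>v. fibre_resolvent \<xi> z g v \<partial>maxwell) = (\<integral>v. ?r v * g v + ?r v * ?c \<partial>maxwell)"
    by (simp add: fibre_resolvent_def distrib_left)
  also have "\<dots> = (\<integral>v. ?r v * g v \<partial>maxwell) + (\<integral>v. ?r v * ?c \<partial>maxwell)"
    using z g by (intro Bochner_Integration.integral_add L2_maxwell_integrable free_resolvent_mult_L2) auto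
  also have "\<dots> = cauchy_transform \<xi> g z + (1 - dispersion \<xi> z) * ?c"
    by (simp add: cauchy_transform_def dispersion_def mult.commute)
  finally show ?thesis using disp by (simp add: field_simps)
qed

lemma fibre_resolvent_mem:
  assumes "Re z > -1" "dispersion \<xi> z \<noteq> 0" "g \<in> L2 maxwell"
  shows "(g, fibre_resolvent \<xi> z g) \<in> resolvent_graph maxwell (L_op \<xi>) z"
proof -
  have "(z + 1 + \<i> * complex_of_real v * complex_of_real \<xi>) * fibre_resolvent \<xi> z g v
     = g v + cauchy_transform \<xi> g z / dispersion \<xi> z" for v
    using free_resolvent_denom[of "z + 1" v \<xi>] assms(1)
    by (simp add: fibre_resolvent_def free_resolvent_def)
  then show ?thesis
    using assms by (simp add: resolvent_graph_L_op_iff fibre_resolvent_L2 integral_fibre_resolvent)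
qed

lemma resolvent_graph_imp_fibre_resolvent:
  assumes z: "Re z > -1" and disp: "dispersion \<xi> z \<noteq> 0"
    and fg: "(g, f) \<in> resolvent_graph maxwell (L_op \<xi>) z"
  shows "AE v in maxwell. f v = fibre_resolvent \<xi> z g v"
proof -
  from fg have g: "g \<in> L2 maxwell" and f: "f \<in> L2 maxwell"
    and eq: "AE v in maxwell. (z + 1 + \<i> * complex_of_real v * complex_of_real \<xi>) * f v = g v + (\<integral>u. f u \<partial>maxwell)"
    by (auto simp: resolvent_graph_L_op_iff)
  let ?r = "free_resolvent (z + 1) \<xi>" and ?c = "\<integral>u. f u \<partial>maxwell"
  have ae: "AE v in maxwell. f v = ?r v * g v + ?r v * ?c"
    using eq
  proof eventually_elim
    case (elim v)
    have "f v = ?r v * ((z + 1 + \<i> * complex_of_real v * complex_of_real \<xi>) * f v)"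
      using free_resolvent_denom[of "z + 1" v \<xi>] z by (simp add: free_resolvent_def)
    then show ?case unfolding elim distrib_left .
  qed
  have L2: "(\<lambda>v. ?r v * g v) \<in> L2 maxwell" "(\<lambda>v. ?r v * ?c) \<in> L2 maxwell"
    using z g by (auto intro!: free_resolvent_mult_L2)
  have "?c = (\<integral>v. ?r v * g v + ?r v * ?c \<partial>maxwell)"
    by (rule integral_cong_AE) (use ae f L2 in \<open>auto intro!: L2_measurable L2_add\<close>)
  also have "\<dots> = (\<integral>v. ?r v * g v \<partial>maxwell) + (\<integral>v. ?r v * ?c \<partial>maxwell)"
    by (intro Bochner_Integration.integral_add L2_maxwell_integrable L2)
  also have "\<dots> = cauchy_transform \<xi> g z + (1 - dispersion \<xi> z) * ?c"
    by (simp add: cauchy_transform_def dispersion_def mult.commute)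
  finally have "?c = cauchy_transform \<xi> g z / dispersion \<xi> z"
    using disp by (simp add: field_simps)
  then show ?thesis using ae by (simp add: fibre_resolvent_def distrib_left)
qed

text \<open>Where the determinant is nonzero the explicit resolvent is bounded; at a zero the free
  resolvent is an eigenfunction, that is, a nonzero solution with right-hand side 0, which no bound
  allows.\<close>

lemma resolvent_set_L_op:
  assumes z: "Re z > -1"
  shows "z \<in> spectrum maxwell (L_op \<xi>) \<longleftrightarrow> dispersion \<xi> z = 0"
proof (cases "dispersion \<xi> z = 0")
  case False
  define c where "c = 1 / (Re z + 1)"
  have c: "c > 0" using z by (simp add: c_def)
  have "l2_norm maxwell f \<le> c * (1 + c / norm (dispersion \<xi> z)) * l2_norm maxwell g"
    if fg: "(g, f) \<in> resolvent_graph maxwell (L_op \<xi>) z" for g f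
  proof -
    have g: "g \<in> L2 maxwell" and f: "f \<in> L2 maxwell" using fg by (auto simp: resolvent_graph_L_op_iff)
    let ?d = "cauchy_transform \<xi> g z / dispersion \<xi> z"
    have "l2_norm maxwell f = l2_norm maxwell (fibre_resolvent \<xi> z g)"
      by (intro l2_norm_cong_AE resolvent_graph_imp_fibre_resolvent[OF z False fg] L2_measurable f
          fibre_resolvent_L2 z g)
    also have "\<dots> \<le> 1 / Re (z + 1) * l2_norm maxwell (\<lambda>v. g v + ?d)"
      unfolding fibre_resolvent_def[abs_def] using z g by (intro free_resolvent_mult_L2 L2_add) auto
    also have "\<dots> \<le> c * (l2_norm maxwell g + l2_norm maxwell (\<lambda>v. ?d))"
      using l2_triangle[OF g maxwell_const_L2[of ?d]] z c by (simp add: c_def divide_right_mono)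
    also have "l2_norm maxwell (\<lambda>v. ?d) = norm ?d"
      using l2_norm_scale[of maxwell ?d "\<lambda>_. 1"] by simp
    also have "norm ?d \<le> c * l2_norm maxwell g / norm (dispersion \<xi> z)"
      unfolding norm_divide c_def by (intro divide_right_mono cauchy_transform_bound z g) simp
    finally show ?thesis using c by (simp add: algebra_simps)
  qed
  then have "z \<in> resolvent_set maxwell (L_op \<xi>)"
    using fibre_resolvent_mem[OF z False] unfolding resolvent_set_def by blast
  then show ?thesis using False by (simp add: spectrum_def)
next
  case True
  let ?r = "free_resolvent (z + 1) \<xi>"
  have r: "?r \<in> L2 maxwell" using z by (intro free_resolvent_L2) auto
  have int: "(\<integral>v. ?r v \<partial>maxwell) = 1" using True by (simp add: dispersion_def cauchy_transform_def)
  have "(z + 1 + \<i> * complex_of_real v * complex_of_real \<xi>) * ?r v = 1" for v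
    using free_resolvent_denom[of "z + 1" v \<xi>] z by (simp add: free_resolvent_def)
  then have mem: "((\<lambda>_. 0), ?r) \<in> resolvent_graph maxwell (L_op \<xi>) z"
    using r int by (simp add: resolvent_graph_L_op_iff)
  have "l2_norm maxwell ?r \<noteq> 0"
    using norm_integral_maxwell_le[OF r] int by auto
  moreover have "l2_norm maxwell ?r \<le> 0" if "z \<in> resolvent_set maxwell (L_op \<xi>)"
  proof -
    have "\<exists>B. \<forall>(g, f)\<in>resolvent_graph maxwell (L_op \<xi>) z. l2_norm maxwell f \<le> B * l2_norm maxwell g"
      using that unfolding resolvent_set_def by simp
    then obtain B where "\<forall>(g, f)\<in>resolvent_graph maxwell (L_op \<xi>) z. l2_norm maxwell f \<le> B * l2_norm maxwell g"
      by (rule exE)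
    from bspec[OF this mem] show ?thesis by (simp add: l2_norm_def)
  qed
  ultimately have "z \<notin> resolvent_set maxwell (L_op \<xi>)"
    using l2_norm_nonneg[of maxwell ?r] by fastforce
  then show ?thesis using True by (simp add: spectrum_def)
qed

text \<open>On odd functions concentrated near \<open>v = 0\<close> the operator \<open>-1 - L\<^sub>\<xi>\<close> is multiplication by
  a small number, so \<open>-1\<close> has no bounded resolvent.\<close>

lemma minus_one_in_spectrum: "-1 \<in> spectrum maxwell (L_op \<xi>)"
proof -
  have False if B: "\<And>g f. (g, f) \<in> resolvent_graph maxwell (L_op \<xi>) (-1) \<Longrightarrow> l2_norm maxwell f \<le> B * l2_norm maxwell g" for B
  proof -
    \<comment> \<open>Chosen so that |B| |\<xi>| d is at most 1/2: the assumed bound then forces the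
      norm of the test function to vanish. The added ones avoid division by zero.\<close>
    define d where "d = 1 / (2 * (\<bar>B\<bar> + 1) * (\<bar>\<xi>\<bar> + 1))"
    have d: "d > 0" by (simp add: d_def add_nonneg_pos)
    have "(\<bar>B\<bar> * \<bar>\<xi>\<bar>) * d \<le> ((\<bar>B\<bar> + 1) * (\<bar>\<xi>\<bar> + 1)) * d"
      using d by (intro mult_right_mono mult_mono) auto
    also have "\<dots> = 1 / 2" by (simp add: d_def add_nonneg_eq_0_iff divide_simps)
    finally have small: "\<bar>B\<bar> * (\<bar>\<xi>\<bar> * d) \<le> 1 / 2" by (simp add: mult.assoc)
    define f where "f v = complex_of_real (indicator {-d..d} v * sgn v)" for v
    have f_meas: "f \<in> borel_measurable borel" unfolding f_def by measurable
    have f: "f \<in> L2 maxwell"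
      by (rule maxwell_bounded_L2[OF f_meas, where C = 1]) (auto simp: f_def indicator_def sgn_if)
    let ?g = "\<lambda>v. \<i> * complex_of_real v * complex_of_real \<xi> * f v"
    have bd: "norm (?g v) \<le> (\<bar>\<xi>\<bar> * d) * norm (f v)" for v
    proof (cases "\<bar>v\<bar> \<le> d")
      case True
      then have "\<bar>v\<bar> * \<bar>\<xi>\<bar> * norm (f v) \<le> d * \<bar>\<xi>\<bar> * norm (f v)"
        by (intro mult_right_mono) auto
      then show ?thesis by (simp add: norm_mult mult.commute)
    next
      case False
      then have "f v = 0" by (auto simp: f_def indicator_def)
      then show ?thesis by simp
    qed
    have g_meas: "?g \<in> borel_measurable maxwell" using f_meas by measurable
    have g: "?g \<in> L2 maxwell" "l2_norm maxwell ?g \<le> (\<bar>\<xi>\<bar> * d) * l2_norm maxwell f"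
      using L2_dominated[OF f g_meas AE_I2[OF bd]] d by auto
    have "(\<integral>v. f v \<partial>maxwell) = (\<integral>v. weight v *\<^sub>R f v \<partial>lborel)"
      unfolding maxwell_def using f_meas
      by (subst integral_density) (auto simp: weight_def)
    also have "(\<integral>v. weight v *\<^sub>R f v \<partial>lborel) = - (\<integral>v. weight v *\<^sub>R f v \<partial>lborel)"
      using lborel_integral_real_affine[of "-1" "\<lambda>v. weight v *\<^sub>R f v" 0]
      by (simp add: weight_def f_def sgn_minus indicator_def minus_le_iff le_minus_iff conj_commute cong: if_cong)
    finally have "(\<integral>v. f v \<partial>maxwell) = - (\<integral>v. weight v *\<^sub>R f v \<partial>lborel)" .
    moreover have "(\<integral>v. f v \<partial>maxwell) = (\<integral>v. weight v *\<^sub>R f v \<partial>lborel)"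
      unfolding maxwell_def using f_meas
      by (subst integral_density) (auto simp: weight_def)
    ultimately have "(\<integral>v. f v \<partial>maxwell) = 0" by (simp add: equation_minus_iff)
    then have "(?g, f) \<in> resolvent_graph maxwell (L_op \<xi>) (-1)"
      using f g by (simp add: resolvent_graph_L_op_iff)
    then have "l2_norm maxwell f \<le> B * l2_norm maxwell ?g" by (rule B)
    also have "\<dots> \<le> \<bar>B\<bar> * ((\<bar>\<xi>\<bar> * d) * l2_norm maxwell f)"
      by (intro mult_mono g) auto
    also have "\<dots> = (\<bar>B\<bar> * (\<bar>\<xi>\<bar> * d)) * l2_norm maxwell f" by simp
    also have "\<dots> \<le> 1 / 2 * l2_norm maxwell f" by (intro mult_right_mono small) simp
    finally have "l2_norm maxwell f = 0" using l2_norm_nonneg[of maxwell f] by linarith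
    then have "AE v in maxwell. f v = 0" using l2_norm_eq_0_iff[OF f] by simp
    then have "AE v in lborel. ennreal (weight v) > 0 \<longrightarrow> f v = 0"
      unfolding maxwell_def by (subst (asm) AE_density) (auto simp: weight_def)
    then have "AE v in lborel. v \<notin> {0<..<d}"
      by eventually_elim (auto simp: f_def weight_def indicator_def sgn_if)
    then have "emeasure lborel {0<..<d} = 0"
      by (subst (asm) AE_iff_measurable[where N = "{0<..<d}"]) auto
    then show False using d by simp
  qed
  then show ?thesis unfolding spectrum_def resolvent_set_def by fastforce
qed

text \<open>The residue of the explicit resolvent at \<open>lambda_star \<xi>\<close>. The pairing
  with k carries no conjugate because the fibre operator is symmetric for the bilinear form
  \<integral> f g w dv; the denominator is \<integral> k^2 w dv, the derivative of the dispersion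
  function at that point.\<close>

definition eigenprojection :: "real \<Rightarrow> (real \<Rightarrow> complex) \<Rightarrow> real \<Rightarrow> complex" where
  "eigenprojection \<xi> f v = free_resolvent (of_real (decay \<xi>)) \<xi> v *
     ((\<integral>u. f u * free_resolvent (of_real (decay \<xi>)) \<xi> u \<partial>maxwell)
        / of_real (gauss_laplace2 (decay \<xi>) (decay \<xi>) \<xi>))"

lemma eigenprojection_L2:
  assumes "\<bar>\<xi>\<bar> < sqrt pi"
  shows "eigenprojection \<xi> f \<in> L2 maxwell"
  unfolding eigenprojection_def[abs_def] using decay_root(1)[OF assms]
  by (intro free_resolvent_mult_L2) auto

lemma of_real_decay: "complex_of_real (decay \<xi>) = complex_of_real (lambda_star \<xi>) + 1"
  by (simp add: decay_def)

text \<open>By \<open>gauss_laplace2_pos\<close> the derivative is positive, so the zero is simple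
  and the resolvent has a simple pole.\<close>

lemma dispersion_lambda_star:
  assumes "\<bar>\<xi>\<bar> < sqrt pi"
  shows "dispersion \<xi> (of_real (lambda_star \<xi>)) = 0"
    and "(dispersion \<xi> has_field_derivative of_real (gauss_laplace2 (decay \<xi>) (decay \<xi>) \<xi>)) (at (of_real (lambda_star \<xi>)))"
proof -
  note d = decay_root[OF assms]
  show "dispersion \<xi> (of_real (lambda_star \<xi>)) = 0"
    using integral_free_resolvent[OF d(1), of \<xi>] d(3)
    by (simp add: dispersion_def cauchy_transform_def of_real_decay)
  have "((\<lambda>z. 1 - cauchy_transform \<xi> (\<lambda>_. 1) z) has_field_derivative
      0 - (- (\<integral>v. 1 * (free_resolvent (of_real (lambda_star \<xi>) + 1) \<xi> v)\<^sup>2 \<partial>maxwell))) (at (of_real (lambda_star \<xi>)))"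
    using d(1) by (intro derivative_intros cauchy_transform_derivative) (auto simp: decay_def)
  then show "(dispersion \<xi> has_field_derivative of_real (gauss_laplace2 (decay \<xi>) (decay \<xi>) \<xi>)) (at (of_real (lambda_star \<xi>)))"
    using integral_free_resolvent_mult[OF d(1) d(1), of \<xi>]
    by (simp add: dispersion_def[abs_def] of_real_decay power2_eq_square)
qed

section \<open>The Riesz projection as a residue\<close>

lemma dispersion_holomorphic: "dispersion \<xi> holomorphic_on {z. Re z > -1}"
  unfolding dispersion_def[abs_def] by (intro holomorphic_intros cauchy_transform_holomorphic) simp

text \<open>The dispersion function with its simple zero divided out; the removable singularity is
  filled by the derivative, which is the denominator of \<open>eigenprojection\<close>.\<close>

definition reduced_dispersion :: "real \<Rightarrow> complex \<Rightarrow> complex" where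
  "reduced_dispersion \<xi> z = (let l = of_real (lambda_star \<xi>) in
     if z = l then deriv (dispersion \<xi>) l else (dispersion \<xi> z - dispersion \<xi> l) / (z - l))"

lemma reduced_dispersion:
  assumes "\<bar>\<xi>\<bar> < sqrt pi"
  defines "l \<equiv> complex_of_real (lambda_star \<xi>)"
  shows "reduced_dispersion \<xi> holomorphic_on {z. Re z > -1}"
    and "reduced_dispersion \<xi> l = of_real (gauss_laplace2 (decay \<xi>) (decay \<xi>) \<xi>)"
    and "dispersion \<xi> z = reduced_dispersion \<xi> z * (z - l)"
proof -
  have l: "Re l > -1" using decay_root(1)[OF assms(1)] by (simp add: l_def decay_def)
  show "reduced_dispersion \<xi> holomorphic_on {z. Re z > -1}"
    unfolding reduced_dispersion_def[abs_def] Let_def l_def[symmetric]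
    by (rule pole_lemma[OF dispersion_holomorphic]) (use l open_right_half_plane in \<open>simp add: interior_open\<close>)
  show "reduced_dispersion \<xi> l = of_real (gauss_laplace2 (decay \<xi>) (decay \<xi>) \<xi>)"
    using DERIV_imp_deriv[OF dispersion_lambda_star(2)[OF assms(1)]] by (simp add: reduced_dispersion_def l_def)
  show "dispersion \<xi> z = reduced_dispersion \<xi> z * (z - l)"
    using dispersion_lambda_star(1)[OF assms(1)] by (simp add: reduced_dispersion_def l_def Let_def)
qed

lemma l2_inner_fibre_resolvent:
  assumes z: "Re z > -1" and f: "f \<in> L2 maxwell" and h: "h \<in> L2 maxwell"
  shows "l2_inner maxwell (fibre_resolvent \<xi> z f) h = cauchy_transform \<xi> (\<lambda>v. f v * cnj (h v)) z
     + cauchy_transform \<xi> f z * cauchy_transform \<xi> (\<lambda>v. cnj (h v)) z / dispersion \<xi> z"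
proof -
  let ?r = "free_resolvent (z + 1) \<xi>" and ?c = "cauchy_transform \<xi> f z / dispersion \<xi> z"
  have r: "?r \<in> L2 maxwell" "(\<lambda>v. ?r v * f v) \<in> L2 maxwell"
    using z f by (auto intro!: free_resolvent_L2 free_resolvent_mult_L2)
  have "l2_inner maxwell (fibre_resolvent \<xi> z f) h = l2_inner maxwell (\<lambda>v. ?r v * f v + ?c * ?r v) h"
    by (simp add: fibre_resolvent_def[abs_def] algebra_simps)
  also have "\<dots> = l2_inner maxwell (\<lambda>v. ?r v * f v) h + ?c * l2_inner maxwell ?r h"
    by (subst l2_inner_add_left[OF r(2) L2_scale[OF r(1)] h]) (simp only: l2_inner_scale_left)
  finally show ?thesis by (simp add: l2_inner_def cauchy_transform_def mult_ac)
qed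

lemma l2_inner_eigenprojection:
  "l2_inner maxwell (eigenprojection \<xi> f) h
    = cauchy_transform \<xi> f (of_real (lambda_star \<xi>)) * cauchy_transform \<xi> (\<lambda>v. cnj (h v)) (of_real (lambda_star \<xi>))
       / of_real (gauss_laplace2 (decay \<xi>) (decay \<xi>) \<xi>)"
proof -
  let ?c = "cauchy_transform \<xi> f (of_real (lambda_star \<xi>)) / of_real (gauss_laplace2 (decay \<xi>) (decay \<xi>) \<xi>)"
  have "eigenprojection \<xi> f = (\<lambda>v. ?c * free_resolvent (of_real (lambda_star \<xi>) + 1) \<xi> v)"
    unfolding eigenprojection_def cauchy_transform_def of_real_decay by (rule ext) (rule mult.commute)
  then have "l2_inner maxwell (eigenprojection \<xi> f) h
      = ?c * l2_inner maxwell (free_resolvent (of_real (lambda_star \<xi>) + 1) \<xi>) h"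
    by (simp only: l2_inner_scale_left)
  also have "l2_inner maxwell (free_resolvent (of_real (lambda_star \<xi>) + 1) \<xi>) h
      = cauchy_transform \<xi> (\<lambda>v. cnj (h v)) (of_real (lambda_star \<xi>))"
    by (simp add: l2_inner_def cauchy_transform_def mult.commute)
  finally show ?thesis by simp
qed

text \<open>On the disc a matrix element of the resolvent splits into a holomorphic part, killed by
  Cauchy's theorem, and a simple pole, evaluated by Cauchy's formula. The radius is arbitrary
  because \<open>riesz_projection\<close> only asserts that some radius works.\<close>

lemma riesz_contour_integral:
  assumes \<xi>: "\<bar>\<xi>\<bar> < sqrt pi" and r: "r > 0"
    and sp: "cball (of_real (lambda_star \<xi>)) r \<inter> spectrum maxwell (L_op \<xi>) = {of_real (lambda_star \<xi>)}"
    and f: "f \<in> L2 maxwell" and h: "h \<in> L2 maxwell"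
  shows "((\<lambda>z. l2_inner maxwell (resolvent maxwell (L_op \<xi>) z f) h) has_contour_integral
      (2 * of_real pi * \<i> * l2_inner maxwell (eigenprojection \<xi> f) h)) (circlepath (of_real (lambda_star \<xi>)) r)"
proof -
  define l where "l = complex_of_real (lambda_star \<xi>)"
  note d = decay_root[OF \<xi>]
  \<comment> \<open>A closed disc of radius at least \<open>decay \<xi>\<close> would contain -1, a
    second point of the spectrum. So the disc stays in the half plane where the resolvent is
    explicit.\<close>
  have r_less: "r < decay \<xi>"
  proof (rule ccontr)
    assume "\<not> ?thesis"
    moreover have "l - (-1) = complex_of_real (decay \<xi>)"
      by (simp add: l_def of_real_decay)
    then have "dist l (-1) = decay \<xi>"
      unfolding dist_norm using d(1) by (simp only: norm_of_real abs_of_pos)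
    ultimately have "-1 \<in> cball l r" by simp
    moreover have "-1 \<noteq> l" using d(1) by (auto simp: l_def complex_eq_iff decay_def)
    ultimately show False using sp minus_one_in_spectrum[of \<xi>] unfolding l_def by blast
  qed
  have cb: "Re z > -1" if "z \<in> cball l r" for z
  proof -
    have "\<bar>Re z - lambda_star \<xi>\<bar> \<le> r"
      using that abs_Re_le_cmod[of "z - l"] by (simp add: l_def dist_norm norm_minus_commute)
    then show ?thesis using r_less by (simp add: decay_def)
  qed
  have nz: "reduced_dispersion \<xi> z \<noteq> 0" if z: "z \<in> cball l r" for z
  proof (cases "z = l")
    case True
    then show ?thesis
      using reduced_dispersion(2)[OF \<xi>] gauss_laplace2_pos[OF d(1) d(1), of \<xi>] by (simp add: l_def)
  next
    case False
    then have "z \<notin> spectrum maxwell (L_op \<xi>)" using sp z unfolding l_def by blast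
    then show ?thesis
      using resolvent_set_L_op[OF cb[OF z], of \<xi>] unfolding reduced_dispersion(3)[OF \<xi>, of z]
      by (metis mult_zero_left)
  qed
  let ?\<Phi> = "\<lambda>g. cauchy_transform \<xi> g"
  let ?N = "\<lambda>z. ?\<Phi> f z * ?\<Phi> (\<lambda>v. cnj (h v)) z / reduced_dispersion \<xi> z"
  have sub: "cball l r \<subseteq> {z. Re z > -1}" using cb by auto
  have hol: "?\<Phi> g holomorphic_on cball l r" if "integrable maxwell g" for g
    using cauchy_transform_holomorphic[OF that] sub by (rule holomorphic_on_subset)
  note int = L2_maxwell_integrable[OF f] L2_maxwell_integrable[OF L2_cnj[OF h]] L2_integrable_inner[OF f h]
  have "?N holomorphic_on cball l r"
    using nz holomorphic_on_subset[OF reduced_dispersion(1)[OF \<xi>] sub]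
    by (intro holomorphic_intros hol int) auto
  then have "((\<lambda>u. ?N u / (u - l)) has_contour_integral (2 * of_real pi * \<i> * ?N l)) (circlepath l r)"
    by (rule Cauchy_integral_circlepath_simple) (use r in simp)
  moreover have "(?\<Phi> (\<lambda>v. f v * cnj (h v)) has_contour_integral 0) (circlepath l r)"
    by (rule Cauchy_theorem_convex_simple[OF hol[OF int(3)]]) (use r in auto)
  ultimately have "((\<lambda>z. ?\<Phi> (\<lambda>v. f v * cnj (h v)) z + ?N z / (z - l)) has_contour_integral
      (0 + 2 * of_real pi * \<i> * ?N l)) (circlepath l r)"
    by (intro has_contour_integral_add)
  moreover have "?N l = l2_inner maxwell (eigenprojection \<xi> f) h"
    unfolding l2_inner_eigenprojection l_def reduced_dispersion(2)[OF \<xi>] ..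
  ultimately have "((\<lambda>z. ?\<Phi> (\<lambda>v. f v * cnj (h v)) z + ?N z / (z - l)) has_contour_integral
      (2 * of_real pi * \<i> * l2_inner maxwell (eigenprojection \<xi> f) h)) (circlepath l r)"
    by simp
  then show ?thesis
    unfolding l_def[symmetric]
  proof (rule has_contour_integral_eq)
    fix z assume "z \<in> path_image (circlepath l r)"
    then have z: "z \<in> cball l r" "z \<noteq> l" using r by auto
    have disp: "dispersion \<xi> z \<noteq> 0"
      using reduced_dispersion(3)[OF \<xi>, of z] nz[OF z(1)] z(2) by (simp add: l_def)
    let ?R = "resolvent maxwell (L_op \<xi>) z f"
    \<comment> \<open>\<open>resolvent\<close> is a choice from the graph; uniqueness on the fibre
      identifies it with \<open>fibre_resolvent\<close> almost everywhere.\<close>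
    have mem: "(f, ?R) \<in> resolvent_graph maxwell (L_op \<xi>) z"
      unfolding resolvent_def
      by (rule someI[where P = "\<lambda>g. (f, g) \<in> resolvent_graph maxwell (L_op \<xi>) z"])
         (rule fibre_resolvent_mem[OF cb[OF z(1)] disp f])
    have "l2_inner maxwell ?R h = l2_inner maxwell (fibre_resolvent \<xi> z f) h"
      using resolvent_graph_imp_fibre_resolvent[OF cb[OF z(1)] disp mem] mem h fibre_resolvent_L2[OF cb[OF z(1)] f, of \<xi>]
      by (intro l2_inner_cong_AE) (auto simp: resolvent_graph_L_op_iff intro: L2_measurable)
    also have "\<dots> = ?\<Phi> (\<lambda>v. f v * cnj (h v)) z + ?N z / (z - l)"
      unfolding l2_inner_fibre_resolvent[OF cb[OF z(1)] f h] reduced_dispersion(3)[OF \<xi>, of z] l_def[symmetric]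
      by simp
    finally show "?\<Phi> (\<lambda>v. f v * cnj (h v)) z + ?N z / (z - l) = l2_inner maxwell ?R h" ..
  qed
qed

text \<open>Continuity keeps \<open>reduced_dispersion\<close> away from 0 near the eigenvalue, so
  the dispersion function has no other zero there.\<close>

lemma lambda_star_isolated:
  assumes \<xi>: "\<bar>\<xi>\<bar> < sqrt pi"
  shows "\<exists>r>0. cball (of_real (lambda_star \<xi>)) r \<inter> spectrum maxwell (L_op \<xi>) = {of_real (lambda_star \<xi>)}"
proof -
  define l where "l = complex_of_real (lambda_star \<xi>)"
  note d = decay_root[OF \<xi>]
  have l: "l \<in> {z. Re z > -1}" using d(1) by (simp add: l_def decay_def)
  have "isCont (reduced_dispersion \<xi>) l"
    using holomorphic_on_imp_continuous_on[OF reduced_dispersion(1)[OF \<xi>]] l open_right_half_plane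
    by (simp add: continuous_on_eq_continuous_at)
  moreover have "reduced_dispersion \<xi> l \<noteq> 0"
    using reduced_dispersion(2)[OF \<xi>] gauss_laplace2_pos[OF d(1) d(1), of \<xi>] by (simp add: l_def)
  ultimately obtain e where e: "e > 0" "\<And>z. dist l z < e \<Longrightarrow> reduced_dispersion \<xi> z \<noteq> 0"
    using continuous_at_avoid[of l "reduced_dispersion \<xi>" 0] by auto
  obtain e' where e': "e' > 0" "ball l e' \<subseteq> {z. Re z > -1}"
    using open_right_half_plane l by (meson open_contains_ball)
  define r where "r = min e e' / 2"
  have r: "r > 0" "r < e" "r < e'" using e e' by (auto simp: r_def)
  have "z \<in> spectrum maxwell (L_op \<xi>) \<longleftrightarrow> z = l" if z: "z \<in> cball l r" for z
  proof -
    have "z \<in> ball l e'" using z r by auto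
    then have "Re z > -1" using e'(2) by auto
    moreover have "reduced_dispersion \<xi> z \<noteq> 0" using e(2)[of z] z r by auto
    ultimately show ?thesis
      using resolvent_set_L_op[of z \<xi>] reduced_dispersion(3)[OF \<xi>, of z] by (auto simp: l_def)
  qed
  then show ?thesis using r(1) unfolding l_def[symmetric] by (intro exI[of _ r]) auto
qed

text \<open>The weak contour integral determines p: testing with the difference of p and
  \<open>eigenprojection \<xi> f\<close> shows that its norm is 0. Conversely, isolation of the
  eigenvalue supplies an admissible circle.\<close>

theorem riesz_projection_eq_eigenprojection:
  assumes \<xi>: "\<bar>\<xi>\<bar> < sqrt pi"
  shows "(f, p) \<in> riesz_projection maxwell (L_op \<xi>) (of_real (lambda_star \<xi>)) \<longleftrightarrow>
     f \<in> L2 maxwell \<and> p \<in> L2 maxwell \<and> (AE v in maxwell. p v = eigenprojection \<xi> f v)"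
proof
  assume "(f, p) \<in> riesz_projection maxwell (L_op \<xi>) (of_real (lambda_star \<xi>))"
  then obtain r where f: "f \<in> L2 maxwell" and p: "p \<in> L2 maxwell" and r: "r > 0"
    "cball (of_real (lambda_star \<xi>)) r \<inter> spectrum maxwell (L_op \<xi>) = {of_real (lambda_star \<xi>)}"
    and ci: "\<And>h. h \<in> L2 maxwell \<Longrightarrow> ((\<lambda>z. l2_inner maxwell (resolvent maxwell (L_op \<xi>) z f) h) has_contour_integral
      (2 * of_real pi * \<i> * l2_inner maxwell p h)) (circlepath (of_real (lambda_star \<xi>)) r)"
    by (auto simp: riesz_projection_def)
  have eq: "l2_inner maxwell p h = l2_inner maxwell (eigenprojection \<xi> f) h" if h: "h \<in> L2 maxwell" for h
    using has_contour_integral_unique[OF ci[OF h] riesz_contour_integral[OF \<xi> r f h]] by simp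
  note e = eigenprojection_L2[OF \<xi>, of f]
  let ?d = "\<lambda>v. p v - eigenprojection \<xi> f v"
  have "l2_inner maxwell ?d ?d = 0"
    by (subst l2_inner_diff_left[OF p e L2_diff[OF p e]]) (simp add: eq L2_diff[OF p e])
  then have "l2_norm maxwell ?d = 0" by (simp add: l2_inner_self)
  then show "f \<in> L2 maxwell \<and> p \<in> L2 maxwell \<and> (AE v in maxwell. p v = eigenprojection \<xi> f v)"
    using l2_norm_diff_eq_0_iff[OF p e] f p by simp
next
  assume *: "f \<in> L2 maxwell \<and> p \<in> L2 maxwell \<and> (AE v in maxwell. p v = eigenprojection \<xi> f v)"
  obtain r where r: "r > 0"
    "cball (of_real (lambda_star \<xi>)) r \<inter> spectrum maxwell (L_op \<xi>) = {of_real (lambda_star \<xi>)}"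
    using lambda_star_isolated[OF \<xi>] by blast
  have "l2_inner maxwell p h = l2_inner maxwell (eigenprojection \<xi> f) h" if h: "h \<in> L2 maxwell" for h
    using * h eigenprojection_L2[OF \<xi>, of f] by (intro l2_inner_cong_AE) (auto intro: L2_measurable)
  then have "\<forall>h\<in>L2 maxwell. ((\<lambda>z. l2_inner maxwell (resolvent maxwell (L_op \<xi>) z f) h) has_contour_integral
      (2 * of_real pi * \<i> * l2_inner maxwell p h)) (circlepath (of_real (lambda_star \<xi>)) r)"
    using riesz_contour_integral[OF \<xi> r] * by auto
  then show "(f, p) \<in> riesz_projection maxwell (L_op \<xi>) (of_real (lambda_star \<xi>))"
    using * r unfolding riesz_projection_def by blast
qed

subsection \<open>A Lyapunov functional on the fibres\<close>

lemma norm_exp_minus_diff_le: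
  fixes z w :: complex
  assumes "Re z \<ge> 0" "Re w \<ge> 0"
  shows "norm (exp (- z) - exp (- w)) \<le> norm (z - w)"
proof -
  have "norm (exp (- z) - exp (- w)) \<le> 1 * norm (z - w)"
  proof (rule field_differentiable_bound[where S = "{z. Re z \<ge> 0}" and f' = "\<lambda>z. - exp (- z)"])
    show "convex {z. Re z \<ge> 0}" by (rule convex_halfspace_Re_ge)
  qed (use assms in \<open>auto intro!: derivative_eq_intros simp: norm_exp_eq_Re\<close>)
  then show ?thesis by simp
qed

definition rate :: "real \<Rightarrow> real \<Rightarrow> real \<Rightarrow> complex" where
  "rate \<beta> \<xi> v = complex_of_real \<beta> + \<i> * complex_of_real v * complex_of_real \<xi>"

definition transport :: "real \<Rightarrow> real \<Rightarrow> (real \<Rightarrow> complex) \<Rightarrow> real \<Rightarrow> complex" where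
  "transport \<beta> \<xi> k s = (\<integral>v. exp (- (rate \<beta> \<xi> v * complex_of_real s)) * k v \<partial>maxwell)"

lemma norm_exp_rate: "norm (exp (- (rate \<beta> \<xi> v * complex_of_real s))) = exp (- (\<beta> * s))"
  by (simp add: rate_def norm_exp_eq_Re)

lemma rate_measurable [measurable]: "rate \<beta> \<xi> \<in> borel_measurable borel"
  unfolding rate_def by measurable

lemma transport_integrable:
  assumes "integrable maxwell k"
  shows "integrable maxwell (\<lambda>v. exp (- (rate \<beta> \<xi> v * complex_of_real s)) * k v)"
    and "norm (transport \<beta> \<xi> k s) \<le> exp (- (\<beta> * s)) * (\<integral>v. norm (k v) \<partial>maxwell)"
proof -
  let ?E = "\<lambda>v. exp (- (rate \<beta> \<xi> v * complex_of_real s))"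
  have meas: "?E \<in> borel_measurable borel" by measurable
  have bd: "norm (?E v) \<le> exp (- (\<beta> * s))" for v by (simp only: norm_exp_rate order_refl)
  have eq: "(\<lambda>v. ?E v * k v) = (\<lambda>v. k v * ?E v)" by (rule ext) (rule mult.commute)
  show "integrable maxwell (\<lambda>v. ?E v * k v)"
    "norm (transport \<beta> \<xi> k s) \<le> exp (- (\<beta> * s)) * (\<integral>v. norm (k v) \<partial>maxwell)"
    unfolding transport_def eq by (rule integrable_maxwell_bounded_mult[OF assms meas bd])+
qed

lemma integral_lincomb3:
  fixes f g h :: "'a \<Rightarrow> complex"
  assumes "integrable M f" "integrable M g" "integrable M h"
  shows "(\<integral>x. f x - g x + c * h x \<partial>M) = (\<integral>x. f x \<partial>M) - (\<integral>x. g x \<partial>M) + c * (\<integral>x. h x \<partial>M)"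
  using assms by simp

lemma transport_continuous:
  assumes k: "integrable maxwell k" and \<beta>: "\<beta> > 0"
  shows "continuous_on {0..} (transport \<beta> \<xi> k)"
  unfolding continuous_on_sequentially o_def transport_def
proof (intro allI ballI impI integral_dominated_convergence; (elim conjE)?)
  fix x :: "nat \<Rightarrow> real" and s assume x: "\<forall>n. x n \<in> {0..}" "x \<longlonglongrightarrow> s"
  have [measurable]: "k \<in> borel_measurable borel" using borel_measurable_integrable[OF k] by (simp cong: measurable_cong_sets)
  show "integrable maxwell (\<lambda>v. norm (k v))" using k by simp
  show "AE v in maxwell. (\<lambda>n. exp (- (rate \<beta> \<xi> v * complex_of_real (x n))) * k v)
      \<longlonglongrightarrow> exp (- (rate \<beta> \<xi> v * complex_of_real s)) * k v"
    by (intro AE_I2 tendsto_intros x)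
  show "AE v in maxwell. norm (exp (- (rate \<beta> \<xi> v * complex_of_real (x n))) * k v) \<le> norm (k v)" for n
    unfolding norm_mult norm_exp_rate using x(1) \<beta> by (intro AE_I2 mult_left_le_one_le) auto
  show "(\<lambda>v. exp (- (rate \<beta> \<xi> v * complex_of_real s)) * k v) \<in> borel_measurable maxwell" by measurable
  show "(\<lambda>v. exp (- (rate \<beta> \<xi> v * complex_of_real (x n))) * k v) \<in> borel_measurable maxwell" for n by measurable
qed

text \<open>Differentiation under the integral although the rate is unbounded in v: the normalised
  remainder is dominated by 2 |rate k|, whose integrability \<open>transport_L_op\<close> supplies
  for functions in the domain of \<open>L_op \<xi>\<close>.\<close>

lemma transport_derivative:
  assumes k: "integrable maxwell k" and ck: "integrable maxwell (\<lambda>v. rate \<beta> \<xi> v * k v)"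
    and \<beta>: "\<beta> > 0" and s: "s \<ge> 0"
  shows "(transport \<beta> \<xi> k has_vector_derivative - transport \<beta> \<xi> (\<lambda>v. rate \<beta> \<xi> v * k v) s) (at s within {0..})"
proof -
  let ?c = "rate \<beta> \<xi>"
  let ?E = "\<lambda>s v. exp (- (?c v * complex_of_real s))"
  have [measurable]: "k \<in> borel_measurable borel" using borel_measurable_integrable[OF k] by (simp cong: measurable_cong_sets)
  define h where "h y v = norm (?E y v - ?E s v + complex_of_real (y - s) * (?c v * ?E s v)) / \<bar>y - s\<bar> * norm (k v)" for y v
  have E_s: "norm (?E s v) \<le> 1" for v unfolding norm_exp_rate using \<beta> s by simp
  have E_diff: "norm (?E y v - ?E s v) \<le> norm (?c v) * \<bar>y - s\<bar>" if "y \<ge> 0" for y v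
  proof -
    have "norm (?E y v - ?E s v) \<le> norm (?c v * complex_of_real y - ?c v * complex_of_real s)"
      using that \<beta> s by (intro norm_exp_minus_diff_le) (auto simp: rate_def)
    also have "\<dots> = norm (?c v) * \<bar>y - s\<bar>"
      by (simp only: right_diff_distrib[symmetric] of_real_diff[symmetric] norm_mult norm_of_real)
    finally show ?thesis .
  qed
  have h_bd: "h y v \<le> 2 * norm (?c v * k v)" if "y \<ge> 0" "y \<noteq> s" for y v
  proof -
    have "norm (?E y v - ?E s v + complex_of_real (y - s) * (?c v * ?E s v)) \<le> norm (?c v) * \<bar>y - s\<bar> + \<bar>y - s\<bar> * (norm (?c v) * 1)"
      using E_diff[OF that(1), of v] mult_left_mono[OF E_s[of v] norm_ge_zero[of "?c v"]]
      by (intro norm_triangle_le add_mono) (auto simp: norm_mult simp flip: of_real_diff intro: mult_left_mono)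
    then have "norm (?E y v - ?E s v + complex_of_real (y - s) * (?c v * ?E s v)) / \<bar>y - s\<bar> \<le> 2 * norm (?c v)"
      using that by (simp add: pos_divide_le_eq mult_ac)
    then show ?thesis
      unfolding h_def norm_mult mult.assoc[symmetric] by (rule mult_right_mono) simp
  qed
  have h_meas: "h y \<in> borel_measurable borel" for y
    unfolding h_def by measurable
  have h_nn: "h y v \<ge> 0" for y v by (simp add: h_def)
  have h_int: "integrable maxwell (h y)" if "y \<ge> 0" "y \<noteq> s" for y
    by (rule Bochner_Integration.integrable_bound[of _ "\<lambda>v. 2 * norm (?c v * k v)"])
       (use ck h_bd[OF that] h_nn h_meas in \<open>auto simp del: norm_mult\<close>)
  have lim: "((\<lambda>y. \<integral>v. h y v \<partial>maxwell) \<longlongrightarrow> 0) (at s within {0..})"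
    unfolding tendsto_at_iff_sequentially o_def
  proof (intro allI impI)
    fix X assume X: "\<forall>i. X i \<in> {0::real..} - {s}" "X \<longlonglongrightarrow> s"
    have "(\<lambda>n. \<integral>v. h (X n) v \<partial>maxwell) \<longlonglongrightarrow> (\<integral>v. 0 \<partial>maxwell)"
    proof (rule integral_dominated_convergence)
      show "integrable maxwell (\<lambda>v. 2 * norm (?c v * k v))" using ck by simp
      show "AE v in maxwell. norm (h (X n) v) \<le> 2 * norm (?c v * k v)" for n
        using h_bd[of "X n"] X(1) h_nn by auto
      show "AE v in maxwell. (\<lambda>n. h (X n) v) \<longlonglongrightarrow> 0"
      proof (rule AE_I2)
        fix v
        have "((\<lambda>s. ?E s v) has_vector_derivative - (?c v * ?E s v)) (at s)"
          by (rule has_vector_derivative_real_field[where f = "\<lambda>z. exp (- (?c v * z))"])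
             (auto intro!: derivative_eq_intros)
        then have "((\<lambda>y. norm (?E y v - ?E s v - (y - s) *\<^sub>R (- (?c v * ?E s v))) / norm (y - s)) \<longlongrightarrow> 0) (at s)"
          unfolding has_vector_derivative_def has_derivative_iff_norm by simp
        then have "((\<lambda>y. norm (?E y v - ?E s v + complex_of_real (y - s) * (?c v * ?E s v)) / \<bar>y - s\<bar>) \<longlongrightarrow> 0) (at s)"
          by (simp add: scaleR_conv_of_real)
        moreover have "filterlim X (at s) sequentially"
          using X by (auto simp: filterlim_at)
        ultimately have "(\<lambda>n. norm (?E (X n) v - ?E s v + complex_of_real (X n - s) * (?c v * ?E s v)) / \<bar>X n - s\<bar>) \<longlonglongrightarrow> 0"
          by (rule filterlim_compose)
        from tendsto_mult_left_zero[OF this, of "norm (k v)"]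
        show "(\<lambda>n. h (X n) v) \<longlonglongrightarrow> 0" by (simp add: h_def mult.commute)
      qed
    qed (use h_meas in auto)
    then show "(\<lambda>n. \<integral>v. h (X n) v \<partial>maxwell) \<longlonglongrightarrow> 0" by simp
  qed
  show ?thesis
    unfolding has_vector_derivative_def has_derivative_iff_norm
  proof (intro conjI)
    show "bounded_linear (\<lambda>x. x *\<^sub>R - transport \<beta> \<xi> (\<lambda>v. ?c v * k v) s)"
      by (rule bounded_linear_scaleR_left)
    show "((\<lambda>y. norm (transport \<beta> \<xi> k y - transport \<beta> \<xi> k s - (y - s) *\<^sub>R - transport \<beta> \<xi> (\<lambda>v. ?c v * k v) s)
        / norm (y - s)) \<longlongrightarrow> 0) (at s within {0..})"
    proof (rule Lim_null_comparison[OF _ lim])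
      show "\<forall>\<^sub>F y in at s within {0..}.
        norm (norm (transport \<beta> \<xi> k y - transport \<beta> \<xi> k s - (y - s) *\<^sub>R - transport \<beta> \<xi> (\<lambda>v. ?c v * k v) s) / norm (y - s))
        \<le> (\<integral>v. h y v \<partial>maxwell)"
        unfolding eventually_at_filter
      proof (intro always_eventually allI impI)
        fix y assume y: "y \<noteq> s" "y \<in> {0::real..}"
        note I = transport_integrable(1)[OF k, of \<beta> \<xi>] transport_integrable(1)[OF ck, of \<beta> \<xi> s]
        let ?T = "transport \<beta> \<xi> k y - transport \<beta> \<xi> k s - (y - s) *\<^sub>R - transport \<beta> \<xi> (\<lambda>v. ?c v * k v) s"
        have T: "?T = (\<integral>v. ?E y v * k v - ?E s v * k v + complex_of_real (y - s) * (?E s v * (?c v * k v)) \<partial>maxwell)"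
          unfolding transport_def integral_lincomb3[OF I(1)[of y] I(1)[of s] I(2)]
          by (simp only: scaleR_conv_of_real mult_minus_right diff_minus_eq_add)
        have "norm ?T \<le> (\<integral>v. norm (?E y v * k v - ?E s v * k v + complex_of_real (y - s) * (?E s v * (?c v * k v))) \<partial>maxwell)"
          unfolding T by (rule integral_norm_bound)
        also have "\<dots> = (\<integral>v. \<bar>y - s\<bar> * h y v \<partial>maxwell)"
        proof (rule Bochner_Integration.integral_cong[OF refl])
          fix v
          have eq: "?E y v * k v - ?E s v * k v + complex_of_real (y - s) * (?E s v * (?c v * k v))
            = (?E y v - ?E s v + complex_of_real (y - s) * (?c v * ?E s v)) * k v"
          proof -
            have "a * x - b * x + c * (b * (d * x)) = (a - b + c * (d * b)) * x" for a b c d x :: complex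
              by (simp add: algebra_simps)
            then show ?thesis .
          qed
          have "\<bar>y - s\<bar> * (x / \<bar>y - s\<bar> * z) = x * z" for x z :: real
            using y by simp
          then show "norm (?E y v * k v - ?E s v * k v + complex_of_real (y - s) * (?E s v * (?c v * k v))) = \<bar>y - s\<bar> * h y v"
            unfolding eq h_def norm_mult by (rule sym)
        qed
        finally have "norm ?T \<le> \<bar>y - s\<bar> * (\<integral>v. h y v \<partial>maxwell)" by simp
        then show "norm (norm ?T / norm (y - s)) \<le> (\<integral>v. h y v \<partial>maxwell)"
          using y by (simp add: pos_divide_le_eq mult.commute)
      qed
    qed
  qed
qed

text \<open>The weight u of the overview, in integrated form.\<close>

definition lyap_weight :: "(real \<Rightarrow> real) \<Rightarrow> real \<Rightarrow> real" where
  "lyap_weight \<kappa> s = 1 - (LINT t:{0..s}|lborel. \<kappa> t)"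

lemma lyap_weight:
  assumes cont: "continuous_on {0..} \<kappa>" and nn: "\<forall>s\<ge>0. \<kappa> s \<ge> 0"
    and int: "set_integrable lborel {0<..} \<kappa>" and q: "(LINT s:{0<..}|lborel. \<kappa> s) \<le> q"
  shows "s \<ge> 0 \<Longrightarrow> 1 - q \<le> lyap_weight \<kappa> s" and "s \<ge> 0 \<Longrightarrow> lyap_weight \<kappa> s \<le> 1"
    and "lyap_weight \<kappa> 0 = 1"
    and "s \<ge> 0 \<Longrightarrow> (lyap_weight \<kappa> has_real_derivative - \<kappa> s) (at s within {0..})"
proof -
  have int0: "set_integrable lborel {0..s} \<kappa>" for s
    by (rule borel_integrable_atLeastAtMost') (rule continuous_on_subset[OF cont], auto)
  show "1 - q \<le> lyap_weight \<kappa> s" if "s \<ge> 0"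
  proof -
    have "(LINT t:{0..s}|lborel. \<kappa> t) \<le> (LINT s:{0<..}|lborel. \<kappa> s)"
      unfolding set_lebesgue_integral_def
    proof (rule integral_mono_AE)
      show "AE t in lborel. indicator {0..s} t *\<^sub>R \<kappa> t \<le> indicator {0<..} t *\<^sub>R \<kappa> t"
        using AE_lborel_singleton[of 0] by eventually_elim (use nn in \<open>auto simp: indicator_def\<close>)
    qed (use int int0 in \<open>auto simp: set_integrable_def\<close>)
    then show ?thesis using q by (simp add: lyap_weight_def)
  qed
  show "lyap_weight \<kappa> s \<le> 1" if "s \<ge> 0"
    unfolding lyap_weight_def set_lebesgue_integral_def
    using nn by (auto simp: indicator_def intro!: integral_nonneg_AE)
  show "lyap_weight \<kappa> 0 = 1"
  proof -
    have "(LINT t:{0..0}|lborel. \<kappa> t) = (\<integral>t. 0 \<partial>(lborel :: real measure))"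
      unfolding set_lebesgue_integral_def
    proof (rule integral_cong_AE)
      show "AE t in lborel. indicator {0..0} t *\<^sub>R \<kappa> t = 0"
        using AE_lborel_singleton[of 0] by eventually_elim (auto simp: indicator_def)
    qed (use int0[of 0] in \<open>auto simp: set_integrable_def\<close>)
    then show ?thesis by (simp add: lyap_weight_def)
  qed
  show "(lyap_weight \<kappa> has_real_derivative - \<kappa> s) (at s within {0..})" if s: "s \<ge> 0"
  proof -
    have "((\<lambda>x. integral {0..x} \<kappa>) has_real_derivative \<kappa> s) (at s within {0..s + 1})"
      using s by (intro integral_has_real_derivative continuous_on_subset[OF cont]) auto
    then have "((\<lambda>x. 1 - integral {0..x} \<kappa>) has_real_derivative - \<kappa> s) (at s within {0..s + 1})"
      by (auto intro!: derivative_eq_intros)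
    moreover have "at s within {0..} = at s within {0..s + 1}"
      by (rule at_within_nhd[of s "{..<s + 1}"]) auto
    moreover have "lyap_weight \<kappa> = (\<lambda>x. 1 - integral {0..x} \<kappa>)"
      unfolding lyap_weight_def set_borel_integral_eq_integral(2)[OF int0] ..
    ultimately show ?thesis by simp
  qed
qed

text \<open>Dividing y by the square root of u makes the integral of |y|^2 / u the squared norm of a
  linear image of f, the form that \<open>l2_energy_decay\<close> expects.\<close>

definition lyap_map :: "real \<Rightarrow> real \<Rightarrow> (real \<Rightarrow> complex) \<Rightarrow> (real \<Rightarrow> real) \<Rightarrow> (real \<Rightarrow> complex) \<Rightarrow> real \<Rightarrow> complex" where
  "lyap_map \<beta> \<xi> \<psi> \<kappa> f s = complex_of_real (indicator {0<..} s / sqrt (lyap_weight \<kappa> s)) * transport \<beta> \<xi> (\<lambda>v. \<psi> v * f v) s"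

lemma exp_half_line_L2:
  assumes "\<beta> > 0"
  shows "(\<lambda>s. complex_of_real (indicator {0<..} s * exp (- (\<beta> * s)))) \<in> L2 lborel"
    and "l2_norm lborel (\<lambda>s. complex_of_real (indicator {0<..} s * exp (- (\<beta> * s)))) = 1 / sqrt (2 * \<beta>)"
proof -
  have eq: "(norm (complex_of_real (indicator {0<..} s * exp (- (\<beta> * s)))))\<^sup>2 = indicator {0<..} s *\<^sub>R exp (- (2 * \<beta> * s))" for s
    by (auto simp: indicator_def power2_eq_square simp flip: exp_add)
  show "(\<lambda>s. complex_of_real (indicator {0<..} s * exp (- (\<beta> * s)))) \<in> L2 lborel"
  proof (rule L2_I)
    show "integrable lborel (\<lambda>s. (norm (complex_of_real (indicator {0<..} s * exp (- (\<beta> * s)))))\<^sup>2)"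
      unfolding eq using exp_minus_half_line(1)[of "2 * \<beta>"] assms by (simp only: set_integrable_def)
  qed measurable
  show "l2_norm lborel (\<lambda>s. complex_of_real (indicator {0<..} s * exp (- (\<beta> * s)))) = 1 / sqrt (2 * \<beta>)"
    unfolding l2_norm_def eq using exp_minus_half_line(2)[of "2 * \<beta>"] assms
    by (simp add: set_lebesgue_integral_def real_sqrt_divide)
qed

lemma lyap_map_L2:
  assumes \<beta>: "\<beta> > 0" and q: "q < 1" and w: "\<forall>s\<ge>0. 1 - q \<le> lyap_weight \<kappa> s"
    and \<psi>[measurable]: "\<psi> \<in> borel_measurable borel" "\<And>v. norm (\<psi> v) \<le> C" and f: "f \<in> L2 maxwell"
    and meas: "lyap_map \<beta> \<xi> \<psi> \<kappa> f \<in> borel_measurable borel"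
  shows "lyap_map \<beta> \<xi> \<psi> \<kappa> f \<in> L2 lborel"
    and "l2_norm lborel (lyap_map \<beta> \<xi> \<psi> \<kappa> f) \<le> C / (sqrt (1 - q) * sqrt (2 * \<beta>)) * l2_norm maxwell f"
proof -
  let ?e = "\<lambda>s. complex_of_real (indicator {0<..} s * exp (- (\<beta> * s)))"
  define K where "K = C / sqrt (1 - q) * l2_norm maxwell f"
  have C: "C \<ge> 0" using \<psi>(2)[of 0] norm_ge_zero order_trans by blast
  have K: "K \<ge> 0" using C q by (simp add: K_def)
  have \<psi>f_L2: "(\<lambda>v. \<psi> v * f v) \<in> L2 maxwell" "l2_norm maxwell (\<lambda>v. \<psi> v * f v) \<le> C * l2_norm maxwell f"
  proof -
    have ae: "AE v in maxwell. norm (\<psi> v * f v) \<le> C * norm (f v)"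
      unfolding norm_mult by (intro AE_I2 mult_right_mono \<psi>) auto
    have m: "(\<lambda>v. \<psi> v * f v) \<in> borel_measurable maxwell" using L2_measurable[OF f] by measurable
    show "(\<lambda>v. \<psi> v * f v) \<in> L2 maxwell" by (rule L2_dominated(1)[OF f m ae])
    show "l2_norm maxwell (\<lambda>v. \<psi> v * f v) \<le> C * l2_norm maxwell f" by (rule L2_dominated(2)[OF f m ae C])
  qed
  have L1: "(\<integral>v. norm (\<psi> v * f v) \<partial>maxwell) \<le> C * l2_norm maxwell f"
  proof -
    have "(\<lambda>v. complex_of_real (norm (\<psi> v * f v))) \<in> L2 maxwell"
      by (rule L2_dominated(1)[OF \<psi>f_L2(1), where C = 1]) (use L2_measurable[OF f] in auto)
    from norm_integral_maxwell_le[OF this]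
    have "\<bar>\<integral>v. norm (\<psi> v * f v) \<partial>maxwell\<bar> \<le> l2_norm maxwell (\<lambda>v. complex_of_real (norm (\<psi> v * f v)))"
      by (simp only: integral_complex_of_real norm_of_real)
    also have "\<dots> = l2_norm maxwell (\<lambda>v. \<psi> v * f v)"
      unfolding l2_norm_def by simp
    finally show ?thesis using \<psi>f_L2(2) by linarith
  qed
  have bd: "norm (lyap_map \<beta> \<xi> \<psi> \<kappa> f s) \<le> K * norm (?e s)" for s
  proof (cases "s > 0")
    case True
    have "1 / sqrt (lyap_weight \<kappa> s) \<le> 1 / sqrt (1 - q)"
      using spec[OF w, of s] q True by (intro divide_left_mono) auto
    moreover have "norm (transport \<beta> \<xi> (\<lambda>v. \<psi> v * f v) s) \<le> exp (- (\<beta> * s)) * (C * l2_norm maxwell f)"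
      using transport_integrable(2)[OF L2_maxwell_integrable[OF \<psi>f_L2(1)], of \<beta> \<xi> s] L1
      by (meson exp_ge_zero mult_left_mono order_trans)
    ultimately have "1 / sqrt (lyap_weight \<kappa> s) * norm (transport \<beta> \<xi> (\<lambda>v. \<psi> v * f v) s)
      \<le> 1 / sqrt (1 - q) * (exp (- (\<beta> * s)) * (C * l2_norm maxwell f))"
      using q by (intro mult_mono) auto
    then show ?thesis
      using True spec[OF w, of s] q by (simp add: lyap_map_def norm_mult norm_divide K_def mult_ac)
  qed (simp add: lyap_map_def)
  have meas': "lyap_map \<beta> \<xi> \<psi> \<kappa> f \<in> borel_measurable lborel" using meas by simp
  show "lyap_map \<beta> \<xi> \<psi> \<kappa> f \<in> L2 lborel"
    by (rule L2_dominated(1)[OF exp_half_line_L2(1)[OF \<beta>] meas' AE_I2[OF bd]])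
  have "l2_norm lborel (lyap_map \<beta> \<xi> \<psi> \<kappa> f) \<le> K * l2_norm lborel ?e"
    by (rule L2_dominated(2)[OF exp_half_line_L2(1)[OF \<beta>] meas' AE_I2[OF bd] K])
  then show "l2_norm lborel (lyap_map \<beta> \<xi> \<psi> \<kappa> f) \<le> C / (sqrt (1 - q) * sqrt (2 * \<beta>)) * l2_norm maxwell f"
    unfolding exp_half_line_L2(2)[OF \<beta>] by (simp add: K_def mult_ac)
qed

text \<open>Completing the square: this is k |\<rho> - a / u|^2 \<ge> 0 rearranged. It is applied
  with a = y, k = \<kappa> and b the transported moment of \<psi> g, where the first fraction on the
  right is the s-derivative of |y|^2 / u.\<close>

lemma lyap_pointwise:
  fixes a b \<rho> :: complex and u k \<sigma> :: real
  assumes "u > 0" "k \<ge> 0"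
  shows "2 * Re (b * cnj a) / u
    \<le> (2 * Re ((b - \<rho> * of_real k - of_real \<sigma> * a) * cnj a) * u + (norm a)\<^sup>2 * k) / u\<^sup>2
       + k * (norm \<rho>)\<^sup>2 + 2 * \<sigma> * ((norm a)\<^sup>2 / u)"
proof -
  define X W N P where "X = Re (b * cnj a)" and "W = k * Re (\<rho> * cnj a)" and "N = (norm a)\<^sup>2" and "P = (norm \<rho>)\<^sup>2"
  have "0 \<le> k * (norm (\<rho> - a / of_real u))\<^sup>2" using assms by simp
  also have "(norm (\<rho> - a / of_real u))\<^sup>2 = P - 2 * Re (\<rho> * cnj a) / u + N / u\<^sup>2"
    unfolding cmod_power2 P_def N_def using assms by (simp add: field_simps power2_eq_square)
  finally have 1: "0 \<le> k * P - 2 * W / u + N * k / u\<^sup>2"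
    by (simp add: algebra_simps W_def)
  have 2: "Re ((b - \<rho> * of_real k - of_real \<sigma> * a) * cnj a) = X - W - \<sigma> * N"
    unfolding cmod_power2 X_def W_def N_def by (simp add: algebra_simps power2_eq_square)
  have 3: "(2 * (X - W - \<sigma> * N) * u + N * k) / u\<^sup>2 = 2 * X / u - 2 * W / u - 2 * \<sigma> * (N / u) + N * k / u\<^sup>2"
    using assms by (simp add: field_simps power2_eq_square)
  show ?thesis unfolding 2 X_def[symmetric] N_def[symmetric] P_def[symmetric] 3 using 1 by linarith
qed

text \<open>The form with an explicit condition, from which measurability in s, and jointly in s and
  \<xi> for a kernel depending on \<xi>, is derived.\<close>

lemma lyap_weight_if: "lyap_weight \<kappa> s = 1 - (\<integral>t. (if 0 \<le> t \<and> t \<le> s then \<kappa> t else 0) \<partial>lborel)"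
  unfolding lyap_weight_def set_lebesgue_integral_def
  by (auto simp: indicator_def intro!: Bochner_Integration.integral_cong)

lemma lyap_weight_measurable:
  assumes [measurable]: "\<kappa> \<in> borel_measurable borel"
  shows "lyap_weight \<kappa> \<in> borel_measurable borel"
  unfolding lyap_weight_if by measurable

lemma transport_measurable [measurable]:
  assumes [measurable]: "k \<in> borel_measurable borel"
  shows "transport \<beta> \<xi> k \<in> borel_measurable borel"
  unfolding transport_def by measurable

section \<open>Dissipation and the transport equation on a fibre\<close>

lemma L2_maxwell_bounded_mult:
  assumes "\<psi> \<in> borel_measurable borel" "\<And>v. norm (\<psi> v) \<le> C" "f \<in> L2 maxwell"
  shows "(\<lambda>v. \<psi> v * f v) \<in> L2 maxwell"
proof (rule L2_dominated(1)[OF assms(3), where C = C])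
  show "AE v in maxwell. norm (\<psi> v * f v) \<le> C * norm (f v)"
    unfolding norm_mult by (intro AE_I2 mult_right_mono assms) auto
  show "(\<lambda>v. \<psi> v * f v) \<in> borel_measurable maxwell"
    using assms(1) L2_measurable[OF assms(3)] by measurable
qed

text \<open>Multiplication by \<open>- \<i> v \<xi>\<close> is skew and drops out of the real part;
  the rank-one term contributes |\<rho>|^2 and the loss term - |f|^2.\<close>

lemma L_op_dissipation:
  assumes "(f, g) \<in> L_op \<xi>"
  shows "Re (l2_inner maxwell g f) = (norm (\<integral>v. f v \<partial>maxwell))\<^sup>2 - (l2_norm maxwell f)\<^sup>2"
proof -
  let ?\<rho> = "\<integral>v. f v \<partial>maxwell"
  have f: "f \<in> L2 maxwell" and g: "g \<in> L2 maxwell"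
    and eq: "AE v in maxwell. g v = (- \<i> * complex_of_real v * complex_of_real \<xi> - 1) * f v + ?\<rho>"
    using assms by (auto simp: L_op_def l2_inner_def)
  note int = L2_integrable_inner[OF g f] L2_integrable_sq[OF f] L2_integrable_inner[OF maxwell_const_L2[of ?\<rho>] f]
  have "Re (l2_inner maxwell g f) = (\<integral>v. Re (g v * cnj (f v)) \<partial>maxwell)"
    unfolding l2_inner_def by (rule integral_Re[symmetric, OF int(1)])
  also have "\<dots> = (\<integral>v. Re (?\<rho> * cnj (f v)) - (norm (f v))\<^sup>2 \<partial>maxwell)"
  proof (rule integral_cong_AE)
    show "AE v in maxwell. Re (g v * cnj (f v)) = Re (?\<rho> * cnj (f v)) - (norm (f v))\<^sup>2"
      using eq
    proof eventually_elim
      case (elim v)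
      have "(- \<i> * complex_of_real v * complex_of_real \<xi> - 1) * f v * cnj (f v)
        = (- \<i> * complex_of_real (v * \<xi>) - 1) * complex_of_real ((norm (f v))\<^sup>2)"
        unfolding complex_norm_square by (simp add: mult.assoc)
      then have "Re ((- \<i> * complex_of_real v * complex_of_real \<xi> - 1) * f v * cnj (f v)) = - (norm (f v))\<^sup>2"
        by simp
      then show ?case unfolding elim distrib_right plus_complex.sel by simp
    qed
    show "(\<lambda>v. Re (g v * cnj (f v))) \<in> borel_measurable maxwell"
      using borel_measurable_integrable[OF int(1)] by measurable
    show "(\<lambda>v. Re (?\<rho> * cnj (f v)) - (norm (f v))\<^sup>2) \<in> borel_measurable maxwell"
      using borel_measurable_integrable[OF int(3)] borel_measurable_integrable[OF int(2)] by measurable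
  qed
  also have "\<dots> = (\<integral>v. Re (?\<rho> * cnj (f v)) \<partial>maxwell) - (\<integral>v. (norm (f v))\<^sup>2 \<partial>maxwell)"
    by (intro Bochner_Integration.integral_diff integrable_Re int)
  also have "(\<integral>v. Re (?\<rho> * cnj (f v)) \<partial>maxwell) = Re (\<integral>v. ?\<rho> * cnj (f v) \<partial>maxwell)"
    by (rule integral_Re[OF int(3)])
  also have "(\<integral>v. ?\<rho> * cnj (f v) \<partial>maxwell) = ?\<rho> * cnj ?\<rho>" by simp
  also have "Re (?\<rho> * cnj ?\<rho>) = (norm ?\<rho>)\<^sup>2"
    unfolding complex_norm_square[symmetric] by simp
  finally show ?thesis by (simp add: l2_norm_sq)
qed

text \<open>On the domain \<open>g = - (1 + \<i> v \<xi>) f + \<rho>\<close>, hence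
  \<open>rate \<beta> \<xi> v * f v\<close> equals \<rho> + (\<beta> - 1) f - g: the unbounded
  factor v is traded for square integrable functions.\<close>

lemma transport_L_op:
  assumes fg: "(f, g) \<in> L_op \<xi>" and \<psi>: "\<psi> \<in> borel_measurable borel" "\<And>v. norm (\<psi> v) \<le> C" and \<beta>: "\<beta> > 0"
  shows "integrable maxwell (\<lambda>v. rate \<beta> \<xi> v * (\<psi> v * f v))"
    and "transport \<beta> \<xi> (\<lambda>v. rate \<beta> \<xi> v * (\<psi> v * f v)) s
      = (\<integral>v. f v \<partial>maxwell) * transport \<beta> \<xi> \<psi> s + of_real (\<beta> - 1) * transport \<beta> \<xi> (\<lambda>v. \<psi> v * f v) s
        - transport \<beta> \<xi> (\<lambda>v. \<psi> v * g v) s"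
proof -
  let ?\<rho> = "\<integral>v. f v \<partial>maxwell"
  have f: "f \<in> L2 maxwell" and g: "g \<in> L2 maxwell"
    and eq: "AE v in maxwell. g v = (- \<i> * complex_of_real v * complex_of_real \<xi> - 1) * f v + ?\<rho>"
    using fg by (auto simp: L_op_def l2_inner_def)
  note int = L2_maxwell_integrable[OF L2_maxwell_bounded_mult[OF \<psi> f]]
    L2_maxwell_integrable[OF L2_maxwell_bounded_mult[OF \<psi> g]]
    L2_maxwell_integrable[OF maxwell_bounded_L2[OF \<psi>]]
  have meas: "(\<lambda>v. rate \<beta> \<xi> v * (\<psi> v * f v)) \<in> borel_measurable maxwell"
    using \<psi>(1) L2_measurable[OF f] by measurable
  have ae: "AE v in maxwell. ?\<rho> * \<psi> v + of_real (\<beta> - 1) * (\<psi> v * f v) - \<psi> v * g v = rate \<beta> \<xi> v * (\<psi> v * f v)"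
    using eq
  proof eventually_elim
    case (elim v)
    show ?case unfolding elim rate_def by (simp add: algebra_simps)
  qed
  have intR: "integrable maxwell (\<lambda>v. ?\<rho> * \<psi> v + of_real (\<beta> - 1) * (\<psi> v * f v) - \<psi> v * g v)"
    using int by simp
  show I: "integrable maxwell (\<lambda>v. rate \<beta> \<xi> v * (\<psi> v * f v))"
    using integrable_cong_AE_imp[OF intR meas ae] .
  let ?E = "\<lambda>v. exp (- (rate \<beta> \<xi> v * complex_of_real s))"
  note T = transport_integrable(1)[OF int(1), of \<beta> \<xi> s] transport_integrable(1)[OF int(2), of \<beta> \<xi> s]
    transport_integrable(1)[OF int(3), of \<beta> \<xi> s] transport_integrable(1)[OF I, of \<beta> \<xi> s]
  have "transport \<beta> \<xi> (\<lambda>v. rate \<beta> \<xi> v * (\<psi> v * f v)) s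
     = (\<integral>v. ?\<rho> * (?E v * \<psi> v) - ?E v * (\<psi> v * g v) + of_real (\<beta> - 1) * (?E v * (\<psi> v * f v)) \<partial>maxwell)"
    unfolding transport_def
  proof (rule integral_cong_AE)
    show "AE v in maxwell. ?E v * (rate \<beta> \<xi> v * (\<psi> v * f v))
       = ?\<rho> * (?E v * \<psi> v) - ?E v * (\<psi> v * g v) + of_real (\<beta> - 1) * (?E v * (\<psi> v * f v))"
      using ae
    proof eventually_elim
      case (elim v)
      have "x * (r * p + c * q - d) = r * (x * p) - x * d + c * (x * q)" for x r p c q d :: complex
        by (simp add: algebra_simps)
      then show ?case unfolding elim[symmetric] .
    qed
    show "(\<lambda>v. ?E v * (rate \<beta> \<xi> v * (\<psi> v * f v))) \<in> borel_measurable maxwell"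
      using borel_measurable_integrable[OF T(4)] .
    show "(\<lambda>v. ?\<rho> * (?E v * \<psi> v) - ?E v * (\<psi> v * g v) + of_real (\<beta> - 1) * (?E v * (\<psi> v * f v))) \<in> borel_measurable maxwell"
      using T(1-3)[THEN borel_measurable_integrable] by measurable
  qed
  also have "\<dots> = (\<integral>v. ?\<rho> * (?E v * \<psi> v) \<partial>maxwell) - transport \<beta> \<xi> (\<lambda>v. \<psi> v * g v) s
      + of_real (\<beta> - 1) * transport \<beta> \<xi> (\<lambda>v. \<psi> v * f v) s"
    unfolding transport_def by (rule integral_lincomb3[OF integrable_mult_right[OF T(3)] T(2) T(1)])
  also have "(\<integral>v. ?\<rho> * (?E v * \<psi> v) \<partial>maxwell) = ?\<rho> * transport \<beta> \<xi> \<psi> s"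
    unfolding transport_def by (rule integral_mult_right_zero)
  finally show "transport \<beta> \<xi> (\<lambda>v. rate \<beta> \<xi> v * (\<psi> v * f v)) s
      = ?\<rho> * transport \<beta> \<xi> \<psi> s + of_real (\<beta> - 1) * transport \<beta> \<xi> (\<lambda>v. \<psi> v * f v) s
        - transport \<beta> \<xi> (\<lambda>v. \<psi> v * g v) s" by simp
qed

text \<open>With \<open>y\<close> the transported moment of \<open>\<psi> f\<close> and \<open>u\<close> the weight, \<open>|y|\<^sup>2 / u\<close> runs from
  \<open>|\<rho>|\<^sup>2\<close> at \<open>s = 0\<close> to \<open>0\<close> at infinity; its \<open>s\<close>-derivative absorbs the memory term \<open>\<rho> \<kappa>\<close> because \<open>u' = - \<kappa>\<close>.\<close>

lemma lyapunov_fibre: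
  assumes fg: "(f, g) \<in> L_op \<xi>" and \<psi>: "\<psi> \<in> borel_measurable borel" "\<And>v. norm (\<psi> v) \<le> C"
    and moment: "(\<integral>v. \<psi> v * f v \<partial>maxwell) = (\<integral>v. f v \<partial>maxwell)"
    and \<beta>: "\<beta> > 0" and q: "q < 1"
    and cont: "continuous_on {0..} \<kappa>" and nn: "\<And>s. s \<ge> 0 \<Longrightarrow> \<kappa> s \<ge> 0"
    and \<kappa>_meas: "\<kappa> \<in> borel_measurable borel"
    and int: "set_integrable lborel {0<..} \<kappa>" and q_le: "(LINT s:{0<..}|lborel. \<kappa> s) \<le> q"
    and \<kappa>: "\<And>s. s \<ge> 0 \<Longrightarrow> transport \<beta> \<xi> \<psi> s = of_real (\<kappa> s)"
  defines "Y \<equiv> lyap_map \<beta> \<xi> \<psi> \<kappa>"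
  shows "(1 - q) / 2 * Re (l2_inner maxwell g f) + Re (l2_inner lborel (Y g) (Y f))
    \<le> (\<beta> - 1) * ((1 - q) / 2 * (l2_norm maxwell f)\<^sup>2 + (l2_norm lborel (Y f))\<^sup>2)"
proof -
  define \<rho> where "\<rho> = (\<integral>v. f v \<partial>maxwell)"
  define \<sigma> where "\<sigma> = \<beta> - 1"
  define u where "u = lyap_weight \<kappa>"
  define y where "y = transport \<beta> \<xi> (\<lambda>v. \<psi> v * f v)"
  define z where "z = transport \<beta> \<xi> (\<lambda>v. \<psi> v * g v)"
  have f: "f \<in> L2 maxwell" and g: "g \<in> L2 maxwell" using fg by (auto simp: L_op_def)
  have nn': "\<forall>s\<ge>0. \<kappa> s \<ge> 0" using nn by blast
  note w = lyap_weight[OF cont nn' int q_le, folded u_def]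
  have w': "\<forall>s\<ge>0. 1 - q \<le> lyap_weight \<kappa> s" using w(1) by (simp add: u_def)
  have u_pos: "u s > 0" if "s \<ge> 0" for s using w(1)[OF that] q by simp
  have C: "C \<ge> 0" using \<psi>(2)[of 0] norm_ge_zero order_trans by blast
  note If = L2_maxwell_integrable[OF L2_maxwell_bounded_mult[OF \<psi> f]]
  note Ig = L2_maxwell_integrable[OF L2_maxwell_bounded_mult[OF \<psi> g]]
  have f_borel: "f \<in> borel_measurable borel" and g_borel: "g \<in> borel_measurable borel"
    using L2_measurable[OF f] L2_measurable[OF g] by (simp_all cong: measurable_cong_sets)
  have [measurable]: "y \<in> borel_measurable borel" "z \<in> borel_measurable borel" "u \<in> borel_measurable borel"
    unfolding y_def z_def u_def using f_borel g_borel \<psi>(1)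
    by (auto intro!: transport_measurable lyap_weight_measurable[OF \<kappa>_meas])
  have y_cont: "continuous_on {0..} y" and z_cont: "continuous_on {0..} z"
    unfolding y_def z_def by (intro transport_continuous If Ig \<beta>)+
  have u_cont: "continuous_on {0..} u"
    using w(4) by (intro DERIV_continuous_on) auto
  \<comment> \<open>The s-derivative of y. Read as z = y' + \<rho> \<kappa> + \<sigma> y, with z the
    transported moment of \<psi> g and g the image of f under the fibre operator, it is the
    transport equation with source \<rho> \<kappa>.\<close>
  define y' where "y' s = z s - \<rho> * of_real (\<kappa> s) - of_real \<sigma> * y s" for s
  have y_deriv: "(y has_vector_derivative y' s) (at s within {0..})" if s: "s \<ge> 0" for s
    using transport_derivative[OF If transport_L_op(1)[OF fg \<psi> \<beta>] \<beta> s]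
    unfolding transport_L_op(2)[OF fg \<psi> \<beta>] \<kappa>[OF s]
    by (simp add: y_def y'_def z_def \<rho>_def \<sigma>_def algebra_simps)
  define Z where "Z s = (norm (y s))\<^sup>2 / u s" for s
  define Z' where "Z' s = (2 * Re (y' s * cnj (y s)) * u s + (norm (y s))\<^sup>2 * \<kappa> s) / (u s)\<^sup>2" for s
  have Z_deriv: "(Z has_real_derivative Z' s) (at s within {0..})" if s: "s \<ge> 0" for s
  proof -
    have ReIm: "((\<lambda>s. Re (y s)) has_real_derivative Re (y' s)) (at s within {0..})"
      "((\<lambda>s. Im (y s)) has_real_derivative Im (y' s)) (at s within {0..})"
      using y_deriv[OF s] by (auto simp: has_vector_derivative_complex_iff)
    have "((\<lambda>s. (Re (y s))\<^sup>2 + (Im (y s))\<^sup>2) has_real_derivative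
        2 * Re (y s) * Re (y' s) + 2 * Im (y s) * Im (y' s)) (at s within {0..})"
      using DERIV_add[OF DERIV_power[OF ReIm(1), of 2] DERIV_power[OF ReIm(2), of 2]]
      by (simp add: mult_ac)
    then have "((\<lambda>s. ((Re (y s))\<^sup>2 + (Im (y s))\<^sup>2) / u s) has_real_derivative
        ((2 * Re (y s) * Re (y' s) + 2 * Im (y s) * Im (y' s)) * u s - ((Re (y s))\<^sup>2 + (Im (y s))\<^sup>2) * - \<kappa> s) / (u s * u s))
        (at s within {0..})"
      using w(4)[OF s] u_pos[OF s] by (intro DERIV_divide) auto
    moreover have "((2 * Re (y s) * Re (y' s) + 2 * Im (y s) * Im (y' s)) * u s - ((Re (y s))\<^sup>2 + (Im (y s))\<^sup>2) * - \<kappa> s) / (u s * u s) = Z' s"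
      unfolding Z'_def cmod_power2 by (simp add: power2_eq_square algebra_simps)
    moreover have "(\<lambda>s. ((Re (y s))\<^sup>2 + (Im (y s))\<^sup>2) / u s) = Z"
      unfolding Z_def cmod_power2 ..
    ultimately show ?thesis by simp
  qed
  have at_eq: "at s within {0..} = at s" if "s > 0" for s :: real
    using that by (intro at_within_interior) simp
  \<comment> \<open>One exponential envelope for y, z and \<kappa>; integrability of
    \<open>Z\<close>, \<open>Z'\<close> and \<open>r\<close> on the half-line reduces to it.\<close>
  obtain A where A: "A \<ge> 0" "\<And>s. norm (y s) \<le> A * exp (- (\<beta> * s))" "\<And>s. norm (z s) \<le> A * exp (- (\<beta> * s))"
    "\<And>s. s \<ge> 0 \<Longrightarrow> \<kappa> s \<le> A * exp (- (\<beta> * s))"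
  proof -
    define A where "A = max (max (\<integral>v. norm (\<psi> v * f v) \<partial>maxwell) (\<integral>v. norm (\<psi> v * g v) \<partial>maxwell)) (\<integral>v. norm (\<psi> v) \<partial>maxwell)"
    have bd: "norm (transport \<beta> \<xi> k s) \<le> A * exp (- (\<beta> * s))"
      if "integrable maxwell k" "(\<integral>v. norm (k v) \<partial>maxwell) \<le> A" for k s
    proof -
      have "norm (transport \<beta> \<xi> k s) \<le> exp (- (\<beta> * s)) * (\<integral>v. norm (k v) \<partial>maxwell)"
        by (rule transport_integrable(2)[OF that(1)])
      also have "\<dots> \<le> exp (- (\<beta> * s)) * A" using that(2) by (rule mult_left_mono) simp
      finally show ?thesis by (simp add: mult.commute)
    qed
    show thesis
    proof (rule that[of A])
      have "0 \<le> (\<integral>v. norm (\<psi> v) \<partial>maxwell)" by simp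
      then show "A \<ge> 0" unfolding A_def by linarith
      show "norm (y s) \<le> A * exp (- (\<beta> * s))" "norm (z s) \<le> A * exp (- (\<beta> * s))" for s
        unfolding y_def z_def by (intro bd If Ig; simp add: A_def)+
      show "\<kappa> s \<le> A * exp (- (\<beta> * s))" if "s \<ge> 0" for s
        using bd[OF L2_maxwell_integrable[OF maxwell_bounded_L2[OF \<psi>]], of s] \<kappa>[OF that] by (simp add: A_def)
    qed
  qed
  have exp2: "exp (- (\<beta> * s)) * exp (- (\<beta> * s)) = exp (- (2 * \<beta> * s))" for s
    by (simp add: exp_add[symmetric])
  have prod_bd: "norm (a * cnj b) / u s \<le> A' * A / (1 - q) * exp (- (2 * \<beta> * s))"
    if "s \<ge> 0" "norm a \<le> A' * exp (- (\<beta> * s))" "norm b \<le> A * exp (- (\<beta> * s))" "A' \<ge> 0" for s a b A'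
  proof -
    have "norm (a * cnj b) \<le> (A' * exp (- (\<beta> * s))) * (A * exp (- (\<beta> * s)))"
      unfolding norm_mult complex_mod_cnj using that A(1) by (intro mult_mono) auto
    also have "\<dots> = A' * A * exp (- (2 * \<beta> * s))" unfolding exp2[symmetric] by (simp add: mult_ac)
    finally have "norm (a * cnj b) / u s \<le> A' * A * exp (- (2 * \<beta> * s)) / (1 - q)"
      using w(1)[OF that(1)] q that(4) A(1) by (intro frac_le) auto
    then show ?thesis by simp
  qed
  have \<kappa>_le: "\<kappa> s \<le> A" if "s \<ge> 0" for s
  proof -
    have "A * exp (- (\<beta> * s)) \<le> A * 1" using A(1) that \<beta> by (intro mult_left_mono) auto
    then show ?thesis using A(4)[OF that] by simp
  qed
  define A' where "A' = A + norm \<rho> * A + \<bar>\<sigma>\<bar> * A"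
  have A': "A' \<ge> 0" using A(1) by (simp add: A'_def)
  have y'_bd: "norm (y' s) \<le> A' * exp (- (\<beta> * s))" if "s \<ge> 0" for s
  proof -
    have "norm (\<rho> * of_real (\<kappa> s)) \<le> norm \<rho> * (A * exp (- (\<beta> * s)))"
      unfolding norm_mult using A(4)[OF that] nn[OF that] by (intro mult_left_mono) auto
    moreover have "norm (of_real \<sigma> * y s) \<le> \<bar>\<sigma>\<bar> * (A * exp (- (\<beta> * s)))"
      unfolding norm_mult norm_of_real using A(2) by (intro mult_left_mono) auto
    ultimately have "norm (y' s) \<le> A * exp (- (\<beta> * s)) + norm \<rho> * (A * exp (- (\<beta> * s))) + \<bar>\<sigma>\<bar> * (A * exp (- (\<beta> * s)))"
      unfolding y'_def using A(3)[of s]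
      by (intro order_trans[OF norm_triangle_ineq4] add_mono) auto
    then show ?thesis by (simp add: A'_def algebra_simps)
  qed
  have Z_bd: "\<bar>Z s\<bar> \<le> A * A / (1 - q) * exp (- (2 * \<beta> * s))" if "s \<ge> 0" for s
    using prod_bd[OF that A(2) A(2) A(1)] u_pos[OF that]
    by (simp add: Z_def norm_mult power2_eq_square)
  have Z'_bd: "\<bar>Z' s\<bar> \<le> (2 * (A' * A / (1 - q)) + A * A / (1 - q) * (A / (1 - q))) * exp (- (2 * \<beta> * s))" if s: "s \<ge> 0" for s
  proof -
    have "Z' s = 2 * (Re (y' s * cnj (y s)) / u s) + (norm (y s * cnj (y s)) / u s) * (\<kappa> s / u s)"
      unfolding Z'_def using u_pos[OF s] by (simp add: power2_eq_square field_simps norm_mult)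
    also have "\<bar>\<dots>\<bar> \<le> 2 * (norm (y' s * cnj (y s)) / u s) + (norm (y s * cnj (y s)) / u s) * (\<kappa> s / u s)"
      using u_pos[OF s] nn[OF s] abs_Re_le_cmod[of "y' s * cnj (y s)"]
      by (intro order_trans[OF abs_triangle_ineq] add_mono) (auto simp: abs_mult divide_right_mono)
    also have "\<dots> \<le> 2 * (A' * A / (1 - q) * exp (- (2 * \<beta> * s))) + (A * A / (1 - q) * exp (- (2 * \<beta> * s))) * (A / (1 - q))"
    proof (intro add_mono mult_mono)
      show "\<kappa> s / u s \<le> A / (1 - q)"
        using \<kappa>_le[OF s] w(1)[OF s] q A(1) by (intro frac_le) auto
    qed (use prod_bd[OF s y'_bd[OF s] A(2) A'] prod_bd[OF s A(2) A(2) A(1)] A(1) q nn[OF s] u_pos[OF s] in auto)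
    finally show ?thesis by (simp add: algebra_simps)
  qed
  have Z'_cont: "continuous_on {0..} Z'"
    unfolding Z'_def y'_def using u_pos
    by (intro continuous_intros y_cont z_cont u_cont cont) (auto simp: less_imp_neq[symmetric])
  have Z'_meas: "Z' \<in> borel_measurable borel"
    unfolding Z'_def y'_def using \<kappa>_meas by measurable
  have \<beta>2: "2 * \<beta> > 0" using \<beta> by simp
  have Z'_int: "set_integrable lborel {0<..} Z'"
  proof (rule set_integrable_exp_bound[OF \<beta>2 Z'_meas])
    fix s :: real assume "s > 0"
    from Z'_bd[OF less_imp_le[OF this]]
    show "norm (Z' s) \<le> (2 * (A' * A / (1 - q)) + A * A / (1 - q) * (A / (1 - q))) * exp (- (2 * \<beta> * s))"
      unfolding real_norm_def .
  qed
  have Z0: "Z 0 = (norm \<rho>)\<^sup>2"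
    unfolding Z_def y_def transport_def using moment w(3) by (simp add: \<rho>_def)
  \<comment> \<open>Only the boundary value at 0 survives, and the hypothesis on the moment is what
    makes it |\<rho>|^2.\<close>
  have "(LBINT s=ereal 0..\<infinity>. Z' s) = 0 - Z 0"
  proof (rule interval_integral_FTC_integrable[where F = Z])
    fix s assume "ereal 0 < ereal s" "ereal s < \<infinity>"
    then have s: "s > 0" by simp
    show "(Z has_vector_derivative Z' s) (at s)"
      using Z_deriv[of s] s at_eq[OF s] by (simp add: has_real_derivative_iff_has_vector_derivative)
    show "isCont Z' s"
      by (rule continuous_on_interior[OF Z'_cont]) (use s in simp)
  next
    show "set_integrable lborel (einterval (ereal 0) \<infinity>) Z'" using Z'_int by simp
    have "continuous_on {0..} Z" using Z_deriv by (intro DERIV_continuous_on) auto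
    then have "(Z \<longlongrightarrow> Z 0) (at 0 within {0..})" by (auto simp: continuous_on_def)
    then have "(Z \<longlongrightarrow> Z 0) (at_right 0)" by (rule tendsto_within_subset) auto
    then show "((Z \<circ> real_of_ereal) \<longlongrightarrow> Z 0) (at_right (ereal 0))"
      by (simp only: at_right_ereal o_def filterlim_filtermap real_of_ereal.simps)
    have "((\<lambda>s. exp (- (2 * \<beta> * s))) \<longlongrightarrow> 0) at_top" using \<beta> by real_asymp
    from tendsto_mult_right_zero[OF this, of "A * A / (1 - q)"]
    have "((\<lambda>s. A * A / (1 - q) * exp (- (2 * \<beta> * s))) \<longlongrightarrow> 0) at_top" .
    then have "(Z \<longlongrightarrow> 0) at_top"
      by (rule Lim_null_comparison[rotated])
         (use Z_bd in \<open>auto intro: eventually_mono[OF eventually_ge_at_top[of 0]]\<close>)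
    then show "((Z \<circ> real_of_ereal) \<longlongrightarrow> 0) (at_left \<infinity>)"
      by (simp only: at_left_PInf o_def filterlim_filtermap real_of_ereal.simps)
  qed simp
  then have Z'_val: "(LINT s:{0<..}|lborel. Z' s) = - (norm \<rho>)\<^sup>2"
    by (simp add: interval_integral_to_infinity_eq Z0)
  define r where "r s = Re (z s * cnj (y s)) / u s" for s
  have r_int: "set_integrable lborel {0<..} r"
  proof (rule set_integrable_exp_bound[OF \<beta>2])
    show "norm (r s) \<le> A * A / (1 - q) * exp (- (2 * \<beta> * s))" if "s > 0" for s
      using prod_bd[OF _ A(3) A(2) A(1), of s] that u_pos[of s] abs_Re_le_cmod[of "z s * cnj (y s)"]
      unfolding r_def real_norm_def abs_divide
      by (intro order_trans[OF _ prod_bd[OF _ A(3) A(2) A(1)]]) (auto simp: divide_right_mono)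
  qed (unfold r_def, measurable)
  have Z_int: "set_integrable lborel {0<..} Z"
  proof (rule set_integrable_exp_bound[OF \<beta>2])
    fix s :: real assume "s > 0"
    from Z_bd[OF less_imp_le[OF this]]
    show "norm (Z s) \<le> A * A / (1 - q) * exp (- (2 * \<beta> * s))" unfolding real_norm_def .
  qed (unfold Z_def, measurable)
  have le: "(LINT s:{0<..}|lborel. 2 * r s) \<le> (LINT s:{0<..}|lborel. Z' s + (norm \<rho>)\<^sup>2 * \<kappa> s + 2 * \<sigma> * Z s)"
  proof (rule set_integral_mono)
    fix s :: real assume "s \<in> {0<..}"
    then have s: "s \<ge> 0" by simp
    show "2 * r s \<le> Z' s + (norm \<rho>)\<^sup>2 * \<kappa> s + 2 * \<sigma> * Z s"
      using lyap_pointwise[OF u_pos[OF s] nn[OF s], of "z s" "y s" \<rho> \<sigma>]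
      unfolding r_def Z'_def Z_def y'_def by (simp add: mult.commute)
  qed (use r_int Z'_int Z_int int in \<open>auto intro!: set_integral_add set_integrable_mult_right\<close>)
  also have "\<dots> = (LINT s:{0<..}|lborel. Z' s) + (norm \<rho>)\<^sup>2 * (LINT s:{0<..}|lborel. \<kappa> s) + 2 * \<sigma> * (LINT s:{0<..}|lborel. Z s)"
    using Z'_int Z_int int by (simp add: set_integral_add)
  also have "\<dots> \<le> - (norm \<rho>)\<^sup>2 + (norm \<rho>)\<^sup>2 * q + 2 * \<sigma> * (LINT s:{0<..}|lborel. Z s)"
    unfolding Z'_val using mult_left_mono[OF q_le, of "(norm \<rho>)\<^sup>2"] by simp
  finally have key: "(LINT s:{0<..}|lborel. r s) \<le> - ((1 - q) / 2 * (norm \<rho>)\<^sup>2) + \<sigma> * (LINT s:{0<..}|lborel. Z s)"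
    by (simp add: field_simps)
  have Y_eq: "Y h s = of_real (indicator {0<..} s / sqrt (u s)) * transport \<beta> \<xi> (\<lambda>v. \<psi> v * h v) s" for h s
    by (simp add: Y_def lyap_map_def u_def)
  have Y_meas: "Y f \<in> borel_measurable borel" "Y g \<in> borel_measurable borel"
    unfolding Y_eq[abs_def] y_def[symmetric] z_def[symmetric] by measurable
  have YL2: "Y f \<in> L2 lborel" "Y g \<in> L2 lborel"
    using lyap_map_L2(1)[OF \<beta> q w' \<psi>] f g Y_meas unfolding Y_def by blast+
  have "Re (l2_inner lborel (Y g) (Y f)) = (\<integral>s. Re (Y g s * cnj (Y f s)) \<partial>lborel)"
    unfolding l2_inner_def by (rule integral_Re[symmetric, OF L2_integrable_inner[OF YL2(2,1)]])
  also have "\<dots> = (LINT s:{0<..}|lborel. r s)"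
    unfolding set_lebesgue_integral_def
  proof (rule Bochner_Integration.integral_cong[OF refl])
    fix s
    show "Re (Y g s * cnj (Y f s)) = indicator {0<..} s *\<^sub>R r s"
    proof (cases "s > 0")
      case True
      then have "Y g s * cnj (Y f s) = z s * cnj (y s) / of_real (u s)"
        using u_pos[of s] by (simp add: Y_eq y_def z_def field_simps flip: of_real_mult)
      then show ?thesis using True by (simp add: r_def)
    qed (simp add: Y_eq)
  qed
  finally have inner: "Re (l2_inner lborel (Y g) (Y f)) = (LINT s:{0<..}|lborel. r s)" .
  have norm: "(l2_norm lborel (Y f))\<^sup>2 = (LINT s:{0<..}|lborel. Z s)"
    unfolding set_lebesgue_integral_def l2_norm_sq
  proof (rule Bochner_Integration.integral_cong[OF refl])
    fix s
    show "(norm (Y f s))\<^sup>2 = indicator {0<..} s *\<^sub>R Z s"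
      using u_pos[of s]
      by (cases "s > 0") (simp_all add: Y_eq y_def Z_def norm_mult norm_divide power_mult_distrib power_divide)
  qed
  \<comment> \<open>The loss rate -1 lies below \<sigma> because \<beta> > 0. The gain (1 - q) / 2
    |\<rho>|^2 from \<open>L_op_dissipation\<close> cancels against the negative term of
    \<open>key\<close>, which fixes the weight (1 - q) / 2.\<close>
  have "(1 - q) / 2 * (- (l2_norm maxwell f)\<^sup>2) \<le> (1 - q) / 2 * (\<sigma> * (l2_norm maxwell f)\<^sup>2)"
  proof (rule mult_left_mono)
    have "0 \<le> \<beta> * (l2_norm maxwell f)\<^sup>2" using \<beta> by simp
    then show "- (l2_norm maxwell f)\<^sup>2 \<le> \<sigma> * (l2_norm maxwell f)\<^sup>2"
      by (simp add: \<sigma>_def algebra_simps)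
  qed (use q in simp)
  moreover have "(1 - q) / 2 * Re (l2_inner maxwell g f) = (1 - q) / 2 * (norm \<rho>)\<^sup>2 + (1 - q) / 2 * (- (l2_norm maxwell f)\<^sup>2)"
    unfolding L_op_dissipation[OF fg] \<rho>_def by (simp add: right_diff_distrib)
  moreover have "\<sigma> * ((1 - q) / 2 * (l2_norm maxwell f)\<^sup>2 + (LINT s:{0<..}|lborel. Z s))
      = (1 - q) / 2 * (\<sigma> * (l2_norm maxwell f)\<^sup>2) + \<sigma> * (LINT s:{0<..}|lborel. Z s)"
    by (simp add: algebra_simps)
  ultimately show ?thesis
    unfolding inner norm \<sigma>_def[symmetric] using key by linarith
qed

subsection \<open>The truncated projector on the phase space\<close>

lemma gauss_laplace_measurable_comp [measurable (raw)]:
  assumes [measurable]: "b \<in> borel_measurable M" "x \<in> borel_measurable M" "s \<in> borel_measurable M"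
  shows "(\<lambda>w. gauss_laplace (b w) (x w) (s w)) \<in> borel_measurable M"
  unfolding gauss_laplace_def set_lebesgue_integral_def by measurable

lemma gauss_laplace2_measurable_comp [measurable (raw)]:
  assumes [measurable]: "a \<in> borel_measurable M" "b \<in> borel_measurable M" "x \<in> borel_measurable M"
  shows "(\<lambda>w. gauss_laplace2 (a w) (b w) (x w)) \<in> borel_measurable M"
  unfolding gauss_laplace2_def set_lebesgue_integral_def by measurable

lemma free_resolvent_measurable_comp [measurable (raw)]:
  assumes [measurable]: "b \<in> borel_measurable M" "x \<in> borel_measurable M" "v \<in> borel_measurable M"
  shows "(\<lambda>w. free_resolvent (b w) (x w) (v w)) \<in> borel_measurable M"
  unfolding free_resolvent_def by measurable

section \<open>Differences and dissipativity of the fibre and phase-space operators\<close>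

lemma L_op_diff:
  assumes "(f, g) \<in> L_op \<xi>" "(f', g') \<in> L_op \<xi>"
  shows "((\<lambda>v. f v - f' v), (\<lambda>v. g v - g' v)) \<in> L_op \<xi>"
proof -
  have L2: "f \<in> L2 maxwell" "g \<in> L2 maxwell" "f' \<in> L2 maxwell" "g' \<in> L2 maxwell"
    using assms by (auto simp: L_op_def)
  have "AE v in maxwell. g v = (- \<i> * complex_of_real v * complex_of_real \<xi> - 1) * f v + l2_inner maxwell f (\<lambda>_. 1)"
    "AE v in maxwell. g' v = (- \<i> * complex_of_real v * complex_of_real \<xi> - 1) * f' v + l2_inner maxwell f' (\<lambda>_. 1)"
    using assms by (auto simp: L_op_def)
  then have "AE v in maxwell. g v - g' v = (- \<i> * complex_of_real v * complex_of_real \<xi> - 1) * (f v - f' v)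
      + l2_inner maxwell (\<lambda>v. f v - f' v) (\<lambda>_. 1)"
    unfolding l2_inner_diff_left[OF L2(1,3) maxwell_const_L2]
  proof eventually_elim
    case (elim v)
    show ?case unfolding elim by (simp add: algebra_simps)
  qed
  then show ?thesis using L2 by (simp add: L_op_def L2_diff)
qed

lemma L_hat_diff:
  assumes "(F, G) \<in> L_hat" "(F', G') \<in> L_hat"
  shows "((\<lambda>z. F z - F' z), (\<lambda>z. G z - G' z)) \<in> L_hat"
proof -
  have "AE \<xi> in lborel. ((\<lambda>v. F (\<xi>, v) - F' (\<xi>, v)), (\<lambda>v. G (\<xi>, v) - G' (\<xi>, v))) \<in> L_op \<xi>"
    using assms unfolding L_hat_def by (auto elim!: eventually_elim2 intro: L_op_diff)
  then show ?thesis using assms by (simp add: L_hat_def L2_diff)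
qed

lemma L_hat_L2: "(F, G) \<in> L_hat \<Longrightarrow> F \<in> L2 phase" "(F, G) \<in> L_hat \<Longrightarrow> G \<in> L2 phase"
  by (auto simp: L_hat_def)

lemma phase_inner:
  assumes "F \<in> L2 phase" "G \<in> L2 phase"
  shows "integrable lborel (\<lambda>\<xi>. Re (l2_inner maxwell (\<lambda>v. F (\<xi>, v)) (\<lambda>v. G (\<xi>, v))))"
    and "Re (l2_inner phase F G) = (\<integral>\<xi>. Re (l2_inner maxwell (\<lambda>v. F (\<xi>, v)) (\<lambda>v. G (\<xi>, v))) \<partial>lborel)"
  using l2_inner_pair[OF sigma_finite_lborel sigma_finite_maxwell assms[unfolded phase_def]]
  unfolding phase_def by (auto intro: integrable_Re simp: integral_Re)

lemma L_hat_dissipative: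
  assumes FG: "(F, G) \<in> L_hat"
  shows "Re (l2_inner phase G F) \<le> 0"
proof -
  note L2 = L_hat_L2[OF FG]
  have "Re (l2_inner phase G F) \<le> (\<integral>\<xi>. 0 \<partial>(lborel :: real measure))"
    unfolding phase_inner(2)[OF L2(2,1)]
  proof (rule integral_mono_AE[OF phase_inner(1)[OF L2(2,1)]])
    have "AE \<xi> in lborel. ((\<lambda>v. F (\<xi>, v)), (\<lambda>v. G (\<xi>, v))) \<in> L_op \<xi>"
      using FG by (simp add: L_hat_def)
    then show "AE \<xi> in lborel. Re (l2_inner maxwell (\<lambda>v. G (\<xi>, v)) (\<lambda>v. F (\<xi>, v))) \<le> 0"
    proof eventually_elim
      case (elim \<xi>)
      then have "(\<lambda>v. F (\<xi>, v)) \<in> L2 maxwell" by (simp add: L_op_def)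
      from power_mono[OF norm_integral_maxwell_le[OF this], of 2]
      show ?case unfolding L_op_dissipation[OF elim] by simp
    qed
  qed simp
  then show ?thesis by simp
qed

text \<open>k is an eigenfunction and, for the bilinear pairing, a left eigenfunction as well:
  pairing g with k gives the eigenvalue times the pairing of f with k. So the projection preserves
  the domain and commutes with the operator.\<close>

lemma eigenprojection_L_op:
  assumes \<xi>: "\<bar>\<xi>\<bar> < sqrt pi" and fg: "(f, g) \<in> L_op \<xi>"
  shows "(eigenprojection \<xi> f, eigenprojection \<xi> g) \<in> L_op \<xi>"
proof -
  note d = decay_root[OF \<xi>]
  let ?r = "free_resolvent (of_real (decay \<xi>)) \<xi>"
  let ?D = "complex_of_real (gauss_laplace2 (decay \<xi>) (decay \<xi>) \<xi>)"
  let ?l = "complex_of_real (decay \<xi> - 1)"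
  let ?\<rho> = "\<integral>u. f u \<partial>maxwell"
  have f: "f \<in> L2 maxwell" and g: "g \<in> L2 maxwell"
    and eq: "AE v in maxwell. g v = (- \<i> * complex_of_real v * complex_of_real \<xi> - 1) * f v + ?\<rho>"
    using fg by (auto simp: L_op_def l2_inner_def)
  have r: "?r \<in> L2 maxwell" using d(1) by (intro free_resolvent_L2) simp
  have r_eq: "(- \<i> * complex_of_real v * complex_of_real \<xi> - 1) * ?r v = ?l * ?r v - 1" for v
    using free_resolvent_denom[of "of_real (decay \<xi>)" v \<xi>] d(1)
    by (simp add: free_resolvent_def divide_simps)
  have r1: "(\<integral>v. ?r v \<partial>maxwell) = 1"
    using integral_free_resolvent[OF d(1), of \<xi>] d(3) by simp
  note int = L2_integrable_mult[OF f r] L2_maxwell_integrable[OF f] L2_maxwell_integrable[OF r]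
  have "(\<integral>v. g v * ?r v \<partial>maxwell) = (\<integral>v. ?l * (f v * ?r v) - f v + ?\<rho> * ?r v \<partial>maxwell)"
  proof (rule integral_cong_AE)
    show "AE v in maxwell. g v * ?r v = ?l * (f v * ?r v) - f v + ?\<rho> * ?r v"
      using eq
    proof eventually_elim
      case (elim v)
      have "g v * ?r v = f v * ((- \<i> * complex_of_real v * complex_of_real \<xi> - 1) * ?r v) + ?\<rho> * ?r v"
        unfolding elim by (simp add: algebra_simps)
      then show ?case unfolding r_eq by (simp add: algebra_simps)
    qed
    show "(\<lambda>v. g v * ?r v) \<in> borel_measurable maxwell" using L2_measurable[OF g] by measurable
    show "(\<lambda>v. ?l * (f v * ?r v) - f v + ?\<rho> * ?r v) \<in> borel_measurable maxwell"
      using L2_measurable[OF f] by measurable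
  qed
  also have "\<dots> = ?l * (\<integral>v. f v * ?r v \<partial>maxwell) - ?\<rho> + ?\<rho> * (\<integral>v. ?r v \<partial>maxwell)"
    by (subst integral_lincomb3[OF integrable_mult_right[OF int(1)] int(2,3)]) simp
  finally have gr: "(\<integral>v. g v * ?r v \<partial>maxwell) = ?l * (\<integral>v. f v * ?r v \<partial>maxwell)"
    unfolding r1 by simp
  define c where "c = (\<integral>v. f v * ?r v \<partial>maxwell) / ?D"
  have Ef: "eigenprojection \<xi> f v = ?r v * c" for v by (simp add: eigenprojection_def c_def)
  have Eg: "eigenprojection \<xi> g v = ?l * (?r v * c)" for v by (simp add: eigenprojection_def c_def gr)
  have "l2_inner maxwell (eigenprojection \<xi> f) (\<lambda>_. 1) = c"
    by (simp add: l2_inner_def Ef r1)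
  moreover have "(- \<i> * complex_of_real v * complex_of_real \<xi> - 1) * (?r v * c) + c = ?l * (?r v * c)" for v
    using arg_cong[OF r_eq[of v], of "\<lambda>x. x * c"] by (simp add: algebra_simps)
  ultimately show ?thesis
    using eigenprojection_L2[OF \<xi>] by (simp add: L_op_def Ef Eg)
qed

text \<open>Each of the two factors k costs 1 / a and the normalisation costs 1 / m. With a and m
  uniform below the cutoff this bounds the projector on the phase space.\<close>

lemma eigenprojection_bound:
  assumes \<xi>: "\<bar>\<xi>\<bar> < sqrt pi" and f: "f \<in> L2 maxwell"
    and a: "0 < a" "a \<le> decay \<xi>" and m: "0 < m" "m \<le> gauss_laplace2 (decay \<xi>) (decay \<xi>) \<xi>"
  shows "l2_norm maxwell (eigenprojection \<xi> f) \<le> 1 / (a * a * m) * l2_norm maxwell f"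
proof -
  let ?r = "free_resolvent (of_real (decay \<xi>)) \<xi>"
  define c where "c = (\<integral>v. f v * ?r v \<partial>maxwell) / of_real (gauss_laplace2 (decay \<xi>) (decay \<xi>) \<xi>)"
  have r: "Re (of_real (decay \<xi>)) > 0" using a by simp
  have ra: "1 / Re (of_real (decay \<xi>)) \<le> 1 / a" using a by (simp add: frac_le)
  have "norm (\<integral>v. f v * ?r v \<partial>maxwell) \<le> l2_norm maxwell (\<lambda>v. ?r v * f v)"
    using norm_integral_maxwell_le[OF free_resolvent_mult_L2(1)[OF r f]] by (simp add: mult.commute)
  also have "\<dots> \<le> 1 / Re (of_real (decay \<xi>)) * l2_norm maxwell f"
    by (rule free_resolvent_mult_L2(2)[OF r f])
  also have "\<dots> \<le> 1 / a * l2_norm maxwell f" by (rule mult_right_mono[OF ra]) simp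
  finally have "norm c \<le> (1 / a * l2_norm maxwell f) / m"
    unfolding c_def norm_divide using m a by (intro frac_le) auto
  moreover have "l2_norm maxwell (eigenprojection \<xi> f) \<le> 1 / a * norm c"
  proof -
    have "l2_norm maxwell (eigenprojection \<xi> f) = l2_norm maxwell (\<lambda>v. ?r v * c)"
      by (simp add: eigenprojection_def[abs_def] c_def)
    also have "\<dots> \<le> 1 / Re (of_real (decay \<xi>)) * l2_norm maxwell (\<lambda>v. c)"
      by (rule free_resolvent_mult_L2(2)[OF r]) simp
    also have "l2_norm maxwell (\<lambda>v. c) = norm c"
      using l2_norm_scale[of maxwell c "\<lambda>_. 1"] by simp
    also have "1 / Re (of_real (decay \<xi>)) * norm c \<le> 1 / a * norm c" by (rule mult_right_mono[OF ra]) simp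
    finally show ?thesis .
  qed
  ultimately have "l2_norm maxwell (eigenprojection \<xi> f) \<le> 1 / a * ((1 / a * l2_norm maxwell f) / m)"
    using a by (meson mult_left_mono order_trans zero_le_divide_1_iff less_imp_le)
  then show ?thesis by (simp add: mult.assoc)
qed

lemma eigenprojection_lincomb:
  assumes \<xi>: "\<bar>\<xi>\<bar> < sqrt pi" and "f \<in> L2 maxwell" "g \<in> L2 maxwell"
  shows "eigenprojection \<xi> (\<lambda>v. a * f v + b * g v) v = a * eigenprojection \<xi> f v + b * eigenprojection \<xi> g v"
proof -
  let ?r = "free_resolvent (of_real (decay \<xi>)) \<xi>"
  have r: "?r \<in> L2 maxwell" using decay_root(1)[OF \<xi>] by (intro free_resolvent_L2) simp
  have "(\<integral>v. (a * f v + b * g v) * ?r v \<partial>maxwell) = a * (\<integral>v. f v * ?r v \<partial>maxwell) + b * (\<integral>v. g v * ?r v \<partial>maxwell)"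
    unfolding distrib_right mult.assoc
    using L2_integrable_mult[OF assms(2) r] L2_integrable_mult[OF assms(3) r] by simp
  then show ?thesis by (simp add: eigenprojection_def add_divide_distrib distrib_left mult.left_commute)
qed

text \<open>Pairing the projection with k reproduces the pairing of f with k, thanks to the
  normalisation by \<integral> k^2 w dv. On the complement, multiplication by 1 - k therefore
  preserves the moment.\<close>

lemma eigenprojection_complement:
  assumes \<xi>: "\<bar>\<xi>\<bar> < sqrt pi" and f: "f \<in> L2 maxwell"
  shows "(\<integral>v. (f v - eigenprojection \<xi> f v) * free_resolvent (of_real (decay \<xi>)) \<xi> v \<partial>maxwell) = 0"
proof -
  note d = decay_root[OF \<xi>]
  let ?r = "free_resolvent (of_real (decay \<xi>)) \<xi>"
  let ?D = "gauss_laplace2 (decay \<xi>) (decay \<xi>) \<xi>"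
  have r: "?r \<in> L2 maxwell" using d(1) by (intro free_resolvent_L2) simp
  have D: "?D \<noteq> 0" using gauss_laplace2_pos[OF d(1) d(1), of \<xi>] by simp
  have "(\<integral>v. (f v - eigenprojection \<xi> f v) * ?r v \<partial>maxwell)
      = (\<integral>v. f v * ?r v \<partial>maxwell) - (\<integral>v. eigenprojection \<xi> f v * ?r v \<partial>maxwell)"
    unfolding left_diff_distrib
    by (intro Bochner_Integration.integral_diff L2_integrable_mult f r eigenprojection_L2 \<xi>)
  also have "(\<integral>v. eigenprojection \<xi> f v * ?r v \<partial>maxwell)
      = (\<integral>v. ((\<integral>u. f u * ?r u \<partial>maxwell) / of_real ?D) * (?r v * ?r v) \<partial>maxwell)"
    unfolding eigenprojection_def by (simp only: mult_ac)
  also have "\<dots> = (\<integral>v. f v * ?r v \<partial>maxwell)"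
    using D by (simp only: integral_mult_right_zero integral_free_resolvent_mult[OF d(1) d(1)]) simp
  finally show ?thesis by simp
qed

section \<open>The projector below a fixed cutoff, with constants uniform in the frequency\<close>

locale frequency_cutoff =
  fixes \<xi>0 :: real
  assumes cutoff: "0 < \<xi>0" "\<xi>0 < sqrt pi"
begin

text \<open>Frozen beyond the cutoff: \<open>decay\<close> rests on a definite description that is
  known to be meaningful only for |\<xi>| < sqrt pi, whereas measurability is required over all
  frequencies.\<close>

definition cut_decay :: "real \<Rightarrow> real" where
  "cut_decay \<xi> = decay (min \<bar>\<xi>\<bar> \<xi>0)"

text \<open>Monotonicity of \<open>decay\<close> on [0, \<xi>0] yields Borel measurability; clamping
  the argument to that interval extends the monotone function to the line.\<close>

lemma cut_decay_measurable [measurable]: "cut_decay \<in> borel_measurable borel"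
proof -
  have "mono (\<lambda>x. - decay (min (max 0 x) \<xi>0))"
    using cutoff by (intro monoI) (auto intro!: decay_antimono)
  from borel_measurable_mono[OF this]
  have "(\<lambda>x. - (- decay (min (max 0 x) \<xi>0))) \<in> borel_measurable borel" by measurable
  then have [measurable]: "(\<lambda>x. decay (min (max 0 x) \<xi>0)) \<in> borel_measurable borel" by simp
  have "cut_decay = (\<lambda>x. (\<lambda>x. decay (min (max 0 x) \<xi>0)) \<bar>x\<bar>)" by (auto simp: cut_decay_def)
  also have "\<dots> \<in> borel_measurable borel" by measurable
  finally show ?thesis .
qed

lemma low_frequency: "\<bar>\<xi>\<bar> \<le> \<xi>0 \<Longrightarrow> \<bar>\<xi>\<bar> < sqrt pi"
  using cutoff by simp

text \<open>\<open>decay\<close> is even, by antimonotonicity in the modulus used in both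
  directions.\<close>

lemma cut_decay_eq: "\<bar>\<xi>\<bar> \<le> \<xi>0 \<Longrightarrow> cut_decay \<xi> = decay \<xi>"
  using decay_antimono[of \<xi> "\<bar>\<xi>\<bar>"] decay_antimono[of "\<bar>\<xi>\<bar>" \<xi>] low_frequency[of \<xi>]
  by (simp add: cut_decay_def)

lemma decay_cutoff: "0 < decay \<xi>0" "decay \<xi>0 \<le> 1" "gauss_laplace (decay \<xi>0) \<xi>0 0 = 1"
  using decay_root[of \<xi>0] cutoff by auto

lemma decay_low: "\<bar>\<xi>\<bar> \<le> \<xi>0 \<Longrightarrow> decay \<xi>0 \<le> decay \<xi>"
  using cutoff by (intro decay_antimono) auto

text \<open>\<open>gauss_laplace2\<close> decreases in both rates and in |\<xi>|, and the rates in
  question are at most 1, so this is a lower bound for it below the cutoff.\<close>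

definition gap :: real where "gap = gauss_laplace2 1 1 \<xi>0"

lemma gap_pos: "gap > 0"
  unfolding gap_def by (rule gauss_laplace2_pos) auto

lemma gap_le:
  assumes "\<bar>\<xi>\<bar> \<le> \<xi>0" "0 < a" "a \<le> 1" "0 < b" "b \<le> 1"
  shows "gap \<le> gauss_laplace2 a b \<xi>"
  unfolding gap_def using assms cutoff by (intro gauss_laplace2_le) (auto simp: abs_le_square_iff[symmetric])

text \<open>An explicit counterpart of \<open>trunc_projector\<close>, defined for every \<xi> and
  preserving joint measurability, against which the chosen one is compared.\<close>

definition projector :: "(real \<times> real \<Rightarrow> complex) \<Rightarrow> real \<times> real \<Rightarrow> complex" where
  "projector F = (\<lambda>(\<xi>, v). if \<bar>\<xi>\<bar> \<le> \<xi>0 then eigenprojection \<xi> (\<lambda>u. F (\<xi>, u)) v else 0)"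

lemma projector_measurable:
  assumes [measurable]: "F \<in> borel_measurable (borel \<Otimes>\<^sub>M borel)"
  shows "projector F \<in> borel_measurable (borel \<Otimes>\<^sub>M borel)"
proof -
  have "projector F = (\<lambda>(\<xi>, v). if \<bar>\<xi>\<bar> \<le> \<xi>0 then free_resolvent (of_real (cut_decay \<xi>)) \<xi> v *
     ((\<integral>u. F (\<xi>, u) * free_resolvent (of_real (cut_decay \<xi>)) \<xi> u \<partial>maxwell)
        / of_real (gauss_laplace2 (cut_decay \<xi>) (cut_decay \<xi>) \<xi>)) else 0)"
    by (auto simp: projector_def eigenprojection_def cut_decay_eq)
  also have "\<dots> \<in> borel_measurable (borel \<Otimes>\<^sub>M borel)" by measurable
  finally show ?thesis .
qed

definition projector_bound :: real where "projector_bound = 1 / (decay \<xi>0 * decay \<xi>0 * gap)"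

lemma projector_bounded: "l2_bounded phase phase projector_bound projector"
  unfolding l2_bounded_def
proof (intro conjI ballI allI)
  show nn: "0 \<le> projector_bound" using decay_cutoff gap_pos by (simp add: projector_bound_def)
  fix F assume F: "F \<in> L2 phase"
  have [measurable]: "F \<in> borel_measurable (borel \<Otimes>\<^sub>M borel)"
    by (rule phase_borel[OF F])
  have meas: "projector F \<in> borel_measurable (lborel \<Otimes>\<^sub>M maxwell)"
    using projector_measurable[of F] by measurable
  have ae: "AE \<xi> in lborel. (\<lambda>v. F (\<xi>, v)) \<in> L2 maxwell \<longrightarrow> (\<lambda>v. projector F (\<xi>, v)) \<in> L2 maxwell \<and>
        l2_norm maxwell (\<lambda>v. projector F (\<xi>, v)) \<le> projector_bound * l2_norm maxwell (\<lambda>v. F (\<xi>, v))"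
  proof (intro AE_I2 impI)
    fix \<xi> assume f: "(\<lambda>v. F (\<xi>, v)) \<in> L2 maxwell"
    show "(\<lambda>v. projector F (\<xi>, v)) \<in> L2 maxwell \<and>
        l2_norm maxwell (\<lambda>v. projector F (\<xi>, v)) \<le> projector_bound * l2_norm maxwell (\<lambda>v. F (\<xi>, v))"
    proof (cases "\<bar>\<xi>\<bar> \<le> \<xi>0")
      case True
      note d = decay_root[OF low_frequency[OF True]]
      have "l2_norm maxwell (eigenprojection \<xi> (\<lambda>v. F (\<xi>, v))) \<le> projector_bound * l2_norm maxwell (\<lambda>v. F (\<xi>, v))"
        unfolding projector_bound_def
        by (rule eigenprojection_bound[OF low_frequency[OF True] f decay_cutoff(1) decay_low[OF True] gap_pos
              gap_le[OF True d(1,2) d(1,2)]])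
      then show ?thesis using True eigenprojection_L2[OF low_frequency[OF True]] by (simp add: projector_def)
    next
      case False
      then show ?thesis using nn by (simp add: projector_def l2_norm_def)
    qed
  qed
  show "projector F \<in> L2 phase" "l2_norm phase (projector F) \<le> projector_bound * l2_norm phase F"
    using L2_pair_dominated[OF sigma_finite_lborel sigma_finite_maxwell sigma_finite_maxwell
        F[unfolded phase_def] meas nn ae]
    unfolding phase_def by this+
  fix G a b assume G: "G \<in> L2 phase"
  show "AE z in phase. projector (\<lambda>y. a * F y + b * G y) z = a * projector F z + b * projector G z"
    using AE_phase_fst[OF L2_phase_fst(1)[OF F]] AE_phase_fst[OF L2_phase_fst(1)[OF G]]
  proof eventually_elim
    case (elim z)
    then show ?case
      by (cases z) (simp add: projector_def eigenprojection_lincomb low_frequency)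
  qed
qed

text \<open>\<open>projector F\<close> witnesses the choice, and the identification of the Riesz
  projection on almost every fibre leaves only the freedom of a null set.\<close>

lemma trunc_projector:
  assumes F: "F \<in> L2 phase"
  shows "trunc_projector \<xi>0 F \<in> L2 phase" "AE z in phase. trunc_projector \<xi>0 F z = projector F z"
proof -
  let ?P = "\<lambda>G. G \<in> L2 phase \<and>
     (AE \<xi> in lborel.
        if \<xi> \<in> {-\<xi>0..\<xi>0}
        then ((\<lambda>v. F (\<xi>, v)), (\<lambda>v. G (\<xi>, v)))
               \<in> riesz_projection maxwell (L_op \<xi>) (complex_of_real (lambda_star \<xi>))
        else (AE v in maxwell. G (\<xi>, v) = 0))"
  have low: "\<xi> \<in> {-\<xi>0..\<xi>0} \<longleftrightarrow> \<bar>\<xi>\<bar> \<le> \<xi>0" for \<xi> by auto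
  have "?P (projector F)"
  proof (intro conjI l2_bounded_L2[OF projector_bounded F])
    show "AE \<xi> in lborel.
        if \<xi> \<in> {-\<xi>0..\<xi>0}
        then ((\<lambda>v. F (\<xi>, v)), (\<lambda>v. projector F (\<xi>, v)))
               \<in> riesz_projection maxwell (L_op \<xi>) (complex_of_real (lambda_star \<xi>))
        else (AE v in maxwell. projector F (\<xi>, v) = 0)"
      using L2_phase_fst(1)[OF F]
    proof eventually_elim
      case (elim \<xi>)
      then show ?case
        unfolding low using riesz_projection_eq_eigenprojection[OF low_frequency[of \<xi>]] eigenprojection_L2[OF low_frequency[of \<xi>]]
        by (auto simp: projector_def)
    qed
  qed
  then have *: "?P (trunc_projector \<xi>0 F)"
    unfolding trunc_projector_def by (rule someI[of ?P])
  then show L2: "trunc_projector \<xi>0 F \<in> L2 phase" by blast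
  from conjunct2[OF *] have "AE \<xi> in lborel. AE v in maxwell. trunc_projector \<xi>0 F (\<xi>, v) = projector F (\<xi>, v)"
  proof eventually_elim
    case (elim \<xi>)
    then show ?case
      unfolding low using riesz_projection_eq_eigenprojection[OF low_frequency[of \<xi>]]
      by (auto simp: projector_def split: if_splits)
  qed
  then show "AE z in phase. trunc_projector \<xi>0 F z = projector F z"
  proof (rule AE_phase_I[rotated])
    have [measurable]: "F \<in> borel_measurable (borel \<Otimes>\<^sub>M borel)" "trunc_projector \<xi>0 F \<in> borel_measurable (borel \<Otimes>\<^sub>M borel)"
      using L2_measurable[OF F] L2_measurable[OF L2] by (simp_all cong: measurable_cong_sets)
    note [measurable] = projector_measurable[of F]
    show "Measurable.pred (borel \<Otimes>\<^sub>M borel) (\<lambda>z. trunc_projector \<xi>0 F z = projector F z)"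
      by measurable
  qed
qed

lemma projector_L_hat:
  assumes FG: "(F, G) \<in> L_hat"
  shows "(projector F, projector G) \<in> L_hat"
proof -
  have "AE \<xi> in lborel. ((\<lambda>v. F (\<xi>, v)), (\<lambda>v. G (\<xi>, v))) \<in> L_op \<xi>"
    using FG by (simp add: L_hat_def)
  then have "AE \<xi> in lborel. ((\<lambda>v. projector F (\<xi>, v)), (\<lambda>v. projector G (\<xi>, v))) \<in> L_op \<xi>"
  proof eventually_elim
    case (elim \<xi>)
    show ?case
    proof (cases "\<bar>\<xi>\<bar> \<le> \<xi>0")
      case True
      then show ?thesis
        using eigenprojection_L_op[OF low_frequency[OF True] elim] by (simp add: projector_def)
    qed (simp add: projector_def L_op_def l2_inner_def)
  qed
  then show ?thesis
    using l2_bounded_L2[OF projector_bounded] L_hat_L2[OF FG] by (simp add: L_hat_def)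
qed

lemma projector_complement:
  assumes F: "F \<in> L2 phase"
  shows "AE \<xi> in lborel. \<bar>\<xi>\<bar> \<le> \<xi>0 \<longrightarrow>
    (\<integral>v. (F (\<xi>, v) - projector F (\<xi>, v)) * free_resolvent (of_real (decay \<xi>)) \<xi> v \<partial>maxwell) = 0"
  using L2_phase_fst(1)[OF F]
proof eventually_elim
  case (elim \<xi>)
  then show ?case
    using eigenprojection_complement[OF low_frequency elim, of \<xi>] by (auto simp: projector_def)
qed

end

context frequency_cutoff
begin

subsection \<open>The Lyapunov functional on the phase space\<close>

definition psi :: "real \<Rightarrow> real \<Rightarrow> complex" where
  "psi \<xi> v = (if \<bar>\<xi>\<bar> \<le> \<xi>0 then 1 - free_resolvent (of_real (cut_decay \<xi>)) \<xi> v else 1)"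

text \<open>The kernel \<kappa> of the overview in closed form; \<open>transport_psi\<close>
  identifies it with the transport of \<open>psi \<xi>\<close> and thereby shows that the latter is
  real.\<close>

definition kap :: "real \<Rightarrow> real \<Rightarrow> real \<Rightarrow> real" where
  "kap \<beta> \<xi> s = exp (- (\<beta> * s)) *
     (exp (- (\<xi>\<^sup>2 * s\<^sup>2 / 4)) - (if \<bar>\<xi>\<bar> \<le> \<xi>0 then gauss_laplace (cut_decay \<xi>) \<xi> s else 0))"

text \<open>The number q of the overview: the first entry serves |\<xi>| > \<xi>0, the second
  |\<xi>| \<le> \<xi>0.\<close>

definition contraction :: "real \<Rightarrow> real" where
  "contraction \<beta> = max (gauss_laplace \<beta> \<xi>0 0) (1 - decay \<xi>0 * gap)"

lemma psi_measurable: "psi \<xi> \<in> borel_measurable borel"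
  unfolding psi_def by measurable

lemma kap_measurable: "kap \<beta> \<xi> \<in> borel_measurable borel"
  unfolding kap_def by measurable

lemma cut_decay_pos: "0 < cut_decay \<xi>" "decay \<xi>0 \<le> cut_decay \<xi>" "cut_decay \<xi> \<le> 1"
  using decay_root[of "min \<bar>\<xi>\<bar> \<xi>0"] decay_antimono[of "min \<bar>\<xi>\<bar> \<xi>0" \<xi>0] cutoff
  by (auto simp: cut_decay_def)

lemma psi_bound: "norm (psi \<xi> v) \<le> 1 + 1 / decay \<xi>0"
proof (cases "\<bar>\<xi>\<bar> \<le> \<xi>0")
  case True
  have "norm (psi \<xi> v) \<le> 1 + norm (free_resolvent (of_real (cut_decay \<xi>)) \<xi> v)"
    using True norm_triangle_ineq4[of 1 "free_resolvent (of_real (cut_decay \<xi>)) \<xi> v"] by (simp add: psi_def)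
  also have "norm (free_resolvent (of_real (cut_decay \<xi>)) \<xi> v) \<le> 1 / decay \<xi>0"
    using decay_cutoff(1) cut_decay_pos(2) by (intro norm_free_resolvent_le) auto
  finally show ?thesis by simp
qed (use decay_cutoff(1) in \<open>simp add: psi_def\<close>)

text \<open>Below the cutoff the relation \<open>gauss_laplace (decay \<xi>) \<xi> 0 = 1\<close>
  turns \<open>gauss_laplace_shift_le\<close> into the statement that the subtracted term does not
  exceed the Gaussian.\<close>

lemma kap_nonneg: "s \<ge> 0 \<Longrightarrow> kap \<beta> \<xi> s \<ge> 0"
  using gauss_laplace_shift_le[OF cut_decay_pos(1), of s \<xi> \<xi>] decay_root(3)[OF low_frequency, of \<xi>]
  by (auto simp: kap_def cut_decay_eq)

text \<open>The subtracted term is nonnegative. The sum 0 + s makes the right side literally the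
  integrand of \<open>gauss_laplace \<beta> \<xi> 0\<close>.\<close>

lemma kap_le: "kap \<beta> \<xi> s \<le> exp (- (\<beta> * s) - \<xi>\<^sup>2 * (0 + s)\<^sup>2 / 4)"
proof -
  have "kap \<beta> \<xi> s \<le> exp (- (\<beta> * s)) * exp (- (\<xi>\<^sup>2 * s\<^sup>2 / 4))"
    unfolding kap_def using gauss_laplace_pos[OF cut_decay_pos(1), of \<xi> \<xi> s]
    by (intro mult_left_mono) auto
  then show ?thesis by (simp add: exp_add[symmetric])
qed

lemma kap_continuous: "continuous_on {0..} (kap \<beta> \<xi>)"
proof -
  have "continuous_on {0..} (gauss_laplace (cut_decay \<xi>) \<xi>)"
    using gauss_laplace_continuous[OF cut_decay_pos(1)] by (intro continuous_at_imp_continuous_on) blast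
  then show ?thesis
    unfolding kap_def[abs_def] by (cases "\<bar>\<xi>\<bar> \<le> \<xi>0") (auto intro!: continuous_intros)
qed

lemma kap_integrable:
  assumes "\<beta> > 0"
  shows "set_integrable lborel {0<..} (kap \<beta> \<xi>)"
proof (rule set_integrable_exp_bound[OF assms kap_measurable])
  fix s :: real assume s: "s > 0"
  have "kap \<beta> \<xi> s \<le> exp (- (\<beta> * s))"
    by (rule order_trans[OF kap_le]) simp
  then show "norm (kap \<beta> \<xi> s) \<le> 1 * exp (- (\<beta> * s))"
    using kap_nonneg[of s \<beta> \<xi>] s by simp
qed

lemma transport_psi: "transport \<beta> \<xi> (psi \<xi>) s = of_real (kap \<beta> \<xi> s)"
proof -
  let ?e = "\<lambda>v. exp (- (\<i> * complex_of_real (v * \<xi> * s)))"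
  let ?r = "free_resolvent (of_real (cut_decay \<xi>)) \<xi>"
  have split: "exp (- (rate \<beta> \<xi> v * complex_of_real s)) = of_real (exp (- (\<beta> * s))) * ?e v" for v
  proof -
    have "- (rate \<beta> \<xi> v * complex_of_real s) = of_real (- (\<beta> * s)) + - (\<i> * complex_of_real (v * \<xi> * s))"
      by (simp add: rate_def algebra_simps)
    then show ?thesis by (simp only: exp_add exp_of_real)
  qed
  have e_norm: "norm (?e v) \<le> 1" for v by (simp add: norm_exp_eq_Re)
  have e_L2: "?e \<in> L2 maxwell" by (rule maxwell_bounded_L2[OF _ e_norm]) measurable
  have r: "?r \<in> L2 maxwell" using cut_decay_pos(1) by (intro free_resolvent_L2) simp
  have "transport \<beta> \<xi> (psi \<xi>) s = of_real (exp (- (\<beta> * s))) * (\<integral>v. ?e v * psi \<xi> v \<partial>maxwell)"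
    unfolding transport_def split mult.assoc by (rule integral_mult_right_zero)
  also have "(\<integral>v. ?e v * psi \<xi> v \<partial>maxwell)
     = of_real (exp (- (\<xi>\<^sup>2 * s\<^sup>2 / 4)) - (if \<bar>\<xi>\<bar> \<le> \<xi>0 then gauss_laplace (cut_decay \<xi>) \<xi> s else 0))"
  proof (cases "\<bar>\<xi>\<bar> \<le> \<xi>0")
    case True
    have "(\<integral>v. ?e v * psi \<xi> v \<partial>maxwell) = (\<integral>v. ?e v - ?e v * ?r v \<partial>maxwell)"
      using True by (simp only: psi_def if_True right_diff_distrib mult_1_right)
    also have "\<dots> = (\<integral>v. ?e v \<partial>maxwell) - (\<integral>v. ?e v * ?r v \<partial>maxwell)"
      by (intro Bochner_Integration.integral_diff L2_maxwell_integrable e_L2 L2_integrable_mult r)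
    finally show ?thesis
      unfolding fourier_maxwell_minus integral_free_resolvent_fourier[OF cut_decay_pos(1)] using True by simp
  next
    case False
    then show ?thesis by (simp only: psi_def if_False mult_1_right fourier_maxwell_minus diff_zero)
  qed
  finally show ?thesis by (simp add: kap_def)
qed

text \<open>The dispersion integral at the cutoff frequency is 1 at the rate
  \<open>decay \<xi>0\<close>, hence strictly less at any larger rate; this is where \<epsilon> > 0
  is spent. The other entry is below 1 because \<open>gap\<close> is positive.\<close>

lemma contraction_less_1:
  assumes "\<beta> > decay \<xi>0"
  shows "contraction \<beta> < 1"
  using gauss_laplace_strict[OF decay_cutoff(1) assms, of \<xi>0] decay_cutoff gap_pos
  by (simp add: contraction_def)

text \<open>Above the cutoff the kernel is dominated by the one at the cutoff frequency.  Below it the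
  mass is evaluated at the rate of the cutoff, where the first resolvent identity applies.\<close>

lemma kap_integral_le:
  assumes \<beta>: "\<beta> > decay \<xi>0"
  shows "(LINT s:{0<..}|lborel. kap \<beta> \<xi> s) \<le> contraction \<beta>"
proof (cases "\<bar>\<xi>\<bar> \<le> \<xi>0")
  case False
  have \<beta>0: "\<beta> > 0" using \<beta> decay_cutoff(1) by simp
  have "(LINT s:{0<..}|lborel. kap \<beta> \<xi> s) \<le> gauss_laplace \<beta> \<xi>0 0"
    unfolding gauss_laplace_def
  proof (rule set_integral_mono[OF kap_integrable[OF \<beta>0] gauss_laplace_integrable[OF \<beta>0]])
    fix s :: real
    have "\<xi>0\<^sup>2 \<le> \<xi>\<^sup>2" using False cutoff by (simp add: abs_le_square_iff[symmetric])
    then have "\<xi>0\<^sup>2 * (0 + s)\<^sup>2 \<le> \<xi>\<^sup>2 * (0 + s)\<^sup>2" by (rule mult_right_mono) simp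
    then show "kap \<beta> \<xi> s \<le> exp (- (\<beta> * s) - \<xi>0\<^sup>2 * (0 + s)\<^sup>2 / 4)"
      by (intro order_trans[OF kap_le]) simp
  qed
  then show ?thesis by (simp add: contraction_def)
next
  case True
  let ?a = "decay \<xi>" and ?b = "decay \<xi>0"
  note d = decay_root[OF low_frequency[OF True]]
  have \<beta>0: "\<beta> > 0" using \<beta> decay_cutoff(1) by simp
  note int = gauss_laplace_integrable[OF decay_cutoff(1), of \<xi> 0] gauss_laplace2_integrable[OF decay_cutoff(1) d(1), of \<xi>]
  have "(LINT s:{0<..}|lborel. kap \<beta> \<xi> s) \<le> (LINT s:{0<..}|lborel.
      exp (- (?b * s) - \<xi>\<^sup>2 * (0 + s)\<^sup>2 / 4) - exp (- (?b * s)) * gauss_laplace ?a \<xi> s)"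
  proof (rule set_integral_mono[OF kap_integrable[OF \<beta>0] set_integral_diff(1)[OF int]])
    fix s :: real assume "s \<in> {0<..}"
    then have s: "s \<ge> 0" by simp
    \<comment> \<open>The kernel at the rate of the cutoff is nonnegative, so lowering \<beta> to
      that rate can only enlarge the mass.\<close>
    have "kap \<beta> \<xi> s = exp (- ((\<beta> - ?b) * s)) * kap ?b \<xi> s"
      by (simp add: kap_def mult.assoc[symmetric] exp_add[symmetric] algebra_simps)
    also have "\<dots> \<le> 1 * kap ?b \<xi> s"
      using \<beta> s kap_nonneg[OF s] by (intro mult_right_mono) auto
    also have "kap ?b \<xi> s = exp (- (?b * s) - \<xi>\<^sup>2 * (0 + s)\<^sup>2 / 4) - exp (- (?b * s)) * gauss_laplace ?a \<xi> s"
      using True by (simp add: kap_def cut_decay_eq right_diff_distrib exp_add[symmetric])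
    finally show "kap \<beta> \<xi> s \<le> exp (- (?b * s) - \<xi>\<^sup>2 * (0 + s)\<^sup>2 / 4) - exp (- (?b * s)) * gauss_laplace ?a \<xi> s"
      by simp
  qed
  also have "\<dots> = gauss_laplace ?b \<xi> 0 - gauss_laplace2 ?b ?a \<xi>"
    unfolding gauss_laplace_def[of ?b] gauss_laplace2_def by (rule set_integral_diff(2)[OF int])
  \<comment> \<open>\<open>gauss_laplace_diff\<close>, with the value 1 at the rate
    \<open>?a\<close>, evaluates the first term as 1 + (\<open>?a\<close> - \<open>?b\<close>) times
    \<open>gauss_laplace2\<close>. Since \<open>?a\<close> is at most 1, the coefficient left over
    is at least \<open>?b\<close>.\<close>
  also have "\<dots> = 1 - (1 - ?a + ?b) * gauss_laplace2 ?b ?a \<xi>"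
    using gauss_laplace_diff[OF decay_cutoff(1) d(1), of \<xi>] d(3) by (simp add: algebra_simps)
  also have "\<dots> \<le> 1 - ?b * gap"
    using d(2) decay_cutoff gap_le[OF True decay_cutoff(1,2) d(1,2)] gap_pos
    by (intro diff_left_mono mult_mono) auto
  finally show ?thesis by (simp add: contraction_def)
qed

definition lyap :: "real \<Rightarrow> (real \<times> real \<Rightarrow> complex) \<Rightarrow> real \<times> real \<Rightarrow> complex" where
  "lyap \<beta> F = (\<lambda>(\<xi>, s). lyap_map \<beta> \<xi> (psi \<xi>) (kap \<beta> \<xi>) (\<lambda>v. F (\<xi>, v)) s)"

lemma lyap_measurable:
  assumes [measurable]: "F \<in> borel_measurable (borel \<Otimes>\<^sub>M borel)"
  shows "lyap \<beta> F \<in> borel_measurable (borel \<Otimes>\<^sub>M borel)"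
  unfolding lyap_def lyap_map_def lyap_weight_if transport_def kap_def psi_def rate_def
  by measurable

lemma kap_weight:
  assumes "\<beta> > decay \<xi>0"
  shows "\<forall>s\<ge>0. 1 - contraction \<beta> \<le> lyap_weight (kap \<beta> \<xi>) s"
proof -
  have "\<beta> > 0" using assms decay_cutoff(1) by simp
  then show ?thesis
    using lyap_weight(1)[OF kap_continuous _ kap_integrable kap_integral_le[OF assms]] kap_nonneg by blast
qed

definition lyap_bound :: "real \<Rightarrow> real" where
  "lyap_bound \<beta> = (1 + 1 / decay \<xi>0) / (sqrt (1 - contraction \<beta>) * sqrt (2 * \<beta>))"

lemma lyap_bounded:
  assumes \<beta>: "\<beta> > decay \<xi>0"
  shows "l2_bounded phase (lborel \<Otimes>\<^sub>M lborel) (lyap_bound \<beta>) (lyap \<beta>)"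
  unfolding l2_bounded_def
proof (intro conjI ballI allI)
  have \<beta>0: "\<beta> > 0" using \<beta> decay_cutoff(1) by simp
  show nn: "0 \<le> lyap_bound \<beta>"
    unfolding lyap_bound_def using contraction_less_1[OF \<beta>] \<beta>0 decay_cutoff(1)
    by (intro divide_nonneg_nonneg mult_nonneg_nonneg add_nonneg_nonneg) auto
  fix F assume F: "F \<in> L2 phase"
  have meas: "lyap \<beta> F \<in> borel_measurable (lborel \<Otimes>\<^sub>M lborel)"
    using lyap_measurable[OF phase_borel[OF F]] by measurable
  have ae: "AE \<xi> in lborel. (\<lambda>v. F (\<xi>, v)) \<in> L2 maxwell \<longrightarrow> (\<lambda>s. lyap \<beta> F (\<xi>, s)) \<in> L2 lborel \<and>
        l2_norm lborel (\<lambda>s. lyap \<beta> F (\<xi>, s)) \<le> lyap_bound \<beta> * l2_norm maxwell (\<lambda>v. F (\<xi>, v))"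
  proof (intro AE_I2 impI)
    fix \<xi> assume f: "(\<lambda>v. F (\<xi>, v)) \<in> L2 maxwell"
    have m: "lyap_map \<beta> \<xi> (psi \<xi>) (kap \<beta> \<xi>) (\<lambda>v. F (\<xi>, v)) \<in> borel_measurable borel"
      using measurable_compose[OF measurable_Pair1' lyap_measurable[OF phase_borel[OF F]], of \<xi> \<beta>]
      by (simp add: lyap_def)
    show "(\<lambda>s. lyap \<beta> F (\<xi>, s)) \<in> L2 lborel \<and>
        l2_norm lborel (\<lambda>s. lyap \<beta> F (\<xi>, s)) \<le> lyap_bound \<beta> * l2_norm maxwell (\<lambda>v. F (\<xi>, v))"
      using lyap_map_L2[OF \<beta>0 contraction_less_1[OF \<beta>] kap_weight[OF \<beta>] psi_measurable psi_bound f m]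
      by (simp add: lyap_def lyap_bound_def)
  qed
  show "lyap \<beta> F \<in> L2 (lborel \<Otimes>\<^sub>M lborel)" "l2_norm (lborel \<Otimes>\<^sub>M lborel) (lyap \<beta> F) \<le> lyap_bound \<beta> * l2_norm phase F"
    using L2_pair_dominated[OF sigma_finite_lborel sigma_finite_maxwell sigma_finite_lborel
        F[unfolded phase_def] meas nn ae]
    unfolding phase_def by this+
  fix G a b assume G: "G \<in> L2 phase"
  have "AE z in lborel \<Otimes>\<^sub>M (lborel :: real measure). (\<lambda>v. F (fst z, v)) \<in> L2 maxwell \<and> (\<lambda>v. G (fst z, v)) \<in> L2 maxwell"
    using L2_phase_fst(1)[OF F] L2_phase_fst(1)[OF G]
    by (intro AE_pair_measure_fst[OF sigma_finite_lborel]) (auto elim: eventually_elim2)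
  then show "AE z in lborel \<Otimes>\<^sub>M lborel. lyap \<beta> (\<lambda>y. a * F y + b * G y) z = a * lyap \<beta> F z + b * lyap \<beta> G z"
  proof eventually_elim
    case (elim z)
    obtain \<xi> s where z: "z = (\<xi>, s)" by (cases z)
    let ?E = "\<lambda>v. exp (- (rate \<beta> \<xi> v * complex_of_real s))"
    have f: "(\<lambda>v. F (\<xi>, v)) \<in> L2 maxwell" and g: "(\<lambda>v. G (\<xi>, v)) \<in> L2 maxwell" using elim by (auto simp: z)
    note int = transport_integrable(1)[OF L2_maxwell_integrable[OF L2_maxwell_bounded_mult[OF psi_measurable psi_bound f]], of \<beta> \<xi> s \<xi>]
      transport_integrable(1)[OF L2_maxwell_integrable[OF L2_maxwell_bounded_mult[OF psi_measurable psi_bound g]], of \<beta> \<xi> s \<xi>]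
    have "transport \<beta> \<xi> (\<lambda>v. psi \<xi> v * (a * F (\<xi>, v) + b * G (\<xi>, v))) s
      = (\<integral>v. a * (?E v * (psi \<xi> v * F (\<xi>, v))) + b * (?E v * (psi \<xi> v * G (\<xi>, v))) \<partial>maxwell)"
      unfolding transport_def by (simp only: distrib_left mult.left_commute)
    also have "\<dots> = a * transport \<beta> \<xi> (\<lambda>v. psi \<xi> v * F (\<xi>, v)) s + b * transport \<beta> \<xi> (\<lambda>v. psi \<xi> v * G (\<xi>, v)) s"
      unfolding transport_def
      by (subst Bochner_Integration.integral_add[OF integrable_mult_right[OF int(1)] integrable_mult_right[OF int(2)]])
         (simp only: integral_mult_right_zero)
    finally show ?case
      unfolding lyap_def lyap_map_def z prod.case by (simp only: distrib_left mult.left_commute)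
  qed
qed

text \<open>The fibre inequality integrated over \<xi>. This is possible because \<eta> and \<beta>
  - 1 do not depend on the frequency, which is the purpose of the uniform bound
  \<open>contraction \<beta>\<close>.\<close>

lemma lyapunov_phase:
  assumes \<beta>: "\<beta> > decay \<xi>0" and FG: "(F, G) \<in> L_hat"
    and ortho: "AE \<xi> in lborel. \<bar>\<xi>\<bar> \<le> \<xi>0 \<longrightarrow>
      (\<integral>v. F (\<xi>, v) * free_resolvent (of_real (decay \<xi>)) \<xi> v \<partial>maxwell) = 0"
  defines "\<eta> \<equiv> (1 - contraction \<beta>) / 2" and "Y \<equiv> lyap \<beta>"
  shows "\<eta> * Re (l2_inner phase G F) + Re (l2_inner (lborel \<Otimes>\<^sub>M lborel) (Y G) (Y F))
    \<le> (\<beta> - 1) * (\<eta> * (l2_norm phase F)\<^sup>2 + (l2_norm (lborel \<Otimes>\<^sub>M lborel) (Y F))\<^sup>2)"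
proof -
  have \<beta>0: "\<beta> > 0" using \<beta> decay_cutoff(1) by simp
  note L2 = L_hat_L2[OF FG]
  note YL2 = l2_bounded_L2[OF lyap_bounded[OF \<beta>], folded Y_def]
  note ll = sigma_finite_lborel sigma_finite_lborel
  have inner: "integrable lborel (\<lambda>\<xi>. Re (l2_inner lborel (\<lambda>s. Y G (\<xi>, s)) (\<lambda>s. Y F (\<xi>, s))))"
    "Re (l2_inner (lborel \<Otimes>\<^sub>M lborel) (Y G) (Y F)) = (\<integral>\<xi>. Re (l2_inner lborel (\<lambda>s. Y G (\<xi>, s)) (\<lambda>s. Y F (\<xi>, s))) \<partial>lborel)"
    using l2_inner_pair[OF ll YL2[OF L2(2)] YL2[OF L2(1)]] by (auto intro: integrable_Re simp: integral_Re)
  note ph = phase_inner[OF L2(2,1)]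
  note nF = L2_phase_fst(2,3)[OF L2(1)]
  note nY = L2_pair_fst(2,3)[OF ll YL2[OF L2(1)]]
  have "\<eta> * Re (l2_inner phase G F) + Re (l2_inner (lborel \<Otimes>\<^sub>M lborel) (Y G) (Y F))
    = (\<integral>\<xi>. \<eta> * Re (l2_inner maxwell (\<lambda>v. G (\<xi>, v)) (\<lambda>v. F (\<xi>, v)))
        + Re (l2_inner lborel (\<lambda>s. Y G (\<xi>, s)) (\<lambda>s. Y F (\<xi>, s))) \<partial>lborel)"
    unfolding ph(2) inner(2) using ph(1) inner(1) by simp
  also have "\<dots> \<le> (\<integral>\<xi>. (\<beta> - 1) * (\<eta> * (l2_norm maxwell (\<lambda>v. F (\<xi>, v)))\<^sup>2
        + (l2_norm lborel (\<lambda>s. Y F (\<xi>, s)))\<^sup>2) \<partial>lborel)"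
  proof (rule integral_mono_AE)
    have "AE \<xi> in lborel. ((\<lambda>v. F (\<xi>, v)), (\<lambda>v. G (\<xi>, v))) \<in> L_op \<xi>"
      using FG by (simp add: L_hat_def)
    then show "AE \<xi> in lborel. \<eta> * Re (l2_inner maxwell (\<lambda>v. G (\<xi>, v)) (\<lambda>v. F (\<xi>, v)))
        + Re (l2_inner lborel (\<lambda>s. Y G (\<xi>, s)) (\<lambda>s. Y F (\<xi>, s)))
        \<le> (\<beta> - 1) * (\<eta> * (l2_norm maxwell (\<lambda>v. F (\<xi>, v)))\<^sup>2 + (l2_norm lborel (\<lambda>s. Y F (\<xi>, s)))\<^sup>2)"
      using ortho
    proof eventually_elim
      case (elim \<xi>)
      have f: "(\<lambda>v. F (\<xi>, v)) \<in> L2 maxwell" using elim(1) by (simp add: L_op_def)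
      \<comment> \<open>Below the cutoff the vanishing pairing with k makes multiplication by 1 - k
        preserve the moment; above it \<open>psi \<xi>\<close> is 1.\<close>
      have moment: "(\<integral>v. psi \<xi> v * F (\<xi>, v) \<partial>maxwell) = (\<integral>v. F (\<xi>, v) \<partial>maxwell)"
      proof (cases "\<bar>\<xi>\<bar> \<le> \<xi>0")
        case True
        let ?r = "free_resolvent (of_real (decay \<xi>)) \<xi>"
        have r: "?r \<in> L2 maxwell" using decay_root(1)[OF low_frequency[OF True]] by (intro free_resolvent_L2) simp
        have "(\<integral>v. psi \<xi> v * F (\<xi>, v) \<partial>maxwell) = (\<integral>v. F (\<xi>, v) - F (\<xi>, v) * ?r v \<partial>maxwell)"
          using True by (simp add: psi_def cut_decay_eq algebra_simps)
        also have "\<dots> = (\<integral>v. F (\<xi>, v) \<partial>maxwell) - (\<integral>v. F (\<xi>, v) * ?r v \<partial>maxwell)"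
          by (intro Bochner_Integration.integral_diff L2_maxwell_integrable f L2_integrable_mult r)
        finally show ?thesis using elim(2) True by simp
      qed (simp add: psi_def)
      show ?case
        unfolding Y_def lyap_def prod.case \<eta>_def
        by (rule lyapunov_fibre[OF elim(1) psi_measurable psi_bound moment \<beta>0 contraction_less_1[OF \<beta>]
              kap_continuous kap_nonneg kap_measurable kap_integrable[OF \<beta>0] kap_integral_le[OF \<beta>] transport_psi])
    qed
  qed (use ph(1) inner(1) nF(1) nY(1) in simp_all)
  also have "\<dots> = (\<beta> - 1) * (\<eta> * (l2_norm phase F)\<^sup>2 + (l2_norm (lborel \<Otimes>\<^sub>M lborel) (Y F))\<^sup>2)"
    unfolding nF(2) nY(2) using nF(1) nY(1) by simp
  finally show ?thesis .
qed

end

subsection \<open>The semigroup generated by \<open>L_hat\<close>\<close>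

lemma l2_bounded_compose:
  assumes A: "l2_bounded M N C A" and B: "l2_bounded N K D B"
  shows "l2_bounded M K (D * C) (\<lambda>f. B (A f))"
  unfolding l2_bounded_def
proof (intro conjI ballI allI)
  note C = l2_bounded_nonneg[OF A] and D = l2_bounded_nonneg[OF B]
  show "0 \<le> D * C" using C D by simp
  fix f assume f: "f \<in> L2 M"
  note Af = l2_bounded_L2[OF A f]
  show "B (A f) \<in> L2 K" by (rule l2_bounded_L2[OF B Af])
  have "l2_norm K (B (A f)) \<le> D * l2_norm N (A f)" by (rule l2_bounded_norm[OF B Af])
  also have "\<dots> \<le> D * (C * l2_norm M f)" by (rule mult_left_mono[OF l2_bounded_norm[OF A f] D])
  finally show "l2_norm K (B (A f)) \<le> D * C * l2_norm M f" by (simp add: mult.assoc)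
  fix g a b assume g: "g \<in> L2 M"
  note Ag = l2_bounded_L2[OF A g]
  show "AE x in K. B (A (\<lambda>y. a * f y + b * g y)) x = a * B (A f) x + b * B (A g) x"
    using l2_bounded_cong_AE[OF B l2_bounded_L2[OF A L2_lincomb[OF f g]] L2_lincomb[OF Af Ag] l2_bounded_lincomb[OF A f g], of a b]
      l2_bounded_lincomb[OF B Af Ag, of a b]
    by eventually_elim simp
qed

text \<open>Restricting to \<open>|v \<xi>| \<le> n\<close> lands in the domain.\<close>

lemma L_hat_dense:
  assumes F: "F \<in> L2 phase"
  obtains U where "\<And>n::nat. \<exists>G. (U n, G) \<in> L_hat" "(\<lambda>n. l2_norm phase (\<lambda>z. F z - U n z)) \<longlonglongrightarrow> 0"
proof -
  define B where "B n = {z :: real \<times> real. \<bar>fst z * snd z\<bar> \<le> real n}" for n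
  define U where "U n z = indicator (B n) z * F z" for n z
  have B_sets[measurable]: "B n \<in> sets (borel \<Otimes>\<^sub>M borel)" for n
  proof -
    have "{z \<in> space (borel \<Otimes>\<^sub>M borel). \<bar>fst z * snd z\<bar> \<le> real n} \<in> sets (borel \<Otimes>\<^sub>M (borel :: real measure))"
      by measurable
    then show ?thesis by (simp add: B_def space_pair_measure)
  qed
  have UL2: "U n \<in> L2 phase" for n
    unfolding U_def by (rule L2_indicator[OF F]) simp
  have "\<exists>G. (U n, G) \<in> L_hat" for n
  proof
    let ?m = "\<lambda>z. (- \<i> * complex_of_real (snd z) * complex_of_real (fst z) - 1) * U n z"
    let ?G = "\<lambda>z. ?m z + velocity_avg (U n) z"
    have [measurable]: "U n \<in> borel_measurable (borel \<Otimes>\<^sub>M borel)" by (rule phase_borel[OF UL2])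
    have m: "?m \<in> L2 phase"
    proof (rule L2_dominated(1)[OF UL2[of n], where C = "real n + 1"])
      show "AE z in phase. norm (?m z) \<le> (real n + 1) * norm (U n z)"
      proof (rule AE_I2)
        fix z
        show "norm (?m z) \<le> (real n + 1) * norm (U n z)"
        proof (cases "z \<in> B n")
          case True
          have "norm (- \<i> * complex_of_real (snd z) * complex_of_real (fst z) - 1) \<le> \<bar>fst z * snd z\<bar> + 1"
            by (rule order_trans[OF norm_triangle_ineq4]) (simp add: norm_mult abs_mult mult.commute)
          also have "\<dots> \<le> real n + 1" using True by (simp add: B_def)
          finally show ?thesis unfolding norm_mult by (rule mult_right_mono) simp
        qed (simp add: U_def)
      qed
    qed measurable
    have G: "?G \<in> L2 phase" by (intro L2_add m l2_bounded_L2[OF velocity_avg_bounded UL2])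
    have "AE \<xi> in lborel. ((\<lambda>v. U n (\<xi>, v)), (\<lambda>v. ?G (\<xi>, v))) \<in> L_op \<xi>"
      using L2_phase_fst(1)[OF UL2[of n]] L2_phase_fst(1)[OF G]
      by eventually_elim (simp add: L_op_def velocity_avg_def moment_def)
    then show "(U n, ?G) \<in> L_hat" using UL2 G by (simp add: L_hat_def)
  qed
  moreover have "(\<lambda>n. l2_norm phase (\<lambda>z. F z - U n z)) \<longlonglongrightarrow> 0"
    unfolding U_def
  proof (rule L2_approx_truncation[OF F])
    fix z :: "real \<times> real"
    obtain N where N: "\<bar>fst z * snd z\<bar> \<le> real N" using real_arch_simple by blast
    have "z \<in> B n" if "n \<ge> N" for n
    proof -
      have "real N \<le> real n" using that by simp
      then show ?thesis using N by (simp add: B_def)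
    qed
    then show "\<exists>N. \<forall>n\<ge>N. z \<in> B n" by blast
  qed simp
  ultimately show ?thesis by (rule that)
qed

text \<open>Density of the domain (\<open>L_hat_dense\<close>) together with the two operator
  bounds.\<close>

lemma l2_bounded_eq_on_L_hat:
  assumes A: "l2_bounded phase M C A" and B: "l2_bounded phase M D B"
    and eq: "\<And>F G. (F, G) \<in> L_hat \<Longrightarrow> AE x in M. A F x = B F x" and F: "F \<in> L2 phase"
  shows "AE x in M. A F x = B F x"
proof -
  obtain U where U: "\<And>n::nat. \<exists>G. (U n, G) \<in> L_hat" and lim: "(\<lambda>n. l2_norm phase (\<lambda>z. F z - U n z)) \<longlonglongrightarrow> 0"
    using L_hat_dense[OF F] by blast
  have UL2: "U n \<in> L2 phase" for n using U[of n] L_hat_L2 by blast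
  note AL2 = l2_bounded_L2[OF A] and BL2 = l2_bounded_L2[OF B]
  show ?thesis
  proof (rule l2_eq_AE_by_limit[OF AL2[OF F] BL2[OF F], where e = "\<lambda>n. (C + D) * l2_norm phase (\<lambda>z. F z - U n z)"])
    show "(\<lambda>n. (C + D) * l2_norm phase (\<lambda>z. F z - U n z)) \<longlonglongrightarrow> 0"
      using tendsto_mult_right_zero[OF lim] .
    fix n
    have A_le: "l2_norm M (\<lambda>x. A F x - A (U n) x) \<le> C * l2_norm phase (\<lambda>z. F z - U n z)"
    proof -
      have "l2_norm M (\<lambda>x. A F x - A (U n) x) = l2_norm M (A (\<lambda>z. F z - U n z))"
        using l2_bounded_diff[OF A F UL2[of n]]
        by (intro l2_norm_cong_AE L2_measurable L2_diff AL2 F UL2) auto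
      also have "\<dots> \<le> C * l2_norm phase (\<lambda>z. F z - U n z)" by (intro l2_bounded_norm[OF A] L2_diff F UL2)
      finally show ?thesis .
    qed
    have B_le: "l2_norm M (\<lambda>x. B (U n) x - B F x) \<le> D * l2_norm phase (\<lambda>z. F z - U n z)"
    proof -
      have "l2_norm M (\<lambda>x. B (U n) x - B F x) = l2_norm M (B (\<lambda>z. U n z - F z))"
        using l2_bounded_diff[OF B UL2[of n] F]
        by (intro l2_norm_cong_AE L2_measurable L2_diff BL2 F UL2) auto
      also have "\<dots> \<le> D * l2_norm phase (\<lambda>z. U n z - F z)" by (intro l2_bounded_norm[OF B] L2_diff F UL2)
      finally show ?thesis by (simp add: l2_norm_minus_commute)
    qed
    have "l2_norm M (\<lambda>x. A F x - B F x) \<le> l2_norm M (\<lambda>x. A F x - A (U n) x) + l2_norm M (\<lambda>x. A (U n) x - B F x)"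
      by (rule l2_triangle_via[OF AL2[OF F] AL2[OF UL2] BL2[OF F]])
    also have "l2_norm M (\<lambda>x. A (U n) x - B F x) = l2_norm M (\<lambda>x. B (U n) x - B F x)"
    proof (rule l2_norm_cong_AE)
      obtain G where "(U n, G) \<in> L_hat" using U by blast
      from eq[OF this] show "AE x in M. A (U n) x - B F x = B (U n) x - B F x" by eventually_elim simp
    qed (intro L2_measurable L2_diff AL2 BL2 F UL2)+
    finally show "l2_norm M (\<lambda>x. A F x - B F x) \<le> (C + D) * l2_norm phase (\<lambda>z. F z - U n z)"
      using A_le B_le by (simp add: distrib_right)
  qed
qed

text \<open>Dissipativity makes |u|^2 nonincreasing; the energy lemma is used with the zero map as
  auxiliary operator.\<close>

lemma L_hat_unique:
  assumes u: "\<And>t. t \<ge> 0 \<Longrightarrow> l2_has_derivative phase u (d t) t"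
    and L: "\<And>t. t \<ge> 0 \<Longrightarrow> (u t, d t) \<in> L_hat"
    and 0: "AE z in phase. u 0 z = 0" and t: "t \<ge> 0"
  shows "AE z in phase. u t z = 0"
proof -
  have "l2_bounded phase phase 0 (\<lambda>_ _. 0)" by (simp add: l2_bounded_def l2_norm_def)
  then have "l2_norm phase (u t) \<le> sqrt ((1 + 0\<^sup>2) / 1) * exp (0 * t) * l2_norm phase (u 0)"
  proof (rule l2_energy_decay[OF _ _ u _ t])
    fix t :: real assume "t \<ge> 0"
    from L_hat_dissipative[OF L[OF this]]
    show "1 * Re (l2_inner phase (d t) (u t)) + Re (l2_inner phase (\<lambda>_. 0) (\<lambda>_. 0))
        \<le> 0 * (1 * (l2_norm phase (u t))\<^sup>2 + (l2_norm phase (\<lambda>_. 0))\<^sup>2)"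
      by (simp add: l2_inner_def)
  qed auto
  also have "l2_norm phase (u 0) = 0" using l2_norm_eq_0_iff[OF L_hat_L2(1)[OF L[of 0]]] 0 by simp
  finally have "l2_norm phase (u t) = 0" using l2_norm_nonneg[of phase "u t"] by linarith
  then show ?thesis using l2_norm_eq_0_iff[OF L_hat_L2(1)[OF L[OF t]]] by simp
qed

text \<open>\<open>semigroup_solution\<close> hides its semigroup behind an existential, so two
  solutions may come with different ones. For data in the domain the difference of the orbits solves
  the equation with zero initial value.\<close>

lemma L_hat_semigroup_unique:
  assumes S: "contraction_semigroup phase S" "generator phase S = L_hat"
    and T: "contraction_semigroup phase T" "generator phase T = L_hat"
    and F: "F \<in> L2 phase" and t: "t \<ge> 0"
  shows "AE z in phase. S t F z = T t F z"
proof (rule l2_bounded_eq_on_L_hat[OF contraction_semigroup_bounded[OF S(1) t] contraction_semigroup_bounded[OF T(1) t] _ F])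
  fix F G assume FG: "(F, G) \<in> L_hat"
  note Sg = FG[folded S(2)] and Tg = FG[folded T(2)]
  have "AE z in phase. S t F z - T t F z = 0"
  proof (rule L_hat_unique[OF _ _ _ t])
    fix t :: real assume t: "t \<ge> 0"
    show "l2_has_derivative phase (\<lambda>t z. S t F z - T t F z) (\<lambda>z. S t G z - T t G z) t"
      by (intro l2_has_derivative_diff generator_orbit_derivative S(1) T(1) Sg Tg t)
    show "((\<lambda>z. S t F z - T t F z), (\<lambda>z. S t G z - T t G z)) \<in> L_hat"
      using generator_orbit[OF S(1) Sg t] generator_orbit[OF T(1) Tg t] unfolding S(2) T(2) by (rule L_hat_diff)
  next
    show "AE z in phase. S 0 F z - T 0 F z = 0"
      using contraction_semigroup_0[OF S(1) L_hat_L2(1)[OF FG]] contraction_semigroup_0[OF T(1) L_hat_L2(1)[OF FG]]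
      by eventually_elim simp
  qed
  then show "AE z in phase. S t F z = T t F z" by simp
qed

section \<open>Commutation with the projector and decay of the complement\<close>

context frequency_cutoff
begin

text \<open>For data in the domain both sides solve the equation with the same initial value,
  because \<open>projector\<close> preserves the domain and commutes with the operator; density does
  the rest.\<close>

lemma projector_commute:
  assumes T: "contraction_semigroup phase T" "generator phase T = L_hat"
    and F: "F \<in> L2 phase" and t: "t \<ge> 0"
  shows "AE z in phase. projector (T t F) z = T t (projector F) z"
proof (rule l2_bounded_eq_on_L_hat[OF l2_bounded_compose[OF contraction_semigroup_bounded[OF T(1) t] projector_bounded]
        l2_bounded_compose[OF projector_bounded contraction_semigroup_bounded[OF T(1) t]] _ F])
  fix F G assume FG: "(F, G) \<in> L_hat"
  note Tg = FG[folded T(2)] and PTg = projector_L_hat[OF FG, folded T(2)]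
  have "AE z in phase. projector (T t F) z - T t (projector F) z = 0"
  proof (rule L_hat_unique[OF _ _ _ t])
    fix t :: real assume t: "t \<ge> 0"
    show "l2_has_derivative phase (\<lambda>t z. projector (T t F) z - T t (projector F) z)
        (\<lambda>z. projector (T t G) z - T t (projector G) z) t"
      by (intro l2_has_derivative_diff l2_has_derivative_bounded[OF projector_bounded] generator_orbit_derivative T(1) Tg PTg t)
    show "((\<lambda>z. projector (T t F) z - T t (projector F) z), (\<lambda>z. projector (T t G) z - T t (projector G) z)) \<in> L_hat"
      using projector_L_hat[OF generator_orbit[OF T(1) Tg t, unfolded T(2)]] generator_orbit[OF T(1) PTg t]
      unfolding T(2) by (rule L_hat_diff)
  next
    note L2 = L_hat_L2(1)[OF FG]
    have "AE z in phase. projector (T 0 F) z = projector F z"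
      by (rule l2_bounded_cong_AE[OF projector_bounded l2_bounded_L2[OF contraction_semigroup_bounded[OF T(1)] L2] L2
            contraction_semigroup_0[OF T(1) L2]]) simp
    then show "AE z in phase. projector (T 0 F) z - T 0 (projector F) z = 0"
      using contraction_semigroup_0[OF T(1) l2_bounded_L2[OF projector_bounded L2]]
      by eventually_elim simp
  qed
  then show "AE z in phase. projector (T t F) z = T t (projector F) z" by simp
qed

text \<open>The constant of \<open>l2_energy_decay\<close> for \<eta> = (1 - q) / 2, with q =
  \<open>contraction \<beta>\<close>, and the norm bound of \<open>lyap \<beta>\<close>.\<close>

definition decay_const :: "real \<Rightarrow> real" where
  "decay_const \<beta> = sqrt (((1 - contraction \<beta>) / 2 + (lyap_bound \<beta>)\<^sup>2) / ((1 - contraction \<beta>) / 2))"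

lemma decay_const_pos: "\<beta> > decay \<xi>0 \<Longrightarrow> decay_const \<beta> > 0"
  using contraction_less_1[of \<beta>] unfolding decay_const_def
  by (intro real_sqrt_gt_zero divide_pos_pos add_pos_nonneg) auto

text \<open>The energy lemma needs a differentiable orbit, which data in the domain provide. Its
  constant does not involve the data, so the estimate extends by density.\<close>

lemma complement_decay:
  assumes T: "contraction_semigroup phase T" "generator phase T = L_hat"
    and \<beta>: "\<beta> > decay \<xi>0" and F: "F \<in> L2 phase" and t: "t \<ge> 0"
  shows "l2_norm phase (\<lambda>z. T t F z - projector (T t F) z)
    \<le> decay_const \<beta> * exp ((\<beta> - 1) * t) * l2_norm phase (\<lambda>z. F z - projector F z)"
proof -
  let ?Q = "\<lambda>F z. F z - projector F z"
  note Q = l2_bounded_complement[OF projector_bounded]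
  note Tb = contraction_semigroup_bounded[OF T(1)]
  define K where "K = decay_const \<beta> * exp ((\<beta> - 1) * t)"
  have dom: "l2_norm phase (?Q (T t F)) \<le> K * l2_norm phase (?Q F)" if FG: "(F, G) \<in> L_hat" for F G
  proof -
    note Tg = FG[folded T(2)] and L2 = L_hat_L2(1)[OF FG]
    have "l2_norm phase (?Q (T t F)) \<le> decay_const \<beta> * exp ((\<beta> - 1) * t) * l2_norm phase (?Q (T 0 F))"
      unfolding decay_const_def
    proof (rule l2_energy_decay[OF lyap_bounded[OF \<beta>] _ _ _ t, where u = "\<lambda>t. ?Q (T t F)" and d = "\<lambda>t. ?Q (T t G)"])
      show "(1 - contraction \<beta>) / 2 > 0" using contraction_less_1[OF \<beta>] by simp
      fix t :: real assume t: "t \<ge> 0"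
      note TFG = generator_orbit[OF T(1) Tg t, unfolded T(2)]
      show "l2_has_derivative phase (\<lambda>t. ?Q (T t F)) (?Q (T t G)) t"
        by (rule l2_has_derivative_bounded[OF Q generator_orbit_derivative[OF T(1) Tg t] t])
      show "(1 - contraction \<beta>) / 2 * Re (l2_inner phase (?Q (T t G)) (?Q (T t F)))
          + Re (l2_inner (lborel \<Otimes>\<^sub>M lborel) (lyap \<beta> (?Q (T t G))) (lyap \<beta> (?Q (T t F))))
        \<le> (\<beta> - 1) * ((1 - contraction \<beta>) / 2 * (l2_norm phase (?Q (T t F)))\<^sup>2
          + (l2_norm (lborel \<Otimes>\<^sub>M lborel) (lyap \<beta> (?Q (T t F))))\<^sup>2)"
        by (rule lyapunov_phase[OF \<beta> L_hat_diff[OF TFG projector_L_hat[OF TFG]] projector_complement[OF L_hat_L2(1)[OF TFG]]])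
    qed
    also have "l2_norm phase (?Q (T 0 F)) = l2_norm phase (?Q F)"
    proof (rule l2_norm_cong_AE)
      show "AE z in phase. ?Q (T 0 F) z = ?Q F z"
        by (rule l2_bounded_cong_AE[OF Q l2_bounded_L2[OF Tb L2] L2 contraction_semigroup_0[OF T(1) L2]]) simp
    qed (auto intro!: L2_measurable l2_bounded_L2[OF Q] l2_bounded_L2[OF Tb] L2)
    finally show ?thesis by (simp add: K_def)
  qed
  obtain U where U: "\<And>n::nat. \<exists>G. (U n, G) \<in> L_hat" and lim: "(\<lambda>n. l2_norm phase (\<lambda>z. F z - U n z)) \<longlonglongrightarrow> 0"
    using L_hat_dense[OF F] by blast
  have UL2: "U n \<in> L2 phase" for n using U[of n] L_hat_L2 by blast
  have conv: "(\<lambda>n. l2_norm phase (A (U n))) \<longlonglongrightarrow> l2_norm phase (A F)" if A: "l2_bounded phase phase C A" for A C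
  proof (rule l2_norm_tendsto)
    show "A (U n) \<in> L2 phase" for n by (rule l2_bounded_L2[OF A UL2])
    show "A F \<in> L2 phase" by (rule l2_bounded_L2[OF A F])
    have "(\<lambda>n. C * l2_norm phase (\<lambda>z. F z - U n z)) \<longlonglongrightarrow> 0" using tendsto_mult_right_zero[OF lim] .
    then show "(\<lambda>n. l2_norm phase (\<lambda>x. A (U n) x - A F x)) \<longlonglongrightarrow> 0"
    proof (rule Lim_null_comparison[rotated], intro always_eventually allI)
      fix n
      have "l2_norm phase (\<lambda>x. A (U n) x - A F x) = l2_norm phase (A (\<lambda>z. U n z - F z))"
        using l2_bounded_diff[OF A UL2[of n] F]
        by (intro l2_norm_cong_AE L2_measurable L2_diff l2_bounded_L2[OF A] F UL2) auto
      also have "\<dots> \<le> C * l2_norm phase (\<lambda>z. U n z - F z)" by (intro l2_bounded_norm[OF A] L2_diff F UL2)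
      finally show "norm (l2_norm phase (\<lambda>x. A (U n) x - A F x)) \<le> C * l2_norm phase (\<lambda>z. F z - U n z)"
        by (simp add: l2_norm_minus_commute)
    qed
  qed
  have "l2_norm phase (?Q (T t F)) \<le> K * l2_norm phase (?Q F)"
  proof (rule LIMSEQ_le)
    show "(\<lambda>n. l2_norm phase (?Q (T t (U n)))) \<longlonglongrightarrow> l2_norm phase (?Q (T t F))"
      by (rule conv[OF l2_bounded_compose[OF Tb[OF t] Q]])
    show "(\<lambda>n. K * l2_norm phase (?Q (U n))) \<longlonglongrightarrow> K * l2_norm phase (?Q F)"
      by (intro tendsto_intros conv[OF Q])
    have "l2_norm phase (?Q (T t (U n))) \<le> K * l2_norm phase (?Q (U n))" for n
      using U[of n] dom by blast
    then show "\<exists>N. \<forall>n\<ge>N. l2_norm phase (?Q (T t (U n))) \<le> K * l2_norm phase (?Q (U n))" by blast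
  qed
  then show ?thesis by (simp add: K_def)
qed

subsection \<open>Grossly determined solutions\<close>

text \<open>The eigenfunction has mean 1 by the dispersion relation, so a projected fibre is k times
  its own moment. This is the reason why these solutions are grossly determined.\<close>

lemma projector_by_moment:
  "projector F (\<xi>, v) = (if \<bar>\<xi>\<bar> \<le> \<xi>0
     then free_resolvent (of_real (decay \<xi>)) \<xi> v * moment (projector F) \<xi> else 0)"
proof (cases "\<bar>\<xi>\<bar> \<le> \<xi>0")
  case True
  note d = decay_root[OF low_frequency[OF True]]
  have "(\<integral>v. free_resolvent (of_real (decay \<xi>)) \<xi> v \<partial>maxwell) = 1"
    using integral_free_resolvent[OF d(1), of \<xi>] d(3) by simp
  then show ?thesis using True by (simp add: projector_def moment_eq eigenprojection_def)
qed (simp add: projector_def)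

text \<open>Averaging in v commutes with the inverse transform and the latter is injective, so equal
  moments in x give equal moments in \<xi>; \<open>projector_by_moment\<close> then recovers the
  whole function. A and B stand for chosen representatives of the two projections.\<close>

lemma projector_determined_by_moment:
  assumes F: "F \<in> L2 phase" and G: "G \<in> L2 phase"
    and A: "A \<in> L2 phase" "AE z in phase. A z = projector F z"
    and B: "B \<in> L2 phase" "AE z in phase. B z = projector G z"
    and eq: "AE x in lborel. moment (inverse_fourier A) x = moment (inverse_fourier B) x"
  shows "AE z in phase. A z = B z"
proof -
  note av = velocity_avg_bounded and PL2 = l2_bounded_L2[OF projector_bounded]
  have "AE z in phase. velocity_avg (inverse_fourier A) z = velocity_avg (inverse_fourier B) z"
    using AE_phase_fst[OF eq] by eventually_elim (auto simp: velocity_avg_def)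
  then have "AE z in phase. inverse_fourier (velocity_avg A) z = inverse_fourier (velocity_avg B) z"
    using velocity_avg_inverse_fourier[OF A(1)] velocity_avg_inverse_fourier[OF B(1)]
    by eventually_elim simp
  then have "AE z in phase. velocity_avg A z = velocity_avg B z"
    by (rule inverse_fourier_inj[OF l2_bounded_L2[OF av A(1)] l2_bounded_L2[OF av B(1)]])
  moreover have "AE z in phase. velocity_avg A z = velocity_avg (projector F) z"
    by (rule l2_bounded_cong_AE[OF av A(1) PL2[OF F] A(2)])
  moreover have "AE z in phase. velocity_avg B z = velocity_avg (projector G) z"
    by (rule l2_bounded_cong_AE[OF av B(1) PL2[OF G] B(2)])
  ultimately show ?thesis
    using A(2) B(2)
  proof eventually_elim
    case (elim z)
    obtain \<xi> v where z: "z = (\<xi>, v)" by (cases z)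
    have "moment (projector F) \<xi> = moment (projector G) \<xi>"
      using elim(1,2,3) by (simp add: z velocity_avg_def)
    then have "projector F (\<xi>, v) = projector G (\<xi>, v)" by (subst (1 2) projector_by_moment) simp
    then show ?case using elim(4,5) by (simp add: z)
  qed
qed

text \<open>By commutation the chosen projections along an orbit again form an orbit, with data
  \<open>projector F0\<close>.\<close>

lemma trunc_projector_solution:
  assumes T: "contraction_semigroup phase T" "generator phase T = L_hat"
    and F0: "F0 \<in> L2 phase"
    and F: "\<forall>t\<ge>0. F t \<in> L2 phase \<and> (AE z in phase. F t z = T t F0 z)" and t: "t \<ge> 0"
  shows "AE z in phase. trunc_projector \<xi>0 (F t) z = projector (T t F0) z"
    and "AE z in phase. trunc_projector \<xi>0 (F t) z = T t (projector F0) z"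
proof -
  note TL2 = l2_bounded_L2[OF contraction_semigroup_bounded[OF T(1) t] F0]
  have Ft: "F t \<in> L2 phase" "AE z in phase. F t z = T t F0 z" using F t by blast+
  show 1: "AE z in phase. trunc_projector \<xi>0 (F t) z = projector (T t F0) z"
    using trunc_projector(2)[OF Ft(1)] l2_bounded_cong_AE[OF projector_bounded Ft(1) TL2 Ft(2)]
    by eventually_elim simp
  show "AE z in phase. trunc_projector \<xi>0 (F t) z = T t (projector F0) z"
    using 1 projector_commute[OF T F0 t] by eventually_elim simp
qed

lemma trunc_projector_semigroup:
  assumes T: "contraction_semigroup phase T" "generator phase T = L_hat"
    and F0: "F0 \<in> L2 phase"
    and F: "\<forall>t\<ge>0. F t \<in> L2 phase \<and> (AE z in phase. F t z = T t F0 z)" and s: "s \<ge> 0" and t: "t \<ge> 0"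
  shows "AE z in phase. trunc_projector \<xi>0 (F (s + t)) z = T t (trunc_projector \<xi>0 (F s)) z"
proof -
  note P0 = l2_bounded_L2[OF projector_bounded F0]
  have st: "s + t \<ge> 0" using s t by simp
  have Fs: "F s \<in> L2 phase" using F s by blast
  have "AE z in phase. T t (trunc_projector \<xi>0 (F s)) z = T t (T s (projector F0)) z"
    by (rule l2_bounded_cong_AE[OF contraction_semigroup_bounded[OF T(1) t] trunc_projector(1)[OF Fs]
          l2_bounded_L2[OF contraction_semigroup_bounded[OF T(1) s] P0] trunc_projector_solution(2)[OF T F0 F s]])
  then show ?thesis
    using trunc_projector_solution(2)[OF T F0 F st] contraction_semigroup_add[OF T(1) t s P0]
    by eventually_elim (simp add: add.commute)
qed

text \<open>Equal moments at the times s and t force equal projected states; from there the two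
  evolve under semigroups that agree by uniqueness.\<close>

lemma grossly_determined_trunc:
  "grossly_determined {g_trunc \<xi>0 F | F0 F. semigroup_solution phase L_hat F0 F}"
  unfolding grossly_determined_def
proof (intro conjI ballI allI impI)
  fix g assume "g \<in> {g_trunc \<xi>0 F | F0 F. semigroup_solution phase L_hat F0 F}"
  then obtain F0 F T where g: "g = g_trunc \<xi>0 F" and F0: "F0 \<in> L2 phase"
    and T: "contraction_semigroup phase T" "generator phase T = L_hat"
    and F: "\<forall>t\<ge>0. F t \<in> L2 phase \<and> (AE z in phase. F t z = T t F0 z)"
    unfolding semigroup_solution_def by blast
  have F1: "F t \<in> L2 phase" if "t \<ge> 0" for t using F that by blast
  have "semigroup_solution phase L_hat (projector F0) (\<lambda>t. trunc_projector \<xi>0 (F t))"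
    unfolding semigroup_solution_def
    using l2_bounded_L2[OF projector_bounded F0] T trunc_projector(1)[OF F1] trunc_projector_solution(2)[OF T F0 F]
    by blast
  moreover have "g t \<in> L2 phase \<and> (AE z in phase. g t z = inverse_fourier (trunc_projector \<xi>0 (F t)) z)" if "t \<ge> 0" for t
    unfolding g g_trunc_def using inverse_fourier_L2[OF trunc_projector(1)[OF F1[OF that]]] by simp
  ultimately show "kinetic_solution g" unfolding kinetic_solution_def by blast
next
  fix g h and s t \<tau> :: real
  assume "g \<in> {g_trunc \<xi>0 F | F0 F. semigroup_solution phase L_hat F0 F}"
  then obtain F0 F T where g: "g = g_trunc \<xi>0 F" and F0: "F0 \<in> L2 phase"
    and T: "contraction_semigroup phase T" "generator phase T = L_hat"
    and F: "\<forall>t\<ge>0. F t \<in> L2 phase \<and> (AE z in phase. F t z = T t F0 z)"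
    unfolding semigroup_solution_def by blast
  assume "h \<in> {g_trunc \<xi>0 F | F0 F. semigroup_solution phase L_hat F0 F}"
  then obtain H0 H S where h: "h = g_trunc \<xi>0 H" and H0: "H0 \<in> L2 phase"
    and S: "contraction_semigroup phase S" "generator phase S = L_hat"
    and H: "\<forall>t\<ge>0. H t \<in> L2 phase \<and> (AE z in phase. H t z = S t H0 z)"
    unfolding semigroup_solution_def by blast
  have F1: "F t \<in> L2 phase" and H1: "H t \<in> L2 phase" if "t \<ge> 0" for t using F H that by blast+
  assume s: "0 \<le> s" and t: "0 \<le> t" and eq: "AE x in lborel. moment (g s) x = moment (h t) x" and \<tau>: "0 \<le> \<tau>"
  let ?A = "trunc_projector \<xi>0 (F s)" and ?B = "trunc_projector \<xi>0 (H t)"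
  note A = trunc_projector[OF F1[OF s]] and B = trunc_projector[OF H1[OF t]]
  have "AE z in phase. ?A z = ?B z"
    using projector_determined_by_moment[OF F1[OF s] H1[OF t] A B] eq
    unfolding g h g_trunc_def by blast
  then have "AE z in phase. T \<tau> ?A z = T \<tau> ?B z"
    by (rule l2_bounded_cong_AE[OF contraction_semigroup_bounded[OF T(1) \<tau>] A(1) B(1)])
  then have "AE z in phase. trunc_projector \<xi>0 (F (s + \<tau>)) z = trunc_projector \<xi>0 (H (t + \<tau>)) z"
    using trunc_projector_semigroup[OF T F0 F s \<tau>] trunc_projector_semigroup[OF S H0 H t \<tau>]
      L_hat_semigroup_unique[OF T S B(1) \<tau>]
    by eventually_elim simp
  then show "AE z in phase. g (s + \<tau>) z = h (t + \<tau>) z"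
    unfolding g h g_trunc_def
    using s t \<tau> F1 H1 by (intro l2_bounded_cong_AE[OF inverse_fourier_bounded] trunc_projector(1)) auto
qed

text \<open>The factor 1 / sqrt (2 pi) of the inverse transform occurs on both sides of each
  inequality, so the bounds for \<xi> carry over to x with the same constants.\<close>

lemma trunc_convergence:
  assumes \<epsilon>: "\<epsilon> > 0"
  shows "\<exists>C>0. \<exists>C2>0. \<forall>F0\<in>L2 phase. \<forall>F f g.
       semigroup_solution phase L_hat F0 F \<longrightarrow>
       f = (\<lambda>t. inverse_fourier (F t)) \<longrightarrow>
       g = g_trunc \<xi>0 F \<longrightarrow>
       (\<forall>t\<ge>0.
          l2_norm phase (\<lambda>z. f t z - g t z)
            \<le> C * exp ((lambda_star \<xi>0 + \<epsilon>) * t) * l2_norm phase (\<lambda>z. f 0 z - g 0 z) \<and>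
          C * exp ((lambda_star \<xi>0 + \<epsilon>) * t) * l2_norm phase (\<lambda>z. f 0 z - g 0 z)
            \<le> C2 * exp ((lambda_star \<xi>0 + \<epsilon>) * t) * l2_norm phase (f 0))"
proof -
  define \<beta> where "\<beta> = decay \<xi>0 + \<epsilon>"
  have \<beta>: "\<beta> > decay \<xi>0" using \<epsilon> by (simp add: \<beta>_def)
  have exponent: "lambda_star \<xi>0 + \<epsilon> = \<beta> - 1" by (simp add: \<beta>_def decay_def)
  define C where "C = decay_const \<beta>"
  \<comment> \<open>1 + \<open>projector_bound\<close> bounds the norm of the complementary
    projection, which is applied at t = 0.\<close>
  define C2 where "C2 = C * (1 + projector_bound)"
  note Q = l2_bounded_complement[OF projector_bounded]
  have C: "C > 0" unfolding C_def by (rule decay_const_pos[OF \<beta>])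
  have C2: "C2 > 0" using C l2_bounded_nonneg[OF projector_bounded] by (simp add: C2_def add_pos_nonneg)
  have main: "l2_norm phase (\<lambda>z. inverse_fourier (F t) z - g_trunc \<xi>0 F t z)
        \<le> C * exp ((\<beta> - 1) * t) * l2_norm phase (\<lambda>z. inverse_fourier (F 0) z - g_trunc \<xi>0 F 0 z) \<and>
      C * exp ((\<beta> - 1) * t) * l2_norm phase (\<lambda>z. inverse_fourier (F 0) z - g_trunc \<xi>0 F 0 z)
        \<le> C2 * exp ((\<beta> - 1) * t) * l2_norm phase (inverse_fourier (F 0))"
    if sol: "semigroup_solution phase L_hat F0 F" and t: "t \<ge> 0" for F0 F t
  proof -
    obtain T where F0: "F0 \<in> L2 phase"
      and T: "contraction_semigroup phase T" "generator phase T = L_hat"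
      and F: "\<And>t. t \<ge> 0 \<Longrightarrow> F t \<in> L2 phase" "\<And>t. t \<ge> 0 \<Longrightarrow> AE z in phase. F t z = T t F0 z"
      using sol unfolding semigroup_solution_def by blast
    have TL2: "T t F0 \<in> L2 phase" if "t \<ge> 0" for t
      by (rule l2_bounded_L2[OF contraction_semigroup_bounded[OF T(1) that] F0])
    have diff: "l2_norm phase (\<lambda>z. inverse_fourier (F t) z - g_trunc \<xi>0 F t z)
        = l2_norm phase (\<lambda>z. F t z - projector (F t) z) / sqrt (2 * pi)" if t: "t \<ge> 0" for t
    proof -
      have "l2_norm phase (\<lambda>z. F t z - trunc_projector \<xi>0 (F t) z) = l2_norm phase (\<lambda>z. F t z - projector (F t) z)"
        using trunc_projector(2)[OF F(1)[OF t]]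
        by (intro l2_norm_cong_AE L2_measurable L2_diff F(1) t trunc_projector(1) l2_bounded_L2[OF projector_bounded])
           (auto elim: eventually_mono)
      then show ?thesis
        unfolding g_trunc_def inverse_fourier_diff_norm[OF F(1)[OF t] trunc_projector(1)[OF F(1)[OF t]]] by simp
    qed
    have QF: "l2_norm phase (\<lambda>z. F t z - projector (F t) z) = l2_norm phase (\<lambda>z. T t F0 z - projector (T t F0) z)"
      if t: "t \<ge> 0" for t
      using l2_bounded_cong_AE[OF Q F(1)[OF t] TL2[OF t] F(2)[OF t]]
      by (intro l2_norm_cong_AE L2_measurable l2_bounded_L2[OF Q] F(1) TL2 t)
    have Q0: "l2_norm phase (\<lambda>z. F 0 z - projector (F 0) z) = l2_norm phase (\<lambda>z. F0 z - projector F0 z)"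
    proof -
      have "AE z in phase. F 0 z = F0 z"
        using F(2)[OF order_refl] contraction_semigroup_0[OF T(1) F0] by eventually_elim simp
      from l2_bounded_cong_AE[OF Q F(1)[OF order_refl] F0 this]
      show ?thesis by (intro l2_norm_cong_AE L2_measurable l2_bounded_L2[OF Q] F(1)[OF order_refl] F0)
    qed
    have 1: "l2_norm phase (\<lambda>z. F t z - projector (F t) z)
        \<le> C * exp ((\<beta> - 1) * t) * l2_norm phase (\<lambda>z. F 0 z - projector (F 0) z)"
      unfolding QF[OF t] Q0 C_def by (rule complement_decay[OF T \<beta> F0 t])
    have 2: "l2_norm phase (\<lambda>z. F 0 z - projector (F 0) z) \<le> (1 + projector_bound) * l2_norm phase (F 0)"
      by (rule l2_bounded_norm[OF Q F(1)[OF order_refl]])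
    have "C * exp ((\<beta> - 1) * t) * l2_norm phase (\<lambda>z. F 0 z - projector (F 0) z)
        \<le> C * exp ((\<beta> - 1) * t) * ((1 + projector_bound) * l2_norm phase (F 0))"
      using 2 C by (intro mult_left_mono) auto
    then have 3: "C * exp ((\<beta> - 1) * t) * l2_norm phase (\<lambda>z. F 0 z - projector (F 0) z)
        \<le> C2 * exp ((\<beta> - 1) * t) * l2_norm phase (F 0)" by (simp add: C2_def mult_ac)
    show ?thesis
      unfolding diff[OF t] diff[OF order_refl] inverse_fourier_norm[OF F(1)[OF order_refl]] times_divide_eq_right
      using 1 3 by (intro conjI divide_right_mono) auto
  qed
  show ?thesis
    unfolding exponent
  proof (rule exI[of _ C], rule conjI[OF C], rule exI[of _ C2], rule conjI[OF C2], intro ballI allI impI)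
    fix F0 F f g and t :: real
    assume sol: "semigroup_solution phase L_hat F0 F" and f: "f = (\<lambda>t. inverse_fourier (F t))"
      and g: "g = g_trunc \<xi>0 F" and t: "0 \<le> t"
    show "l2_norm phase (\<lambda>z. f t z - g t z) \<le> C * exp ((\<beta> - 1) * t) * l2_norm phase (\<lambda>z. f 0 z - g 0 z) \<and>
      C * exp ((\<beta> - 1) * t) * l2_norm phase (\<lambda>z. f 0 z - g 0 z) \<le> C2 * exp ((\<beta> - 1) * t) * l2_norm phase (f 0)"
      unfolding f g by (rule main[OF sol t])
  qed
qed

end

theorem theorem9p6:
  fixes \<xi>0 :: real
  assumes "0 < \<xi>0" and "\<xi>0 < sqrt pi"
  shows "grossly_determined
           {g_trunc \<xi>0 F | F0 F. semigroup_solution phase L_hat F0 F} \<and>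
    (\<forall>\<epsilon>>0. \<exists>C>0. \<exists>C2>0. \<forall>F0\<in>L2 phase. \<forall>F f g.
       semigroup_solution phase L_hat F0 F \<longrightarrow>
       f = (\<lambda>t. inverse_fourier (F t)) \<longrightarrow>
       g = g_trunc \<xi>0 F \<longrightarrow>
       (\<forall>t\<ge>0.
          l2_norm phase (\<lambda>z. f t z - g t z)
            \<le> C * exp ((lambda_star \<xi>0 + \<epsilon>) * t) * l2_norm phase (\<lambda>z. f 0 z - g 0 z) \<and>
          C * exp ((lambda_star \<xi>0 + \<epsilon>) * t) * l2_norm phase (\<lambda>z. f 0 z - g 0 z)
            \<le> C2 * exp ((lambda_star \<xi>0 + \<epsilon>) * t) * l2_norm phase (f 0)))"
proof -
  interpret frequency_cutoff \<xi>0 by unfold_locales (rule assms)+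
  show ?thesis by (intro conjI allI impI grossly_determined_trunc trunc_convergence)
qed

end
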